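(* Let $\widetilde{\mathscr P}$ be a pro-conformal pseudo operad over a field $\mathbb F$ of characteristic $0$, let $\mathscr P=\widetilde{\mathscr P}/\partial\widetilde{\mathscr P}$ be the associated linear pseudo operad, $W(\mathscr P)=\bigoplus_{n\ge-1}W_n$ the associated $\mathbb Z_{\ge-1}$-graded Lie superalgebra, and $\widetilde W(\widetilde{\mathscr P})=\bigoplus_{n\ge-1}\widetilde W_n$ the associated $\mathbb Z_{\ge-1}$-graded pro-Lie conformal superalgebra. There is a canonical surjective homomorphism of $\mathbb Z_{\ge-1}$-graded Lie superalgebras $$\widetilde W(\widetilde{\mathscr P})/\partial\widetilde W(\widetilde{\mathscr P})\twoheadrightarrow W(\mathscr P),$$ induced by the quotient maps $\widetilde{\mathscr P}(n)\to\mathscr P(n)$. It restricts to an isomorphism $\widetilde W_n/\partial\widetilde W_n\simeq W_n$ in degree $n$ provided that $\partial$ has zero kernel on $\widetilde{\mathscr P}(n+1)$, or that $n=0$. Moreover there is a Lie superalgebra action of $W(\mathscr P)$ on $\widetilde W(\widetilde{\mathscr P})$, compatible with this map and preserving the gradings, given by $$[\bar f,g]=\tilde f\,\Box_0\,g-(-1)^{p(\tilde f)p(g)}\,g\,\Box_{-\partial}\,\tilde f$$ for $\bar f\in W_m$, $g\in\widetilde W_n$ and any $\tilde f\in\widetilde W_m$ representing a preimage of $\bar f$ under the map above.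
   Context: Superspaces are over $\mathbb F$; $p$ is parity; $S_0$ is trivial. Permutations: $\sigma\circ_i\tau\in S_{n+m-1}$ ($\sigma\in S_n,\tau\in S_m$) acts on $v_1\otimes\cdots\otimes v_{n+m-1}$ by first applying $\tau$ to $v_i\otimes\cdots\otimes v_{i+m-1}$ and then $\sigma$ to the result viewed as a tensor product of $n$ factors, where $\sigma\in S_n$ acts on tensors by $\sigma(v_1\otimes\cdots\otimes v_n)=\pm v_{\sigma^{-1}(1)}\otimes\cdots\otimes v_{\sigma^{-1}(n)}$ (Koszul sign). $S_{m,n}\subset S_{m+n}$: $(m,n)$-shuffles ($\sigma(1)<\dots<\sigma(m)$, $\sigma(m+1)<\dots<\sigma(m+n)$), $S_{n,0}=S_{0,n}=\{1\}$, empty if $m<0$ or $n<0$. $\mathbb F[\partial]$-mod-$S_n$ is the category of superspaces with commuting parity preserving left action of $\mathbb F[\partial]$ and right action of $S_n$, with parity preserving equivariant linear maps. Projective systems $(V_q)_{q\ge0}$ have morphisms $V_{q+1}\to V_q$; $\pi_q:\varprojlim V_q\to V_q$ are the canonical maps. A pro-conformal pseudo operad is a collection of superspaces $\widetilde{\mathscr P}(n)$, $n\ge0$, with an even endomorphism $\partial$, a parity preserving right action of $S_n$ commuting with $\partial$, and parity preserving bilinear products $\circ^i_\lambda:\widetilde{\mathscr P}(n)\otimes\widetilde{\mathscr P}(m)\to\widetilde{\mathscr P}(m+n-1)[[\lambda]]$, $1\le i\le n$, satisfying ($f\in\widetilde{\mathscr P}(n)$, $g\in\widetilde{\mathscr P}(m)$,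 $h\in\widetilde{\mathscr P}(\ell)$): $(\partial f)\circ^i_\lambda g=(\lambda+\partial)(f\circ^i_\lambda g)$; $f\circ^i_\lambda(\partial g)=-\lambda f\circ^i_\lambda g$; $(f\circ^i_\lambda g)\circ^j_\mu h=(-1)^{p(g)p(h)}(f\circ^j_\mu h)\circ^{\ell+i-1}_\lambda g$ for $1\le j<i$; $(f\circ^i_\lambda g)\circ^j_\mu h=f\circ^i_{\lambda+\mu}(g\circ^{j-i+1}_\mu h)$ for $i\le j<i+m$; $f^\sigma\circ^i_\lambda g^\tau=(f\circ^{\sigma(i)}_\lambda g)^{\sigma\circ_i\tau}$. Moreover each $\widetilde{\mathscr P}(n)=\varprojlim\widetilde{\mathscr P}_q(n)$ for a projective system in $\mathbb F[\partial]$-mod-$S_n$, and $\pi_q(f\circ^i_\lambda g)\in\widetilde{\mathscr P}_q(m+n-1)[\lambda]$ for all $q,f,g,i$. Substitutions $\lambda\mapsto-\lambda-\partial$ (or $\lambda\mapsto-\partial$) are made in each polynomial $\pi_q(\cdot)$, with $\partial$ moved to the left acting on the coefficients; by the universal property of the projective limit they define elements over $\widetilde{\mathscr P}$ itself. For $f\in\widetilde{\mathscr P}(n+1)$, $g\in\widetilde{\mathscr P}(m+1)$: $f\Box_\lambda g=\sum_{\sigma\in S_{m+1,n}}(f\circ^1_{-\lambda-\partial}g)^{\sigma^{-1}}$. $\mathscr P(n)=\widetilde{\mathscr P}(n)/\partial\widetilde{\mathscr P}(n)$ is a linear pseudo operad (products $\circ_i$ satisfying the associativity and equivariance conditions above with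 all $\lambda,\mu$ suppressed) with $\bar f\circ_i\bar g=\overline{f\circ^i_0g}$ and induced $S_n$-action. $W_n=\mathscr P(n+1)^{S_{n+1}}$, and $W(\mathscr P)=\bigoplus_{n\ge-1}W_n$ is a graded Lie superalgebra with $[f,g]=f\Box g-(-1)^{p(f)p(g)}g\Box f$, $f\Box g=\sum_{\sigma\in S_{m+1,n}}(f\circ_1g)^{\sigma^{-1}}$ for $f\in W_n,g\in W_m$. $\widetilde W_n=\widetilde{\mathscr P}(n+1)^{S_{n+1}}$, with $\lambda$-bracket on $\widetilde W(\widetilde{\mathscr P})=\bigoplus_{n\ge-1}\widetilde W_n$: $[f_\lambda g]=f\Box_\lambda g-(-1)^{p(f)p(g)}g\Box_{-\lambda-\partial}f$. $\widetilde W/\partial\widetilde W$ is a Lie superalgebra with bracket $[\bar a,\bar b]=\overline{[a_\lambda b]|_{\lambda=0}}$ and acts on $\widetilde W$ by $\bar a(b)=[a_\lambda b]|_{\lambda=0}$; compatibility of the action of $W(\mathscr P)$ means that its pullback along $\widetilde W/\partial\widetilde W\to W(\mathscr P)$ is this action. *)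

theory Defs
  imports
    "HOL-Algebra.Module"
    "HOL-Algebra.AbelCoset"
    "HOL-Library.Z2"
    "HOL-Combinatorics.Permutations"
begin

section \<open>Superspaces\<close>

text \<open>
  A superspace is a vector space with a decomposition into two homogeneous parts, indexed by the
  parities, which are the elements of \<^typ>\<open>bit\<close>. The ring fields \<open>mult\<close> and \<open>one\<close> inherited from
  the record \<^type>\<open>module\<close> play no role.
\<close>

record ('f, 'v) superspace = "('f, 'v) module" +
  hpart :: "bit \<Rightarrow> 'v set"

locale superspace = module F V + field F
  for F :: "('f, 'r) ring_scheme" and V :: "('f, 'v, 'z) superspace_scheme" +
  assumes hpart_submodule: "submodule (hpart V p) F V"
    and hpart_decomposition:
      "x \<in> carrier V \<Longrightarrow> \<exists>!c. (\<forall>p. c p \<in> hpart V p) \<and> x = c 0 \<oplus>\<^bsub>V\<^esub> c 1"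

definition hcomp :: "('f, 'v, 'z) superspace_scheme \<Rightarrow> bit \<Rightarrow> 'v \<Rightarrow> 'v" where
  "hcomp V p x = (THE c. (\<forall>r. c r \<in> hpart V r) \<and> x = c 0 \<oplus>\<^bsub>V\<^esub> c 1) p"

definition koszul :: "bit \<Rightarrow> bit \<Rightarrow> int" where
  "koszul p q = (if p = 1 \<and> q = 1 then -1 else 1)"

definition linear_maps ::
    "('f, 'r) ring_scheme \<Rightarrow> ('f, 'v, 'x) module_scheme \<Rightarrow> ('f, 'w, 'y) module_scheme
      \<Rightarrow> ('v \<Rightarrow> 'w) set" where
  "linear_maps F V W = {h \<in> carrier V \<rightarrow> carrier W.
     (\<forall>x\<in>carrier V. \<forall>y\<in>carrier V. h (x \<oplus>\<^bsub>V\<^esub> y) = h x \<oplus>\<^bsub>W\<^esub> h y) \<and>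
     (\<forall>a\<in>carrier F. \<forall>x\<in>carrier V. h (a \<odot>\<^bsub>V\<^esub> x) = a \<odot>\<^bsub>W\<^esub> h x)}"

definition even_maps ::
    "('f, 'r) ring_scheme \<Rightarrow> ('f, 'v, 'x) superspace_scheme \<Rightarrow> ('f, 'w, 'y) superspace_scheme
      \<Rightarrow> ('v \<Rightarrow> 'w) set" where
  "even_maps F V W = {h \<in> linear_maps F V W. \<forall>p. \<forall>x\<in>hpart V p. h x \<in> hpart W p}"

definition superspace_iso ::
    "('f, 'r) ring_scheme \<Rightarrow> ('f, 'v, 'x) superspace_scheme \<Rightarrow> ('f, 'w, 'y) superspace_scheme
      \<Rightarrow> ('v \<Rightarrow> 'w) \<Rightarrow> bool" where
  "superspace_iso F V W h \<longleftrightarrow> h \<in> even_maps F V W \<and> bij_betw h (carrier V) (carrier W)"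

definition even_bilinear ::
    "('f, 'r) ring_scheme \<Rightarrow> ('f, 'u, 'x) superspace_scheme \<Rightarrow> ('f, 'v, 'y) superspace_scheme
      \<Rightarrow> ('f, 'w, 'z) superspace_scheme \<Rightarrow> ('u \<Rightarrow> 'v \<Rightarrow> 'w) \<Rightarrow> bool" where
  "even_bilinear F U V W b \<longleftrightarrow>
     (\<forall>x\<in>carrier U. b x \<in> linear_maps F V W) \<and>
     (\<forall>y\<in>carrier V. (\<lambda>x. b x y) \<in> linear_maps F U W) \<and>
     (\<forall>p q. \<forall>x\<in>hpart U p. \<forall>y\<in>hpart V q. b x y \<in> hpart W (p + q))"

definition quot_space ::
    "('f, 'v, 'z) superspace_scheme \<Rightarrow> 'v set \<Rightarrow> ('f, 'v set) superspace" where
  "quot_space V U = \<lparr>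
     carrier = a_rcosets\<^bsub>V\<^esub> U,
     monoid.mult = undefined,
     one = undefined,
     zero = U,
     add = set_add V,
     smult = (\<lambda>a A. \<Union>x\<in>A. U +>\<^bsub>V\<^esub> (a \<odot>\<^bsub>V\<^esub> x)),
     hpart = (\<lambda>p. (\<lambda>x. U +>\<^bsub>V\<^esub> x) ` hpart V p)\<rparr>"


section \<open>Graded superspaces and graded Lie superalgebras\<close>

text \<open>The degrees are integers \<open>\<ge> -1\<close>; the component of any smaller degree is zero.\<close>

record ('f, 'v) graded_superspace =
  gspace :: "('f, 'v) superspace"
  gpart :: "int \<Rightarrow> 'v set"

record ('f, 'v) graded_super_lie = "('f, 'v) graded_superspace" +
  bracket :: "'v \<Rightarrow> 'v \<Rightarrow> 'v"

locale graded_superspace =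
  fixes F :: "('f, 'r) ring_scheme" and G :: "('f, 'v, 'z) graded_superspace_scheme"
  assumes superspace: "superspace F (gspace G)"
    and gpart_submodule: "submodule (gpart G n) F (gspace G)"
    and gpart_hcomp: "x \<in> gpart G n \<Longrightarrow> hcomp (gspace G) p x \<in> gpart G n"
    and gpart_low: "n < -1 \<Longrightarrow> gpart G n = {\<zero>\<^bsub>gspace G\<^esub>}"
    and gpart_decomposition:
      "x \<in> carrier (gspace G) \<Longrightarrow>
        \<exists>!c. (\<forall>n. c n \<in> gpart G n) \<and> finite {n. c n \<noteq> \<zero>\<^bsub>gspace G\<^esub>} \<and>
          x = (\<Oplus>\<^bsub>gspace G\<^esub>n\<in>{n. c n \<noteq> \<zero>\<^bsub>gspace G\<^esub>}. c n)"

locale graded_super_lie =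
  fixes F :: "('f, 'r) ring_scheme" and L :: "('f, 'v, 'z) graded_super_lie_scheme"
  assumes graded_superspace: "graded_superspace F L"
    and bracket_bilinear: "even_bilinear F (gspace L) (gspace L) (gspace L) (bracket L)"
    and bracket_skew:
      "\<lbrakk>x \<in> hpart (gspace L) p; y \<in> hpart (gspace L) q\<rbrakk> \<Longrightarrow>
        bracket L x y = \<ominus>\<^bsub>gspace L\<^esub> ([koszul p q] \<cdot>\<^bsub>gspace L\<^esub> bracket L y x)"
    and bracket_jacobi:
      "\<lbrakk>x \<in> hpart (gspace L) p; y \<in> hpart (gspace L) q; z \<in> carrier (gspace L)\<rbrakk> \<Longrightarrow>
        bracket L x (bracket L y z) =
          bracket L (bracket L x y) z
            \<oplus>\<^bsub>gspace L\<^esub> [koszul p q] \<cdot>\<^bsub>gspace L\<^esub> bracket L y (bracket L x z)"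
    and bracket_graded:
      "\<lbrakk>x \<in> gpart L i; y \<in> gpart L j\<rbrakk> \<Longrightarrow> bracket L x y \<in> gpart L (i + j)"

locale graded_super_lie_hom =
  fixes F :: "('f, 'r) ring_scheme"
    and A :: "('f, 'v, 'x) graded_super_lie_scheme"
    and B :: "('f, 'w, 'y) graded_super_lie_scheme"
    and h :: "'v \<Rightarrow> 'w"
  assumes dom: "graded_super_lie F A"
    and cod: "graded_super_lie F B"
    and hom_even: "h \<in> even_maps F (gspace A) (gspace B)"
    and hom_bracket:
      "\<lbrakk>x \<in> carrier (gspace A); y \<in> carrier (gspace A)\<rbrakk> \<Longrightarrow>
        h (bracket A x y) = bracket B (h x) (h y)"
    and hom_graded: "x \<in> gpart A n \<Longrightarrow> h x \<in> gpart B n"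

locale graded_super_lie_action =
  fixes F :: "('f, 'r) ring_scheme"
    and L :: "('f, 'v, 'x) graded_super_lie_scheme"
    and M :: "('f, 'w, 'y) graded_superspace_scheme"
    and act :: "'v \<Rightarrow> 'w \<Rightarrow> 'w"
  assumes lie: "graded_super_lie F L"
    and space: "graded_superspace F M"
    and act_bilinear: "even_bilinear F (gspace L) (gspace M) (gspace M) act"
    and act_bracket:
      "\<lbrakk>x \<in> hpart (gspace L) p; y \<in> hpart (gspace L) q; v \<in> carrier (gspace M)\<rbrakk> \<Longrightarrow>
        act (bracket L x y) v =
          act x (act y v) \<ominus>\<^bsub>gspace M\<^esub> [koszul p q] \<cdot>\<^bsub>gspace M\<^esub> act y (act x v)"
    and act_graded: "\<lbrakk>x \<in> gpart L i; v \<in> gpart M j\<rbrakk> \<Longrightarrow> act x v \<in> gpart M (i + j)"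

text \<open>
  The direct sum of the spaces \<open>W n\<close>, \<open>n \<ge> -1\<close>, consists of the finitely supported families on
  \<open>{-1..}\<close> (extensional functions). The map \<open>dsum_emb W n\<close> is the embedding of the \<open>n\<close>-th
  summand; for \<open>n < -1\<close>, where there is no such summand, it is the zero map.
\<close>

definition dsum_space :: "(int \<Rightarrow> ('f, 'v) superspace) \<Rightarrow> ('f, int \<Rightarrow> 'v) superspace" where
  "dsum_space W = \<lparr>
     carrier = {x \<in> (\<Pi>\<^sub>E n\<in>{-1..}. carrier (W n)). finite {n. -1 \<le> n \<and> x n \<noteq> \<zero>\<^bsub>W n\<^esub>}},
     monoid.mult = undefined,
     one = undefined,
     zero = (\<lambda>n\<in>{-1..}. \<zero>\<^bsub>W n\<^esub>),
     add = (\<lambda>x y. \<lambda>n\<in>{-1..}. x n \<oplus>\<^bsub>W n\<^esub> y n),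
     smult = (\<lambda>a x. \<lambda>n\<in>{-1..}. a \<odot>\<^bsub>W n\<^esub> x n),
     hpart = (\<lambda>p. {x \<in> (\<Pi>\<^sub>E n\<in>{-1..}. hpart (W n) p). finite {n. -1 \<le> n \<and> x n \<noteq> \<zero>\<^bsub>W n\<^esub>}})\<rparr>"

definition dsum_part :: "(int \<Rightarrow> ('f, 'v) superspace) \<Rightarrow> int \<Rightarrow> (int \<Rightarrow> 'v) set" where
  "dsum_part W n = {x \<in> carrier (dsum_space W). \<forall>k\<ge>-1. k \<noteq> n \<longrightarrow> x k = \<zero>\<^bsub>W k\<^esub>}"

definition dsum_emb :: "(int \<Rightarrow> ('f, 'v) superspace) \<Rightarrow> int \<Rightarrow> 'v \<Rightarrow> int \<Rightarrow> 'v" where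
  "dsum_emb W n f = (\<lambda>k\<in>{-1..}. if k = n then f else \<zero>\<^bsub>W k\<^esub>)"


section \<open>Permutations\<close>

text \<open>
  \<open>S\<^sub>n\<close> is the set of \<open>\<sigma>\<close> with \<open>\<sigma> permutes {1..n}\<close>, with \<open>\<circ>\<close> as product. Since
  \<open>\<sigma>(v\<^sub>1 \<otimes> \<dots> \<otimes> v\<^sub>n)\<close> has \<open>v\<close> with index \<open>\<sigma>\<inverse>(j)\<close> at position \<open>j\<close>, the permutation \<open>\<sigma>\<close> moves
  the factor at position \<open>k\<close> to position \<open>\<sigma> k\<close>.

  In \<open>\<sigma> \<circ>\<^sub>i \<tau>\<close>, the vectors are grouped into \<open>n\<close> factors, where the \<open>i\<close>-th one consists of \<open>m\<close>
  vectors and each of the others of one vector. Then \<open>before a\<close> is the number of vectors that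
  precede the factor \<open>a\<close> after \<open>\<sigma>\<close> has been applied, so that the value at \<open>k\<close> is the
  position to which the \<open>k\<close>-th vector is moved.
\<close>

definition perm_circ ::
    "nat \<Rightarrow> nat \<Rightarrow> nat \<Rightarrow> (nat \<Rightarrow> nat) \<Rightarrow> (nat \<Rightarrow> nat) \<Rightarrow> nat \<Rightarrow> nat" where
  "perm_circ n m i \<sigma> \<tau> k =
     (let before = (\<lambda>a. \<Sum>b | b \<in> {1..n} \<and> \<sigma> b < \<sigma> a. if b = i then m else 1)
      in if k \<notin> {1..n + m - 1} then k
         else if k < i then before k + 1
         else if k < i + m then before i + \<tau> (k - i + 1)
         else before (k + 1 - m) + 1)"

definition shuffle_perms :: "int \<Rightarrow> int \<Rightarrow> (nat \<Rightarrow> nat) set" where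
  "shuffle_perms m n =
     (if m < 0 \<or> n < 0 then {}
      else {\<sigma>. \<sigma> permutes {1..nat (m + n)} \<and>
               strict_mono_on {1..nat m} \<sigma> \<and>
               strict_mono_on {nat m + 1..nat (m + n)} \<sigma>})"


section \<open>Projective systems in the category of \<open>F[\<partial>]\<close>-modules with a right action of \<open>S\<^sub>n\<close>\<close>

definition dS_module ::
    "('f, 'r) ring_scheme \<Rightarrow> nat \<Rightarrow> ('f, 'v, 'z) superspace_scheme \<Rightarrow> ('v \<Rightarrow> 'v)
      \<Rightarrow> ('v \<Rightarrow> (nat \<Rightarrow> nat) \<Rightarrow> 'v) \<Rightarrow> bool" where
  "dS_module F n V d a \<longleftrightarrow>
     superspace F V \<and>
     d \<in> even_maps F V V \<and>
     (\<forall>\<sigma>. \<sigma> permutes {1..n} \<longrightarrow> (\<lambda>x. a x \<sigma>) \<in> even_maps F V V) \<and>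
     (\<forall>x\<in>carrier V. a x id = x) \<and>
     (\<forall>x\<in>carrier V. \<forall>\<sigma> \<tau>. \<sigma> permutes {1..n} \<longrightarrow> \<tau> permutes {1..n} \<longrightarrow>
        a x (\<sigma> \<circ> \<tau>) = a (a x \<sigma>) \<tau>) \<and>
     (\<forall>x\<in>carrier V. \<forall>\<sigma>. \<sigma> permutes {1..n} \<longrightarrow> d (a x \<sigma>) = a (d x) \<sigma>)"

definition dS_hom ::
    "('f, 'r) ring_scheme \<Rightarrow> nat
      \<Rightarrow> ('f, 'v, 'x) superspace_scheme \<Rightarrow> ('v \<Rightarrow> 'v) \<Rightarrow> ('v \<Rightarrow> (nat \<Rightarrow> nat) \<Rightarrow> 'v)
      \<Rightarrow> ('f, 'w, 'y) superspace_scheme \<Rightarrow> ('w \<Rightarrow> 'w) \<Rightarrow> ('w \<Rightarrow> (nat \<Rightarrow> nat) \<Rightarrow> 'w)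
      \<Rightarrow> ('v \<Rightarrow> 'w) \<Rightarrow> bool" where
  "dS_hom F n V d a W d' a' h \<longleftrightarrow>
     h \<in> even_maps F V W \<and>
     (\<forall>x\<in>carrier V. h (d x) = d' (h x)) \<and>
     (\<forall>x\<in>carrier V. \<forall>\<sigma>. \<sigma> permutes {1..n} \<longrightarrow> h (a x \<sigma>) = a' (h x) \<sigma>)"


section \<open>Pro-conformal pseudo operads\<close>

text \<open>
  The data of a pro-conformal pseudo operad: the superspaces \<open>P(n)\<close> with \<open>\<partial>\<close> and the actions of
  \<open>S\<^sub>n\<close>, the products, where \<open>ocirc P n m i f g k\<close> is the coefficient of \<open>\<lambda>\<^sup>k\<close> in the product
  of \<open>f \<in> P(n)\<close> and \<open>g \<in> P(m)\<close> at \<open>i\<close>, and for each \<open>n\<close> the projective system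
  \<open>(P\<^sub>q(n))\<close>, with transition maps \<open>otrans P q n: P\<^sub>q\<^sub>+\<^sub>1(n) \<rightarrow> P\<^sub>q(n)\<close> and canonical
  maps \<open>oproj P q n: P(n) \<rightarrow> P\<^sub>q(n)\<close>.
\<close>

record ('f, 'v, 'w) pro_operad =
  osp :: "nat \<Rightarrow> ('f, 'v) superspace"
  oder :: "nat \<Rightarrow> 'v \<Rightarrow> 'v"
  oact :: "nat \<Rightarrow> 'v \<Rightarrow> (nat \<Rightarrow> nat) \<Rightarrow> 'v"
  ocirc :: "nat \<Rightarrow> nat \<Rightarrow> nat \<Rightarrow> 'v \<Rightarrow> 'v \<Rightarrow> nat \<Rightarrow> 'v"
  osys :: "nat \<Rightarrow> nat \<Rightarrow> ('f, 'w) superspace"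
  osysder :: "nat \<Rightarrow> nat \<Rightarrow> 'w \<Rightarrow> 'w"
  osysact :: "nat \<Rightarrow> nat \<Rightarrow> 'w \<Rightarrow> (nat \<Rightarrow> nat) \<Rightarrow> 'w"
  otrans :: "nat \<Rightarrow> nat \<Rightarrow> 'w \<Rightarrow> 'w"
  oproj :: "nat \<Rightarrow> nat \<Rightarrow> 'v \<Rightarrow> 'w"

text \<open>
  Identities between formal power series are stated coefficientwise: those of \<open>\<lambda>\<^sup>k\<close> in
  \<open>sesqui_left\<close>, \<open>sesqui_right\<close>, \<open>equivariance\<close>, and those of \<open>\<lambda>\<^sup>r\<mu>\<^sup>s\<close> in \<open>assoc_parallel\<close>,
  \<open>assoc_nested\<close>. In the latter, the contribution of the coefficient \<open>g \<circ> h\<close> of \<open>\<mu>\<^sup>t\<close> to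
  \<open>\<lambda>\<^sup>r\<mu>\<^sup>s\<close> comes from \<open>(\<lambda> + \<mu>)\<^bsup>r+s-t\<^esup>\<close>.
\<close>

locale pro_conformal_pseudo_operad =
  fixes F :: "('f, 'r) ring_scheme" and P :: "('f, 'v, 'w) pro_operad"
  assumes dS_module: "dS_module F n (osp P n) (oder P n) (oact P n)"
    and circ_bilinear:
      "\<lbrakk>1 \<le> i; i \<le> n\<rbrakk> \<Longrightarrow>
        even_bilinear F (osp P n) (osp P m) (osp P (m + n - 1)) (\<lambda>f g. ocirc P n m i f g k)"
    and sesqui_left:
      "\<lbrakk>1 \<le> i; i \<le> n; f \<in> carrier (osp P n); g \<in> carrier (osp P m)\<rbrakk> \<Longrightarrow>
        ocirc P n m i (oder P n f) g k =
          (if k = 0 then \<zero>\<^bsub>osp P (m + n - 1)\<^esub> else ocirc P n m i f g (k - 1))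
            \<oplus>\<^bsub>osp P (m + n - 1)\<^esub> oder P (m + n - 1) (ocirc P n m i f g k)"
    and sesqui_right:
      "\<lbrakk>1 \<le> i; i \<le> n; f \<in> carrier (osp P n); g \<in> carrier (osp P m)\<rbrakk> \<Longrightarrow>
        ocirc P n m i f (oder P m g) k =
          (if k = 0 then \<zero>\<^bsub>osp P (m + n - 1)\<^esub>
           else \<ominus>\<^bsub>osp P (m + n - 1)\<^esub> ocirc P n m i f g (k - 1))"
    and assoc_parallel:
      "\<lbrakk>1 \<le> j; j < i; i \<le> n; f \<in> carrier (osp P n);
        g \<in> hpart (osp P m) a; h \<in> hpart (osp P l) b\<rbrakk> \<Longrightarrow>
        ocirc P (m + n - 1) l j (ocirc P n m i f g r) h s =
          [koszul a b] \<cdot>\<^bsub>osp P (l + m + n - 2)\<^esub>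
            ocirc P (l + n - 1) m (l + i - 1) (ocirc P n l j f h s) g r"
    and assoc_nested:
      "\<lbrakk>1 \<le> i; i \<le> n; i \<le> j; j < i + m; f \<in> carrier (osp P n);
        g \<in> carrier (osp P m); h \<in> carrier (osp P l)\<rbrakk> \<Longrightarrow>
        ocirc P (m + n - 1) l j (ocirc P n m i f g r) h s =
          (\<Oplus>\<^bsub>osp P (l + m + n - 2)\<^esub>t\<in>{..s}.
             [int ((r + s - t) choose r)] \<cdot>\<^bsub>osp P (l + m + n - 2)\<^esub>
               ocirc P n (l + m - 1) i f (ocirc P m l (j - i + 1) g h t) (r + s - t))"
    and equivariance:
      "\<lbrakk>1 \<le> i; i \<le> n; f \<in> carrier (osp P n); g \<in> carrier (osp P m);
        \<sigma> permutes {1..n}; \<tau> permutes {1..m}\<rbrakk> \<Longrightarrow>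
        ocirc P n m i (oact P n f \<sigma>) (oact P m g \<tau>) k =
          oact P (m + n - 1) (ocirc P n m (\<sigma> i) f g k) (perm_circ n m i \<sigma> \<tau>)"
    and sys_dS_module: "dS_module F n (osys P q n) (osysder P q n) (osysact P q n)"
    and trans_hom:
      "dS_hom F n (osys P (Suc q) n) (osysder P (Suc q) n) (osysact P (Suc q) n)
         (osys P q n) (osysder P q n) (osysact P q n) (otrans P q n)"
    and proj_hom:
      "dS_hom F n (osp P n) (oder P n) (oact P n)
         (osys P q n) (osysder P q n) (osysact P q n) (oproj P q n)"
    and proj_trans:
      "x \<in> carrier (osp P n) \<Longrightarrow> otrans P q n (oproj P (Suc q) n x) = oproj P q n x"
    and proj_limit:
      "\<lbrakk>\<And>q. y q \<in> carrier (osys P q n); \<And>q. otrans P q n (y (Suc q)) = y q\<rbrakk> \<Longrightarrow>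
        \<exists>!x. x \<in> carrier (osp P n) \<and> (\<forall>q. oproj P q n x = y q)"
    and proj_circ_polynomial:
      "\<lbrakk>1 \<le> i; i \<le> n; f \<in> carrier (osp P n); g \<in> carrier (osp P m)\<rbrakk> \<Longrightarrow>
        finite {k. oproj P q (m + n - 1) (ocirc P n m i f g k) \<noteq> \<zero>\<^bsub>osys P q (m + n - 1)\<^esub>}"

text \<open>
  For a power series \<open>c\<close> over \<open>P(N)\<close> whose images over all \<open>P\<^sub>q(N)\<close> are polynomials,
  \<open>subst_neg P N c j\<close> is the coefficient of \<open>\<lambda>\<^sup>j\<close> after the substitution
  \<open>\<lambda> \<mapsto> -\<lambda> - \<partial>\<close>, and \<open>eval_neg_der P N c\<close> is the value at \<open>\<lambda> = -\<partial>\<close>.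
\<close>

definition subst_neg ::
    "('f, 'v, 'w) pro_operad \<Rightarrow> nat \<Rightarrow> (nat \<Rightarrow> 'v) \<Rightarrow> nat \<Rightarrow> 'v" where
  "subst_neg P N c j = (THE x. x \<in> carrier (osp P N) \<and>
     (\<forall>q. oproj P q N x =
       (\<Oplus>\<^bsub>osys P q N\<^esub>k\<in>{k. j \<le> k \<and> oproj P q N (c k) \<noteq> \<zero>\<^bsub>osys P q N\<^esub>}.
          [((-1) ^ k * int (k choose j))] \<cdot>\<^bsub>osys P q N\<^esub>
            (osysder P q N ^^ (k - j)) (oproj P q N (c k)))))"

definition eval_neg_der ::
    "('f, 'v, 'w) pro_operad \<Rightarrow> nat \<Rightarrow> (nat \<Rightarrow> 'v) \<Rightarrow> 'v" where
  "eval_neg_der P N c = (THE x. x \<in> carrier (osp P N) \<and>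
     (\<forall>q. oproj P q N x =
       (\<Oplus>\<^bsub>osys P q N\<^esub>k\<in>{k. oproj P q N (c k) \<noteq> \<zero>\<^bsub>osys P q N\<^esub>}.
          [((-1::int) ^ k)] \<cdot>\<^bsub>osys P q N\<^esub> (osysder P q N ^^ k) (oproj P q N (c k)))))"


section \<open>The associated pro-Lie conformal superalgebra\<close>

text \<open>
  \<open>conf_box P n m f g k\<close> is the coefficient of \<open>\<lambda>\<^sup>k\<close> in the \<open>\<lambda>\<close>-box product of
  \<open>f \<in> P(n+1)\<close> and \<open>g \<in> P(m+1)\<close>, where \<open>n, m \<ge> -1\<close>.
\<close>

definition conf_box ::
    "('f, 'v, 'w) pro_operad \<Rightarrow> int \<Rightarrow> int \<Rightarrow> 'v \<Rightarrow> 'v \<Rightarrow> nat \<Rightarrow> 'v" where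
  "conf_box P n m f g k =
     (let N = nat (n + m + 1)
      in \<Oplus>\<^bsub>osp P N\<^esub>\<sigma>\<in>shuffle_perms (m + 1) n.
           oact P N (subst_neg P N (ocirc P (nat (n + 1)) (nat (m + 1)) 1 f g) k) (inv_into UNIV \<sigma>))"

definition invariants ::
    "nat \<Rightarrow> ('f, 'v) superspace \<Rightarrow> ('v \<Rightarrow> (nat \<Rightarrow> nat) \<Rightarrow> 'v) \<Rightarrow> ('f, 'v) superspace" where
  "invariants n V a =
     (let I = {x \<in> carrier V. \<forall>\<sigma>. \<sigma> permutes {1..n} \<longrightarrow> a x \<sigma> = x}
      in V\<lparr>carrier := I, hpart := (\<lambda>p. hpart V p \<inter> I)\<rparr>)"

definition conf_W :: "('f, 'v, 'w) pro_operad \<Rightarrow> int \<Rightarrow> ('f, 'v) superspace" where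
  "conf_W P n = invariants (nat (n + 1)) (osp P (nat (n + 1))) (oact P (nat (n + 1)))"

text \<open>
  The coefficient of \<open>\<lambda>\<^sup>k\<close> in the \<open>\<lambda>\<close>-bracket of elements of degrees \<open>n\<close> and \<open>m\<close>. The defining
  formula for elements of definite parity is extended bilinearly.
\<close>

definition conf_bracket_deg ::
    "('f, 'v, 'w) pro_operad \<Rightarrow> int \<Rightarrow> int \<Rightarrow> 'v \<Rightarrow> 'v \<Rightarrow> nat \<Rightarrow> 'v" where
  "conf_bracket_deg P n m f g k =
     (let N = nat (n + m + 1)
      in \<Oplus>\<^bsub>osp P N\<^esub>p\<in>{0, 1}. \<Oplus>\<^bsub>osp P N\<^esub>q\<in>{0, 1}.
           conf_box P n m (hcomp (conf_W P n) p f) (hcomp (conf_W P m) q g) k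
             \<ominus>\<^bsub>osp P N\<^esub> [koszul p q] \<cdot>\<^bsub>osp P N\<^esub>
               subst_neg P N (conf_box P m n (hcomp (conf_W P m) q g) (hcomp (conf_W P n) p f)) k)"

definition conf_W_total :: "('f, 'v, 'w) pro_operad \<Rightarrow> ('f, int \<Rightarrow> 'v) graded_superspace" where
  "conf_W_total P = \<lparr>gspace = dsum_space (conf_W P), gpart = dsum_part (conf_W P)\<rparr>"

definition conf_bracket ::
    "('f, 'v, 'w) pro_operad \<Rightarrow> (int \<Rightarrow> 'v) \<Rightarrow> (int \<Rightarrow> 'v) \<Rightarrow> nat \<Rightarrow> int \<Rightarrow> 'v" where
  "conf_bracket P x y k =
     (\<lambda>n\<in>{-1..}. \<Oplus>\<^bsub>conf_W P n\<^esub>i\<in>{-1..n + 1}. conf_bracket_deg P i (n - i) (x i) (y (n - i)) k)"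

definition conf_der_image :: "('f, 'v, 'w) pro_operad \<Rightarrow> (int \<Rightarrow> 'v) set" where
  "conf_der_image P =
     (\<lambda>x. \<lambda>n\<in>{-1..}. oder P (nat (n + 1)) (x n)) ` carrier (gspace (conf_W_total P))"

definition conf_class :: "('f, 'v, 'w) pro_operad \<Rightarrow> (int \<Rightarrow> 'v) \<Rightarrow> (int \<Rightarrow> 'v) set" where
  "conf_class P x = conf_der_image P +>\<^bsub>gspace (conf_W_total P)\<^esub> x"

definition conf_W_quot ::
    "('f, 'v, 'w) pro_operad \<Rightarrow> ('f, (int \<Rightarrow> 'v) set) graded_super_lie" where
  "conf_W_quot P = \<lparr>
     gspace = quot_space (gspace (conf_W_total P)) (conf_der_image P),
     gpart = (\<lambda>n. conf_class P ` gpart (conf_W_total P) n),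
     bracket = (\<lambda>A B. \<Union>a\<in>A. \<Union>b\<in>B. conf_class P (conf_bracket P a b 0))\<rparr>"


section \<open>The associated linear pseudo operad and its Lie superalgebra\<close>

record ('f, 'v) lin_operad =
  lsp :: "nat \<Rightarrow> ('f, 'v) superspace"
  lact :: "nat \<Rightarrow> 'v \<Rightarrow> (nat \<Rightarrow> nat) \<Rightarrow> 'v"
  lcirc :: "nat \<Rightarrow> nat \<Rightarrow> nat \<Rightarrow> 'v \<Rightarrow> 'v \<Rightarrow> 'v"

definition op_class :: "('f, 'v, 'w) pro_operad \<Rightarrow> nat \<Rightarrow> 'v \<Rightarrow> 'v set" where
  "op_class P n f = (oder P n ` carrier (osp P n)) +>\<^bsub>osp P n\<^esub> f"

definition quot_operad :: "('f, 'v, 'w) pro_operad \<Rightarrow> ('f, 'v set) lin_operad" where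
  "quot_operad P = \<lparr>
     lsp = (\<lambda>n. quot_space (osp P n) (oder P n ` carrier (osp P n))),
     lact = (\<lambda>n A \<sigma>. \<Union>f\<in>A. op_class P n (oact P n f \<sigma>)),
     lcirc = (\<lambda>n m i A B. \<Union>f\<in>A. \<Union>g\<in>B. op_class P (m + n - 1) (ocirc P n m i f g 0))\<rparr>"

definition lin_box :: "('f, 'v) lin_operad \<Rightarrow> int \<Rightarrow> int \<Rightarrow> 'v \<Rightarrow> 'v \<Rightarrow> 'v" where
  "lin_box Q n m f g =
     (let N = nat (n + m + 1)
      in \<Oplus>\<^bsub>lsp Q N\<^esub>\<sigma>\<in>shuffle_perms (m + 1) n.
           lact Q N (lcirc Q (nat (n + 1)) (nat (m + 1)) 1 f g) (inv_into UNIV \<sigma>))"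

definition lin_W :: "('f, 'v) lin_operad \<Rightarrow> int \<Rightarrow> ('f, 'v) superspace" where
  "lin_W Q n = invariants (nat (n + 1)) (lsp Q (nat (n + 1))) (lact Q (nat (n + 1)))"

definition lin_bracket_deg :: "('f, 'v) lin_operad \<Rightarrow> int \<Rightarrow> int \<Rightarrow> 'v \<Rightarrow> 'v \<Rightarrow> 'v" where
  "lin_bracket_deg Q n m f g =
     (let N = nat (n + m + 1)
      in \<Oplus>\<^bsub>lsp Q N\<^esub>p\<in>{0, 1}. \<Oplus>\<^bsub>lsp Q N\<^esub>q\<in>{0, 1}.
           lin_box Q n m (hcomp (lin_W Q n) p f) (hcomp (lin_W Q m) q g)
             \<ominus>\<^bsub>lsp Q N\<^esub> [koszul p q] \<cdot>\<^bsub>lsp Q N\<^esub>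
               lin_box Q m n (hcomp (lin_W Q m) q g) (hcomp (lin_W Q n) p f))"

definition lin_W_lie :: "('f, 'v) lin_operad \<Rightarrow> ('f, int \<Rightarrow> 'v) graded_super_lie" where
  "lin_W_lie Q = \<lparr>
     gspace = dsum_space (lin_W Q),
     gpart = dsum_part (lin_W Q),
     bracket = (\<lambda>x y. \<lambda>n\<in>{-1..}.
       \<Oplus>\<^bsub>lin_W Q n\<^esub>i\<in>{-1..n + 1}. lin_bracket_deg Q i (n - i) (x i) (y (n - i)))\<rparr>"

end

theory Submission
  imports Defs "HOL-Library.Infinite_Set"
begin

text \<open>
  Let \<open>W\<close> be the conformal superalgebra and \<open>[a\<^sub>\<lambda> b]\<close> its bracket. Everything in the theorem is expressed
  by the value \<open>[a\<^sub>0 b]\<close> of the bracket at \<open>\<lambda> = 0\<close>. This bilinear operation satisfies the Jacobi identity in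
  the form \<open>[a\<^sub>0 [b\<^sub>0 c]] = [[a\<^sub>0 b]\<^sub>0 c] \<plusminus> [b\<^sub>0 [a\<^sub>0 c]]\<close> (\<open>T_leibniz\<close>), it is skew-symmetric modulo \<open>\<partial>W\<close> (\<open>T_skew\<close>), and
  \<open>[\<partial>a\<^sub>0 b] = 0\<close> and \<open>[a\<^sub>0 \<partial>b] = \<partial>[a\<^sub>0 b]\<close> (\<open>br_der\<close>). Therefore it induces the structure of a Lie superalgebra on
  each graded superspace that is the image of \<open>W\<close> under an even map that kills \<open>\<partial>W\<close> and is compatible with
  the brackets (\<open>graded_super_lie_image\<close>). This applies to the quotient \<open>W / \<partial>W\<close> and to the invariants of
  the linear pseudo operad, and the operators \<open>b \<mapsto> [a\<^sub>0 b]\<close> define the action.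

  The Jacobi identity rests on the symmetry of an associator. Let \<open>f \<box> g\<close> be the sum of the
  products \<open>(f \<circ>\<^sup>1\<^sub>\<lambda> g)\<close> over the shuffles, before any substitution (\<open>bul\<close>). On invariants, \<open>f \<box> g\<close> is a
  symmetrization up to a factor that is invertible in characteristic \<open>0\<close>, and a symmetrization absorbs
  the permutations of the arguments. Hence in \<open>(f \<box> g) \<box> h - f \<box> (g \<box> h)\<close> the nested compositions
  cancel, and the parallel ones are symmetric in \<open>g\<close> and \<open>h\<close> up to the sign (\<open>pre_lie\<close>).
  Now \<open>[f\<^sub>0 g]\<close> is the value of \<open>f \<box> g\<close> at \<open>\<lambda> = -\<partial>\<close> minus, up to the sign, the value of \<open>g \<box> f\<close> at \<open>\<lambda> = 0\<close>
  (\<open>conf_box_values\<close>). The values of the associators at \<open>-\<partial>\<close> and \<open>0\<close> (\<open>associator_star\<close>,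
  \<open>associator_dot\<close>) give three relations, of which the Jacobi identity is a linear combination
  (\<open>jacobi_homogeneous\<close>).

  The substitution of \<open>-\<partial>\<close> is an infinite sum in the projective limit, and has to be exchanged with the
  products. In the right factor this is formal (\<open>circ_E_right\<close>). In the left factor it requires the
  continuity of the products, which follows from the polynomiality of all of them over \<open>P\<^sub>q(N)\<close>: if infinitely
  many members of a sequence that tends to zero had nonzero products with \<open>h\<close>, then they could be arranged
  in a series whose product with \<open>h\<close> is not a polynomial (\<open>circ_left_continuous\<close>).

  The canonical map takes a family of invariants to the family of its classes. Averaging over the
  symmetric group shows that it is surjective (\<open>op_class_surj\<close>), and that an invariant element of \<open>\<partial>P(n)\<close>
  is the derivative of an invariant element (\<open>op_class_kernel\<close>), which gives the isomorphisms in single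
  degrees. Finally, \<open>[\<partial>a\<^sub>0 b] = 0\<close> implies that \<open>[a\<^sub>0 b]\<close> only depends on the image of \<open>a\<close> under the canonical map
  (\<open>action_opf\<close>).
\<close>

section \<open>Permutations\<close>

lemma permutes_range: "\<sigma> permutes {1..n} \<Longrightarrow> a \<in> {1..n} \<Longrightarrow> 1 \<le> \<sigma> a \<and> \<sigma> a \<le> (n::nat)"
  using permutes_in_image[of \<sigma> "{1..n}" a] by auto

lemma permutes_eqD: "\<sigma> permutes S \<Longrightarrow> \<sigma> a = \<sigma> b \<Longrightarrow> a = b"
  using permutes_inj[of \<sigma> S] by (auto dest: injD)

text \<open>
  The vectors that precede the factor \<open>a\<close> after \<open>\<sigma>\<close> belong to the \<open>\<sigma> a - 1\<close> factors moved in front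
  of it, and one of these has \<open>m\<close> vectors if it is the factor \<open>i\<close>.
\<close>

lemma vectors_before_factor:
  fixes \<sigma> :: "nat \<Rightarrow> nat"
  assumes \<sigma>: "\<sigma> permutes {1..n}" and a: "a \<in> {1..n}" and i: "i \<in> {1..n}"
  shows "(\<Sum>b | b \<in> {1..n} \<and> \<sigma> b < \<sigma> a. if b = i then m else 1) =
    (if \<sigma> i < \<sigma> a then m + \<sigma> a - 2 else \<sigma> a - 1)"
proof -
  define B where "B = {b. b \<in> {1..n} \<and> \<sigma> b < \<sigma> a}"
  have fin: "finite B" by (simp add: B_def)
  have "\<sigma> ` B = {1..<\<sigma> a}"
  proof (intro Set.set_eqI iffI)
    fix v assume "v \<in> \<sigma> ` B"
    then show "v \<in> {1..<\<sigma> a}" using permutes_range[OF \<sigma>] by (auto simp: B_def)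
  next
    fix v assume v: "v \<in> {1..<\<sigma> a}"
    with permutes_range[OF \<sigma> a] have "v \<in> {1..n}" by auto
    then obtain b where "b \<in> {1..n}" "\<sigma> b = v"
      using permutes_image[OF \<sigma>] by (metis imageE)
    with v show "v \<in> \<sigma> ` B" by (auto simp: B_def)
  qed
  moreover have "inj_on \<sigma> B"
    using permutes_inj[OF \<sigma>] by (rule inj_on_subset) simp
  ultimately have card: "card B = \<sigma> a - 1"
    using card_image[of \<sigma> B] by simp
  show ?thesis
  proof (cases "\<sigma> i < \<sigma> a")
    case True
    with i have "i \<in> B" by (simp add: B_def)
    then have "(\<Sum>b\<in>B. if b = i then m else 1) = m + (\<Sum>b\<in>B - {i}. if b = i then m else 1)"
      using fin by (subst sum.remove[of B i]) auto
    also have "(\<Sum>b\<in>B - {i}. if b = i then m else 1) = card (B - {i})"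
      by (subst sum.cong[OF refl, of _ _ "\<lambda>_. 1"]) auto
    finally show ?thesis
      unfolding B_def[symmetric] using True card \<open>i \<in> B\<close> fin permutes_range[OF \<sigma> i] by simp
  next
    case False
    then have "i \<notin> B" by (simp add: B_def)
    then have "(\<Sum>b\<in>B. if b = i then m else 1) = card B"
      by (subst sum.cong[OF refl, of _ _ "\<lambda>_. 1"]) auto
    then show ?thesis unfolding B_def[symmetric] using False card by simp
  qed
qed

text \<open>
  The sum in the definition is evaluated: the factors behind the block are shifted by \<open>m - 1\<close>.
\<close>

lemma perm_circ_eq:
  assumes \<sigma>: "\<sigma> permutes {1..n}" and i: "i \<in> {1..n}"
  shows "perm_circ n m i \<sigma> \<tau> k =
    (if k \<notin> {1..n + m - 1} then k
     else if k < i then (if \<sigma> k < \<sigma> i then \<sigma> k else m + \<sigma> k - 1)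
     else if k < i + m then \<sigma> i - 1 + \<tau> (k - i + 1)
     else if \<sigma> (k + 1 - m) < \<sigma> i then \<sigma> (k + 1 - m) else m + \<sigma> (k + 1 - m) - 1)"
proof (cases "k \<in> {1..n + m - 1}")
  case False
  then show ?thesis by (simp add: perm_circ_def Let_def del: atLeastAtMost_iff)
next
  case k: True
  have ri: "1 \<le> \<sigma> i" using permutes_range[OF \<sigma> i] by simp
  consider "k < i" | "i \<le> k" "k < i + m" | "i + m \<le> k" by linarith
  then show ?thesis
  proof cases
    case 1
    with k i have k': "k \<in> {1..n}" by auto
    have "\<sigma> k \<noteq> \<sigma> i" using permutes_eqD[OF \<sigma>] 1 by blast
    then show ?thesis
      using 1 k permutes_range[OF \<sigma> k'] ri vectors_before_factor[OF \<sigma> k' i, of m]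
      by (auto simp: perm_circ_def Let_def simp del: One_nat_def)
  next
    case 2
    then show ?thesis using k vectors_before_factor[OF \<sigma> i i, of m]
      by (auto simp: perm_circ_def Let_def simp del: One_nat_def)
  next
    case 3
    with k i have k': "k + 1 - m \<in> {1..n}" by auto
    have "\<sigma> (k + 1 - m) \<noteq> \<sigma> i" using permutes_eqD[OF \<sigma>, of "k + 1 - m" i] 3 by auto
    then have "\<sigma> (k + 1 - m) < \<sigma> i \<or> \<sigma> i < \<sigma> (k + 1 - m) \<and> 2 \<le> \<sigma> (k + 1 - m)"
      using ri by linarith
    then show ?thesis
      using 3 k vectors_before_factor[OF \<sigma> k' i, of m] permutes_range[OF \<sigma> k']
      unfolding perm_circ_def Let_def by (simp del: One_nat_def) linarith
  qed
qed

lemma perm_circ_permutes: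
  assumes \<sigma>: "\<sigma> permutes {1..n}" and \<tau>: "\<tau> permutes {1..m}" and i: "i \<in> {1..n}"
  shows "perm_circ n m i \<sigma> \<tau> permutes {1..n + m - 1}"
proof -
  let ?f = "perm_circ n m i \<sigma> \<tau>"
  define out where "out = (\<lambda>k. if k < i then k else k + 1 - m)"
  have ri: "1 \<le> \<sigma> i" "\<sigma> i \<le> n" using permutes_range[OF \<sigma> i] by auto
  \<comment> \<open>The position of a vector tells whether it belongs to the factor \<open>i\<close>, and then determines it.\<close>
  have inner: "\<sigma> i \<le> ?f k \<and> ?f k < \<sigma> i + m \<and> \<tau> (k - i + 1) = ?f k - \<sigma> i + 1 \<and> ?f k \<in> {1..n+m-1}"
    if k: "k \<in> {1..n + m - 1}" "i \<le> k" "k < i + m" for k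
  proof -
    have "k - i + 1 \<in> {1..m}" using k by auto
    then show ?thesis
      using permutes_range[OF \<tau>, of "k - i + 1"] k ri by (auto simp: perm_circ_eq[OF \<sigma> i])
  qed
  have outer: "(?f k < \<sigma> i \<and> \<sigma> (out k) = ?f k \<or> \<sigma> i + m \<le> ?f k \<and> \<sigma> (out k) = ?f k + 1 - m) \<and>
      ?f k \<in> {1..n+m-1}"
    if k: "k \<in> {1..n + m - 1}" "\<not> (i \<le> k \<and> k < i + m)" for k
  proof -
    have o: "out k \<in> {1..n}" "out k \<noteq> i" using k i by (auto simp: out_def)
    then have "\<sigma> (out k) \<noteq> \<sigma> i" using permutes_eqD[OF \<sigma>] by blast
    then show ?thesis
      using permutes_range[OF \<sigma> o(1)] k ri by (auto simp: perm_circ_eq[OF \<sigma> i] out_def)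
  qed
  have out_inj: "k = k'"
    if "out k = out k'" "\<not> (i \<le> k \<and> k < i + m)" "\<not> (i \<le> k' \<and> k' < i + m)" for k k'
    using that by (auto simp: out_def split: if_splits)
  have "inj_on ?f {1..n + m - 1}"
  proof (rule inj_onI)
    fix k k' assume k: "k \<in> {1..n + m - 1}" and k': "k' \<in> {1..n + m - 1}" and eq: "?f k = ?f k'"
    show "k = k'"
    proof (cases "i \<le> k \<and> k < i + m"; cases "i \<le> k' \<and> k' < i + m")
      assume a: "i \<le> k \<and> k < i + m" "i \<le> k' \<and> k' < i + m"
      then have "\<tau> (k - i + 1) = \<tau> (k' - i + 1)" using inner k k' eq by metis
      then have "k - i + 1 = k' - i + 1" by (rule permutes_eqD[OF \<tau>])
      with a show ?thesis by auto
    next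
      assume a: "\<not> (i \<le> k \<and> k < i + m)" "\<not> (i \<le> k' \<and> k' < i + m)"
      then have "\<sigma> (out k) = \<sigma> (out k')" using outer[OF k] outer[OF k'] eq by linarith
      then have "out k = out k'" by (rule permutes_eqD[OF \<sigma>])
      with a show ?thesis using out_inj by blast
    next
      assume a: "i \<le> k \<and> k < i + m" "\<not> (i \<le> k' \<and> k' < i + m)"
      then show ?thesis using inner[OF k] outer[OF k'] eq by linarith
    next
      assume a: "\<not> (i \<le> k \<and> k < i + m)" "i \<le> k' \<and> k' < i + m"
      then show ?thesis using inner[OF k'] outer[OF k] eq by linarith
    qed
  qed
  moreover have "?f ` {1..n + m - 1} \<subseteq> {1..n + m - 1}"
    using inner outer by blast
  ultimately have "bij_betw ?f {1..n + m - 1} {1..n + m - 1}"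
    by (simp only: bij_betw_def endo_inj_surj[OF finite_atLeastAtMost])
  then show ?thesis
    by (rule bij_imp_permutes) (simp add: perm_circ_def Let_def del: atLeastAtMost_iff)
qed

text \<open>
  The transposition moves the block of \<open>m\<close> vectors to the front, and the first vector behind it and the
  \<open>i - 2\<close> vectors in between.
\<close>

lemma perm_circ_transpose_first:
  assumes "i \<in> {2..n}"
  shows "perm_circ n m i (transpose 1 i) \<tau> 1 = m + i - 1"
proof -
  have "transpose 1 i permutes {1..n}" using assms by (intro permutes_swap_id) auto
  then show ?thesis using assms by (subst perm_circ_eq) auto
qed

text \<open>
  At the least point of disagreement, the smaller one of the two values would have to be taken by
  the other map at an earlier point.
\<close>

lemma strict_mono_on_image_unique:
  fixes f g :: "nat \<Rightarrow> nat"
  assumes f: "strict_mono_on A f" and g: "strict_mono_on A g" and im: "f ` A = g ` A" and "x \<in> A"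
  shows "f x = g x"
  using \<open>x \<in> A\<close>
proof (induction x rule: less_induct)
  case (less x)
  have *: "\<not> f' x < g' x"
    if mono: "strict_mono_on A f'" "strict_mono_on A g'" and image: "f' ` A = g' ` A"
      and IH: "\<And>y. y < x \<Longrightarrow> y \<in> A \<Longrightarrow> f' y = g' y" for f' g' :: "nat \<Rightarrow> nat"
  proof
    assume lt: "f' x < g' x"
    obtain y where y: "y \<in> A" "f' x = g' y" using image less.prems by (metis imageE imageI)
    with lt have "y < x"
      using strict_mono_on_less[OF mono(2)] less.prems by auto
    with IH y have "f' y = f' x" by auto
    with \<open>y < x\<close> y less.prems strict_mono_on_less[OF mono(1), of y x] show False by auto
  qed
  show ?case using *[OF f g im] *[OF g f im[symmetric]] less.IH by (metis linorder_neqE_nat)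
qed

text \<open>
  The Young subgroup \<open>S\<^sub>b \<times> S\<^sub>n\<close> of \<open>S\<^bsub>b+n\<^esub>\<close>.
\<close>

definition young :: "nat \<Rightarrow> nat \<Rightarrow> (nat \<Rightarrow> nat) set" where
  "young b n = {y. y permutes {1..b + n} \<and> y ` {1..b} = {1..b}}"

lemma shuffle_perms_nat:
  "shuffle_perms (int b) (int n) = {\<sigma>. \<sigma> permutes {1..b + n} \<and>
     strict_mono_on {1..b} \<sigma> \<and> strict_mono_on {b + 1..b + n} \<sigma>}"
  by (simp add: shuffle_perms_def nat_add_distrib)

lemma finite_shuffle_perms: "finite (shuffle_perms m n)"
  by (rule finite_subset[of _ "{\<sigma>. \<sigma> permutes {1..nat (m + n)}}"])
    (auto simp: shuffle_perms_def finite_permutations)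

lemma finite_young: "finite (young b n)"
  by (rule finite_subset[of _ "{\<sigma>. \<sigma> permutes {1..b + n}}"])
    (auto simp: young_def finite_permutations)

lemma permutes_image_upper:
  assumes "y permutes {1..b + n}" "(y ` {1..b} :: nat set) = C"
  shows "y ` {b + 1..b + n} = {1..b + n} - C"
proof -
  have "{b + 1..b + n} = {1..b + n} - {1..b}" by auto
  then have "y ` {b + 1..b + n} = y ` {1..b + n} - y ` {1..b}"
    using image_set_diff[OF permutes_inj[OF assms(1)]] by simp
  then show ?thesis using permutes_image[OF assms(1)] assms(2) by simp
qed

text \<open>
  A shuffle is determined by the image of the first block, so that the shuffles represent the
  cosets of the stabilizer of this block.
\<close>

lemma shuffle_young_bij:
  "bij_betw (\<lambda>(\<sigma>, y). \<sigma> \<circ> y) (shuffle_perms (int b) (int n) \<times> young b n) {\<pi>. \<pi> permutes {1..b + n}}"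
proof (rule bij_betw_imageI)
  show "inj_on (\<lambda>(\<sigma>, y). \<sigma> \<circ> y) (shuffle_perms (int b) (int n) \<times> young b n)"
  proof (rule inj_onI, clarify)
    fix \<sigma> y \<sigma>' y'
    assume s: "\<sigma> \<in> shuffle_perms (int b) (int n)" "\<sigma>' \<in> shuffle_perms (int b) (int n)"
      and y: "y \<in> young b n" "y' \<in> young b n" and eq: "\<sigma> \<circ> y = \<sigma>' \<circ> y'"
    have perm: "\<sigma> permutes {1..b + n}" "\<sigma>' permutes {1..b + n}"
      using s by (auto simp: shuffle_perms_nat)
    have "\<sigma> ` y ` {1..b} = \<sigma>' ` y' ` {1..b}" unfolding image_comp eq ..
    then have lower: "\<sigma> ` {1..b} = \<sigma>' ` {1..b}" using y by (simp add: young_def)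
    have "\<sigma> ` {b + 1..b + n} = \<sigma>' ` {b + 1..b + n}"
      unfolding permutes_image_upper[OF perm(1) lower] permutes_image_upper[OF perm(2) refl] ..
    note unique = strict_mono_on_image_unique[OF _ _ lower] strict_mono_on_image_unique[OF _ _ this]
    have "\<sigma> x = \<sigma>' x" if "x \<in> {1..b} \<or> x \<in> {b + 1..b + n}" for x
      using that s unique(1)[of x] unique(2)[of x] unfolding shuffle_perms_nat by blast
    moreover have "\<sigma> x = \<sigma>' x" if "\<not> (x \<in> {1..b} \<or> x \<in> {b + 1..b + n})" for x
      using that permutes_not_in[OF perm(1), of x] permutes_not_in[OF perm(2), of x] by auto
    ultimately have "\<sigma> = \<sigma>'" by blast
    moreover have "y = y'"
      using eq permutes_inj[OF perm(1)] unfolding \<open>\<sigma> = \<sigma>'\<close>[symmetric]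
      by (auto simp: fun_eq_iff dest: injD)
    ultimately show "\<sigma> = \<sigma>' \<and> y = y'" by simp
  qed
  show "(\<lambda>(\<sigma>, y). \<sigma> \<circ> y) ` (shuffle_perms (int b) (int n) \<times> young b n) = {\<pi>. \<pi> permutes {1..b + n}}"
  proof (intro Set.set_eqI iffI)
    fix \<pi> assume "\<pi> \<in> (\<lambda>(\<sigma>, y). \<sigma> \<circ> y) ` (shuffle_perms (int b) (int n) \<times> young b n)"
    then show "\<pi> \<in> {\<pi>. \<pi> permutes {1..b + n}}"
      by (auto simp: shuffle_perms_nat young_def intro: permutes_compose)
  next
    fix \<pi> assume "\<pi> \<in> {\<pi>. \<pi> permutes {1..b + n}}"
    then have \<pi>: "\<pi> permutes {1..b + n}" by simp
    have inj: "inj_on \<pi> A" for A using permutes_inj[OF \<pi>] by (rule inj_on_subset) simp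
    obtain h1 where h1: "bij_betw h1 {..<b} (\<pi> ` {1..b})" "strict_mono_on {..<b} h1"
      using ex_bij_betw_strict_mono_card[of "\<pi> ` {1..b}"] by (auto simp: card_image[OF inj])
    obtain h2 where h2: "bij_betw h2 {..<n} (\<pi> ` {b+1..b+n})" "strict_mono_on {..<n} h2"
      using ex_bij_betw_strict_mono_card[of "\<pi> ` {b+1..b+n}"] by (auto simp: card_image[OF inj])
    define \<sigma> where
      "\<sigma> k = (if k \<in> {1..b} then h1 (k - 1) else if k \<in> {b+1..b+n} then h2 (k - 1 - b) else k)" for k
    have "k \<in> (\<lambda>k. k - 1) ` {1..b}" if "k < b" for k
      using that by (intro image_eqI[of _ _ "Suc k"]) auto
    then have shift1: "(\<lambda>k. k - 1) ` {1..b} = {..<b}" by auto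
    have "\<sigma> ` {1..b} = h1 ` (\<lambda>k. k - 1) ` {1..b}"
      unfolding image_image by (rule image_cong) (auto simp: \<sigma>_def)
    then have im1: "\<sigma> ` {1..b} = \<pi> ` {1..b}"
      using h1(1) unfolding shift1 by (simp add: bij_betw_def)
    have "k \<in> (\<lambda>k. k - 1 - b) ` {b+1..b+n}" if "k < n" for k
      using that by (intro image_eqI[of _ _ "k + b + 1"]) auto
    then have shift2: "(\<lambda>k. k - 1 - b) ` {b+1..b+n} = {..<n}" by auto
    have "\<sigma> ` {b+1..b+n} = h2 ` (\<lambda>k. k - 1 - b) ` {b+1..b+n}"
      unfolding image_image by (rule image_cong) (auto simp: \<sigma>_def)
    then have im2: "\<sigma> ` {b+1..b+n} = \<pi> ` {b+1..b+n}"
      using h2(1) unfolding shift2 by (simp add: bij_betw_def)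
    have split: "{1..b+n} = {1..b} \<union> {b+1..b+n}" by auto
    have "\<sigma> ` {1..b+n} = {1..b+n}"
      using permutes_image[OF \<pi>] im1 im2 unfolding split by (simp only: image_Un)
    then have "bij_betw \<sigma> {1..b+n} {1..b+n}"
      by (simp add: bij_betw_def eq_card_imp_inj_on)
    then have \<sigma>: "\<sigma> permutes {1..b+n}"
      by (rule bij_imp_permutes) (auto simp: \<sigma>_def)
    have m1: "strict_mono_on {1..b} \<sigma>"
    proof (rule strict_mono_onI)
      fix r s assume "r \<in> {1..b}" "s \<in> {1..b}" "r < s"
      then show "\<sigma> r < \<sigma> s"
        using strict_mono_onD[OF h1(2), of "r - 1" "s - 1"] by (auto simp: \<sigma>_def)
    qed
    have m2: "strict_mono_on {b+1..b+n} \<sigma>"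
    proof (rule strict_mono_onI)
      fix r s assume "r \<in> {b+1..b+n}" "s \<in> {b+1..b+n}" "r < s"
      then show "\<sigma> r < \<sigma> s"
        using strict_mono_onD[OF h2(2), of "r - 1 - b" "s - 1 - b"] by (auto simp: \<sigma>_def)
    qed
    have sh: "\<sigma> \<in> shuffle_perms (int b) (int n)"
      unfolding shuffle_perms_nat using \<sigma> m1 m2 by simp
    have "(inv_into UNIV \<sigma> \<circ> \<pi>) ` {1..b} = inv_into UNIV \<sigma> ` \<sigma> ` {1..b}"
      by (simp only: image_comp[symmetric] im1)
    also have "\<dots> = {1..b}"
      by (simp add: image_comp permutes_inv_o(2)[OF \<sigma>])
    finally have "inv_into UNIV \<sigma> \<circ> \<pi> \<in> young b n"
      using \<sigma> \<pi> by (simp add: young_def permutes_compose permutes_inv)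
    moreover have "\<pi> = \<sigma> \<circ> (inv_into UNIV \<sigma> \<circ> \<pi>)"
      by (simp add: comp_assoc[symmetric] permutes_inv_o(1)[OF \<sigma>])
    ultimately show "\<pi> \<in> (\<lambda>(\<sigma>, y). \<sigma> \<circ> y) ` (shuffle_perms (int b) (int n) \<times> young b n)"
      using sh by (auto simp: image_iff intro!: bexI[of _ "(\<sigma>, inv_into UNIV \<sigma> \<circ> \<pi>)"])
  qed
qed

lemma permutes_block:
  assumes "y permutes {1..b + n}" "y ` A = A" "A \<subseteq> {1..b+n::nat}"
  shows "(\<lambda>k. if k \<in> A then y k else k) permutes A"
proof (rule bij_imp_permutes)
  have "inj_on y A" using permutes_inj[OF assms(1)] by (rule inj_on_subset) simp
  then show "bij_betw (\<lambda>k. if k \<in> A then y k else k) A A"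
    using assms(2) by (simp add: bij_betw_def inj_on_def cong: image_cong)
qed simp

lemma card_young: "card (young b n) = fact b * fact n"
proof -
  let ?S = "{\<tau>. \<tau> permutes {1..b}}" and ?T = "{\<rho>. \<rho> permutes {b+1..b+n}}"
  have lower: "(\<tau> \<circ> \<rho>) k = \<tau> k" if "\<rho> \<in> ?T" "k \<in> {1..b}" for \<tau> \<rho> k
    using that permutes_not_in[of \<rho> "{b+1..b+n}" k] by auto
  have upper: "(\<tau> \<circ> \<rho>) k = \<rho> k" if "\<tau> \<in> ?S" "\<rho> \<in> ?T" "k \<notin> {1..b}" for \<tau> \<rho> k
  proof -
    have "\<rho> k \<notin> {1..b}"
      using that permutes_in_image[of \<rho> "{b+1..b+n}" k] permutes_not_in[of \<rho> "{b+1..b+n}" k]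
      by (cases "k \<in> {b+1..b+n}") auto
    then show ?thesis using that permutes_not_in[of \<tau> "{1..b}"] by auto
  qed
  have "bij_betw (\<lambda>(\<tau>, \<rho>). \<tau> \<circ> \<rho>) (?S \<times> ?T) (young b n)"
  proof (rule bij_betw_imageI)
    show "inj_on (\<lambda>(\<tau>, \<rho>). \<tau> \<circ> \<rho>) (?S \<times> ?T)"
    proof (rule inj_onI, clarify)
      fix \<tau> \<rho> \<tau>' \<rho>'
      assume p: "\<tau> permutes {1..b}" "\<rho> permutes {b+1..b+n}" "\<tau>' permutes {1..b}" "\<rho>' permutes {b+1..b+n}"
        and eq: "\<tau> \<circ> \<rho> = \<tau>' \<circ> \<rho>'"
      have "\<tau> k = \<tau>' k" for k
        using p lower[of \<rho> k \<tau>] lower[of \<rho>' k \<tau>'] eq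
          permutes_not_in[of \<tau> "{1..b}" k] permutes_not_in[of \<tau>' "{1..b}" k]
        by (cases "k \<in> {1..b}") simp_all
      moreover have "\<rho> k = \<rho>' k" for k
        using p upper[of \<tau> \<rho> k] upper[of \<tau>' \<rho>' k] eq
          permutes_not_in[of \<rho> "{b+1..b+n}" k] permutes_not_in[of \<rho>' "{b+1..b+n}" k]
        by (cases "k \<in> {1..b}") simp_all
      ultimately show "\<tau> = \<tau>' \<and> \<rho> = \<rho>'" by auto
    qed
    show "(\<lambda>(\<tau>, \<rho>). \<tau> \<circ> \<rho>) ` (?S \<times> ?T) = young b n"
    proof (intro Set.set_eqI iffI)
      fix y assume "y \<in> (\<lambda>(\<tau>, \<rho>). \<tau> \<circ> \<rho>) ` (?S \<times> ?T)"
      then obtain \<tau> \<rho> where y: "y = \<tau> \<circ> \<rho>" "\<tau> \<in> ?S" "\<rho> \<in> ?T" by auto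
      then have "y permutes {1..b+n}"
        using permutes_compose[OF permutes_subset[of \<rho> "{b+1..b+n}" "{1..b+n}"]
            permutes_subset[of \<tau> "{1..b}" "{1..b+n}"]] by auto
      moreover have "y ` {1..b} = {1..b}"
      proof -
        have "y ` {1..b} = \<tau> ` {1..b}"
          unfolding y(1) by (intro image_cong refl lower y(3))
        then show ?thesis using permutes_image[of \<tau> "{1..b}"] y(2) by simp
      qed
      ultimately show "y \<in> young b n" by (simp add: young_def)
    next
      fix y assume "y \<in> young b n"
      then have y: "y permutes {1..b + n}" "y ` {1..b} = {1..b}" by (auto simp: young_def)
      have y': "y ` {b+1..b+n} = {b+1..b+n}"
        unfolding permutes_image_upper[OF y] by auto
      let ?\<tau> = "\<lambda>k. if k \<in> {1..b} then y k else k" and ?\<rho> = "\<lambda>k. if k \<in> {b+1..b+n} then y k else k"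
      have p: "?\<tau> permutes {1..b}" "?\<rho> permutes {b+1..b+n}"
        using permutes_block[OF y] permutes_block[OF y(1) y'] by auto
      have "y = ?\<tau> \<circ> ?\<rho>"
      proof
        fix k
        consider "k \<in> {1..b}" | "k \<in> {b+1..b+n}" | "k \<notin> {1..b+n}" by fastforce
        then show "y k = (?\<tau> \<circ> ?\<rho>) k"
        proof cases
          case 2
          then have "y k \<in> {b+1..b+n}" using y' by blast
          with 2 show ?thesis by auto
        qed (use permutes_not_in[OF y(1), of k] in auto)
      qed
      with p show "y \<in> (\<lambda>(\<tau>, \<rho>). \<tau> \<circ> \<rho>) ` (?S \<times> ?T)"
        by (auto simp: image_iff intro!: bexI[of _ "(?\<tau>, ?\<rho>)"])
    qed
  qed
  then have "card (young b n) = card ?S * card ?T"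
    by (metis bij_betw_same_card card_cartesian_product)
  then show ?thesis
    by (simp add: card_permutations[of _ b] card_permutations[of _ n])
qed

text \<open>
  The stabilizer of the first block consists of the permutations \<open>\<sigma> \<circ>\<^sub>1 \<tau>\<close> where \<open>\<sigma>\<close> fixes \<open>1\<close>. So
  products at \<open>1\<close> of invariants are invariant under this subgroup.
\<close>

lemma young_perm_circ:
  assumes "y \<in> young b n"
  obtains \<sigma> \<tau> where "\<sigma> permutes {1..Suc n}" "\<tau> permutes {1..b}" "\<sigma> 1 = 1"
    "y = perm_circ (Suc n) b 1 \<sigma> \<tau>"
proof
  let ?\<tau> = "\<lambda>k. if k \<in> {1..b} then y k else k"
  let ?\<sigma> = "\<lambda>k. if k \<in> {2..Suc n} then y (k + b - 1) + 1 - b else k"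
  from assms have y: "y permutes {1..b + n}" "y ` {1..b} = {1..b}" by (auto simp: young_def)
  have y': "y ` {b+1..b+n} = {b+1..b+n}"
    unfolding permutes_image_upper[OF y] by auto
  show \<tau>: "?\<tau> permutes {1..b}" using permutes_block[OF y] by auto
  have up: "y (k + b - 1) \<in> {b+1..b+n}" if "k \<in> {2..Suc n}" for k
  proof -
    from that have "k + b - 1 \<in> {b+1..b+n}" by auto
    with y' show ?thesis by blast
  qed
  have "?\<sigma> permutes {2..Suc n}"
  proof (rule bij_imp_permutes)
    have "inj_on ?\<sigma> {2..Suc n}"
    proof (rule inj_onI)
      fix k k' assume k: "k \<in> {2..Suc n}" "k' \<in> {2..Suc n}" and "?\<sigma> k = ?\<sigma> k'"
      then have "y (k + b - 1) = y (k' + b - 1)"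
        using up[OF k(1)] up[OF k(2)] k by (simp del: One_nat_def) linarith
      then have "k + b - 1 = k' + b - 1" by (rule permutes_eqD[OF y(1)])
      with k show "k = k'" by auto
    qed
    moreover have "?\<sigma> ` {2..Suc n} \<subseteq> {2..Suc n}"
    proof
      fix v assume "v \<in> ?\<sigma> ` {2..Suc n}"
      then obtain k where k: "k \<in> {2..Suc n}" "v = ?\<sigma> k" by blast
      with up[OF k(1)] show "v \<in> {2..Suc n}" by auto
    qed
    ultimately show "bij_betw ?\<sigma> {2..Suc n} {2..Suc n}"
      by (simp only: bij_betw_def endo_inj_surj[OF finite_atLeastAtMost])
  qed auto
  then show \<sigma>: "?\<sigma> permutes {1..Suc n}" by (rule permutes_subset) auto
  show one: "?\<sigma> 1 = 1" by simp
  show "y = perm_circ (Suc n) b 1 ?\<sigma> ?\<tau>"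
  proof
    fix k
    have i1: "(1::nat) \<in> {1..Suc n}" by simp
    consider "k \<notin> {1..b+n}" | "k \<in> {1..b}" | "k \<in> {b+1..b+n}" by fastforce
    then show "y k = perm_circ (Suc n) b 1 ?\<sigma> ?\<tau> k"
    proof cases
      case 1
      then have "y k = k" by (rule permutes_not_in[OF y(1)])
      with 1 show ?thesis by (subst perm_circ_eq[OF \<sigma> i1]) auto
    next
      case 2
      then show ?thesis by (subst perm_circ_eq[OF \<sigma> i1]) auto
    next
      case 3
      then have k: "k + 1 - b \<in> {2..Suc n}" by auto
      from 3 have "k + 1 - b + b - 1 = k" by auto
      with up[OF k] have "y k \<in> {b+1..b+n}" by simp
      with 3 k \<open>k + 1 - b + b - 1 = k\<close> show ?thesis
        by (subst perm_circ_eq[OF \<sigma> i1]) auto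
    qed
  qed
qed

lemma card_permutes_first:
  assumes j: "j \<in> {1..Suc n}"
  shows "card {\<sigma>. \<sigma> permutes {1..Suc n} \<and> \<sigma> 1 = j} = fact n"
proof -
  let ?t = "transpose 1 j"
  have t: "?t permutes {1..Suc n}" using j by (intro permutes_swap_id) auto
  have fix1: "{\<sigma>. \<sigma> permutes {1..Suc n} \<and> \<sigma> 1 = 1} = {\<sigma>. \<sigma> permutes {2..Suc n}}"
  proof (intro Set.set_eqI iffI)
    fix \<sigma> assume "\<sigma> \<in> {\<sigma>. \<sigma> permutes {1..Suc n} \<and> \<sigma> 1 = 1}"
    then have "\<sigma> permutes {1..Suc n}" "\<sigma> 1 = 1" by auto
    then show "\<sigma> \<in> {\<sigma>. \<sigma> permutes {2..Suc n}}"
    proof (intro CollectI permutes_superset[of \<sigma> "{1..Suc n}" "{2..Suc n}"])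
      fix x assume "x \<in> {1..Suc n} - {2..Suc n}"
      then have "x = 1" by auto
      with \<open>\<sigma> 1 = 1\<close> show "\<sigma> x = x" by simp
    qed
  next
    fix \<sigma> :: "nat \<Rightarrow> nat" assume "\<sigma> \<in> {\<sigma>. \<sigma> permutes {2..Suc n}}"
    then show "\<sigma> \<in> {\<sigma>. \<sigma> permutes {1..Suc n} \<and> \<sigma> 1 = 1}"
      using permutes_subset[of \<sigma> "{2..Suc n}" "{1..Suc n}"] permutes_not_in[of \<sigma> "{2..Suc n}" 1] by auto
  qed
  have "bij_betw ((\<circ>) ?t) {\<sigma>. \<sigma> permutes {1..Suc n} \<and> \<sigma> 1 = 1} {\<sigma>. \<sigma> permutes {1..Suc n} \<and> \<sigma> 1 = j}"
  proof (rule bij_betw_byWitness[where f' = "(\<circ>) ?t"])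
    show "(\<circ>) ?t ` {\<sigma>. \<sigma> permutes {1..Suc n} \<and> \<sigma> 1 = 1} \<subseteq> {\<sigma>. \<sigma> permutes {1..Suc n} \<and> \<sigma> 1 = j}"
      using permutes_compose[OF _ t] by (auto simp del: One_nat_def)
    show "(\<circ>) ?t ` {\<sigma>. \<sigma> permutes {1..Suc n} \<and> \<sigma> 1 = j} \<subseteq> {\<sigma>. \<sigma> permutes {1..Suc n} \<and> \<sigma> 1 = 1}"
      using permutes_compose[OF _ t] by (auto simp del: One_nat_def)
  qed (simp_all add: fun_eq_iff)
  then have "card {\<sigma>. \<sigma> permutes {1..Suc n} \<and> \<sigma> 1 = j} = card {\<sigma>. \<sigma> permutes {2..Suc n}}"
    using bij_betw_same_card fix1 by fastforce
  then show ?thesis by (simp add: card_permutations[of _ n])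
qed

section \<open>Superspaces\<close>

lemma (in module) nat_scalar:
  "x \<in> carrier M \<Longrightarrow> [(k::nat)] \<cdot>\<^bsub>M\<^esub> x = ([k] \<cdot>\<^bsub>R\<^esub> \<one>\<^bsub>R\<^esub>) \<odot>\<^bsub>M\<^esub> x"
  by (induction k) (simp_all add: smult_l_distr)

lemma (in module) int_scalar:
  "x \<in> carrier M \<Longrightarrow> [(k::int)] \<cdot>\<^bsub>M\<^esub> x = ([k] \<cdot>\<^bsub>R\<^esub> \<one>\<^bsub>R\<^esub>) \<odot>\<^bsub>M\<^esub> x"
  by (cases "k < 0") (simp_all add: add_pow_int_lt add_pow_int_ge nat_scalar smult_l_minus)

text \<open>The Koszul sign as a scalar, so that linear maps commute with it.\<close>

definition sgn_of :: "('f, 'r) ring_scheme \<Rightarrow> bit \<Rightarrow> bit \<Rightarrow> 'f" where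
  "sgn_of F p q = (if p = 1 \<and> q = 1 then \<ominus>\<^bsub>F\<^esub> \<one>\<^bsub>F\<^esub> else \<one>\<^bsub>F\<^esub>)"

lemma (in module) koszul_scalar:
  "x \<in> carrier M \<Longrightarrow> [koszul p q] \<cdot>\<^bsub>M\<^esub> x = sgn_of R p q \<odot>\<^bsub>M\<^esub> x"
  by (simp add: koszul_def sgn_of_def int_scalar add_pow_int_lt add_pow_int_ge)

lemma (in module) sgn_of_closed [simp, intro]: "sgn_of R p q \<in> carrier R"
  by (simp add: sgn_of_def)

lemma sgn_of_commute: "sgn_of F p q = sgn_of F q p"
  by (auto simp: sgn_of_def)

lemma (in module) sgn_of_sq: "x \<in> carrier M \<Longrightarrow> sgn_of R p q \<odot>\<^bsub>M\<^esub> (sgn_of R p q \<odot>\<^bsub>M\<^esub> x) = x"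
  by (simp add: sgn_of_def smult_l_minus smult_r_minus)

lemma koszul_add: "koszul p (q + r) = koszul p q * koszul p r" "koszul (p + q) r = koszul p r * koszul q r"
  by (cases p; cases q; cases r; simp add: koszul_def)+

lemma koszul_sq: "koszul p q * koszul p q = 1" and koszul_commute: "koszul p q = koszul q p"
  by (auto simp: koszul_def)

lemma (in module) minus_scalar:
  "x \<in> carrier M \<Longrightarrow> y \<in> carrier M \<Longrightarrow> x \<ominus>\<^bsub>M\<^esub> y = x \<oplus>\<^bsub>M\<^esub> (\<ominus>\<^bsub>R\<^esub> \<one>\<^bsub>R\<^esub>) \<odot>\<^bsub>M\<^esub> y"
  by (simp add: M.minus_eq smult_l_minus)

lemma (in module) smult_commute:
  "a \<in> carrier R \<Longrightarrow> b \<in> carrier R \<Longrightarrow> x \<in> carrier M \<Longrightarrow>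
    a \<odot>\<^bsub>M\<^esub> (b \<odot>\<^bsub>M\<^esub> x) = b \<odot>\<^bsub>M\<^esub> (a \<odot>\<^bsub>M\<^esub> x)"
  by (simp add: smult_assoc1[symmetric] R.m_comm)

text \<open>Linear maps preserve all the operations that are derived from addition and scalars.\<close>

locale linear_map = V: module F V + W: module F W
  for F :: "('f, 'r) ring_scheme" and V :: "('f, 'v, 'x) module_scheme" and W :: "('f, 'w, 'y) module_scheme" +
  fixes h
  assumes linear: "h \<in> linear_maps F V W"
begin

lemma closed [simp]: "x \<in> carrier V \<Longrightarrow> h x \<in> carrier W"
  and add: "x \<in> carrier V \<Longrightarrow> y \<in> carrier V \<Longrightarrow> h (x \<oplus>\<^bsub>V\<^esub> y) = h x \<oplus>\<^bsub>W\<^esub> h y"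
  and scale: "a \<in> carrier F \<Longrightarrow> x \<in> carrier V \<Longrightarrow> h (a \<odot>\<^bsub>V\<^esub> x) = a \<odot>\<^bsub>W\<^esub> h x"
  using linear by (auto simp: linear_maps_def)

lemma zero [simp]: "h \<zero>\<^bsub>V\<^esub> = \<zero>\<^bsub>W\<^esub>"
  using scale[of "\<zero>\<^bsub>F\<^esub>" "\<zero>\<^bsub>V\<^esub>"] by simp

lemma uminus: "x \<in> carrier V \<Longrightarrow> h (\<ominus>\<^bsub>V\<^esub> x) = \<ominus>\<^bsub>W\<^esub> h x"
  using scale[of "\<ominus>\<^bsub>F\<^esub> \<one>\<^bsub>F\<^esub>" x] by (simp add: V.smult_l_minus W.smult_l_minus)

lemma minus: "x \<in> carrier V \<Longrightarrow> y \<in> carrier V \<Longrightarrow> h (x \<ominus>\<^bsub>V\<^esub> y) = h x \<ominus>\<^bsub>W\<^esub> h y"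
  by (simp add: V.minus_eq W.minus_eq add uminus)

lemma nat_mult: "x \<in> carrier V \<Longrightarrow> h ([(k::nat)] \<cdot>\<^bsub>V\<^esub> x) = [k] \<cdot>\<^bsub>W\<^esub> h x"
  by (simp add: V.nat_scalar W.nat_scalar scale)

lemma int_mult: "x \<in> carrier V \<Longrightarrow> h ([(k::int)] \<cdot>\<^bsub>V\<^esub> x) = [k] \<cdot>\<^bsub>W\<^esub> h x"
  by (simp add: V.int_scalar W.int_scalar scale)

lemma finsum: "f \<in> A \<rightarrow> carrier V \<Longrightarrow> h (\<Oplus>\<^bsub>V\<^esub>i\<in>A. f i) = (\<Oplus>\<^bsub>W\<^esub>i\<in>A. h (f i))"
proof (induction A rule: infinite_finite_induct)
  case (insert a A)
  then have "f a \<in> carrier V" "f \<in> A \<rightarrow> carrier V" by auto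
  then have "(\<lambda>i. h (f i)) \<in> A \<rightarrow> carrier W" by (intro funcsetI closed) auto
  with insert \<open>f a \<in> carrier V\<close> \<open>f \<in> A \<rightarrow> carrier V\<close> show ?case by (simp add: add)
qed simp_all

end

lemma linear_map_comp:
  "linear_map F U V h \<Longrightarrow> linear_map F V W h' \<Longrightarrow> linear_map F U W (\<lambda>x. h' (h x))"
  by (auto simp: linear_map_def linear_map_axioms_def linear_maps_def Pi_iff)

lemma linear_map_diff:
  assumes "linear_map F U V h" "linear_map F U V h'"
  shows "linear_map F U V (\<lambda>x. h x \<ominus>\<^bsub>V\<^esub> [(k::int)] \<cdot>\<^bsub>V\<^esub> h' x)"
proof -
  interpret h: linear_map F U V h by fact
  interpret h': linear_map F U V h' by fact
  have e: "h x \<ominus>\<^bsub>V\<^esub> [k] \<cdot>\<^bsub>V\<^esub> h' x = h x \<oplus>\<^bsub>V\<^esub> (\<ominus>\<^bsub>F\<^esub> ([k] \<cdot>\<^bsub>F\<^esub> \<one>\<^bsub>F\<^esub>)) \<odot>\<^bsub>V\<^esub> h' x" if "x \<in> carrier U" for x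
    using that by (simp add: h.W.int_scalar h.W.minus_eq h.W.smult_l_minus)
  have "(\<lambda>x. h x \<ominus>\<^bsub>V\<^esub> [k] \<cdot>\<^bsub>V\<^esub> h' x) \<in> linear_maps F U V"
    unfolding linear_maps_def
  proof (intro CollectI conjI ballI funcsetI)
    fix a x assume "a \<in> carrier F" "x \<in> carrier U"
    then show "h (a \<odot>\<^bsub>U\<^esub> x) \<ominus>\<^bsub>V\<^esub> [k] \<cdot>\<^bsub>V\<^esub> h' (a \<odot>\<^bsub>U\<^esub> x) =
        a \<odot>\<^bsub>V\<^esub> (h x \<ominus>\<^bsub>V\<^esub> [k] \<cdot>\<^bsub>V\<^esub> h' x)"
      unfolding e[OF h.V.smult_closed[OF \<open>a \<in> carrier F\<close> \<open>x \<in> carrier U\<close>]] e[OF \<open>x \<in> carrier U\<close>]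
      by (simp add: h.scale h'.scale h.W.smult_r_distr h.W.smult_commute)
  next
    fix x y assume xy: "x \<in> carrier U" "y \<in> carrier U"
    show "h (x \<oplus>\<^bsub>U\<^esub> y) \<ominus>\<^bsub>V\<^esub> [k] \<cdot>\<^bsub>V\<^esub> h' (x \<oplus>\<^bsub>U\<^esub> y) =
        (h x \<ominus>\<^bsub>V\<^esub> [k] \<cdot>\<^bsub>V\<^esub> h' x) \<oplus>\<^bsub>V\<^esub> (h y \<ominus>\<^bsub>V\<^esub> [k] \<cdot>\<^bsub>V\<^esub> h' y)"
      unfolding e[OF h.V.a_closed[OF xy]] e[OF xy(1)] e[OF xy(2)]
      using xy by (simp add: h.add h'.add h.W.smult_r_distr h.W.a_ac)
  qed simp
  then show ?thesis
    by (intro linear_map.intro linear_map_axioms.intro h.V.module_axioms h.W.module_axioms)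
qed

lemma (in abelian_monoid) finsum_swap:
  assumes "finite A" "finite B" "\<And>i j. i \<in> A \<Longrightarrow> j \<in> B \<Longrightarrow> f i j \<in> carrier G"
  shows "(\<Oplus>\<^bsub>G\<^esub>i\<in>A. \<Oplus>\<^bsub>G\<^esub>j\<in>B. f i j) = (\<Oplus>\<^bsub>G\<^esub>j\<in>B. \<Oplus>\<^bsub>G\<^esub>i\<in>A. f i j)"
  using assms(1,3)
proof (induction A)
  case empty
  then show ?case by simp
next
  case (insert a A)
  then have "(\<Oplus>\<^bsub>G\<^esub>j\<in>B. \<Oplus>\<^bsub>G\<^esub>i\<in>insert a A. f i j) = (\<Oplus>\<^bsub>G\<^esub>j\<in>B. f a j \<oplus>\<^bsub>G\<^esub> (\<Oplus>\<^bsub>G\<^esub>i\<in>A. f i j))"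
    by (intro finsum_cong') (auto simp: Pi_def)
  also have "\<dots> = (\<Oplus>\<^bsub>G\<^esub>j\<in>B. f a j) \<oplus>\<^bsub>G\<^esub> (\<Oplus>\<^bsub>G\<^esub>j\<in>B. \<Oplus>\<^bsub>G\<^esub>i\<in>A. f i j)"
    using insert.prems by (subst finsum_addf) (auto simp: Pi_def)
  finally show ?case using insert by (simp add: Pi_def)
qed

lemma (in abelian_monoid) finsum_pairs:
  assumes "finite A" "finite B" "\<And>i j. i \<in> A \<Longrightarrow> j \<in> B \<Longrightarrow> f i j \<in> carrier G"
  shows "(\<Oplus>\<^bsub>G\<^esub>i\<in>A. \<Oplus>\<^bsub>G\<^esub>j\<in>B. f i j) = finsum G (\<lambda>(i, j). f i j) (A \<times> B)"
  using assms(1,3)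
proof (induction A)
  case empty
  then show ?case by simp
next
  case (insert a A)
  have "insert a A \<times> B = Pair a ` B \<union> A \<times> B" by auto
  moreover have "finsum G (\<lambda>(i, j). f i j) (Pair a ` B \<union> A \<times> B)
      = finsum G (\<lambda>(i, j). f i j) (Pair a ` B) \<oplus>\<^bsub>G\<^esub> finsum G (\<lambda>(i, j). f i j) (A \<times> B)"
    using insert assms(2) by (intro finsum_Un_disjoint) auto
  moreover have "finsum G (\<lambda>(i, j). f i j) (Pair a ` B) = (\<Oplus>\<^bsub>G\<^esub>j\<in>B. f a j)"
    using insert.prems by (subst finsum_reindex) (auto simp: inj_on_def)
  ultimately show ?case using insert by (simp add: Pi_def)
qed

text \<open>Sums with repeated terms, grouped by their index.\<close>

lemma (in abelian_monoid) finsum_fibres: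
  assumes "finite A" "finite B" "h ` A \<subseteq> B" "\<And>j. j \<in> B \<Longrightarrow> f j \<in> carrier G"
    and card: "\<And>j. j \<in> B \<Longrightarrow> card {a \<in> A. h a = j} = c"
  shows "(\<Oplus>\<^bsub>G\<^esub>a\<in>A. f (h a)) = [c] \<cdot>\<^bsub>G\<^esub> (\<Oplus>\<^bsub>G\<^esub>j\<in>B. f j)"
proof -
  have "A = (\<Union>j\<in>B. {a \<in> A. h a = j})" using assms(3) by auto
  then have "(\<Oplus>\<^bsub>G\<^esub>a\<in>A. f (h a)) = (\<Oplus>\<^bsub>G\<^esub>a\<in>(\<Union>j\<in>B. {a \<in> A. h a = j}). f (h a))" by simp
  also have "\<dots> = (\<Oplus>\<^bsub>G\<^esub>j\<in>B. \<Oplus>\<^bsub>G\<^esub>a\<in>{a \<in> A. h a = j}. f (h a))"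
    using assms by (intro add.finprod_UN_disjoint) (auto simp: pairwise_def disjnt_def)
  also have "\<dots> = (\<Oplus>\<^bsub>G\<^esub>j\<in>B. [c] \<cdot>\<^bsub>G\<^esub> f j)"
  proof (rule finsum_cong')
    fix j assume j: "j \<in> B"
    have "(\<Oplus>\<^bsub>G\<^esub>a\<in>{a \<in> A. h a = j}. f (h a)) = (\<Oplus>\<^bsub>G\<^esub>a\<in>{a \<in> A. h a = j}. f j)"
      using assms(4)[OF j] by (intro finsum_cong') auto
    also have "\<dots> = [c] \<cdot>\<^bsub>G\<^esub> f j"
      using add.finprod_const[OF assms(4)[OF j], of "{a \<in> A. h a = j}"] card[OF j] by simp
    finally show "(\<Oplus>\<^bsub>G\<^esub>a\<in>{a \<in> A. h a = j}. f (h a)) = [c] \<cdot>\<^bsub>G\<^esub> f j" .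
  qed (use assms in auto)
  also have "\<dots> = [c] \<cdot>\<^bsub>G\<^esub> (\<Oplus>\<^bsub>G\<^esub>j\<in>B. f j)"
    using assms(2,4)
  proof (induction B)
    case empty
    then show ?case using add.nat_pow_one by simp
  next
    case (insert b B)
    then show ?case by (simp add: Pi_def add.nat_pow_distrib)
  qed
  finally show ?thesis .
qed

lemma (in abelian_group) minus_eq_zero_iff:
  "x \<in> carrier G \<Longrightarrow> y \<in> carrier G \<Longrightarrow> x \<ominus>\<^bsub>G\<^esub> y = \<zero>\<^bsub>G\<^esub> \<longleftrightarrow> x = y"
  by (metis add.inv_solve_right l_zero minus_eq zero_closed)

lemma (in abelian_group) interleaved_cancel:
  assumes "a \<in> carrier G" "b \<in> carrier G" "v \<in> carrier G" "w \<in> carrier G"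
  shows "a \<oplus> (w \<oplus> (\<ominus> a \<oplus> (b \<oplus> (v \<oplus> \<ominus> b)))) = w \<oplus> v"
proof -
  have "a \<oplus> (w \<oplus> (\<ominus> a \<oplus> (b \<oplus> (v \<oplus> \<ominus> b)))) = w \<oplus> (a \<oplus> (\<ominus> a \<oplus> (b \<oplus> (v \<oplus> \<ominus> b))))"
    by (rule a_lcomm) (use assms in simp_all)
  also have "\<dots> = w \<oplus> (v \<oplus> (b \<oplus> \<ominus> b))"
    using assms a_lcomm[of b v "\<ominus> b"] by (simp add: r_neg2)
  finally show ?thesis using assms by (simp add: r_neg)
qed

lemma (in abelian_group) finsum_int_mult:
  assumes "finite A" "x \<in> carrier G"
  shows "(\<Oplus>\<^bsub>G\<^esub>i\<in>A. [(w i :: int)] \<cdot>\<^bsub>G\<^esub> x) = [(\<Sum>i\<in>A. w i)] \<cdot>\<^bsub>G\<^esub> x"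
  using assms(1) by induction (use assms(2) in \<open>simp_all add: add.int_pow_mult Pi_def add_pow_int_ge\<close>)

lemma int_mult_0 [simp]: "[(0::int)] \<cdot>\<^bsub>G\<^esub> x = \<zero>\<^bsub>G\<^esub>"
  by (simp add: add_pow_def)

text \<open>
  The uniqueness of the decomposition amounts to the triviality of the intersection of the two parts.
\<close>

lemma superspaceI:
  assumes "module F V" "field F" "\<And>p. submodule (hpart V p) F V"
    and split: "\<And>x. x \<in> carrier V \<Longrightarrow> \<exists>y\<in>hpart V 0. \<exists>z\<in>hpart V 1. x = y \<oplus>\<^bsub>V\<^esub> z"
    and trivial: "\<And>x. x \<in> hpart V 0 \<Longrightarrow> x \<in> hpart V 1 \<Longrightarrow> x = \<zero>\<^bsub>V\<^esub>"
  shows "superspace F V"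
proof -
  interpret module F V by fact
  have sub: "hpart V p \<subseteq> carrier V" for p using submoduleE(1)[OF assms(3)] .
  show ?thesis
  proof (intro superspace.intro superspace_axioms.intro assms(1-3))
    fix x assume "x \<in> carrier V"
    then obtain y z where yz: "y \<in> hpart V 0" "z \<in> hpart V 1" "x = y \<oplus>\<^bsub>V\<^esub> z" using split by blast
    show "\<exists>!c. (\<forall>p. c p \<in> hpart V p) \<and> x = c 0 \<oplus>\<^bsub>V\<^esub> c 1"
    proof (rule ex1I)
      show "(\<forall>p. (\<lambda>p. if p = 0 then y else z) p \<in> hpart V p) \<and>
          x = (\<lambda>p. if p = 0 then y else z) 0 \<oplus>\<^bsub>V\<^esub> (\<lambda>p. if p = 0 then y else z) (1::bit)"
        using yz bit_not_zero_iff by (auto split: if_splits)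
    next
      fix c :: "bit \<Rightarrow> _" assume c: "(\<forall>p. c p \<in> hpart V p) \<and> x = c 0 \<oplus>\<^bsub>V\<^esub> c 1"
      have car: "c 0 \<in> carrier V" "c 1 \<in> carrier V" "y \<in> carrier V" "z \<in> carrier V"
        using c yz sub by blast+
      have "c 0 \<ominus>\<^bsub>V\<^esub> y \<in> hpart V 0" "z \<ominus>\<^bsub>V\<^esub> c 1 \<in> hpart V 1"
        using c yz submoduleE(3,5)[OF assms(3)] by (auto simp: M.minus_eq)
      moreover have "c 0 \<ominus>\<^bsub>V\<^esub> y = z \<ominus>\<^bsub>V\<^esub> c 1"
      proof -
        have "(c 0 \<ominus>\<^bsub>V\<^esub> y) \<oplus>\<^bsub>V\<^esub> (y \<oplus>\<^bsub>V\<^esub> c 1) = c 0 \<oplus>\<^bsub>V\<^esub> c 1"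
          using car by (simp add: M.minus_eq M.a_assoc M.r_neg2 M.r_neg1)
        also have "\<dots> = z \<oplus>\<^bsub>V\<^esub> y" using c yz car M.a_comm by simp
        also have "\<dots> = (z \<ominus>\<^bsub>V\<^esub> c 1) \<oplus>\<^bsub>V\<^esub> (c 1 \<oplus>\<^bsub>V\<^esub> y)"
          using car by (simp add: M.minus_eq M.a_assoc M.r_neg2 M.r_neg1)
        finally show ?thesis using car by (simp add: M.a_comm[of y "c 1"])
      qed
      ultimately have "c 0 \<ominus>\<^bsub>V\<^esub> y = \<zero>\<^bsub>V\<^esub>" "z \<ominus>\<^bsub>V\<^esub> c 1 = \<zero>\<^bsub>V\<^esub>" using trivial by auto
      then have "c 0 = y" "c 1 = z" using car by (simp_all add: M.minus_eq_zero_iff)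
      then show "c = (\<lambda>p. if p = 0 then y else z)"
        using bit_not_zero_iff by (auto simp: fun_eq_iff)
    qed
  qed
qed

context superspace
begin

lemma hpart_closed [simp]: "x \<in> hpart V p \<Longrightarrow> x \<in> carrier V"
  using submoduleE(1)[OF hpart_submodule] by blast

lemma hpart_zero [simp]: "\<zero>\<^bsub>V\<^esub> \<in> hpart V p"
  using subgroup.one_closed[OF submodule.axioms(1)[OF hpart_submodule]] by simp

lemma hpart_add [simp]: "x \<in> hpart V p \<Longrightarrow> y \<in> hpart V p \<Longrightarrow> x \<oplus>\<^bsub>V\<^esub> y \<in> hpart V p"
  and hpart_smult [simp]: "a \<in> carrier F \<Longrightarrow> x \<in> hpart V p \<Longrightarrow> a \<odot>\<^bsub>V\<^esub> x \<in> hpart V p"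
  and hpart_uminus [simp]: "x \<in> hpart V p \<Longrightarrow> \<ominus>\<^bsub>V\<^esub> x \<in> hpart V p"
  using submoduleE[OF hpart_submodule] by blast+

lemma hpart_finsum: "(\<And>i. i \<in> A \<Longrightarrow> f i \<in> hpart V p) \<Longrightarrow> (\<Oplus>\<^bsub>V\<^esub>i\<in>A. f i) \<in> hpart V p"
proof (induction A rule: infinite_finite_induct)
  case (insert a A)
  then have "f \<in> A \<rightarrow> carrier V" "f a \<in> hpart V p" "f a \<in> carrier V" by (auto intro: hpart_closed)
  moreover have "finsum V f A \<in> hpart V p" using insert by simp
  ultimately show ?case using insert.hyps by simp
qed simp_all

lemma hcomp_split:
  assumes "x \<in> carrier V"
  shows hcomp_hpart [simp]: "hcomp V p x \<in> hpart V p"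
    and hcomp_sum: "hcomp V 0 x \<oplus>\<^bsub>V\<^esub> hcomp V 1 x = x"
proof -
  have "(\<forall>r. hcomp V r x \<in> hpart V r) \<and> x = hcomp V 0 x \<oplus>\<^bsub>V\<^esub> hcomp V 1 x"
    unfolding hcomp_def by (rule theI'[OF hpart_decomposition[OF assms]])
  then show "hcomp V p x \<in> hpart V p" "hcomp V 0 x \<oplus>\<^bsub>V\<^esub> hcomp V 1 x = x" by auto
qed

lemma hcomp_closed [simp]: "x \<in> carrier V \<Longrightarrow> hcomp V p x \<in> carrier V"
  using hpart_closed[OF hcomp_hpart] .

lemma hcomp_unique:
  assumes "\<And>p. c p \<in> hpart V p" "x = c 0 \<oplus>\<^bsub>V\<^esub> c 1"
  shows "hcomp V p x = c p"
proof -
  have "x \<in> carrier V" using assms by (metis M.a_closed hpart_closed)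
  then have "(THE c. (\<forall>r. c r \<in> hpart V r) \<and> x = c 0 \<oplus>\<^bsub>V\<^esub> c 1) = c"
    using hpart_decomposition assms by (intro the1_equality) auto
  then show ?thesis by (simp add: hcomp_def)
qed

lemma hcomp_homogeneous:
  assumes "x \<in> hpart V p"
  shows "hcomp V r x = (if r = p then x else \<zero>\<^bsub>V\<^esub>)"
  using assms by (intro hcomp_unique) (cases p; auto)+

lemma hcomp_linear: "hcomp V p \<in> linear_maps F V V"
proof -
  have "hcomp V p (x \<oplus>\<^bsub>V\<^esub> y) = hcomp V p x \<oplus>\<^bsub>V\<^esub> hcomp V p y"
    if xy: "x \<in> carrier V" "y \<in> carrier V" for x y
  proof (rule hcomp_unique)
    have "x \<oplus>\<^bsub>V\<^esub> y = (hcomp V 0 x \<oplus>\<^bsub>V\<^esub> hcomp V 1 x) \<oplus>\<^bsub>V\<^esub> (hcomp V 0 y \<oplus>\<^bsub>V\<^esub> hcomp V 1 y)"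
      using xy by (simp add: hcomp_sum)
    then show "x \<oplus>\<^bsub>V\<^esub> y = (hcomp V 0 x \<oplus>\<^bsub>V\<^esub> hcomp V 0 y) \<oplus>\<^bsub>V\<^esub> (hcomp V 1 x \<oplus>\<^bsub>V\<^esub> hcomp V 1 y)"
      using xy by (simp add: M.a_ac)
  qed (use xy in simp)
  moreover have "hcomp V p (a \<odot>\<^bsub>V\<^esub> x) = a \<odot>\<^bsub>V\<^esub> hcomp V p x"
    if ax: "a \<in> carrier F" "x \<in> carrier V" for a x
  proof (rule hcomp_unique)
    show "a \<odot>\<^bsub>V\<^esub> x = a \<odot>\<^bsub>V\<^esub> hcomp V 0 x \<oplus>\<^bsub>V\<^esub> a \<odot>\<^bsub>V\<^esub> hcomp V 1 x"
      using ax by (simp add: smult_r_distr[symmetric] hcomp_sum)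
  qed (use ax in simp)
  ultimately show ?thesis by (auto simp: linear_maps_def)
qed

end

lemma linear_mapI: "superspace F V \<Longrightarrow> superspace F W \<Longrightarrow> h \<in> even_maps F V W \<Longrightarrow> linear_map F V W h"
  by (simp add: linear_map_def linear_map_axioms_def superspace_def even_maps_def)

lemma hcomp_even_map:
  assumes "superspace F V" "superspace F W" "h \<in> even_maps F V W" "x \<in> carrier V"
  shows "hcomp W p (h x) = h (hcomp V p x)"
proof -
  interpret V: superspace F V by fact
  interpret W: superspace F W by fact
  interpret linear_map F V W h by (rule linear_mapI) fact+
  show ?thesis
  proof (rule W.hcomp_unique)
    show "h (hcomp V p x) \<in> hpart W p" for p
      using assms V.hcomp_hpart by (auto simp: even_maps_def)
    show "h x = h (hcomp V 0 x) \<oplus>\<^bsub>W\<^esub> h (hcomp V 1 x)"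
      using assms by (simp add: add[symmetric] V.hcomp_sum)
  qed
qed

lemma even_lift:
  assumes V: "superspace F V" and W: "superspace F W" and h: "h \<in> even_maps F V W"
    and surj: "h ` carrier V = carrier W" and x: "x \<in> hpart W p"
  obtains y where "y \<in> hpart V p" "h y = x"
proof -
  interpret V: superspace F V by fact
  interpret W: superspace F W by fact
  have "x \<in> h ` carrier V" unfolding surj using x by (rule W.hpart_closed)
  then obtain z where z: "z \<in> carrier V" "x = h z" by blast
  have "h (hcomp V p z) = hcomp W p x" unfolding z(2) by (rule hcomp_even_map[OF V W h z(1), symmetric])
  also have "\<dots> = x" using W.hcomp_homogeneous[OF x, of p] by simp
  finally show ?thesis using that[OF V.hcomp_hpart[OF z(1)]] by simp
qed

text \<open>All axioms of a module are equations, so they pass to images.\<close>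

lemma module_image:
  assumes "module F V"
    and carrier: "carrier L = h ` carrier V"
    and add: "\<And>x y. x \<in> carrier V \<Longrightarrow> y \<in> carrier V \<Longrightarrow> h x \<oplus>\<^bsub>L\<^esub> h y = h (x \<oplus>\<^bsub>V\<^esub> y)"
    and zero: "\<zero>\<^bsub>L\<^esub> = h \<zero>\<^bsub>V\<^esub>"
    and smult: "\<And>a x. a \<in> carrier F \<Longrightarrow> x \<in> carrier V \<Longrightarrow> a \<odot>\<^bsub>L\<^esub> h x = h (a \<odot>\<^bsub>V\<^esub> x)"
  shows "module F L" "h \<in> linear_maps F V L"
proof -
  interpret module F V by fact
  have "abelian_group L"
  proof (rule abelian_groupI)
    fix x assume "x \<in> carrier L"
    then obtain x' where "x' \<in> carrier V" "x = h x'" by (auto simp: carrier)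
    then show "\<exists>y\<in>carrier L. y \<oplus>\<^bsub>L\<^esub> x = \<zero>\<^bsub>L\<^esub>"
      by (intro bexI[of _ "h (\<ominus>\<^bsub>V\<^esub> x')"]) (auto simp: carrier add zero M.l_neg)
  qed (auto simp: carrier add zero M.a_ac)
  then show "module F L"
    by (intro moduleI) (auto simp: carrier add smult R.is_cring smult_l_distr smult_r_distr smult_assoc1)
  show "h \<in> linear_maps F V L"
    by (auto simp: linear_maps_def carrier add smult)
qed

text \<open>
  The quotient inherits the decomposition if the kernel contains the homogeneous components of its
  elements.
\<close>

lemma superspace_image:
  assumes V: "superspace F V"
    and carrier: "carrier L = h ` carrier V"
    and add: "\<And>x y. x \<in> carrier V \<Longrightarrow> y \<in> carrier V \<Longrightarrow> h x \<oplus>\<^bsub>L\<^esub> h y = h (x \<oplus>\<^bsub>V\<^esub> y)"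
    and zero: "\<zero>\<^bsub>L\<^esub> = h \<zero>\<^bsub>V\<^esub>"
    and smult: "\<And>a x. a \<in> carrier F \<Longrightarrow> x \<in> carrier V \<Longrightarrow> a \<odot>\<^bsub>L\<^esub> h x = h (a \<odot>\<^bsub>V\<^esub> x)"
    and hpart: "\<And>p. hpart L p = h ` hpart V p"
    and kernel: "\<And>x p. x \<in> carrier V \<Longrightarrow> h x = \<zero>\<^bsub>L\<^esub> \<Longrightarrow> h (hcomp V p x) = \<zero>\<^bsub>L\<^esub>"
  shows "superspace F L" "h \<in> even_maps F V L"
proof -
  interpret V: superspace F V by fact
  note L = module_image[OF V.module_axioms carrier add zero smult]
  interpret L: module F L by (rule L(1))
  interpret h: linear_map F V L h
    by (intro linear_map.intro linear_map_axioms.intro V.module_axioms L)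
  show even: "h \<in> even_maps F V L" using L(2) by (auto simp: even_maps_def hpart)
  show "superspace F L"
  proof (rule superspaceI)
    show "module F L" by (rule L(1))
    show "field F" by (rule V.field_axioms)
    show "submodule (hpart L p) F L" for p
    proof (rule L.submoduleI)
      fix a b assume "a \<in> hpart L p" "b \<in> hpart L p"
      then obtain x y where "x \<in> hpart V p" "y \<in> hpart V p" "a = h x" "b = h y"
        by (auto simp: hpart)
      then show "a \<oplus>\<^bsub>L\<^esub> b \<in> hpart L p" by (simp add: hpart add)
    next
      fix a assume "a \<in> hpart L p"
      then show "\<ominus>\<^bsub>L\<^esub> a \<in> hpart L p" by (auto simp: hpart h.uminus[symmetric])
    next
      fix a x assume "a \<in> carrier F" "x \<in> hpart L p"
      then show "a \<odot>\<^bsub>L\<^esub> x \<in> hpart L p" by (auto simp: hpart smult)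
    next
      show "\<zero>\<^bsub>L\<^esub> \<in> hpart L p" unfolding hpart zero by (rule imageI[OF V.hpart_zero])
    qed (auto simp: hpart)
  next
    fix x assume "x \<in> carrier L"
    then obtain x' where x': "x' \<in> carrier V" "x = h x'" by (auto simp: carrier)
    then have "x = h (hcomp V 0 x') \<oplus>\<^bsub>L\<^esub> h (hcomp V 1 x')" by (simp add: add V.hcomp_sum)
    with x' show "\<exists>y\<in>hpart L 0. \<exists>z\<in>hpart L 1. x = y \<oplus>\<^bsub>L\<^esub> z"
      by (metis V.hcomp_hpart hpart imageI)
  next
    fix x assume "x \<in> hpart L 0" "x \<in> hpart L 1"
    then obtain y z where yz: "y \<in> hpart V 0" "z \<in> hpart V 1" "x = h y" "x = h z"
      by (auto simp: hpart)
    then have "h (y \<ominus>\<^bsub>V\<^esub> z) = \<zero>\<^bsub>L\<^esub>"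
      by (simp add: h.minus L.M.minus_eq L.M.r_neg)
    moreover have "hcomp V 0 (y \<ominus>\<^bsub>V\<^esub> z) = y"
      using yz bit_not_zero_iff
        V.hcomp_unique[of "\<lambda>p. if p = 0 then y else \<ominus>\<^bsub>V\<^esub> z" "y \<ominus>\<^bsub>V\<^esub> z" 0]
      by (auto simp: V.M.minus_eq)
    ultimately show "x = \<zero>\<^bsub>L\<^esub>" using kernel[of "y \<ominus>\<^bsub>V\<^esub> z" 0] yz by simp
  qed
qed

text \<open>
  The submodule \<open>\<partial>V\<close> is the image of an even endomorphism, and for such submodules the parity
  components of a member are again members.
\<close>

locale even_endomorphism = superspace F V
  for F :: "('f, 'r) ring_scheme" and V :: "('f, 'v, 'z) superspace_scheme" +
  fixes d :: "'v \<Rightarrow> 'v"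
  assumes even: "d \<in> even_maps F V V"
begin

sublocale d: linear_map F V V d
  using even by (intro linear_mapI superspace_axioms)

definition cls :: "'v \<Rightarrow> 'v set" where "cls x = (d ` carrier V) +>\<^bsub>V\<^esub> x"

lemma mem_cls_iff: "y \<in> cls x \<longleftrightarrow> (\<exists>z\<in>carrier V. y = d z \<oplus>\<^bsub>V\<^esub> x)"
  by (auto simp: cls_def a_r_coset_def')

lemma mem_cls_self: "x \<in> carrier V \<Longrightarrow> x \<in> cls x"
  by (auto simp: mem_cls_iff intro!: bexI[of _ "\<zero>\<^bsub>V\<^esub>"])

lemma cls_eqI:
  assumes "x \<in> carrier V" "y \<in> carrier V" "z \<in> carrier V" "x = y \<oplus>\<^bsub>V\<^esub> d z"
  shows "cls x = cls y"
proof (intro Set.set_eqI iffI)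
  fix u assume "u \<in> cls x"
  then obtain w where w: "w \<in> carrier V" "u = d w \<oplus>\<^bsub>V\<^esub> x" by (auto simp: mem_cls_iff)
  then have "u = d (w \<oplus>\<^bsub>V\<^esub> z) \<oplus>\<^bsub>V\<^esub> y" using assms by (simp add: d.add M.a_ac)
  then show "u \<in> cls y" using w assms by (auto simp: mem_cls_iff)
next
  fix u assume "u \<in> cls y"
  then obtain w where w: "w \<in> carrier V" "u = d w \<oplus>\<^bsub>V\<^esub> y" by (auto simp: mem_cls_iff)
  then have "u = d (w \<oplus>\<^bsub>V\<^esub> (\<ominus>\<^bsub>V\<^esub> z)) \<oplus>\<^bsub>V\<^esub> x"
    using assms by (simp add: d.add d.uminus M.a_ac M.r_neg M.r_neg1 M.r_neg2)
  then show "u \<in> cls x" using w assms by (auto simp: mem_cls_iff)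
qed

lemma cls_eq_iff:
  assumes "x \<in> carrier V" "y \<in> carrier V"
  shows "cls x = cls y \<longleftrightarrow> (\<exists>z\<in>carrier V. x = y \<oplus>\<^bsub>V\<^esub> d z)"
proof
  assume "cls x = cls y"
  then have "x \<in> cls y" using mem_cls_self assms by blast
  then show "\<exists>z\<in>carrier V. x = y \<oplus>\<^bsub>V\<^esub> d z"
    using assms by (auto simp: mem_cls_iff M.a_comm)
qed (use assms cls_eqI in blast)

text \<open>
  The operations on quotients are unions over representatives, and collapse if they respect the
  classes.
\<close>

lemma UN_cls:
  assumes "x \<in> carrier V" "\<And>z. z \<in> carrier V \<Longrightarrow> f (x \<oplus>\<^bsub>V\<^esub> d z) = f x"
  shows "(\<Union>y\<in>cls x. f y) = f x"
proof -
  have "f y = f x" if "y \<in> cls x" for y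
    using that assms by (auto simp: mem_cls_iff M.a_comm)
  then show ?thesis using mem_cls_self[OF assms(1)] by blast
qed

abbreviation "Q \<equiv> quot_space V (d ` carrier V)"

lemma quot_carrier: "carrier Q = cls ` carrier V"
  by (auto simp: quot_space_def A_RCOSETS_def' cls_def)

lemma quot_hpart: "hpart Q p = cls ` hpart V p"
  by (simp add: quot_space_def cls_def)

lemma quot_zero: "\<zero>\<^bsub>Q\<^esub> = cls \<zero>\<^bsub>V\<^esub>"
  by (auto simp: quot_space_def mem_cls_iff)

lemma quot_add:
  assumes "x \<in> carrier V" "y \<in> carrier V"
  shows "cls x \<oplus>\<^bsub>Q\<^esub> cls y = cls (x \<oplus>\<^bsub>V\<^esub> y)"
proof -
  have "cls x \<oplus>\<^bsub>Q\<^esub> cls y = {u \<oplus>\<^bsub>V\<^esub> v | u v. u \<in> cls x \<and> v \<in> cls y}"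
    by (auto simp: quot_space_def set_add_def')
  also have "\<dots> = cls (x \<oplus>\<^bsub>V\<^esub> y)"
  proof (intro Set.set_eqI iffI)
    fix w assume "w \<in> {u \<oplus>\<^bsub>V\<^esub> v | u v. u \<in> cls x \<and> v \<in> cls y}"
    then obtain a b where ab: "a \<in> carrier V" "b \<in> carrier V" "w = (d a \<oplus>\<^bsub>V\<^esub> x) \<oplus>\<^bsub>V\<^esub> (d b \<oplus>\<^bsub>V\<^esub> y)"
      by (auto simp: mem_cls_iff)
    then have "w = d (a \<oplus>\<^bsub>V\<^esub> b) \<oplus>\<^bsub>V\<^esub> (x \<oplus>\<^bsub>V\<^esub> y)" using assms by (simp add: d.add M.a_ac)
    then show "w \<in> cls (x \<oplus>\<^bsub>V\<^esub> y)" using ab by (auto simp: mem_cls_iff)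
  next
    fix w assume "w \<in> cls (x \<oplus>\<^bsub>V\<^esub> y)"
    then obtain a where a: "a \<in> carrier V" "w = d a \<oplus>\<^bsub>V\<^esub> (x \<oplus>\<^bsub>V\<^esub> y)" by (auto simp: mem_cls_iff)
    then have "w = (d a \<oplus>\<^bsub>V\<^esub> x) \<oplus>\<^bsub>V\<^esub> y" "d a \<oplus>\<^bsub>V\<^esub> x \<in> cls x"
      using assms by (auto simp: mem_cls_iff M.a_ac)
    then show "w \<in> {u \<oplus>\<^bsub>V\<^esub> v | u v. u \<in> cls x \<and> v \<in> cls y}"
      using mem_cls_self[OF assms(2)] by blast
  qed
  finally show ?thesis .
qed

lemma quot_smult:
  assumes "a \<in> carrier F" "x \<in> carrier V"
  shows "a \<odot>\<^bsub>Q\<^esub> cls x = cls (a \<odot>\<^bsub>V\<^esub> x)"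
proof -
  have "a \<odot>\<^bsub>Q\<^esub> cls x = (\<Union>y\<in>cls x. cls (a \<odot>\<^bsub>V\<^esub> y))"
    by (simp add: quot_space_def cls_def)
  also have "\<dots> = cls (a \<odot>\<^bsub>V\<^esub> x)"
  proof (rule UN_cls)
    fix z assume "z \<in> carrier V"
    then show "cls (a \<odot>\<^bsub>V\<^esub> (x \<oplus>\<^bsub>V\<^esub> d z)) = cls (a \<odot>\<^bsub>V\<^esub> x)"
      using assms by (intro cls_eqI[of _ _ "a \<odot>\<^bsub>V\<^esub> z"]) (auto simp: smult_r_distr d.scale)
  qed fact
  finally show ?thesis .
qed

lemma cls_zero_iff: "x \<in> carrier V \<Longrightarrow> cls x = \<zero>\<^bsub>Q\<^esub> \<longleftrightarrow> x \<in> d ` carrier V"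
  by (auto simp: quot_zero cls_eq_iff)

lemma superspace_quot: "superspace F Q" and cls_even: "cls \<in> even_maps F V Q"
proof -
  have "cls (hcomp V p x) = \<zero>\<^bsub>Q\<^esub>" if "x \<in> carrier V" "cls x = \<zero>\<^bsub>Q\<^esub>" for x p
    using that hcomp_even_map[OF superspace_axioms superspace_axioms even]
    by (auto simp: cls_zero_iff)
  note * = superspace_image[OF superspace_axioms quot_carrier quot_add quot_zero quot_smult quot_hpart this]
  show "superspace F Q" "cls \<in> even_maps F V Q" using * by blast+
qed

text \<open>
  A map that vanishes on the image of \<open>d\<close> is constant on the classes, so that it can be evaluated at
  any representative.
\<close>

definition lift :: "('v \<Rightarrow> 'w) \<Rightarrow> 'v set \<Rightarrow> 'w" where
  "lift h A = h (SOME x. x \<in> A)"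

lemma quot_lift:
  assumes W: "superspace F W" and h: "h \<in> even_maps F V W"
    and hd: "\<And>z. z \<in> carrier V \<Longrightarrow> h (d z) = \<zero>\<^bsub>W\<^esub>"
  shows lift_cls: "x \<in> carrier V \<Longrightarrow> lift h (cls x) = h x"
    and lift_even: "lift h \<in> even_maps F Q W"
    and lift_image: "lift h ` carrier Q = h ` carrier V"
    and lift_inj: "(\<And>x. x \<in> carrier V \<Longrightarrow> h x = \<zero>\<^bsub>W\<^esub> \<Longrightarrow> x \<in> d ` carrier V) \<Longrightarrow> inj_on (lift h) (carrier Q)"
proof -
  interpret W: superspace F W by fact
  interpret l: linear_map F V W h by (rule linear_mapI[OF superspace_axioms W h])
  have lift: "lift h (cls x) = h x" if x: "x \<in> carrier V" for x
  proof -
    have "(SOME y. y \<in> cls x) \<in> cls x" by (rule someI[of _ x]) (rule mem_cls_self[OF x])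
    then obtain z where z: "z \<in> carrier V" "(SOME y. y \<in> cls x) = d z \<oplus>\<^bsub>V\<^esub> x" by (auto simp: mem_cls_iff)
    show ?thesis unfolding lift_def z(2) using z(1) x by (simp add: l.add hd)
  qed
  then show "x \<in> carrier V \<Longrightarrow> lift h (cls x) = h x" for x .
  show "lift h ` carrier Q = h ` carrier V"
    unfolding quot_carrier image_image using lift by (intro image_cong) auto
  have hp: "h x \<in> hpart W p" if "x \<in> hpart V p" for x p using h that by (auto simp: even_maps_def)
  show "lift h \<in> even_maps F Q W"
    by (auto simp: even_maps_def linear_maps_def quot_carrier quot_hpart quot_add quot_smult lift
        l.add l.scale hp)
  assume ker: "\<And>x. x \<in> carrier V \<Longrightarrow> h x = \<zero>\<^bsub>W\<^esub> \<Longrightarrow> x \<in> d ` carrier V"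
  show "inj_on (lift h) (carrier Q)"
  proof (rule inj_onI)
    fix A B assume "A \<in> carrier Q" "B \<in> carrier Q" and e: "lift h A = lift h B"
    then obtain x y where xy: "x \<in> carrier V" "y \<in> carrier V" "A = cls x" "B = cls y"
      by (auto simp: quot_carrier)
    then have "h (x \<ominus>\<^bsub>V\<^esub> y) = \<zero>\<^bsub>W\<^esub>" using e lift by (simp add: l.minus W.M.minus_eq W.M.r_neg)
    then obtain z where z: "z \<in> carrier V" "x \<ominus>\<^bsub>V\<^esub> y = d z" using ker[of "x \<ominus>\<^bsub>V\<^esub> y"] xy by auto
    have "x = y \<oplus>\<^bsub>V\<^esub> (x \<ominus>\<^bsub>V\<^esub> y)" using xy by (simp add: M.minus_eq M.a_ac M.r_neg M.r_neg2 M.r_neg1)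
    then show "A = B" unfolding xy(3,4) using xy z by (intro cls_eqI[of x y z]) auto
  qed
qed

end

lemma sub_superspace:
  assumes V: "superspace F V" and I: "submodule I F V"
    and hcomp: "\<And>x p. x \<in> I \<Longrightarrow> hcomp V p x \<in> I"
  shows "superspace F (V\<lparr>carrier := I, hpart := \<lambda>p. hpart V p \<inter> I\<rparr>)" (is "superspace F ?U")
    and "x \<in> I \<Longrightarrow> hcomp (V\<lparr>carrier := I, hpart := \<lambda>p. hpart V p \<inter> I\<rparr>) p x = hcomp V p x"
proof -
  interpret V: superspace F V by fact
  interpret V': module F "V\<lparr>carrier := I\<rparr>"
    by (rule submodule.submodule_is_module[OF I V.module_axioms])
  have sub: "I \<subseteq> carrier V" using V.submoduleE(1)[OF I] .
  have mod: "module F ?U"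
    using V'.module_axioms
    by (simp add: module_def abelian_group_def abelian_monoid_def abelian_group_axioms_def module_axioms_def)
  interpret U: module F ?U by (rule mod)
  have inv: "\<ominus>\<^bsub>?U\<^esub> x = \<ominus>\<^bsub>V\<^esub> x" if "x \<in> I" for x
  proof (rule U.M.minus_equality)
    show "\<ominus>\<^bsub>V\<^esub> x \<oplus>\<^bsub>?U\<^esub> x = \<zero>\<^bsub>?U\<^esub>" using that sub by (simp add: V.M.l_neg subset_iff)
  qed (use that V.submoduleE(3)[OF I] in auto)
  show *: "superspace F ?U"
  proof (rule superspaceI[OF mod V.field_axioms])
    show "submodule (hpart ?U p) F ?U" for p
      by (rule U.submoduleI) (use V.submoduleE[OF I] inv subgroup.one_closed[OF submodule.axioms(1)[OF I]] in auto)
  next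
    fix x assume "x \<in> carrier ?U"
    then have "x \<in> I" by simp
    then show "\<exists>y\<in>hpart ?U 0. \<exists>z\<in>hpart ?U 1. x = y \<oplus>\<^bsub>?U\<^esub> z"
      using sub hcomp[of x] V.hcomp_hpart[of x] V.hcomp_sum[of x]
      by (intro bexI[of _ "hcomp V 0 x"] bexI[of _ "hcomp V 1 x"]) auto
  next
    fix x assume "x \<in> hpart ?U 0" "x \<in> hpart ?U 1"
    then show "x = \<zero>\<^bsub>?U\<^esub>"
      using V.hcomp_homogeneous[of x 0 0] V.hcomp_homogeneous[of x 1 0] by simp
  qed
  interpret U': superspace F ?U by (rule *)
  show "hcomp ?U p x = hcomp V p x" if "x \<in> I"
    using that sub hcomp by (intro U'.hcomp_unique) (auto simp: V.hcomp_sum subset_iff)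
qed

lemma invariants_superspace:
  assumes V: "superspace F V" and a: "\<And>\<sigma>. \<sigma> permutes {1..n} \<Longrightarrow> (\<lambda>x. a x \<sigma>) \<in> even_maps F V V"
  shows "superspace F (invariants n V a)"
    and "x \<in> carrier (invariants n V a) \<Longrightarrow> hcomp (invariants n V a) p x = hcomp V p x"
    and "linear_map F (invariants n V a) V (\<lambda>x. x)"
proof -
  interpret V: superspace F V by fact
  define I where "I = {x \<in> carrier V. \<forall>\<sigma>. \<sigma> permutes {1..n} \<longrightarrow> a x \<sigma> = x}"
  have inv: "invariants n V a = V\<lparr>carrier := I, hpart := \<lambda>p. hpart V p \<inter> I\<rparr>"
    by (simp add: invariants_def I_def Let_def)
  have lin: "linear_map F V V (\<lambda>x. a x \<sigma>)" if "\<sigma> permutes {1..n}" for \<sigma>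
    by (rule linear_mapI[OF V V a[OF that]])
  have sub: "submodule I F V"
    by (rule V.submoduleI)
      (auto simp: I_def linear_map.zero[OF lin] linear_map.add[OF lin] linear_map.scale[OF lin] linear_map.uminus[OF lin])
  have hc: "hcomp V p x \<in> I" if "x \<in> I" for x p
    using that hcomp_even_map[OF V V a, of _ x p] by (auto simp: I_def)
  note * = sub_superspace[OF V sub hc]
  show "superspace F (invariants n V a)" unfolding inv by (rule *(1))
  then have m: "module F (invariants n V a)" by (simp add: superspace_def)
  show "x \<in> carrier (invariants n V a) \<Longrightarrow> hcomp (invariants n V a) p x = hcomp V p x"
    unfolding inv using *(2) by simp
  show "linear_map F (invariants n V a) V (\<lambda>x. x)"
    using m V.module_axioms unfolding inv
    by (auto simp: linear_map_def linear_map_axioms_def linear_maps_def I_def)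
qed

section \<open>Graded superspaces\<close>

locale dsum =
  fixes F :: "('f, 'r) ring_scheme" and W :: "int \<Rightarrow> ('f, 'v) superspace"
  assumes component: "superspace F (W n)"
begin

sublocale W: superspace F "W n" for n
  by (rule component)

abbreviation "D \<equiv> dsum_space W"

lemma D_carrier_iff: "x \<in> carrier D \<longleftrightarrow>
    x \<in> extensional {-1..} \<and> (\<forall>n\<ge>-1. x n \<in> carrier (W n)) \<and> finite {n. -1 \<le> n \<and> x n \<noteq> \<zero>\<^bsub>W n\<^esub>}"
  by (auto simp: dsum_space_def PiE_iff)

lemma D_closed: "x \<in> carrier D \<Longrightarrow> -1 \<le> n \<Longrightarrow> x n \<in> carrier (W n)"
  by (simp add: D_carrier_iff)

lemma D_eqI: "x \<in> carrier D \<Longrightarrow> y \<in> carrier D \<Longrightarrow> (\<And>n. -1 \<le> n \<Longrightarrow> x n = y n) \<Longrightarrow> x = y"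
  by (rule extensionalityI[of _ "{-1..}"]) (auto simp: D_carrier_iff)

lemma D_add: "-1 \<le> n \<Longrightarrow> (x \<oplus>\<^bsub>D\<^esub> y) n = x n \<oplus>\<^bsub>W n\<^esub> y n"
  and D_zero: "-1 \<le> n \<Longrightarrow> \<zero>\<^bsub>D\<^esub> n = \<zero>\<^bsub>W n\<^esub>"
  and D_smult: "-1 \<le> n \<Longrightarrow> (a \<odot>\<^bsub>D\<^esub> x) n = a \<odot>\<^bsub>W n\<^esub> x n"
  by (simp_all add: dsum_space_def)

lemma D_hpart_iff: "x \<in> hpart D p \<longleftrightarrow> x \<in> carrier D \<and> (\<forall>n\<ge>-1. x n \<in> hpart (W n) p)"
  by (auto simp: dsum_space_def PiE_iff intro: W.hpart_closed)

lemma D_restrict_closed: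
  assumes "\<And>n. -1 \<le> n \<Longrightarrow> f n \<in> carrier (W n)" "x \<in> carrier D" "y \<in> carrier D"
    and "\<And>n. -1 \<le> n \<Longrightarrow> x n = \<zero>\<^bsub>W n\<^esub> \<Longrightarrow> y n = \<zero>\<^bsub>W n\<^esub> \<Longrightarrow> f n = \<zero>\<^bsub>W n\<^esub>"
  shows "(\<lambda>n\<in>{-1..}. f n) \<in> carrier D"
proof -
  have "{n. -1 \<le> n \<and> (\<lambda>n\<in>{-1..}. f n) n \<noteq> \<zero>\<^bsub>W n\<^esub>}
      \<subseteq> {n. -1 \<le> n \<and> x n \<noteq> \<zero>\<^bsub>W n\<^esub>} \<union> {n. -1 \<le> n \<and> y n \<noteq> \<zero>\<^bsub>W n\<^esub>}"
    using assms(4) by auto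
  moreover have "finite \<dots>" using assms(2,3) by (auto simp: D_carrier_iff)
  ultimately have "finite {n. -1 \<le> n \<and> (\<lambda>n\<in>{-1..}. f n) n \<noteq> \<zero>\<^bsub>W n\<^esub>}" by (rule finite_subset)
  then show ?thesis using assms(1) by (simp add: D_carrier_iff)
qed

lemma D_add_closed: "x \<in> carrier D \<Longrightarrow> y \<in> carrier D \<Longrightarrow> x \<oplus>\<^bsub>D\<^esub> y \<in> carrier D"
  using D_restrict_closed[of "\<lambda>n. x n \<oplus>\<^bsub>W n\<^esub> y n" x y] by (simp add: dsum_space_def D_closed[unfolded dsum_space_def])

lemma D_zero_closed: "\<zero>\<^bsub>D\<^esub> \<in> carrier D"
  by (auto simp: D_carrier_iff dsum_space_def)

lemma D_smult_closed: "a \<in> carrier F \<Longrightarrow> x \<in> carrier D \<Longrightarrow> a \<odot>\<^bsub>D\<^esub> x \<in> carrier D"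
  using D_restrict_closed[of "\<lambda>n. a \<odot>\<^bsub>W n\<^esub> x n" x x] by (simp add: dsum_space_def D_closed[unfolded dsum_space_def])

lemma D_module: "module F D"
proof (rule moduleI)
  show "cring F" by (rule W.R.is_cring)
  show "abelian_group D"
  proof (rule abelian_groupI)
    fix x assume x: "x \<in> carrier D"
    have "(\<ominus>\<^bsub>F\<^esub> \<one>\<^bsub>F\<^esub>) \<odot>\<^bsub>D\<^esub> x \<oplus>\<^bsub>D\<^esub> x = \<zero>\<^bsub>D\<^esub>"
      using x by (intro D_eqI)
        (auto simp: D_add_closed D_smult_closed D_zero_closed D_add D_smult D_zero D_closed
          W.smult_l_minus W.M.l_neg)
    then show "\<exists>y\<in>carrier D. y \<oplus>\<^bsub>D\<^esub> x = \<zero>\<^bsub>D\<^esub>"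
      using x by (intro bexI[of _ "(\<ominus>\<^bsub>F\<^esub> \<one>\<^bsub>F\<^esub>) \<odot>\<^bsub>D\<^esub> x"] D_smult_closed) auto
  qed (auto intro!: D_eqI simp: D_add_closed D_zero_closed D_add D_zero D_closed W.M.a_ac)
qed (auto intro!: D_eqI simp: D_add_closed D_smult_closed D_add D_smult D_closed
      W.smult_l_distr W.smult_r_distr W.smult_assoc1)

sublocale D: module F D
  by (rule D_module)

lemma D_uminus: "x \<in> carrier D \<Longrightarrow> -1 \<le> n \<Longrightarrow> (\<ominus>\<^bsub>D\<^esub> x) n = \<ominus>\<^bsub>W n\<^esub> x n"
  using D.smult_l_minus[of "\<one>\<^bsub>F\<^esub>" x] D_smult[of n "\<ominus>\<^bsub>F\<^esub> \<one>\<^bsub>F\<^esub>" x]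
  by (simp add: W.smult_l_minus D_closed)

lemma D_superspace: "superspace F D"
proof (rule superspaceI[OF D_module W.field_axioms])
  show "submodule (hpart D p) F D" for p
  proof (rule D.submoduleI)
    show "hpart D p \<subseteq> carrier D" by (auto simp: D_hpart_iff)
  qed (auto simp: D_hpart_iff D_add D_zero D_smult D_uminus)
next
  fix x assume x: "x \<in> carrier D"
  have cl: "(\<lambda>n\<in>{-1..}. hcomp (W n) p (x n)) \<in> carrier D" for p
    using x W.hcomp_homogeneous[OF W.hpart_zero]
    by (intro D_restrict_closed[of _ x x]) (auto simp: D_closed)
  then have "(\<lambda>n\<in>{-1..}. hcomp (W n) p (x n)) \<in> hpart D p" for p
    using x by (auto simp: D_hpart_iff D_closed)
  moreover have "x = (\<lambda>n\<in>{-1..}. hcomp (W n) 0 (x n)) \<oplus>\<^bsub>D\<^esub> (\<lambda>n\<in>{-1..}. hcomp (W n) 1 (x n))"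
    using x cl by (intro D_eqI) (auto simp: D_add W.hcomp_sum D_closed)
  ultimately show "\<exists>y\<in>hpart D 0. \<exists>z\<in>hpart D 1. x = y \<oplus>\<^bsub>D\<^esub> z" by blast
next
  fix x assume x: "x \<in> hpart D 0" "x \<in> hpart D 1"
  show "x = \<zero>\<^bsub>D\<^esub>"
  proof (rule D_eqI)
    fix n :: int assume n: "-1 \<le> n"
    then have "x n \<in> hpart (W n) 0" "x n \<in> hpart (W n) 1" using x by (auto simp: D_hpart_iff)
    then have "x n = \<zero>\<^bsub>W n\<^esub>"
      using W.hcomp_homogeneous[of "x n" n 0 0] W.hcomp_homogeneous[of "x n" n 1 0] by simp
    with n show "x n = \<zero>\<^bsub>D\<^esub> n" by (simp add: D_zero)
  qed (use x in \<open>auto simp: D_hpart_iff D_zero_closed\<close>)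
qed

sublocale D: superspace F D
  by (rule D_superspace)

lemma emb_same [simp]: "-1 \<le> n \<Longrightarrow> dsum_emb W n f n = f"
  and emb_other: "-1 \<le> k \<Longrightarrow> k \<noteq> n \<Longrightarrow> dsum_emb W n f k = \<zero>\<^bsub>W k\<^esub>"
  and emb_app: "-1 \<le> k \<Longrightarrow> dsum_emb W n f k = (if k = n then f else \<zero>\<^bsub>W k\<^esub>)"
  by (auto simp: dsum_emb_def)

lemma emb_low: "n < -1 \<Longrightarrow> dsum_emb W n f = \<zero>\<^bsub>D\<^esub>"
  by (auto simp: dsum_emb_def dsum_space_def fun_eq_iff)

lemma emb_closed: "f \<in> carrier (W n) \<Longrightarrow> dsum_emb W n f \<in> carrier D"
  by (auto simp: D_carrier_iff dsum_emb_def intro: finite_subset[of _ "{n}"])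

lemma emb_part: "f \<in> carrier (W n) \<Longrightarrow> dsum_emb W n f \<in> dsum_part W n"
  by (simp add: dsum_part_def emb_closed emb_other)

lemma emb_hpart: "f \<in> hpart (W n) p \<Longrightarrow> dsum_emb W n f \<in> hpart D p"
  by (auto simp: D_hpart_iff emb_closed emb_app)

lemma emb_zero: "dsum_emb W n \<zero>\<^bsub>W n\<^esub> = \<zero>\<^bsub>D\<^esub>"
  by (auto simp: dsum_emb_def dsum_space_def)

lemma eval_linear: "-1 \<le> n \<Longrightarrow> (\<lambda>x. x n) \<in> linear_maps F D (W n)"
  by (auto simp: linear_maps_def D_closed D_add D_smult)

lemma D_finsum:
  assumes "-1 \<le> n" "f \<in> A \<rightarrow> carrier D"
  shows "(\<Oplus>\<^bsub>D\<^esub>i\<in>A. f i) n = (\<Oplus>\<^bsub>W n\<^esub>i\<in>A. f i n)"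
proof -
  interpret linear_map F D "W n" "\<lambda>x. x n"
    by (intro linear_map.intro linear_map_axioms.intro eval_linear D_module W.module_axioms assms)
  show ?thesis using assms(2) by (rule finsum)
qed

lemma hcomp_D:
  assumes "x \<in> carrier D" "-1 \<le> n"
  shows "hcomp D p x n = hcomp (W n) p (x n)"
proof (rule W.hcomp_unique[symmetric, where c = "\<lambda>p. hcomp D p x n"])
  show "hcomp D p x n \<in> hpart (W n) p" for p
    using D.hcomp_hpart[OF assms(1), of p] assms(2) by (simp add: D_hpart_iff)
  show "x n = hcomp D 0 x n \<oplus>\<^bsub>W n\<^esub> hcomp D 1 x n"
    using assms D.hcomp_sum[of x] D_add[of n "hcomp D 0 x" "hcomp D 1 x"] by simp
qed

lemma dsum_decomposition:
  assumes "x \<in> carrier D" "finite A" "{n. -1 \<le> n \<and> x n \<noteq> \<zero>\<^bsub>W n\<^esub>} \<subseteq> A" "A \<subseteq> {-1..}"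
  shows "x = (\<Oplus>\<^bsub>D\<^esub>n\<in>A. dsum_emb W n (x n))"
proof (rule D_eqI)
  have car: "(\<lambda>n. dsum_emb W n (x n)) \<in> A \<rightarrow> carrier D"
    using assms by (auto intro!: emb_closed D_closed)
  then show "(\<Oplus>\<^bsub>D\<^esub>n\<in>A. dsum_emb W n (x n)) \<in> carrier D" by simp
  fix k :: int assume k: "-1 \<le> k"
  have "(\<Oplus>\<^bsub>D\<^esub>n\<in>A. dsum_emb W n (x n)) k = (\<Oplus>\<^bsub>W k\<^esub>n\<in>A. dsum_emb W n (x n) k)"
    by (rule D_finsum[OF k car])
  also have "\<dots> = (\<Oplus>\<^bsub>W k\<^esub>n\<in>A. if k = n then x k else \<zero>\<^bsub>W k\<^esub>)"
    using assms k by (intro W.M.finsum_cong') (auto simp: emb_app D_closed)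
  also have "\<dots> = x k"
  proof (cases "k \<in> A")
    case True
    then show ?thesis
      using W.M.finsum_singleton[of k A "\<lambda>_. x k"] assms k by (simp add: D_closed)
  next
    case False
    then have "x k = \<zero>\<^bsub>W k\<^esub>" using assms k by auto
    moreover have "(\<Oplus>\<^bsub>W k\<^esub>n\<in>A. if k = n then x k else \<zero>\<^bsub>W k\<^esub>) = \<zero>\<^bsub>W k\<^esub>"
      using False by (intro W.M.add.finprod_one_eqI) auto
    ultimately show ?thesis by simp
  qed
  finally show "x k = (\<Oplus>\<^bsub>D\<^esub>n\<in>A. dsum_emb W n (x n)) k" by simp
qed fact

text \<open>
  A multilinear identity on the direct sum only has to be verified on homogeneous elements of the
  summands.
\<close>

lemma homogeneous_induct [consumes 1, case_names zero add emb]: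
  assumes x: "x \<in> hpart D p"
    and zero: "Q \<zero>\<^bsub>D\<^esub>"
    and add: "\<And>x y. x \<in> hpart D p \<Longrightarrow> y \<in> hpart D p \<Longrightarrow> Q x \<Longrightarrow> Q y \<Longrightarrow> Q (x \<oplus>\<^bsub>D\<^esub> y)"
    and emb: "\<And>n f. -1 \<le> n \<Longrightarrow> f \<in> hpart (W n) p \<Longrightarrow> Q (dsum_emb W n f)"
  shows "Q x"
proof -
  define A where "A = {n. -1 \<le> n \<and> x n \<noteq> \<zero>\<^bsub>W n\<^esub>}"
  have xc: "x \<in> carrier D" and xh: "\<And>n. -1 \<le> n \<Longrightarrow> x n \<in> hpart (W n) p"
    using x by (auto simp: D_hpart_iff)
  then have fin: "finite A" "A \<subseteq> {-1..}" by (auto simp: D_carrier_iff A_def)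
  have "Q (\<Oplus>\<^bsub>D\<^esub>n\<in>B. dsum_emb W n (x n)) \<and> (\<Oplus>\<^bsub>D\<^esub>n\<in>B. dsum_emb W n (x n)) \<in> hpart D p"
    if "finite B" "B \<subseteq> {-1..}" for B
    using that
  proof (induction B)
    case empty
    then show ?case using zero by simp
  next
    case (insert b B)
    then have b: "dsum_emb W b (x b) \<in> hpart D p" "Q (dsum_emb W b (x b))"
      using xh emb emb_hpart by auto
    moreover have "(\<lambda>n. dsum_emb W n (x n)) \<in> B \<rightarrow> carrier D"
      using insert.prems xc by (auto intro!: emb_closed D_closed)
    ultimately have "(\<Oplus>\<^bsub>D\<^esub>n\<in>insert b B. dsum_emb W n (x n))
        = dsum_emb W b (x b) \<oplus>\<^bsub>D\<^esub> (\<Oplus>\<^bsub>D\<^esub>n\<in>B. dsum_emb W n (x n))"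
      using insert.hyps by (intro D.M.finsum_insert) auto
    then show ?case using insert b add by simp
  qed
  from this[OF fin] dsum_decomposition[OF xc fin(1) _ fin(2)] show ?thesis by (simp add: A_def)
qed

lemma dsum_graded:
  assumes [simp]: "gspace G = D" "gpart G = dsum_part W"
  shows "graded_superspace F G"
proof (rule graded_superspace.intro)
  show "superspace F (gspace G)" by (simp add: D_superspace)
  show "submodule (gpart G n) F (gspace G)" for n
    unfolding assms
    by (rule D.submoduleI)
      (auto simp: dsum_part_def D_zero_closed D_zero D_add_closed D_add D_smult_closed D_smult D_uminus)
  show "hcomp (gspace G) p x \<in> gpart G n" if "x \<in> gpart G n" for x p n
    using that W.hcomp_homogeneous[OF W.hpart_zero] by (auto simp: dsum_part_def hcomp_D)
  have low: "c = \<zero>\<^bsub>D\<^esub>" if "n < -1" "c \<in> dsum_part W n" for n c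
  proof (rule D_eqI)
    show "c k = \<zero>\<^bsub>D\<^esub> k" if "-1 \<le> k" for k
      using that \<open>n < -1\<close> \<open>c \<in> dsum_part W n\<close> by (auto simp: dsum_part_def D_zero)
  qed (use that in \<open>simp_all add: dsum_part_def D_zero_closed\<close>)
  show "gpart G n = {\<zero>\<^bsub>gspace G\<^esub>}" if "n < -1" for n
    using low[OF that] that by (auto simp: dsum_part_def D_zero D_zero_closed)
  fix x assume "x \<in> carrier (gspace G)"
  then have x: "x \<in> carrier D" by simp
  define A where "A = {n. -1 \<le> n \<and> x n \<noteq> \<zero>\<^bsub>W n\<^esub>}"
  have supp: "{n. dsum_emb W n (x n) \<noteq> \<zero>\<^bsub>D\<^esub>} = A"
  proof (intro Set.set_eqI iffI)
    fix n assume "n \<in> {n. dsum_emb W n (x n) \<noteq> \<zero>\<^bsub>D\<^esub>}"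
    then have n: "dsum_emb W n (x n) \<noteq> \<zero>\<^bsub>D\<^esub>" by simp
    then have "-1 \<le> n" using emb_low by fastforce
    with n emb_zero[of n] show "n \<in> A" by (auto simp: A_def)
  next
    fix n assume "n \<in> A"
    then show "n \<in> {n. dsum_emb W n (x n) \<noteq> \<zero>\<^bsub>D\<^esub>}"
      using emb_same[of n "x n"] D_zero[of n] by (auto simp: A_def simp del: emb_same)
  qed
  have fin: "finite A" "A \<subseteq> {-1..}" using x by (auto simp: D_carrier_iff A_def)
  show "\<exists>!c. (\<forall>n. c n \<in> gpart G n) \<and> finite {n. c n \<noteq> \<zero>\<^bsub>gspace G\<^esub>} \<and>
      x = (\<Oplus>\<^bsub>gspace G\<^esub>n\<in>{n. c n \<noteq> \<zero>\<^bsub>gspace G\<^esub>}. c n)"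
    unfolding assms
  proof (rule ex1I, intro conjI)
    show "\<forall>n. dsum_emb W n (x n) \<in> dsum_part W n"
    proof
      fix n show "dsum_emb W n (x n) \<in> dsum_part W n"
      proof (cases "-1 \<le> n")
        case True
        then show ?thesis using x by (intro emb_part D_closed)
      next
        case False
        then show ?thesis by (simp add: emb_low dsum_part_def D_zero D_zero_closed)
      qed
    qed
    show "finite {n. dsum_emb W n (x n) \<noteq> \<zero>\<^bsub>D\<^esub>}" by (simp add: supp fin)
    show "x = (\<Oplus>\<^bsub>D\<^esub>n\<in>{n. dsum_emb W n (x n) \<noteq> \<zero>\<^bsub>D\<^esub>}. dsum_emb W n (x n))"
      unfolding supp by (rule dsum_decomposition[OF x fin(1) _ fin(2)]) (simp add: A_def)
  next
    fix c assume "(\<forall>n. c n \<in> dsum_part W n) \<and> finite {n. c n \<noteq> \<zero>\<^bsub>D\<^esub>} \<and>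
      x = (\<Oplus>\<^bsub>D\<^esub>n\<in>{n. c n \<noteq> \<zero>\<^bsub>D\<^esub>}. c n)"
    then have c: "\<And>n. c n \<in> dsum_part W n" "finite {n. c n \<noteq> \<zero>\<^bsub>D\<^esub>}"
      and x_eq: "x = (\<Oplus>\<^bsub>D\<^esub>n\<in>{n. c n \<noteq> \<zero>\<^bsub>D\<^esub>}. c n)" by auto
    have cc: "c n \<in> carrier D" for n using c(1) by (auto simp: dsum_part_def)
    have entry: "x k = c k k" if k: "-1 \<le> k" for k
    proof -
      have "x k = (\<Oplus>\<^bsub>W k\<^esub>n\<in>{n. c n \<noteq> \<zero>\<^bsub>D\<^esub>}. c n k)"
        unfolding x_eq using k cc by (intro D_finsum) auto
      also have "\<dots> = (\<Oplus>\<^bsub>W k\<^esub>n\<in>{n. c n \<noteq> \<zero>\<^bsub>D\<^esub>}. if k = n then c k k else \<zero>\<^bsub>W k\<^esub>)"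
        using k c(1) cc by (intro W.M.finsum_cong') (auto simp: dsum_part_def D_closed)
      also have "\<dots> = c k k"
      proof (cases "c k = \<zero>\<^bsub>D\<^esub>")
        case True
        then have "(\<Oplus>\<^bsub>W k\<^esub>n\<in>{n. c n \<noteq> \<zero>\<^bsub>D\<^esub>}. if k = n then c k k else \<zero>\<^bsub>W k\<^esub>) = \<zero>\<^bsub>W k\<^esub>"
          by (intro W.M.add.finprod_one_eqI) auto
        with True k show ?thesis by (simp add: D_zero)
      next
        case False
        then show ?thesis
          using W.M.finsum_singleton[of k "{n. c n \<noteq> \<zero>\<^bsub>D\<^esub>}" "\<lambda>_. c k k"] k cc c(2) by (simp add: D_closed)
      qed
      finally show ?thesis .
    qed
    show "c = (\<lambda>n. dsum_emb W n (x n))"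
    proof
      fix n
      show "c n = dsum_emb W n (x n)"
      proof (cases "-1 \<le> n")
        case True
        show ?thesis
        proof (rule D_eqI[OF cc])
          show "dsum_emb W n (x n) \<in> carrier D" using True x by (intro emb_closed D_closed)
          show "c n k = dsum_emb W n (x n) k" if "-1 \<le> k" for k
            using that True c(1)[of n] by (auto simp: emb_app entry dsum_part_def)
        qed
      next
        case False
        then show ?thesis using low[OF _ c(1)[of n]] by (simp add: emb_low)
      qed
    qed
  qed
qed

end

text \<open>
  Both the derivation and the passage to the classes in the linear pseudo operad act on the direct
  sums componentwise.
\<close>

locale dsum_map = A: dsum F A + B: dsum F B
  for F :: "('f, 'r) ring_scheme" and A :: "int \<Rightarrow> ('f, 'v) superspace"
    and B :: "int \<Rightarrow> ('f, 'w) superspace" +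
  fixes h :: "int \<Rightarrow> 'v \<Rightarrow> 'w"
  assumes even: "-1 \<le> n \<Longrightarrow> h n \<in> even_maps F (A n) (B n)"
begin

definition H :: "(int \<Rightarrow> 'v) \<Rightarrow> int \<Rightarrow> 'w" where "H x = (\<lambda>n\<in>{-1..}. h n (x n))"

lemma H_app: "-1 \<le> n \<Longrightarrow> H x n = h n (x n)"
  by (simp add: H_def)

lemma component_linear: "-1 \<le> n \<Longrightarrow> linear_map F (A n) (B n) (h n)"
  by (rule linear_mapI[OF A.component B.component even])

lemma H_closed:
  assumes "x \<in> carrier A.D"
  shows "H x \<in> carrier B.D"
proof -
  have "{n. -1 \<le> n \<and> H x n \<noteq> \<zero>\<^bsub>B n\<^esub>} \<subseteq> {n. -1 \<le> n \<and> x n \<noteq> \<zero>\<^bsub>A n\<^esub>}"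
    using linear_map.zero[OF component_linear] by (auto simp: H_app)
  moreover have "finite {n. -1 \<le> n \<and> x n \<noteq> \<zero>\<^bsub>A n\<^esub>}" using assms by (simp add: A.D_carrier_iff)
  ultimately have "finite {n. -1 \<le> n \<and> H x n \<noteq> \<zero>\<^bsub>B n\<^esub>}" by (rule finite_subset)
  then show ?thesis
    using linear_map.closed[OF component_linear A.D_closed[OF assms]] by (simp add: B.D_carrier_iff H_app) (simp add: H_def)
qed

lemma H_even: "H \<in> even_maps F A.D B.D"
proof -
  have "H (x \<oplus>\<^bsub>A.D\<^esub> y) = H x \<oplus>\<^bsub>B.D\<^esub> H y" if "x \<in> carrier A.D" "y \<in> carrier A.D" for x y
    using that A.D_closed linear_map.add[OF component_linear]
    by (auto simp: dsum_space_def fun_eq_iff H_def)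
  moreover have "H (a \<odot>\<^bsub>A.D\<^esub> x) = a \<odot>\<^bsub>B.D\<^esub> H x" if "a \<in> carrier F" "x \<in> carrier A.D" for a x
    using that A.D_closed linear_map.scale[OF component_linear]
    by (auto simp: dsum_space_def fun_eq_iff H_def)
  moreover have "H x \<in> hpart B.D p" if "x \<in> hpart A.D p" for x p
    using that H_closed[of x] even by (auto simp: A.D_hpart_iff B.D_hpart_iff even_maps_def H_app)
  ultimately show ?thesis by (auto simp: even_maps_def linear_maps_def H_closed)
qed

lemma H_emb: "H (dsum_emb A n f) = dsum_emb B n (h n f)"
  using linear_map.zero[OF component_linear] by (auto simp: dsum_emb_def fun_eq_iff H_def)

lemma H_part: "x \<in> dsum_part A n \<Longrightarrow> H x \<in> dsum_part B n"
  using H_closed[of x] linear_map.zero[OF component_linear] by (auto simp: dsum_part_def H_app)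

text \<open>Zero is lifted to zero, which keeps the support finite and the degree.\<close>

lemma H_lift:
  assumes surj: "\<forall>n\<ge>-1. h n ` carrier (A n) = carrier (B n)" and y: "y \<in> carrier B.D"
  obtains x where "x \<in> carrier A.D" "H x = y" "\<And>n. -1 \<le> n \<Longrightarrow> y n = \<zero>\<^bsub>B n\<^esub> \<Longrightarrow> x n = \<zero>\<^bsub>A n\<^esub>"
proof -
  have "\<exists>u. -1 \<le> n \<longrightarrow> u \<in> carrier (A n) \<and> h n u = y n \<and> (y n = \<zero>\<^bsub>B n\<^esub> \<longrightarrow> u = \<zero>\<^bsub>A n\<^esub>)" for n
  proof (cases "-1 \<le> n \<and> y n \<noteq> \<zero>\<^bsub>B n\<^esub>")
    case True
    then have "y n \<in> h n ` carrier (A n)" using surj[rule_format, of n] B.D_closed[OF y, of n] by simp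
    then show ?thesis using True by auto
  next
    case False
    then show ?thesis
      using linear_map.zero[OF component_linear, of n] A.W.M.zero_closed[of n]
      by (intro exI[of _ "\<zero>\<^bsub>A n\<^esub>"]) (simp del: A.W.M.zero_closed, blast?)
  qed
  then obtain s where s: "\<And>n. -1 \<le> n \<Longrightarrow> s n \<in> carrier (A n) \<and> h n (s n) = y n \<and>
      (y n = \<zero>\<^bsub>B n\<^esub> \<longrightarrow> s n = \<zero>\<^bsub>A n\<^esub>)" by metis
  have s': "s n \<in> carrier (A n)" "h n (s n) = y n" "y n = \<zero>\<^bsub>B n\<^esub> \<Longrightarrow> s n = \<zero>\<^bsub>A n\<^esub>" if "-1 \<le> n" for n
    using s[OF that] by blast+
  let ?x = "\<lambda>n\<in>{-1..}. s n"
  have "{n. -1 \<le> n \<and> ?x n \<noteq> \<zero>\<^bsub>A n\<^esub>} \<subseteq> {n. -1 \<le> n \<and> y n \<noteq> \<zero>\<^bsub>B n\<^esub>}"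
    using s'(3) by auto
  moreover have "finite {n. -1 \<le> n \<and> y n \<noteq> \<zero>\<^bsub>B n\<^esub>}" using y by (simp add: B.D_carrier_iff)
  ultimately have "finite {n. -1 \<le> n \<and> ?x n \<noteq> \<zero>\<^bsub>A n\<^esub>}" by (rule finite_subset)
  then have "?x \<in> carrier A.D" using s'(1) by (simp add: A.D_carrier_iff)
  moreover have "H ?x = y"
  proof (rule extensionalityI[of _ "{-1..}"])
    show "y \<in> extensional {-1..}" using y by (simp add: B.D_carrier_iff)
  qed (simp_all add: s'(2) H_def)
  ultimately show ?thesis using s'(3) by (intro that[of ?x]) simp_all
qed

lemma H_surj:
  assumes "\<forall>n\<ge>-1. h n ` carrier (A n) = carrier (B n)"
  shows "H ` carrier A.D = carrier B.D" and "H ` dsum_part A n = dsum_part B n"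
proof -
  show "H ` carrier A.D = carrier B.D"
  proof (intro equalityI subsetI)
    fix y assume "y \<in> carrier B.D"
    then obtain x where "x \<in> carrier A.D" "H x = y" using H_lift[OF assms] by blast
    then show "y \<in> H ` carrier A.D" by blast
  qed (use H_closed in blast)
  show "H ` dsum_part A n = dsum_part B n"
  proof (intro equalityI subsetI)
    fix y assume y: "y \<in> dsum_part B n"
    then have "y \<in> carrier B.D" by (simp add: dsum_part_def)
    then obtain x where "x \<in> carrier A.D" "H x = y" "\<And>n. -1 \<le> n \<Longrightarrow> y n = \<zero>\<^bsub>B n\<^esub> \<Longrightarrow> x n = \<zero>\<^bsub>A n\<^esub>"
      using H_lift[OF assms] by blast
    then have "x \<in> dsum_part A n" "H x = y" using y by (auto simp: dsum_part_def)
    then show "y \<in> H ` dsum_part A n" by blast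
  qed (use H_part in blast)
qed

end

text \<open>
  A product on the direct sum is assembled from products of the summands, as in
  the definitions of both Lie superalgebras.
\<close>

locale dsum_product = dsum F W
  for F :: "('f, 'r) ring_scheme" and W :: "int \<Rightarrow> ('f, 'v) superspace" +
  fixes B :: "int \<Rightarrow> int \<Rightarrow> 'v \<Rightarrow> 'v \<Rightarrow> 'v"
  assumes component_bilinear:
    "-1 \<le> i \<Longrightarrow> -1 \<le> j \<Longrightarrow> -1 \<le> i + j \<Longrightarrow> even_bilinear F (W i) (W j) (W (i + j)) (B i j)"
begin

definition br :: "(int \<Rightarrow> 'v) \<Rightarrow> (int \<Rightarrow> 'v) \<Rightarrow> int \<Rightarrow> 'v" where
  "br x y = (\<lambda>n\<in>{-1..}. \<Oplus>\<^bsub>W n\<^esub>i\<in>{-1..n + 1}. B i (n - i) (x i) (y (n - i)))"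

lemma B_linear:
  assumes "-1 \<le> i" "-1 \<le> j" "-1 \<le> i + j"
  shows "x \<in> carrier (W i) \<Longrightarrow> linear_map F (W j) (W (i + j)) (B i j x)"
    and "y \<in> carrier (W j) \<Longrightarrow> linear_map F (W i) (W (i + j)) (\<lambda>x. B i j x y)"
  using component_bilinear[OF assms]
  by (auto simp: even_bilinear_def linear_map_def linear_map_axioms_def W.module_axioms)

lemma term_linear:
  assumes "-1 \<le> n" "i \<in> {-1..n + 1}"
  shows "x \<in> carrier D \<Longrightarrow> linear_map F (W (n - i)) (W n) (B i (n - i) (x i))"
    and "y \<in> carrier D \<Longrightarrow> linear_map F (W i) (W n) (\<lambda>u. B i (n - i) u (y (n - i)))"
  using B_linear[of i "n - i"] assms D_closed[of x i] D_closed[of y "n - i"] by auto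

lemma term_closed:
  assumes "-1 \<le> n" "i \<in> {-1..n + 1}" "x \<in> carrier D" "y \<in> carrier D"
  shows "B i (n - i) (x i) (y (n - i)) \<in> carrier (W n)"
  using linear_map.closed[OF term_linear(1)[OF assms(1-3)]] assms D_closed[OF assms(4), of "n - i"] by auto

lemma term_zero:
  assumes "-1 \<le> n" "i \<in> {-1..n + 1}" "x \<in> carrier D" "y \<in> carrier D"
    and "x i = \<zero>\<^bsub>W i\<^esub> \<or> y (n - i) = \<zero>\<^bsub>W (n - i)\<^esub>"
  shows "B i (n - i) (x i) (y (n - i)) = \<zero>\<^bsub>W n\<^esub>"
  using assms(5) linear_map.zero[OF term_linear(1)[OF assms(1-3)]]
    linear_map.zero[OF term_linear(2)[OF assms(1,2,4)]] by auto

lemma br_closed: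
  assumes x: "x \<in> carrier D" and y: "y \<in> carrier D"
  shows "br x y \<in> carrier D"
proof -
  let ?s = "\<lambda>x. {n. -1 \<le> n \<and> x n \<noteq> \<zero>\<^bsub>W n\<^esub>}"
  have "?s (br x y) \<subseteq> (\<lambda>(i, j). i + j) ` (?s x \<times> ?s y)"
  proof
    fix n assume n: "n \<in> ?s (br x y)"
    have "\<exists>i\<in>{-1..n + 1}. x i \<noteq> \<zero>\<^bsub>W i\<^esub> \<and> y (n - i) \<noteq> \<zero>\<^bsub>W (n - i)\<^esub>"
    proof (rule ccontr)
      assume "\<not> ?thesis"
      then have "br x y n = \<zero>\<^bsub>W n\<^esub>"
        unfolding br_def using n x y by (auto intro!: W.M.add.finprod_one_eqI term_zero)
      with n show False by simp
    qed
    then obtain i where "i \<in> ?s x" "n - i \<in> ?s y" "n = i + (n - i)" by auto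
    then show "n \<in> (\<lambda>(i, j). i + j) ` (?s x \<times> ?s y)" by (intro image_eqI[of _ _ "(i, n - i)"]) auto
  qed
  then have "finite (?s (br x y))"
    using x y by (elim finite_subset) (auto simp: D_carrier_iff)
  moreover have "br x y n \<in> carrier (W n)" if "-1 \<le> n" for n
    using that x y by (auto simp: br_def intro!: W.M.finsum_closed term_closed)
  moreover have "br x y \<in> extensional {-1..}" by (simp add: br_def)
  ultimately show ?thesis by (simp add: D_carrier_iff)
qed

lemma br_bilinear: "even_bilinear F D D D br"
  unfolding even_bilinear_def linear_maps_def
proof (intro conjI ballI allI CollectI funcsetI br_closed)
  fix x y z assume c: "x \<in> carrier D" "y \<in> carrier D" "z \<in> carrier D"
  show "br x (y \<oplus>\<^bsub>D\<^esub> z) = br x y \<oplus>\<^bsub>D\<^esub> br x z"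
  proof (rule D_eqI)
    fix n :: int assume n: "-1 \<le> n"
    have "(\<Oplus>\<^bsub>W n\<^esub>i\<in>{-1..n + 1}. B i (n - i) (x i) ((y \<oplus>\<^bsub>D\<^esub> z) (n - i))) =
      (\<Oplus>\<^bsub>W n\<^esub>i\<in>{-1..n + 1}. B i (n - i) (x i) (y (n - i)) \<oplus>\<^bsub>W n\<^esub> B i (n - i) (x i) (z (n - i)))"
      using n c
      by (intro W.M.finsum_cong')
        (auto simp: D_add D_closed linear_map.add[OF term_linear(1)] intro!: W.M.a_closed term_closed)
    then show "br x (y \<oplus>\<^bsub>D\<^esub> z) n = (br x y \<oplus>\<^bsub>D\<^esub> br x z) n"
      using n c term_closed by (simp add: D_add br_def W.M.finsum_addf Pi_def)
  qed (use c in \<open>auto intro!: br_closed D.M.a_closed\<close>)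
  show "br (y \<oplus>\<^bsub>D\<^esub> z) x = br y x \<oplus>\<^bsub>D\<^esub> br z x"
  proof (rule D_eqI)
    fix n :: int assume n: "-1 \<le> n"
    have "(\<Oplus>\<^bsub>W n\<^esub>i\<in>{-1..n + 1}. B i (n - i) ((y \<oplus>\<^bsub>D\<^esub> z) i) (x (n - i))) =
      (\<Oplus>\<^bsub>W n\<^esub>i\<in>{-1..n + 1}. B i (n - i) (y i) (x (n - i)) \<oplus>\<^bsub>W n\<^esub> B i (n - i) (z i) (x (n - i)))"
      using n c
      by (intro W.M.finsum_cong')
        (auto simp: D_add D_closed linear_map.add[OF term_linear(2)] intro!: W.M.a_closed term_closed)
    then show "br (y \<oplus>\<^bsub>D\<^esub> z) x n = (br y x \<oplus>\<^bsub>D\<^esub> br z x) n"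
      using n c term_closed by (simp add: D_add br_def W.M.finsum_addf Pi_def)
  qed (use c in \<open>auto intro!: br_closed D.M.a_closed\<close>)
next
  fix a x y assume c: "a \<in> carrier F" "x \<in> carrier D" "y \<in> carrier D"
  show "br x (a \<odot>\<^bsub>D\<^esub> y) = a \<odot>\<^bsub>D\<^esub> br x y"
  proof (rule D_eqI)
    fix n :: int assume n: "-1 \<le> n"
    have "(\<Oplus>\<^bsub>W n\<^esub>i\<in>{-1..n + 1}. B i (n - i) (x i) ((a \<odot>\<^bsub>D\<^esub> y) (n - i))) =
      (\<Oplus>\<^bsub>W n\<^esub>i\<in>{-1..n + 1}. a \<odot>\<^bsub>W n\<^esub> B i (n - i) (x i) (y (n - i)))"
      using n c
      by (intro W.M.finsum_cong')
        (auto simp: D_smult D_closed linear_map.scale[OF term_linear(1)] intro!: W.smult_closed term_closed)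
    then show "br x (a \<odot>\<^bsub>D\<^esub> y) n = (a \<odot>\<^bsub>D\<^esub> br x y) n"
      using n c term_closed by (simp add: D_smult br_def W.finsum_smult_ldistr Pi_def)
  qed (use c in \<open>auto intro!: br_closed D.smult_closed\<close>)
  show "br (a \<odot>\<^bsub>D\<^esub> x) y = a \<odot>\<^bsub>D\<^esub> br x y"
  proof (rule D_eqI)
    fix n :: int assume n: "-1 \<le> n"
    have "(\<Oplus>\<^bsub>W n\<^esub>i\<in>{-1..n + 1}. B i (n - i) ((a \<odot>\<^bsub>D\<^esub> x) i) (y (n - i))) =
      (\<Oplus>\<^bsub>W n\<^esub>i\<in>{-1..n + 1}. a \<odot>\<^bsub>W n\<^esub> B i (n - i) (x i) (y (n - i)))"
      using n c
      by (intro W.M.finsum_cong')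
        (auto simp: D_smult D_closed linear_map.scale[OF term_linear(2)] intro!: W.smult_closed term_closed)
    then show "br (a \<odot>\<^bsub>D\<^esub> x) y n = (a \<odot>\<^bsub>D\<^esub> br x y) n"
      using n c term_closed by (simp add: D_smult br_def W.finsum_smult_ldistr Pi_def)
  qed (use c in \<open>auto intro!: br_closed D.smult_closed\<close>)
next
  fix p q x y assume xy: "x \<in> hpart D p" "y \<in> hpart D q"
  have "B i (n - i) (x i) (y (n - i)) \<in> hpart (W n) (p + q)" if "-1 \<le> n" "i \<in> {-1..n + 1}" for n i
    using component_bilinear[of i "n - i"] that xy by (auto simp: even_bilinear_def D_hpart_iff)
  then have "br x y n \<in> hpart (W n) (p + q)" if "-1 \<le> n" for n
    using that unfolding br_def by (subst restrict_apply') (auto intro: W.hpart_finsum)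
  then show "br x y \<in> hpart D (p + q)"
    using br_closed[OF D.hpart_closed[OF xy(1)] D.hpart_closed[OF xy(2)]]
    by (intro iffD2[OF D_hpart_iff] conjI allI impI)
qed

lemma br_emb:
  assumes i: "-1 \<le> i" and j: "-1 \<le> j" and f: "f \<in> carrier (W i)" and g: "g \<in> carrier (W j)"
  shows "br (dsum_emb W i f) (dsum_emb W j g) = dsum_emb W (i + j) (B i j f g)"
proof
  fix n
  note c = emb_closed[OF f] emb_closed[OF g]
  let ?t = "\<lambda>k. B k (n - k) (dsum_emb W i f k) (dsum_emb W j g (n - k))"
  consider "n < -1" | "-1 \<le> n" "n = i + j" | "-1 \<le> n" "n \<noteq> i + j" by linarith
  then show "br (dsum_emb W i f) (dsum_emb W j g) n = dsum_emb W (i + j) (B i j f g) n"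
  proof cases
    case 1
    then show ?thesis by (simp add: br_def dsum_emb_def)
  next
    case 2
    have "(\<Oplus>\<^bsub>W n\<^esub>k\<in>{-1..n + 1}. ?t k) = (\<Oplus>\<^bsub>W n\<^esub>k\<in>{-1..n + 1}. if i = k then B i j f g else \<zero>\<^bsub>W n\<^esub>)"
    proof (rule W.M.finsum_cong'[OF refl])
      have B: "B i j f g \<in> carrier (W n)"
        using linear_map.closed[OF B_linear(1)[OF i j _ f] g] 2 by simp
      then show "(\<lambda>k. if i = k then B i j f g else \<zero>\<^bsub>W n\<^esub>) \<in> {-1..n + 1} \<rightarrow> carrier (W n)" by auto
      fix k assume k: "k \<in> {-1..n + 1}"
      show "?t k = (if i = k then B i j f g else \<zero>\<^bsub>W n\<^esub>)"
      proof (cases "i = k")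
        case True
        then show ?thesis using 2 k j by simp
      next
        case False
        then show ?thesis
          using 2 k term_zero[of n k, OF _ _ c] by (simp add: emb_other)
      qed
    qed
    also have "\<dots> = B i j f g"
      using 2 i j linear_map.closed[OF B_linear(1)[OF i j _ f] g]
      by (intro W.M.finsum_singleton) auto
    finally show ?thesis using 2 by (simp add: br_def)
  next
    case 3
    have "?t k = \<zero>\<^bsub>W n\<^esub>" if "k \<in> {-1..n + 1}" for k
      using that 3 term_zero[of n k, OF _ _ c] by (cases "k = i") (simp_all add: emb_other)
    then show ?thesis using 3 by (auto simp: br_def emb_other intro!: W.M.add.finprod_one_eqI)
  qed
qed

lemma br_part:
  assumes "x \<in> dsum_part W i" "y \<in> dsum_part W j"
  shows "br x y \<in> dsum_part W (i + j)"
proof -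
  have c: "x \<in> carrier D" "y \<in> carrier D" using assms by (auto simp: dsum_part_def)
  have "br x y n = \<zero>\<^bsub>W n\<^esub>" if "-1 \<le> n" "n \<noteq> i + j" for n
  proof -
    have "B k (n - k) (x k) (y (n - k)) = \<zero>\<^bsub>W n\<^esub>" if "k \<in> {-1..n + 1}" for k
      using that assms \<open>-1 \<le> n\<close> \<open>n \<noteq> i + j\<close>
      by (intro term_zero c) (auto simp: dsum_part_def)
    then show ?thesis using that by (auto simp: br_def intro!: W.M.add.finprod_one_eqI)
  qed
  then show ?thesis using br_closed[OF c] by (simp add: dsum_part_def)
qed

end

text \<open>
  This transports the grading of the Lie superalgebra of the linear pseudo operad along the
  canonical map.
\<close>

lemma graded_superspace_iso:
  fixes A :: "('f, 'v, 'x) graded_superspace_scheme" and B :: "('f, 'w, 'y) graded_superspace_scheme"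
  assumes B: "graded_superspace F B" and A: "superspace F (gspace A)"
    and even: "h \<in> even_maps F (gspace A) (gspace B)" and inj: "inj_on h (carrier (gspace A))"
    and sub: "\<And>n. gpart A n \<subseteq> carrier (gspace A)" and gpart: "\<And>n. h ` gpart A n = gpart B n"
  shows "graded_superspace F A"
proof -
  let ?A = "gspace A" and ?B = "gspace B"
  interpret A: superspace F ?A by fact
  interpret B: superspace F ?B by (rule graded_superspace.superspace[OF B])
  interpret h: linear_map F ?A ?B h by (rule linear_mapI[OF A B.superspace_axioms even])
  note sB = B.submoduleE[OF graded_superspace.gpart_submodule[OF B]]
  have mem: "x \<in> gpart A n" if "x \<in> carrier ?A" "h x \<in> gpart B n" for x n
  proof -
    from that(2) obtain y where "y \<in> gpart A n" "h x = h y" unfolding gpart[symmetric] by blast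
    with that(1) sub show ?thesis using inj_onD[OF inj, of x y] by blast
  qed
  have cl: "x \<in> carrier ?A" "h x \<in> gpart B n" if "x \<in> gpart A n" for x n
    using that sub gpart by blast+
  have zero: "\<zero>\<^bsub>?B\<^esub> \<in> gpart B n" for n
    using subgroup.one_closed[OF submodule.axioms(1)[OF graded_superspace.gpart_submodule[OF B]]] by simp
  have zero_iff: "h x = \<zero>\<^bsub>?B\<^esub> \<longleftrightarrow> x = \<zero>\<^bsub>?A\<^esub>" if "x \<in> carrier ?A" for x
    using inj_onD[OF inj, of x "\<zero>\<^bsub>?A\<^esub>"] that by auto
  show ?thesis
  proof (rule graded_superspace.intro[OF A])
    show "submodule (gpart A n) F ?A" for n
      by (rule A.submoduleI) (use cl in \<open>auto intro!: mem simp: h.add h.scale h.uminus zero sB(3-5)\<close>)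
    show "hcomp ?A p x \<in> gpart A n" if "x \<in> gpart A n" for x p n
      using that cl[OF that] graded_superspace.gpart_hcomp[OF B cl(2)[OF that], of p]
      by (auto intro!: mem simp: hcomp_even_map[OF A B.superspace_axioms even])
    show "gpart A n = {\<zero>\<^bsub>?A\<^esub>}" if "n < -1" for n
    proof (intro equalityI subsetI)
      fix x assume "x \<in> gpart A n"
      then show "x \<in> {\<zero>\<^bsub>?A\<^esub>}"
        using cl[of x n] graded_superspace.gpart_low[OF B that] zero_iff[of x] by simp
    next
      fix x assume "x \<in> {\<zero>\<^bsub>?A\<^esub>}"
      then show "x \<in> gpart A n" using mem[of "\<zero>\<^bsub>?A\<^esub>" n] zero by simp
    qed
    fix x assume x: "x \<in> carrier ?A"
    from graded_superspace.gpart_decomposition[OF B h.closed[OF x]] obtain c where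
      c: "\<And>n. c n \<in> gpart B n" "finite {n. c n \<noteq> \<zero>\<^bsub>?B\<^esub>}" "h x = (\<Oplus>\<^bsub>?B\<^esub>n\<in>{n. c n \<noteq> \<zero>\<^bsub>?B\<^esub>}. c n)"
      and unique: "\<And>c'. (\<forall>n. c' n \<in> gpart B n) \<and> finite {n. c' n \<noteq> \<zero>\<^bsub>?B\<^esub>} \<and>
        h x = (\<Oplus>\<^bsub>?B\<^esub>n\<in>{n. c' n \<noteq> \<zero>\<^bsub>?B\<^esub>}. c' n) \<Longrightarrow> c' = c"
      by (elim ex1E) blast
    have "\<exists>d. d \<in> gpart A n \<and> h d = c n" for n using c(1)[of n] unfolding gpart[symmetric] by auto
    then obtain d where d: "\<And>n. d n \<in> gpart A n" "\<And>n. h (d n) = c n" by metis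
    have supp: "{n. h (e n) \<noteq> \<zero>\<^bsub>?B\<^esub>} = {n. e n \<noteq> \<zero>\<^bsub>?A\<^esub>}" if "\<And>n. e n \<in> gpart A n" for e
      using zero_iff[OF cl(1)[OF that]] by simp
    show "\<exists>!c. (\<forall>n. c n \<in> gpart A n) \<and> finite {n. c n \<noteq> \<zero>\<^bsub>?A\<^esub>} \<and>
        x = (\<Oplus>\<^bsub>?A\<^esub>n\<in>{n. c n \<noteq> \<zero>\<^bsub>?A\<^esub>}. c n)"
    proof (rule ex1I, intro conjI)
      show "\<forall>n. d n \<in> gpart A n" using d by simp
      show "finite {n. d n \<noteq> \<zero>\<^bsub>?A\<^esub>}" using c(2) supp[OF d(1)] d(2) by simp
      have "h (\<Oplus>\<^bsub>?A\<^esub>n\<in>{n. d n \<noteq> \<zero>\<^bsub>?A\<^esub>}. d n) = (\<Oplus>\<^bsub>?B\<^esub>n\<in>{n. d n \<noteq> \<zero>\<^bsub>?A\<^esub>}. h (d n))"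
        using d cl by (intro h.finsum) auto
      also have "\<dots> = h x" using c(3) supp[OF d(1)] d(2) by simp
      finally show "x = (\<Oplus>\<^bsub>?A\<^esub>n\<in>{n. d n \<noteq> \<zero>\<^bsub>?A\<^esub>}. d n)"
        using x cl(1)[OF d(1)] by (intro inj_onD[OF inj]) auto
    next
      fix e assume e: "(\<forall>n. e n \<in> gpart A n) \<and> finite {n. e n \<noteq> \<zero>\<^bsub>?A\<^esub>} \<and>
        x = (\<Oplus>\<^bsub>?A\<^esub>n\<in>{n. e n \<noteq> \<zero>\<^bsub>?A\<^esub>}. e n)"
      then have eA: "\<And>n. e n \<in> gpart A n" by auto
      have "h x = h (\<Oplus>\<^bsub>?A\<^esub>n\<in>{n. e n \<noteq> \<zero>\<^bsub>?A\<^esub>}. e n)" using e by simp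
      also have "\<dots> = (\<Oplus>\<^bsub>?B\<^esub>n\<in>{n. e n \<noteq> \<zero>\<^bsub>?A\<^esub>}. h (e n))"
        using eA cl by (intro h.finsum) auto
      finally have "(\<lambda>n. h (e n)) = c"
        using e cl(2)[OF eA] supp[OF eA] by (intro unique) auto
      then have "h (e n) = h (d n)" for n using d(2) by (simp add: fun_eq_iff)
      then show "e = d"
        using cl(1)[OF eA] cl(1)[OF d(1)] by (intro ext inj_onD[OF inj])
    qed
  qed
qed

text \<open>
  A bracket that satisfies the Jacobi identity, but need not be skew-symmetric, induces the
  bracket of a Lie superalgebra on every quotient in which it becomes skew-symmetric.
\<close>

lemma graded_super_lie_image:
  fixes T :: "('f, 'v, 'x) graded_superspace_scheme" and L :: "('f, 'w, 'y) graded_super_lie_scheme"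
  assumes T: "graded_superspace F T" and L: "graded_superspace F L"
    and even: "h \<in> even_maps F (gspace T) (gspace L)"
    and surj: "h ` carrier (gspace T) = carrier (gspace L)"
    and gpart: "\<And>n. gpart L n \<subseteq> h ` gpart T n" and hgpart: "\<And>n x. x \<in> gpart T n \<Longrightarrow> h x \<in> gpart L n"
    and br: "even_bilinear F (gspace T) (gspace T) (gspace T) br"
    and hbr: "\<And>x y. x \<in> carrier (gspace T) \<Longrightarrow> y \<in> carrier (gspace T) \<Longrightarrow> bracket L (h x) (h y) = h (br x y)"
    and skew: "\<And>x y p q. x \<in> hpart (gspace T) p \<Longrightarrow> y \<in> hpart (gspace T) q \<Longrightarrow>
      h (br x y) = \<ominus>\<^bsub>gspace L\<^esub> (sgn_of F p q \<odot>\<^bsub>gspace L\<^esub> h (br y x))"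
    and jacobi: "\<And>x y z p q. x \<in> hpart (gspace T) p \<Longrightarrow> y \<in> hpart (gspace T) q \<Longrightarrow> z \<in> carrier (gspace T) \<Longrightarrow>
      br x (br y z) = br (br x y) z \<oplus>\<^bsub>gspace T\<^esub> sgn_of F p q \<odot>\<^bsub>gspace T\<^esub> br y (br x z)"
    and graded: "\<And>x y i j. x \<in> gpart T i \<Longrightarrow> y \<in> gpart T j \<Longrightarrow> br x y \<in> gpart T (i + j)"
  shows "graded_super_lie F L"
proof -
  let ?T = "gspace T" and ?L = "gspace L"
  interpret T: superspace F ?T by (rule graded_superspace.superspace[OF T])
  interpret L: superspace F ?L by (rule graded_superspace.superspace[OF L])
  interpret h: linear_map F ?T ?L h by (rule linear_mapI[OF T.superspace_axioms L.superspace_axioms even])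
  have br1: "br x \<in> linear_maps F ?T ?T" if "x \<in> carrier ?T" for x
    using br that by (auto simp: even_bilinear_def)
  have br2: "(\<lambda>x. br x y) \<in> linear_maps F ?T ?T" if "y \<in> carrier ?T" for y
    using br that by (auto simp: even_bilinear_def)
  have br_closed [simp]: "br x y \<in> carrier ?T" if "x \<in> carrier ?T" "y \<in> carrier ?T" for x y
    using br1[OF that(1)] that(2) by (auto simp: linear_maps_def)
  have hlift: "\<exists>y\<in>hpart ?T p. x = h y" if "x \<in> hpart ?L p" for x p
  proof -
    have "x \<in> h ` carrier ?T" unfolding surj using that by (rule L.hpart_closed)
    then obtain y where y: "y \<in> carrier ?T" "x = h y" by blast
    have "h (hcomp ?T p y) = hcomp ?L p x"
      unfolding y(2) by (rule hcomp_even_map[OF T.superspace_axioms L.superspace_axioms even y(1), symmetric])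
    also have "\<dots> = x" using L.hcomp_homogeneous[OF that, of p] by simp
    finally show ?thesis using T.hcomp_hpart[OF y(1)] by blast
  qed
  have hhpart: "h x \<in> hpart ?L p" if "x \<in> hpart ?T p" for x p
    using even that by (auto simp: even_maps_def)
  show ?thesis
  proof (rule graded_super_lie.intro[OF L])
    show "even_bilinear F ?L ?L ?L (bracket L)"
      unfolding even_bilinear_def
    proof (intro conjI ballI allI)
      fix x assume "x \<in> carrier ?L"
      then obtain x' where x': "x' \<in> carrier ?T" "x = h x'" unfolding surj[symmetric] by blast
      show "bracket L x \<in> linear_maps F ?L ?L"
        using br1[OF x'(1)] x'(1)
        by (auto simp: linear_maps_def surj[symmetric] x'(2) hbr h.add[symmetric] h.scale[symmetric])
      show "(\<lambda>y. bracket L y x) \<in> linear_maps F ?L ?L"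
        using br2[OF x'(1)] x'(1)
        by (auto simp: linear_maps_def surj[symmetric] x'(2) hbr h.add[symmetric] h.scale[symmetric])
    next
      fix p q x y assume xy: "x \<in> hpart ?L p" "y \<in> hpart ?L q"
      then obtain x' y' where x': "x' \<in> hpart ?T p" "x = h x'" and y': "y' \<in> hpart ?T q" "y = h y'"
        using hlift by metis
      then have "br x' y' \<in> hpart ?T (p + q)" using br unfolding even_bilinear_def by blast
      then show "bracket L x y \<in> hpart ?L (p + q)"
        using hhpart hbr[OF T.hpart_closed[OF x'(1)] T.hpart_closed[OF y'(1)]] x'(2) y'(2) by simp
    qed
  next
    fix x y p q assume xy: "x \<in> hpart ?L p" "y \<in> hpart ?L q"
    then obtain x' y' where x': "x' \<in> hpart ?T p" "x = h x'" and y': "y' \<in> hpart ?T q" "y = h y'"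
      using hlift by metis
    have car: "x' \<in> carrier ?T" "y' \<in> carrier ?T" using T.hpart_closed[OF x'(1)] T.hpart_closed[OF y'(1)] by auto
    show "bracket L x y = \<ominus>\<^bsub>?L\<^esub> ([koszul p q] \<cdot>\<^bsub>?L\<^esub> bracket L y x)"
      unfolding x'(2) y'(2) using skew[OF x'(1) y'(1)] car by (simp add: hbr L.koszul_scalar)
  next
    fix x y z p q assume xy: "x \<in> hpart ?L p" "y \<in> hpart ?L q" and z: "z \<in> carrier ?L"
    then obtain x' y' z' where x': "x' \<in> hpart ?T p" "x = h x'" and y': "y' \<in> hpart ?T q" "y = h y'"
      and z': "z' \<in> carrier ?T" "z = h z'"
      using hlift[OF xy(1)] hlift[OF xy(2)] z unfolding surj[symmetric] by blast
    have car: "x' \<in> carrier ?T" "y' \<in> carrier ?T" using T.hpart_closed[OF x'(1)] T.hpart_closed[OF y'(1)] by auto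
    show "bracket L x (bracket L y z) =
        bracket L (bracket L x y) z \<oplus>\<^bsub>?L\<^esub> [koszul p q] \<cdot>\<^bsub>?L\<^esub> bracket L y (bracket L x z)"
      unfolding x'(2) y'(2) z'(2) using jacobi[OF x'(1) y'(1) z'(1)] car z'(1)
      by (simp add: hbr L.koszul_scalar h.add h.scale)
  next
    fix x y i j assume "x \<in> gpart L i" "y \<in> gpart L j"
    then obtain x' y' where x': "x' \<in> gpart T i" "x = h x'" and y': "y' \<in> gpart T j" "y = h y'"
      using gpart by blast
    moreover have "x' \<in> carrier ?T" "y' \<in> carrier ?T"
      using x' y' T.submoduleE(1)[OF graded_superspace.gpart_submodule[OF T]] by blast+
    ultimately show "bracket L x y \<in> gpart L (i + j)"
      using graded by (auto simp: hbr intro!: hgpart)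
  qed
qed

section \<open>Box products of invariants\<close>

locale char0_pro_operad = pro_conformal_pseudo_operad F P + F: field F
  for F :: "('f, 'r) ring_scheme" and P :: "('f, 'v, 'w) pro_operad" +
  assumes char_zero: "0 < (k::nat) \<Longrightarrow> [k] \<cdot>\<^bsub>F\<^esub> \<one>\<^bsub>F\<^esub> \<noteq> \<zero>\<^bsub>F\<^esub>"
begin

abbreviation "X \<equiv> osp P"

sublocale X: even_endomorphism F "osp P n" "oder P n" for n
  using dS_module[of n]
  by (intro even_endomorphism.intro even_endomorphism_axioms.intro) (simp_all add: dS_module_def)

sublocale S: even_endomorphism F "osys P q n" "osysder P q n" for q n
  using sys_dS_module[of n q]
  by (intro even_endomorphism.intro even_endomorphism_axioms.intro) (simp_all add: dS_module_def)

lemma nat_cancel: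
  assumes "0 < (k::nat)" "x \<in> carrier (X n)" "y \<in> carrier (X n)" "[k] \<cdot>\<^bsub>X n\<^esub> x = [k] \<cdot>\<^bsub>X n\<^esub> y"
  shows "x = y"
proof -
  let ?k = "[k] \<cdot>\<^bsub>F\<^esub> \<one>\<^bsub>F\<^esub>"
  have k: "?k \<in> carrier F" "inv\<^bsub>F\<^esub> ?k \<in> carrier F" "inv\<^bsub>F\<^esub> ?k \<otimes>\<^bsub>F\<^esub> ?k = \<one>\<^bsub>F\<^esub>"
    using char_zero[OF assms(1)] F.field_Units by auto
  have "inv\<^bsub>F\<^esub> ?k \<odot>\<^bsub>X n\<^esub> (?k \<odot>\<^bsub>X n\<^esub> x) = inv\<^bsub>F\<^esub> ?k \<odot>\<^bsub>X n\<^esub> (?k \<odot>\<^bsub>X n\<^esub> y)"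
    using assms by (simp add: X.nat_scalar)
  then show ?thesis using k assms(2,3) by (simp add: X.smult_assoc1[symmetric])
qed

lemma act_linear: "\<sigma> permutes {1..n} \<Longrightarrow> linear_map F (X n) (X n) (\<lambda>x. oact P n x \<sigma>)"
  using dS_module[of n] by (intro linear_mapI X.superspace_axioms) (simp add: dS_module_def)

lemma act_closed [simp]: "\<sigma> permutes {1..n} \<Longrightarrow> x \<in> carrier (X n) \<Longrightarrow> oact P n x \<sigma> \<in> carrier (X n)"
  by (rule linear_map.closed[OF act_linear])

lemma act_hpart: "\<sigma> permutes {1..n} \<Longrightarrow> x \<in> hpart (X n) p \<Longrightarrow> oact P n x \<sigma> \<in> hpart (X n) p"
  using dS_module[of n] by (auto simp: dS_module_def even_maps_def)

lemma act_id: "x \<in> carrier (X n) \<Longrightarrow> oact P n x id = x"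
  and act_comp: "x \<in> carrier (X n) \<Longrightarrow> \<sigma> permutes {1..n} \<Longrightarrow> \<tau> permutes {1..n} \<Longrightarrow>
    oact P n (oact P n x \<sigma>) \<tau> = oact P n x (\<sigma> \<circ> \<tau>)"
  and act_der: "x \<in> carrier (X n) \<Longrightarrow> \<sigma> permutes {1..n} \<Longrightarrow>
    oder P n (oact P n x \<sigma>) = oact P n (oder P n x) \<sigma>"
  using dS_module[of n] unfolding dS_module_def by metis+

definition Inv :: "nat \<Rightarrow> 'v set" where
  "Inv n = {x \<in> carrier (X n). \<forall>\<sigma>. \<sigma> permutes {1..n} \<longrightarrow> oact P n x \<sigma> = x}"

lemma Inv_closed: "x \<in> Inv n \<Longrightarrow> x \<in> carrier (X n)"
  and Inv_act: "x \<in> Inv n \<Longrightarrow> \<sigma> permutes {1..n} \<Longrightarrow> oact P n x \<sigma> = x"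
  by (auto simp: Inv_def)

abbreviation "perms n \<equiv> {\<sigma>::nat \<Rightarrow> nat. \<sigma> permutes {1..n}}"

lemma finite_perms: "finite (perms n)"
  by (simp add: finite_permutations)

text \<open>The symmetrization without the denominator \<open>n!\<close>.\<close>

definition Sym :: "nat \<Rightarrow> 'v \<Rightarrow> 'v" where
  "Sym n x = (\<Oplus>\<^bsub>X n\<^esub>\<sigma>\<in>perms n. oact P n x \<sigma>)"

lemma Sym_closed [simp]: "x \<in> carrier (X n) \<Longrightarrow> Sym n x \<in> carrier (X n)"
  unfolding Sym_def by (rule X.finsum_closed) auto

lemma Sym_linear: "linear_map F (X n) (X n) (Sym n)"
proof (intro linear_map.intro linear_map_axioms.intro X.module_axioms)
  show "Sym n \<in> linear_maps F (X n) (X n)"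
    unfolding linear_maps_def
  proof (intro CollectI conjI ballI funcsetI)
    fix x y assume xy: "x \<in> carrier (X n)" "y \<in> carrier (X n)"
    have "Sym n (x \<oplus>\<^bsub>X n\<^esub> y) = (\<Oplus>\<^bsub>X n\<^esub>\<sigma>\<in>perms n. oact P n x \<sigma> \<oplus>\<^bsub>X n\<^esub> oact P n y \<sigma>)"
      unfolding Sym_def using xy by (intro X.finsum_cong') (auto simp: linear_map.add[OF act_linear])
    then show "Sym n (x \<oplus>\<^bsub>X n\<^esub> y) = Sym n x \<oplus>\<^bsub>X n\<^esub> Sym n y"
      unfolding Sym_def using xy by (simp add: X.finsum_addf Pi_def)
  next
    fix a x assume ax: "a \<in> carrier F" "x \<in> carrier (X n)"
    have "Sym n (a \<odot>\<^bsub>X n\<^esub> x) = (\<Oplus>\<^bsub>X n\<^esub>\<sigma>\<in>perms n. a \<odot>\<^bsub>X n\<^esub> oact P n x \<sigma>)"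
      unfolding Sym_def using ax by (intro X.finsum_cong') (auto simp: linear_map.scale[OF act_linear])
    then show "Sym n (a \<odot>\<^bsub>X n\<^esub> x) = a \<odot>\<^bsub>X n\<^esub> Sym n x"
      unfolding Sym_def using ax finite_perms
      by (subst X.finsum_smult_ldistr) auto
  qed simp
qed

lemma Sym_act:
  assumes "x \<in> carrier (X n)" "\<rho> permutes {1..n}"
  shows "Sym n (oact P n x \<rho>) = Sym n x"
proof -
  have image: "(\<circ>) \<rho> ` perms n = perms n"
    using image_compose_permutations_left[OF assms(2)] unfolding image_Collect .
  have "Sym n (oact P n x \<rho>) = (\<Oplus>\<^bsub>X n\<^esub>\<sigma>\<in>perms n. oact P n x (\<rho> \<circ> \<sigma>))"
    unfolding Sym_def using assms by (intro X.finsum_cong') (auto simp: act_comp permutes_compose)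
  also have "\<dots> = (\<Oplus>\<^bsub>X n\<^esub>\<sigma>\<in>(\<circ>) \<rho> ` perms n. oact P n x \<sigma>)"
  proof (rule X.finsum_reindex[symmetric])
    show "inj_on ((\<circ>) \<rho>) (perms n)"
      using permutes_inj[OF assms(2)] by (auto simp: inj_on_def fun_eq_iff)
  qed (unfold image, use assms in auto)
  finally show ?thesis unfolding Sym_def image .
qed

lemma act_Sym:
  assumes "x \<in> carrier (X n)" "\<rho> permutes {1..n}"
  shows "oact P n (Sym n x) \<rho> = Sym n x"
proof -
  have image: "(\<lambda>\<sigma>. \<sigma> \<circ> \<rho>) ` perms n = perms n"
    using image_compose_permutations_right[OF assms(2)] unfolding image_Collect .
  have "oact P n (Sym n x) \<rho> = (\<Oplus>\<^bsub>X n\<^esub>\<sigma>\<in>perms n. oact P n (oact P n x \<sigma>) \<rho>)"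
    unfolding Sym_def using assms by (intro linear_map.finsum[OF act_linear]) auto
  also have "\<dots> = (\<Oplus>\<^bsub>X n\<^esub>\<sigma>\<in>perms n. oact P n x (\<sigma> \<circ> \<rho>))"
    using assms by (intro X.finsum_cong') (auto simp: act_comp permutes_compose)
  also have "\<dots> = (\<Oplus>\<^bsub>X n\<^esub>\<sigma>\<in>(\<lambda>\<sigma>. \<sigma> \<circ> \<rho>) ` perms n. oact P n x \<sigma>)"
  proof (rule X.finsum_reindex[symmetric])
    show "inj_on (\<lambda>\<sigma>. \<sigma> \<circ> \<rho>) (perms n)"
      using permutes_surj[OF assms(2)] by (auto simp: inj_on_def fun_eq_iff surj_def) metis
  qed (unfold image, use assms in auto)
  finally show ?thesis unfolding Sym_def image .
qed

lemma Sym_Inv: "x \<in> carrier (X n) \<Longrightarrow> Sym n x \<in> Inv n"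
  by (simp add: Inv_def act_Sym)

lemma Sym_of_Inv:
  assumes "x \<in> Inv n"
  shows "Sym n x = [(fact n :: nat)] \<cdot>\<^bsub>X n\<^esub> x"
proof -
  have "Sym n x = (\<Oplus>\<^bsub>X n\<^esub>\<sigma>\<in>perms n. x)"
    unfolding Sym_def using assms by (intro X.finsum_cong') (auto simp: Inv_act Inv_closed)
  also have "\<dots> = [card (perms n)] \<cdot>\<^bsub>X n\<^esub> x"
    using X.add.finprod_const[OF Inv_closed[OF assms], of "perms n"] by simp
  finally show ?thesis by (simp add: card_permutations[of _ n])
qed

text \<open>
  Every permutation is a shuffle times a member of the Young subgroup, which does not affect \<open>x\<close>. So
  the sum over the shuffles occurs \<open>b! n!\<close> times in the sum over all permutations.
\<close>

lemma Sym_shuffles: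
  assumes x: "x \<in> carrier (X (b + n))" and young: "\<And>y. y \<in> young b n \<Longrightarrow> oact P (b + n) x y = x"
  shows "[(fact b * fact n :: nat)] \<cdot>\<^bsub>X (b + n)\<^esub>
      (\<Oplus>\<^bsub>X (b + n)\<^esub>\<sigma>\<in>shuffle_perms (int b) (int n). oact P (b + n) x (inv_into UNIV \<sigma>)) = Sym (b + n) x"
proof -
  let ?N = "b + n"
  let ?A = "shuffle_perms (int b) (int n)"
  have perm: "\<sigma> permutes {1..?N}" if "\<sigma> \<in> ?A" for \<sigma> using that by (simp add: shuffle_perms_nat)
  have permy: "y permutes {1..?N}" if "y \<in> young b n" for y using that by (simp add: young_def)
  have inv_fix: "oact P ?N x (inv_into UNIV y) = x" if "y \<in> young b n" for y
  proof -
    have "oact P ?N x (inv_into UNIV y) = oact P ?N (oact P ?N x y) (inv_into UNIV y)"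
      using young[OF that] by simp
    also have "\<dots> = x"
      using permy[OF that] x by (simp add: act_comp permutes_inv permutes_inv_o act_id)
    finally show ?thesis .
  qed
  have "Sym ?N x = (\<Oplus>\<^bsub>X ?N\<^esub>\<pi>\<in>inv_into UNIV ` perms ?N. oact P ?N x \<pi>)"
    unfolding Sym_def image_Collect image_inverse_permutations ..
  also have "\<dots> = (\<Oplus>\<^bsub>X ?N\<^esub>\<pi>\<in>perms ?N. oact P ?N x (inv_into UNIV \<pi>))"
  proof (rule X.finsum_reindex)
    show "inj_on (inv_into UNIV) (perms ?N)"
      by (rule inj_on_inverseI[where g = "inv_into UNIV"]) (simp add: permutes_inv_inv)
  qed (use x in \<open>auto intro!: act_closed permutes_inv\<close>)
  also have "\<dots> = (\<Oplus>\<^bsub>X ?N\<^esub>\<pi>\<in>(\<lambda>(\<sigma>, y). \<sigma> \<circ> y) ` (?A \<times> young b n). oact P ?N x (inv_into UNIV \<pi>))"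
    using bij_betw_imp_surj_on[OF shuffle_young_bij, of b n] by simp
  also have "\<dots> = finsum (X ?N) (\<lambda>z. oact P ?N x (inv_into UNIV ((\<lambda>(\<sigma>, y). \<sigma> \<circ> y) z))) (?A \<times> young b n)"
    using x perm permy
    by (intro X.finsum_reindex bij_betw_imp_inj_on[OF shuffle_young_bij])
      (auto intro!: act_closed permutes_inv permutes_compose)
  also have "\<dots> = finsum (X ?N) (\<lambda>(\<sigma>, y). oact P ?N x (inv_into UNIV \<sigma>)) (?A \<times> young b n)"
  proof (rule X.finsum_cong')
    fix z assume "z \<in> ?A \<times> young b n"
    then obtain \<sigma> y where z: "z = (\<sigma>, y)" "\<sigma> \<in> ?A" "y \<in> young b n" by auto
    have "inv_into UNIV (\<sigma> \<circ> y) = inv_into UNIV y \<circ> inv_into UNIV \<sigma>"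
      using perm[OF z(2)] permy[OF z(3)] by (meson o_inv_distrib permutes_bij)
    then show "oact P ?N x (inv_into UNIV ((\<lambda>(\<sigma>, y). \<sigma> \<circ> y) z)) = (\<lambda>(\<sigma>, y). oact P ?N x (inv_into UNIV \<sigma>)) z"
      using z act_comp[OF x permutes_inv[OF permy[OF z(3)]] permutes_inv[OF perm[OF z(2)]]] inv_fix[OF z(3)]
      by simp
  qed (use x perm in \<open>auto intro!: act_closed permutes_inv\<close>)
  also have "\<dots> = (\<Oplus>\<^bsub>X ?N\<^esub>\<sigma>\<in>?A. \<Oplus>\<^bsub>X ?N\<^esub>y\<in>young b n. oact P ?N x (inv_into UNIV \<sigma>))"
    using x perm
    by (intro X.finsum_pairs[symmetric]) (auto intro!: act_closed permutes_inv simp: finite_shuffle_perms finite_young)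
  also have "\<dots> = (\<Oplus>\<^bsub>X ?N\<^esub>y\<in>young b n. \<Oplus>\<^bsub>X ?N\<^esub>\<sigma>\<in>?A. oact P ?N x (inv_into UNIV \<sigma>))"
    using x perm
    by (intro X.finsum_swap) (auto intro!: act_closed permutes_inv simp: finite_shuffle_perms finite_young)
  also have "\<dots> = [card (young b n)] \<cdot>\<^bsub>X ?N\<^esub> (\<Oplus>\<^bsub>X ?N\<^esub>\<sigma>\<in>?A. oact P ?N x (inv_into UNIV \<sigma>))"
    using x perm by (intro X.add.finprod_const[simplified]) (auto intro!: act_closed permutes_inv X.finsum_closed)
  finally show ?thesis by (simp add: card_young)
qed

lemma circ_linear_left:
  assumes "1 \<le> i" "i \<le> n" "g \<in> carrier (X m)" "N = m + n - 1"
  shows "linear_map F (X n) (X N) (\<lambda>f. ocirc P n m i f g k)"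
  using circ_bilinear[OF assms(1,2), of m k] assms(3,4)
  by (intro linear_map.intro linear_map_axioms.intro X.module_axioms) (simp add: even_bilinear_def)

lemma circ_linear_right:
  assumes "1 \<le> i" "i \<le> n" "f \<in> carrier (X n)" "N = m + n - 1"
  shows "linear_map F (X m) (X N) (\<lambda>g. ocirc P n m i f g k)"
  using circ_bilinear[OF assms(1,2), of m k] assms(3,4)
  by (intro linear_map.intro linear_map_axioms.intro X.module_axioms) (simp add: even_bilinear_def)

lemma circ_closed:
  assumes "1 \<le> i" "i \<le> n" "f \<in> carrier (X n)" "g \<in> carrier (X m)" "N = m + n - 1"
  shows "ocirc P n m i f g k \<in> carrier (X N)"
  using linear_map.closed[OF circ_linear_left[OF assms(1,2,4,5)] assms(3)] .

lemma circ_hpart: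
  assumes "1 \<le> i" "i \<le> n" "f \<in> hpart (X n) p" "g \<in> hpart (X m) q" "N = m + n - 1"
  shows "ocirc P n m i f g k \<in> hpart (X N) (p + q)"
  using circ_bilinear[OF assms(1,2), of m k] assms(3-5) unfolding even_bilinear_def by blast

lemma circ_equiv:
  assumes "1 \<le> i" "i \<le> n" "f \<in> carrier (X n)" "g \<in> carrier (X m)" "\<sigma> permutes {1..n}"
    "\<tau> permutes {1..m}" "N = m + n - 1"
  shows "ocirc P n m i (oact P n f \<sigma>) (oact P m g \<tau>) k =
    oact P N (ocirc P n m (\<sigma> i) f g k) (perm_circ n m i \<sigma> \<tau>)"
  using equivariance[OF assms(1-6)] assms(7) by simp

lemma perm_circ_perm:
  assumes "1 \<le> i" "i \<le> n" "\<sigma> permutes {1..n}" "\<tau> permutes {1..m}" "N = m + n - 1"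
  shows "perm_circ n m i \<sigma> \<tau> permutes {1..N}"
  using perm_circ_permutes[OF assms(3,4), of i] assms(1,2,5) by (simp add: add.commute)

text \<open>
  The sums over shuffles are replaced by symmetrizations, which absorb every permutation. That is
  possible in characteristic \<open>0\<close>.
\<close>

lemma Sym_circ_act:
  assumes "f \<in> carrier (X n)" "g \<in> carrier (X m)" "\<sigma> permutes {1..n}" "\<tau> permutes {1..m}"
    "1 \<le> i" "i \<le> n" "N = m + n - 1"
  shows "Sym N (ocirc P n m i (oact P n f \<sigma>) (oact P m g \<tau>) k) = Sym N (ocirc P n m (\<sigma> i) f g k)"
proof -
  have "1 \<le> \<sigma> i" "\<sigma> i \<le> n" using permutes_range[OF assms(3), of i] assms(5,6) by auto
  then show ?thesis
    unfolding circ_equiv[OF assms(5,6,1-4,7)] using assms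
    by (intro Sym_act circ_closed perm_circ_perm)
qed

text \<open>
  The coefficients of the sum of the \<open>(f \<circ>\<^sup>1\<^sub>\<lambda> g)\<close> over the shuffles, without the substitution that turns it into the
  \<open>\<lambda>\<close>-box product. The indices \<open>a\<close> and \<open>b\<close> are the arities \<open>n + 1\<close> and \<open>m + 1\<close> of \<open>f\<close> and \<open>g\<close>.
\<close>

definition bul :: "nat \<Rightarrow> nat \<Rightarrow> 'v \<Rightarrow> 'v \<Rightarrow> nat \<Rightarrow> 'v" where
  "bul a b f g k = (\<Oplus>\<^bsub>X (b + a - 1)\<^esub>\<sigma>\<in>shuffle_perms (int b) (int a - 1).
     oact P (b + a - 1) (ocirc P a b 1 f g k) (inv_into UNIV \<sigma>))"

lemma bul_0: "bul 0 b f g k = \<zero>\<^bsub>X (b - 1)\<^esub>"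
  by (simp add: bul_def shuffle_perms_def)

lemma shuffle_inv_permutes:
  assumes "\<sigma> \<in> shuffle_perms (int b) (int a - 1)"
  shows "inv_into UNIV \<sigma> permutes {1..b + a - 1}" "1 \<le> a"
proof -
  show "1 \<le> a" using assms by (auto simp: shuffle_perms_def split: if_splits)
  then have "nat (int b + (int a - 1)) = b + a - 1" by linarith
  then show "inv_into UNIV \<sigma> permutes {1..b + a - 1}"
    using assms by (auto simp: shuffle_perms_def intro!: permutes_inv split: if_splits)
qed

lemma bul_closed:
  assumes "f \<in> carrier (X a)" "g \<in> carrier (X b)" "N = b + a - 1"
  shows "bul a b f g k \<in> carrier (X N)"
  unfolding bul_def assms(3) using assms(1,2) shuffle_inv_permutes
  by (intro X.finsum_closed funcsetI act_closed circ_closed) auto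

lemma bul_hpart:
  assumes "f \<in> hpart (X a) p" "g \<in> hpart (X b) q" "N = b + a - 1"
  shows "bul a b f g k \<in> hpart (X N) (p + q)"
  unfolding bul_def assms(3) using assms(1,2) shuffle_inv_permutes
  by (intro X.hpart_finsum act_hpart circ_hpart) auto

lemma finsum_linear:
  assumes "finite A" "\<And>i. i \<in> A \<Longrightarrow> linear_map F (X m) (X n) (h i)"
  shows "linear_map F (X m) (X n) (\<lambda>x. \<Oplus>\<^bsub>X n\<^esub>i\<in>A. h i x)"
proof (intro linear_map.intro linear_map_axioms.intro X.module_axioms)
  have cl: "h i x \<in> carrier (X n)" if "i \<in> A" "x \<in> carrier (X m)" for i x
    using that by (intro linear_map.closed[OF assms(2)])
  show "(\<lambda>x. \<Oplus>\<^bsub>X n\<^esub>i\<in>A. h i x) \<in> linear_maps F (X m) (X n)"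
    unfolding linear_maps_def
  proof (intro CollectI conjI ballI funcsetI)
    fix x y assume xy: "x \<in> carrier (X m)" "y \<in> carrier (X m)"
    have "(\<Oplus>\<^bsub>X n\<^esub>i\<in>A. h i (x \<oplus>\<^bsub>X m\<^esub> y)) = (\<Oplus>\<^bsub>X n\<^esub>i\<in>A. h i x \<oplus>\<^bsub>X n\<^esub> h i y)"
      using xy cl by (intro X.finsum_cong') (auto simp: linear_map.add[OF assms(2)])
    then show "(\<Oplus>\<^bsub>X n\<^esub>i\<in>A. h i (x \<oplus>\<^bsub>X m\<^esub> y)) = (\<Oplus>\<^bsub>X n\<^esub>i\<in>A. h i x) \<oplus>\<^bsub>X n\<^esub> (\<Oplus>\<^bsub>X n\<^esub>i\<in>A. h i y)"
      using xy cl by (simp add: X.finsum_addf Pi_def)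
  next
    fix a x assume ax: "a \<in> carrier F" "x \<in> carrier (X m)"
    have "(\<Oplus>\<^bsub>X n\<^esub>i\<in>A. h i (a \<odot>\<^bsub>X m\<^esub> x)) = (\<Oplus>\<^bsub>X n\<^esub>i\<in>A. a \<odot>\<^bsub>X n\<^esub> h i x)"
      using ax cl by (intro X.finsum_cong') (auto simp: linear_map.scale[OF assms(2)])
    then show "(\<Oplus>\<^bsub>X n\<^esub>i\<in>A. h i (a \<odot>\<^bsub>X m\<^esub> x)) = a \<odot>\<^bsub>X n\<^esub> (\<Oplus>\<^bsub>X n\<^esub>i\<in>A. h i x)"
      using ax cl assms(1) by (subst X.finsum_smult_ldistr) auto
  qed (use cl in auto)
qed

lemma bul_linear_left:
  assumes "g \<in> carrier (X b)" "N = b + a - 1"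
  shows "linear_map F (X a) (X N) (\<lambda>f. bul a b f g k)"
  unfolding bul_def assms(2) using assms(1) shuffle_inv_permutes
  by (intro finsum_linear linear_map_comp[OF circ_linear_left act_linear] finite_shuffle_perms) auto

lemma bul_linear_right:
  assumes "f \<in> carrier (X a)" "N = b + a - 1"
  shows "linear_map F (X b) (X N) (\<lambda>g. bul a b f g k)"
  unfolding bul_def assms(2) using assms(1) shuffle_inv_permutes
  by (intro finsum_linear linear_map_comp[OF circ_linear_right act_linear] finite_shuffle_perms) auto

lemma circ_young_invariant:
  assumes f: "f \<in> Inv (Suc n)" and g: "g \<in> Inv b" and y: "y \<in> young b n"
  shows "oact P (b + n) (ocirc P (Suc n) b 1 f g k) y = ocirc P (Suc n) b 1 f g k"
proof -
  obtain \<sigma> \<tau> where p: "\<sigma> permutes {1..Suc n}" "\<tau> permutes {1..b}" "\<sigma> 1 = 1"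
    "y = perm_circ (Suc n) b 1 \<sigma> \<tau>"
    using young_perm_circ[OF y] .
  have "ocirc P (Suc n) b 1 (oact P (Suc n) f \<sigma>) (oact P b g \<tau>) k =
      oact P (b + n) (ocirc P (Suc n) b (\<sigma> 1) f g k) y"
    unfolding p(4) using f g p by (intro circ_equiv) (auto simp: Inv_closed)
  then show ?thesis using f g p by (simp add: Inv_act)
qed

lemma Sym_bul:
  assumes f: "f \<in> Inv (Suc n)" and g: "g \<in> Inv b"
  shows "[(fact b * fact n :: nat)] \<cdot>\<^bsub>X (b + n)\<^esub> bul (Suc n) b f g k = Sym (b + n) (ocirc P (Suc n) b 1 f g k)"
proof -
  have "ocirc P (Suc n) b 1 f g k \<in> carrier (X (b + n))"
    using f g by (intro circ_closed) (auto simp: Inv_closed)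
  from Sym_shuffles[OF this circ_young_invariant[OF f g]] show ?thesis by (simp add: bul_def)
qed

text \<open>
  The multiple by \<open>b! n!\<close> is a symmetrization, and \<open>b! n!\<close> can be cancelled.
\<close>

lemma bul_Inv:
  assumes f: "f \<in> Inv a" and g: "g \<in> Inv b" and N: "N = b + a - 1"
  shows "bul a b f g k \<in> Inv N"
proof (cases a)
  case 0
  have "\<zero>\<^bsub>X m\<^esub> \<in> Inv m" for m
    using linear_map.zero[OF act_linear] by (simp add: Inv_def)
  then show ?thesis by (simp add: 0 bul_0 N)
next
  case (Suc n)
  let ?x = "bul (Suc n) b f g k"
  have x: "?x \<in> carrier (X (b + n))" using f g by (intro bul_closed) (auto simp: Inv_closed Suc)
  have c: "ocirc P (Suc n) b 1 f g k \<in> carrier (X (b + n))"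
    using f g by (intro circ_closed) (auto simp: Inv_closed Suc)
  have "oact P (b + n) ?x \<sigma> = ?x" if \<sigma>: "\<sigma> permutes {1..b + n}" for \<sigma>
  proof (rule nat_cancel)
    have "[(fact b * fact n :: nat)] \<cdot>\<^bsub>X (b + n)\<^esub> oact P (b + n) ?x \<sigma> =
        oact P (b + n) ([(fact b * fact n :: nat)] \<cdot>\<^bsub>X (b + n)\<^esub> ?x) \<sigma>"
      using x by (simp add: linear_map.nat_mult[OF act_linear[OF \<sigma>]])
    also have "\<dots> = [(fact b * fact n :: nat)] \<cdot>\<^bsub>X (b + n)\<^esub> ?x"
      using f g act_Sym[OF c \<sigma>] by (simp add: Sym_bul[of f n g b] Suc)
    finally show "[(fact b * fact n :: nat)] \<cdot>\<^bsub>X (b + n)\<^esub> oact P (b + n) ?x \<sigma> =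
        [(fact b * fact n :: nat)] \<cdot>\<^bsub>X (b + n)\<^esub> ?x" .
  qed (use x \<sigma> in auto)
  with x show ?thesis by (simp add: Inv_def N Suc)
qed

text \<open>
  A permutation \<open>\<sigma>\<close> of the arguments of \<open>x\<close> only affects the position \<open>\<sigma> 1\<close> of \<open>h\<close>, and \<open>n!\<close> of them have
  the same \<open>\<sigma> 1\<close>.
\<close>

lemma Sym_circ_Sym_left:
  assumes x: "x \<in> carrier (X (Suc n))" and h: "h \<in> Inv c"
  shows "Sym (c + n) (ocirc P (Suc n) c 1 (Sym (Suc n) x) h k) =
    [(fact n :: nat)] \<cdot>\<^bsub>X (c + n)\<^esub> (\<Oplus>\<^bsub>X (c + n)\<^esub>j\<in>{1..Suc n}. Sym (c + n) (ocirc P (Suc n) c j x h k))"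
proof -
  have hc: "h \<in> carrier (X c)" using h by (rule Inv_closed)
  interpret l: linear_map F "X (Suc n)" "X (c + n)" "\<lambda>f. Sym (c + n) (ocirc P (Suc n) c 1 f h k)"
    using hc by (intro linear_map_comp[OF circ_linear_left Sym_linear]) auto
  have term_closed: "Sym (c + n) (ocirc P (Suc n) c j x h k) \<in> carrier (X (c + n))" if "j \<in> {1..Suc n}" for j
    using that x hc by (intro Sym_closed circ_closed) auto
  have range: "\<sigma> 1 \<in> {1..Suc n}" if "\<sigma> permutes {1..Suc n}" for \<sigma>
    using permutes_in_image[OF that, of 1] by simp
  have "Sym (c + n) (ocirc P (Suc n) c 1 (Sym (Suc n) x) h k) =
      (\<Oplus>\<^bsub>X (c + n)\<^esub>\<sigma>\<in>perms (Suc n). Sym (c + n) (ocirc P (Suc n) c 1 (oact P (Suc n) x \<sigma>) h k))"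
    unfolding Sym_def[of "Suc n" x] using x by (intro l.finsum) auto
  also have "\<dots> = (\<Oplus>\<^bsub>X (c + n)\<^esub>\<sigma>\<in>perms (Suc n). Sym (c + n) (ocirc P (Suc n) c (\<sigma> 1) x h k))"
  proof (rule X.finsum_cong')
    fix \<sigma> assume "\<sigma> \<in> perms (Suc n)"
    then show "Sym (c + n) (ocirc P (Suc n) c 1 (oact P (Suc n) x \<sigma>) h k) =
        Sym (c + n) (ocirc P (Suc n) c (\<sigma> 1) x h k)"
      using Sym_circ_act[OF x hc, of \<sigma> id 1 "c + n" k] hc by (simp add: act_id)
  qed (use term_closed range in auto)
  also have "\<dots> = [(fact n :: nat)] \<cdot>\<^bsub>X (c + n)\<^esub> (\<Oplus>\<^bsub>X (c + n)\<^esub>j\<in>{1..Suc n}. Sym (c + n) (ocirc P (Suc n) c j x h k))"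
    using card_permutes_first[of _ n] range term_closed
    by (intro X.finsum_fibres[of _ _ "\<lambda>\<sigma>. \<sigma> 1"]) (auto simp: finite_permutations)
  finally show ?thesis .
qed

text \<open>
  Permutations of the arguments of \<open>x\<close> are absorbed by the outer symmetrization.
\<close>

lemma Sym_circ_Sym_right:
  assumes f: "f \<in> Inv (Suc n)" and x: "x \<in> carrier (X b)"
  shows "Sym (b + n) (ocirc P (Suc n) b 1 f (Sym b x) k) =
    [(fact b :: nat)] \<cdot>\<^bsub>X (b + n)\<^esub> Sym (b + n) (ocirc P (Suc n) b 1 f x k)"
proof -
  have fc: "f \<in> carrier (X (Suc n))" using f by (rule Inv_closed)
  interpret l: linear_map F "X b" "X (b + n)" "\<lambda>g. Sym (b + n) (ocirc P (Suc n) b 1 f g k)"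
    using fc by (intro linear_map_comp[OF circ_linear_right Sym_linear]) auto
  have cl: "Sym (b + n) (ocirc P (Suc n) b 1 f x k) \<in> carrier (X (b + n))"
    using x fc by (intro Sym_closed circ_closed) auto
  have "Sym (b + n) (ocirc P (Suc n) b 1 f (Sym b x) k) =
      (\<Oplus>\<^bsub>X (b + n)\<^esub>\<sigma>\<in>perms b. Sym (b + n) (ocirc P (Suc n) b 1 f (oact P b x \<sigma>) k))"
    unfolding Sym_def[of b x] using x by (intro l.finsum) auto
  also have "\<dots> = (\<Oplus>\<^bsub>X (b + n)\<^esub>\<sigma>\<in>perms b. Sym (b + n) (ocirc P (Suc n) b 1 f x k))"
    using Sym_circ_act[OF fc x, of id _ 1 "b + n" k] fc cl
    by (intro X.finsum_cong') (auto simp: act_id)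
  also have "\<dots> = [card (perms b)] \<cdot>\<^bsub>X (b + n)\<^esub> Sym (b + n) (ocirc P (Suc n) b 1 f x k)"
    using X.add.finprod_const[OF cl, of "perms b"] by simp
  finally show ?thesis by (simp add: card_permutations[of _ b])
qed

text \<open>The permutation that moves the position \<open>1\<close> of \<open>g\<close> to \<open>j\<close> is absorbed by the symmetrization.\<close>

lemma Sym_nested:
  assumes f: "f \<in> Inv (Suc n)" and g: "g \<in> Inv (Suc m)" and h: "h \<in> Inv c" and j: "j \<in> {1..Suc m}"
  shows "Sym (c + m + n) (ocirc P (Suc n) (c + m) 1 f (ocirc P (Suc m) c j g h t) u) =
    Sym (c + m + n) (ocirc P (Suc n) (c + m) 1 f (ocirc P (Suc m) c 1 g h t) u)"
proof -
  let ?\<tau> = "transpose 1 j"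
  have \<tau>: "?\<tau> permutes {1..Suc m}" using j by (intro permutes_swap_id) auto
  have car: "f \<in> carrier (X (Suc n))" "g \<in> carrier (X (Suc m))" "h \<in> carrier (X c)"
    using f g h by (auto simp: Inv_closed)
  have cl: "ocirc P (Suc m) c j g h t \<in> carrier (X (c + m))"
    using car j by (intro circ_closed) auto
  let ?\<rho> = "perm_circ (Suc m) c 1 ?\<tau> id"
  have \<rho>: "?\<rho> permutes {1..c + m}" using \<tau> by (intro perm_circ_perm) auto
  have "ocirc P (Suc m) c 1 g h t = ocirc P (Suc m) c 1 (oact P (Suc m) g ?\<tau>) (oact P c h id) t"
    using Inv_act[OF g \<tau>] car by (simp add: act_id)
  also have "\<dots> = oact P (c + m) (ocirc P (Suc m) c j g h t) ?\<rho>"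
    using car \<tau> circ_equiv[of 1 "Suc m" g h c ?\<tau> id "c + m" t] by simp
  finally have "ocirc P (Suc n) (c + m) 1 f (ocirc P (Suc m) c 1 g h t) u =
      ocirc P (Suc n) (c + m) 1 (oact P (Suc n) f id) (oact P (c + m) (ocirc P (Suc m) c j g h t) ?\<rho>) u"
    using car by (simp add: act_id)
  then show ?thesis
    using Sym_circ_act[OF car(1) cl permutes_id \<rho>, of 1 "c + m + n" u] by simp
qed

text \<open>
  The parallel compositions exchange \<open>g\<close> and \<open>h\<close>: their positions in \<open>f\<close> are moved to the front by
  a transposition, which fixes \<open>f\<close>.
\<close>

lemma Sym_parallel:
  assumes f: "f \<in> Inv (Suc n)" and g: "g \<in> Inv b" "g \<in> hpart (X b) p"
    and h: "h \<in> Inv c" "h \<in> hpart (X c) q" and i: "i \<in> {2..Suc n}" and N: "N = b + c + n - 1"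
  shows "Sym N (ocirc P (b + n) c (b + i - 1) (ocirc P (Suc n) b 1 f g r) h s) =
    sgn_of F p q \<odot>\<^bsub>X N\<^esub> Sym N (ocirc P (c + n) b (c + i - 1) (ocirc P (Suc n) c 1 f h s) g r)"
proof -
  let ?\<tau> = "transpose 1 i"
  have \<tau>: "?\<tau> permutes {1..Suc n}" using i by (intro permutes_swap_id) auto
  have car: "f \<in> carrier (X (Suc n))" "g \<in> carrier (X b)" "h \<in> carrier (X c)"
    using f g h by (auto simp: Inv_closed)
  let ?\<rho> = "perm_circ (Suc n) c i ?\<tau> id"
  have \<rho>: "?\<rho> permutes {1..c + n}" using \<tau> i by (intro perm_circ_perm) auto
  have \<rho>1: "?\<rho> 1 = c + i - 1" using i by (intro perm_circ_transpose_first) auto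
  have cl: "ocirc P (Suc n) c 1 f h s \<in> carrier (X (c + n))" "ocirc P (Suc n) b 1 f g r \<in> carrier (X (b + n))"
    using car by (auto intro!: circ_closed)
  have cl': "ocirc P (b + n) c (b + i - 1) (ocirc P (Suc n) b 1 f g r) h s \<in> carrier (X N)"
    using cl car i by (intro circ_closed) (auto simp: N)
  have "ocirc P (Suc n) c i f h s = ocirc P (Suc n) c i (oact P (Suc n) f ?\<tau>) (oact P c h id) s"
    using Inv_act[OF f \<tau>] car by (simp add: act_id)
  also have "\<dots> = oact P (c + n) (ocirc P (Suc n) c 1 f h s) ?\<rho>"
    using car \<tau> i circ_equiv[of i "Suc n" f h c ?\<tau> id "c + n" s] by simp
  finally have fh: "ocirc P (Suc n) c i f h s = oact P (c + n) (ocirc P (Suc n) c 1 f h s) ?\<rho>" .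
  have "Sym N (ocirc P (c + n) b 1 (ocirc P (Suc n) c i f h s) g r) =
      Sym N (ocirc P (c + n) b (c + i - 1) (ocirc P (Suc n) c 1 f h s) g r)"
    using Sym_circ_act[OF cl(1) car(2) \<rho> permutes_id, of 1 N r] i
    unfolding fh \<rho>1 act_id[OF car(2)] by (simp add: N add.assoc)
  moreover have "ocirc P (c + n) b 1 (ocirc P (Suc n) c i f h s) g r =
      [koszul q p] \<cdot>\<^bsub>X N\<^esub> ocirc P (b + n) c (b + i - 1) (ocirc P (Suc n) b 1 f g r) h s"
    using assoc_parallel[of 1 i "Suc n" f h c q g b p s r] i car g(2) h(2)
    by (simp add: N)
  ultimately have "Sym N (ocirc P (c + n) b (c + i - 1) (ocirc P (Suc n) c 1 f h s) g r) =
      sgn_of F q p \<odot>\<^bsub>X N\<^esub> Sym N (ocirc P (b + n) c (b + i - 1) (ocirc P (Suc n) b 1 f g r) h s)"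
    using cl' by (simp add: X.koszul_scalar linear_map.scale[OF Sym_linear])
  then show ?thesis unfolding sgn_of_commute[of F q p] using cl' by (simp add: X.sgn_of_sq)
qed

text \<open>
  In \<open>(f \<box> g) \<box> h\<close>, the element \<open>h\<close> is inserted at all positions of \<open>f \<circ>\<^sub>1 g\<close>: into \<open>g\<close> for \<open>j \<le> b\<close>, and at
  another argument of \<open>f\<close> for \<open>j > b\<close>.
\<close>

lemma bul_iterated:
  assumes f: "f \<in> Inv (Suc n)" and g: "g \<in> Inv b" and h: "h \<in> Inv c" and N: "N = b + c + n - 1"
  shows "[(fact n * fact b * fact c :: nat)] \<cdot>\<^bsub>X N\<^esub> bul (b + n) c (bul (Suc n) b f g r) h s =
    (\<Oplus>\<^bsub>X N\<^esub>j\<in>{1..b + n}. Sym N (ocirc P (b + n) c j (ocirc P (Suc n) b 1 f g r) h s))"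
    (is "[_] \<cdot>\<^bsub>_\<^esub> ?x = _")
proof (cases "b + n")
  case 0
  then show ?thesis by (simp add: bul_0 N)
next
  case (Suc k)
  have car: "f \<in> carrier (X (Suc n))" "g \<in> carrier (X b)" "h \<in> carrier (X c)"
    using f g h by (auto simp: Inv_closed)
  have NN: "N = c + k" using Suc N by simp
  let ?fg = "bul (Suc n) b f g r"
  have fg: "?fg \<in> Inv (Suc k)" using f g Suc by (intro bul_Inv) auto
  have o: "ocirc P (Suc n) b 1 f g r \<in> carrier (X (Suc k))" using car Suc by (intro circ_closed) auto
  have cl: "?x \<in> carrier (X N)"
    unfolding Suc by (rule bul_closed[OF Inv_closed[OF fg] car(3)]) (simp add: NN)
  interpret l: linear_map F "X (Suc k)" "X N" "\<lambda>f. Sym N (ocirc P (Suc k) c 1 f h s)"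
    using car by (intro linear_map_comp[OF circ_linear_left Sym_linear]) (auto simp: NN)
  have cl': "(\<Oplus>\<^bsub>X N\<^esub>j\<in>{1..b + n}. Sym N (ocirc P (b + n) c j (ocirc P (Suc n) b 1 f g r) h s)) \<in> carrier (X N)"
    using o car by (intro X.finsum_closed funcsetI Sym_closed circ_closed) (auto simp: Suc NN)
  show ?thesis
  proof (rule nat_cancel)
    show "0 < (fact k :: nat)" by simp
    have "[(fact k :: nat)] \<cdot>\<^bsub>X N\<^esub> ([(fact n * fact b * fact c :: nat)] \<cdot>\<^bsub>X N\<^esub> ?x) =
        [(fact b * fact n :: nat)] \<cdot>\<^bsub>X N\<^esub> ([(fact c * fact k :: nat)] \<cdot>\<^bsub>X N\<^esub> ?x)"
      using cl by (simp add: X.add.nat_pow_pow ac_simps)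
    also have "[(fact c * fact k :: nat)] \<cdot>\<^bsub>X N\<^esub> ?x = Sym N (ocirc P (Suc k) c 1 ?fg h s)"
      using Sym_bul[OF fg h, of s] by (simp add: NN Suc)
    also have "[(fact b * fact n :: nat)] \<cdot>\<^bsub>X N\<^esub> Sym N (ocirc P (Suc k) c 1 ?fg h s) =
        Sym N (ocirc P (Suc k) c 1 ([(fact b * fact n :: nat)] \<cdot>\<^bsub>X (Suc k)\<^esub> ?fg) h s)"
      by (rule l.nat_mult[OF Inv_closed[OF fg], symmetric])
    also have "[(fact b * fact n :: nat)] \<cdot>\<^bsub>X (Suc k)\<^esub> ?fg = Sym (Suc k) (ocirc P (Suc n) b 1 f g r)"
      using Sym_bul[OF f g, of r] Suc by simp
    also have "Sym N (ocirc P (Suc k) c 1 (Sym (Suc k) (ocirc P (Suc n) b 1 f g r)) h s) =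
        [(fact k :: nat)] \<cdot>\<^bsub>X N\<^esub>
          (\<Oplus>\<^bsub>X N\<^esub>j\<in>{1..Suc k}. Sym N (ocirc P (Suc k) c j (ocirc P (Suc n) b 1 f g r) h s))"
      unfolding NN by (rule Sym_circ_Sym_left[OF o h])
    finally show "[(fact k :: nat)] \<cdot>\<^bsub>X N\<^esub> ([(fact n * fact b * fact c :: nat)] \<cdot>\<^bsub>X N\<^esub> ?x) =
        [(fact k :: nat)] \<cdot>\<^bsub>X N\<^esub>
          (\<Oplus>\<^bsub>X N\<^esub>j\<in>{1..b + n}. Sym N (ocirc P (b + n) c j (ocirc P (Suc n) b 1 f g r) h s))"
      by (simp add: Suc)
  qed (use cl cl' in auto)
qed

text \<open>
  The composite \<open>f \<box> (g \<box> h)\<close> vanishes if \<open>g\<close> and \<open>h\<close> have arity \<open>0\<close>, because there is no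
  component for \<open>g \<box> h\<close>, whose arity would be \<open>-1\<close>. The same holds for \<open>(g \<box> h) \<box> f\<close>.
\<close>

definition boxL :: "nat \<Rightarrow> nat \<Rightarrow> nat \<Rightarrow> 'v \<Rightarrow> 'v \<Rightarrow> nat \<Rightarrow> 'v" where
  "boxL a b c f w k = (if b + c = 0 then \<zero>\<^bsub>X (a + b + c - 2)\<^esub> else bul a (b + c - 1) f w k)"

definition boxR :: "nat \<Rightarrow> nat \<Rightarrow> nat \<Rightarrow> 'v \<Rightarrow> 'v \<Rightarrow> nat \<Rightarrow> 'v" where
  "boxR a b c w h k = (if a + b = 0 then \<zero>\<^bsub>X (a + b + c - 2)\<^esub> else bul (a + b - 1) c w h k)"

lemma boxL_linear:
  assumes "f \<in> carrier (X a)" "N = a + b + c - 2"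
  shows "linear_map F (X (b + c - 1)) (X N) (\<lambda>w. boxL a b c f w k)"
proof (cases "b + c = 0")
  case True
  then show ?thesis
    using assms by (auto simp: boxL_def linear_map_def linear_map_axioms_def linear_maps_def X.module_axioms)
next
  case False
  then show ?thesis unfolding boxL_def if_not_P[OF False]
    using assms by (intro bul_linear_right) auto
qed

lemma boxL_closed:
  assumes "f \<in> carrier (X a)" "w \<in> carrier (X (b + c - 1))" "N = a + b + c - 2"
  shows "boxL a b c f w k \<in> carrier (X N)"
  using linear_map.closed[OF boxL_linear[OF assms(1,3)] assms(2)] .

lemma boxR_linear:
  assumes "h \<in> carrier (X c)" "N = a + b + c - 2"
  shows "linear_map F (X (a + b - 1)) (X N) (\<lambda>w. boxR a b c w h k)"
proof (cases "a + b = 0")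
  case True
  then show ?thesis
    using assms by (auto simp: boxR_def linear_map_def linear_map_axioms_def linear_maps_def X.module_axioms)
next
  case False
  then show ?thesis unfolding boxR_def if_not_P[OF False]
    using assms by (intro bul_linear_left) auto
qed

lemma boxR_closed:
  assumes "w \<in> carrier (X (a + b - 1))" "h \<in> carrier (X c)" "N = a + b + c - 2"
  shows "boxR a b c w h k \<in> carrier (X N)"
  using linear_map.closed[OF boxR_linear[OF assms(2,3)] assms(1)] .

text \<open>
  In \<open>f \<box> (g \<box> h)\<close>, the element \<open>h\<close> is inserted at all positions of \<open>g\<close>; they contribute equally to the
  symmetrization.
\<close>

lemma bul_nested:
  assumes f: "f \<in> Inv (Suc n)" and g: "g \<in> Inv b" and h: "h \<in> Inv c" and N: "N = b + c + n - 1"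
  shows "[(fact n * fact b * fact c :: nat)] \<cdot>\<^bsub>X N\<^esub> boxL (Suc n) b c f (bul b c g h t) u =
    (\<Oplus>\<^bsub>X N\<^esub>j\<in>{1..b}. Sym N (ocirc P (Suc n) (c + b - 1) 1 f (ocirc P b c j g h t) u))"
proof (cases b)
  case 0
  have "linear_map F (X (b + c - 1)) (X N) (\<lambda>w. boxL (Suc n) b c f w u)"
    using f by (intro boxL_linear) (auto simp: Inv_closed N)
  from linear_map.zero[OF this] show ?thesis by (simp add: 0 bul_0)
next
  case (Suc m)
  have car: "f \<in> carrier (X (Suc n))" "g \<in> carrier (X (Suc m))" "h \<in> carrier (X c)"
    using f g h by (auto simp: Inv_closed Suc)
  have NN: "N = c + m + n" using Suc N by simp
  let ?gh = "bul b c g h t"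
  have gh: "?gh \<in> Inv (c + m)" using g h Suc by (intro bul_Inv) auto
  have o: "ocirc P (Suc m) c 1 g h t \<in> carrier (X (c + m))" using car by (intro circ_closed) auto
  interpret l: linear_map F "X (c + m)" "X N" "\<lambda>g. Sym N (ocirc P (Suc n) (c + m) 1 f g u)"
    using car by (intro linear_map_comp[OF circ_linear_right Sym_linear]) (auto simp: NN)
  let ?y = "bul (Suc n) (c + m) f ?gh u" and ?z = "Sym N (ocirc P (Suc n) (c + m) 1 f (ocirc P (Suc m) c 1 g h t) u)"
  have cl: "?y \<in> carrier (X N)"
    by (rule bul_closed[OF car(1) Inv_closed[OF gh]]) (simp add: NN)
  have cl_z: "?z \<in> carrier (X N)"
    by (intro Sym_closed circ_closed[OF _ _ car(1) o]) (simp_all add: NN)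
  note cl = cl cl_z
  have "[(fact n * fact b * fact c :: nat)] \<cdot>\<^bsub>X N\<^esub> ?y = [b] \<cdot>\<^bsub>X N\<^esub> ?z"
  proof (rule nat_cancel)
    show "0 < (fact (c + m) :: nat)" by simp
    have "[(fact (c + m) :: nat)] \<cdot>\<^bsub>X N\<^esub> ([(fact n * fact b * fact c :: nat)] \<cdot>\<^bsub>X N\<^esub> ?y) =
        [b] \<cdot>\<^bsub>X N\<^esub> ([(fact c * fact m :: nat)] \<cdot>\<^bsub>X N\<^esub> ([(fact (c + m) * fact n :: nat)] \<cdot>\<^bsub>X N\<^esub> ?y))"
      using cl by (simp add: X.add.nat_pow_pow algebra_simps Suc del: X.add.nat_pow_Suc)
    also have "[(fact (c + m) * fact n :: nat)] \<cdot>\<^bsub>X N\<^esub> ?y = Sym N (ocirc P (Suc n) (c + m) 1 f ?gh u)"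
      using Sym_bul[OF f gh, of u] by (simp add: NN)
    also have "[(fact c * fact m :: nat)] \<cdot>\<^bsub>X N\<^esub> Sym N (ocirc P (Suc n) (c + m) 1 f ?gh u) =
        Sym N (ocirc P (Suc n) (c + m) 1 f ([(fact c * fact m :: nat)] \<cdot>\<^bsub>X (c + m)\<^esub> ?gh) u)"
      by (rule l.nat_mult[OF Inv_closed[OF gh], symmetric])
    also have "[(fact c * fact m :: nat)] \<cdot>\<^bsub>X (c + m)\<^esub> ?gh = Sym (c + m) (ocirc P (Suc m) c 1 g h t)"
      using Sym_bul[OF g[unfolded Suc] h, of t] Suc by simp
    also have "Sym N (ocirc P (Suc n) (c + m) 1 f (Sym (c + m) (ocirc P (Suc m) c 1 g h t)) u) =
        [(fact (c + m) :: nat)] \<cdot>\<^bsub>X N\<^esub> ?z"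
      unfolding NN by (rule Sym_circ_Sym_right[OF f o])
    also have "[b] \<cdot>\<^bsub>X N\<^esub> ([(fact (c + m) :: nat)] \<cdot>\<^bsub>X N\<^esub> ?z) = [(fact (c + m) :: nat)] \<cdot>\<^bsub>X N\<^esub> ([b] \<cdot>\<^bsub>X N\<^esub> ?z)"
      using cl by (simp add: X.add.nat_pow_pow ac_simps)
    finally show "[(fact (c + m) :: nat)] \<cdot>\<^bsub>X N\<^esub> ([(fact n * fact b * fact c :: nat)] \<cdot>\<^bsub>X N\<^esub> ?y) =
        [(fact (c + m) :: nat)] \<cdot>\<^bsub>X N\<^esub> ([b] \<cdot>\<^bsub>X N\<^esub> ?z)" .
  qed (use cl in auto)
  also have "[b] \<cdot>\<^bsub>X N\<^esub> ?z = (\<Oplus>\<^bsub>X N\<^esub>j\<in>{1..b}. ?z)"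
    using X.add.finprod_const[OF cl(2), of "{1..b}"] by simp
  also have "\<dots> = (\<Oplus>\<^bsub>X N\<^esub>j\<in>{1..b}. Sym N (ocirc P (Suc n) (c + m) 1 f (ocirc P (Suc m) c j g h t) u))"
  proof (rule X.finsum_cong'[OF refl])
    show "(\<lambda>j. Sym N (ocirc P (Suc n) (c + m) 1 f (ocirc P (Suc m) c j g h t) u)) \<in> {1..b} \<rightarrow> carrier (X N)"
      using car by (intro funcsetI Sym_closed circ_closed) (auto simp: NN Suc)
    show "?z = Sym N (ocirc P (Suc n) (c + m) 1 f (ocirc P (Suc m) c j g h t) u)" if "j \<in> {1..b}" for j
      using Sym_nested[OF f g[unfolded Suc] h, of j t u] that by (simp add: NN Suc)
  qed
  finally show ?thesis by (simp add: Suc boxL_def add.commute)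
qed

text \<open>
  The part of \<open>(f \<box> g) \<box> h\<close> where \<open>g\<close> and \<open>h\<close> are inserted at different arguments of \<open>f\<close>.
\<close>

definition outer :: "nat \<Rightarrow> nat \<Rightarrow> nat \<Rightarrow> 'v \<Rightarrow> 'v \<Rightarrow> nat \<Rightarrow> 'v \<Rightarrow> nat \<Rightarrow> 'v" where
  "outer n b c f g r h s = (\<Oplus>\<^bsub>X (b + c + n - 1)\<^esub>i\<in>{2..Suc n}.
     Sym (b + c + n - 1) (ocirc P (b + n) c (b + i - 1) (ocirc P (Suc n) b 1 f g r) h s))"

text \<open>
  The nested compositions, after expansion by the nested associativity, make up \<open>f \<box> (g \<box> h)\<close>. The
  exponents \<open>u\<close> and \<open>v\<close> of the parameters depend on the coefficient that is considered.
\<close>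

lemma associator:
  assumes f: "f \<in> Inv (Suc n)" and g: "g \<in> Inv b" and h: "h \<in> Inv c" and N: "N = b + c + n - 1"
    and nested: "\<And>j. j \<in> {1..b} \<Longrightarrow> ocirc P (b + n) c j (ocirc P (Suc n) b 1 f g r) h s =
      (\<Oplus>\<^bsub>X N\<^esub>t\<in>A. ocirc P (Suc n) (c + b - 1) 1 f (ocirc P b c j g h (v t)) (u t))"
    and A: "finite A"
  shows "[(fact n * fact b * fact c :: nat)] \<cdot>\<^bsub>X N\<^esub> bul (b + n) c (bul (Suc n) b f g r) h s =
    [(fact n * fact b * fact c :: nat)] \<cdot>\<^bsub>X N\<^esub> (\<Oplus>\<^bsub>X N\<^esub>t\<in>A. boxL (Suc n) b c f (bul b c g h (v t)) (u t))
      \<oplus>\<^bsub>X N\<^esub> outer n b c f g r h s"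
proof -
  let ?k = "fact n * fact b * fact c :: nat"
  have car: "f \<in> carrier (X (Suc n))" "g \<in> carrier (X b)" "h \<in> carrier (X c)"
    using f g h by (auto simp: Inv_closed)
  let ?T = "\<lambda>j. Sym N (ocirc P (b + n) c j (ocirc P (Suc n) b 1 f g r) h s)"
  have T: "?T j \<in> carrier (X N)" if "j \<in> {1..b + n}" for j
    using car that by (intro Sym_closed circ_closed[where N = "N"] circ_closed[where N = "b + n"]) (auto simp: N)
  have U: "Sym N (ocirc P (Suc n) (c + b - 1) 1 f (ocirc P b c j g h t) w) \<in> carrier (X N)"
    "ocirc P (Suc n) (c + b - 1) 1 f (ocirc P b c j g h t) w \<in> carrier (X N)" if "j \<in> {1..b}" for j t w
    using car that by (auto intro!: Sym_closed circ_closed simp: N)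
  have B: "boxL (Suc n) b c f (bul b c g h t) w \<in> carrier (X N)" for t w
    using car by (intro boxL_closed bul_closed) (auto simp: N)
  have split: "{1..b + n} = {1..b} \<union> (\<lambda>i. b + i - 1) ` {2..Suc n}"
  proof (intro Set.set_eqI iffI)
    fix j assume j: "j \<in> {1..b + n}"
    show "j \<in> {1..b} \<union> (\<lambda>i. b + i - 1) ` {2..Suc n}"
    proof (cases "j \<le> b")
      case False
      then have "j = b + (j - b + 1) - 1" "j - b + 1 \<in> {2..Suc n}" using j by auto
      then show ?thesis by blast
    qed (use j in simp)
  qed auto
  have T': "?T \<in> {1..b} \<rightarrow> carrier (X N)" "?T \<in> (\<lambda>i. b + i - 1) ` {2..Suc n} \<rightarrow> carrier (X N)"
    using T split by blast+
  have "(\<Oplus>\<^bsub>X N\<^esub>j\<in>{1..b + n}. ?T j) =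
      (\<Oplus>\<^bsub>X N\<^esub>j\<in>{1..b}. ?T j) \<oplus>\<^bsub>X N\<^esub> (\<Oplus>\<^bsub>X N\<^esub>j\<in>(\<lambda>i. b + i - 1) ` {2..Suc n}. ?T j)"
    unfolding split by (rule X.finsum_Un_disjoint) (use T' in auto)
  also have "(\<Oplus>\<^bsub>X N\<^esub>j\<in>(\<lambda>i. b + i - 1) ` {2..Suc n}. ?T j) = (\<Oplus>\<^bsub>X N\<^esub>i\<in>{2..Suc n}. ?T (b + i - 1))"
    by (rule X.finsum_reindex[OF T'(2)]) (auto simp: inj_on_def)
  also have "(\<Oplus>\<^bsub>X N\<^esub>i\<in>{2..Suc n}. ?T (b + i - 1)) = outer n b c f g r h s"
    by (simp add: outer_def N)
  also have "(\<Oplus>\<^bsub>X N\<^esub>j\<in>{1..b}. ?T j) = (\<Oplus>\<^bsub>X N\<^esub>j\<in>{1..b}. \<Oplus>\<^bsub>X N\<^esub>t\<in>A.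
      Sym N (ocirc P (Suc n) (c + b - 1) 1 f (ocirc P b c j g h (v t)) (u t)))"
  proof (rule X.finsum_cong'[OF refl])
    show "?T j = (\<Oplus>\<^bsub>X N\<^esub>t\<in>A. Sym N (ocirc P (Suc n) (c + b - 1) 1 f (ocirc P b c j g h (v t)) (u t)))"
      if "j \<in> {1..b}" for j
      unfolding nested[OF that] using U(2)[OF that] by (intro linear_map.finsum[OF Sym_linear]) auto
  qed (use U in \<open>auto intro!: X.finsum_closed\<close>)
  also have "\<dots> = (\<Oplus>\<^bsub>X N\<^esub>t\<in>A. \<Oplus>\<^bsub>X N\<^esub>j\<in>{1..b}.
      Sym N (ocirc P (Suc n) (c + b - 1) 1 f (ocirc P b c j g h (v t)) (u t)))"
    using U A by (intro X.finsum_swap) auto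
  also have "\<dots> = (\<Oplus>\<^bsub>X N\<^esub>t\<in>A. [?k] \<cdot>\<^bsub>X N\<^esub> boxL (Suc n) b c f (bul b c g h (v t)) (u t))"
    using U B by (intro X.finsum_cong') (auto simp: bul_nested[OF f g h N] simp del: One_nat_def)
  also have "\<dots> = [?k] \<cdot>\<^bsub>X N\<^esub> (\<Oplus>\<^bsub>X N\<^esub>t\<in>A. boxL (Suc n) b c f (bul b c g h (v t)) (u t))"
    using B A by (simp add: X.nat_scalar X.finsum_smult_ldistr)
  finally show ?thesis unfolding bul_iterated[OF f g h N] .
qed

lemma outer_symmetric:
  assumes f: "f \<in> Inv (Suc n)" and g: "g \<in> Inv b" "g \<in> hpart (X b) p"
    and h: "h \<in> Inv c" "h \<in> hpart (X c) q" and N: "N = b + c + n - 1"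
  shows "outer n b c f g r h s = sgn_of F p q \<odot>\<^bsub>X N\<^esub> outer n c b f h s g r"
proof -
  have car: "f \<in> carrier (X (Suc n))" "g \<in> carrier (X b)" "h \<in> carrier (X c)"
    using f g h by (auto simp: Inv_closed)
  have N': "c + b + n - 1 = N" by (simp add: N)
  have cl: "Sym N (ocirc P (c + n) b (c + i - 1) (ocirc P (Suc n) c 1 f h s) g r) \<in> carrier (X N)"
    if "i \<in> {2..Suc n}" for i
    using car that by (intro Sym_closed circ_closed[where N = "N"] circ_closed[where N = "c + n"]) (auto simp: N)
  have "outer n b c f g r h s = (\<Oplus>\<^bsub>X N\<^esub>i\<in>{2..Suc n}.
      sgn_of F p q \<odot>\<^bsub>X N\<^esub> Sym N (ocirc P (c + n) b (c + i - 1) (ocirc P (Suc n) c 1 f h s) g r))"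
    unfolding outer_def N[symmetric]
    using Sym_parallel[OF f g h _ N] cl by (intro X.finsum_cong') (auto simp del: One_nat_def)
  then show ?thesis
    unfolding outer_def N' using cl by (subst X.finsum_smult_ldistr) auto
qed

text \<open>
  The associator of the box product is symmetric in its last two arguments, up to the sign: its
  nested compositions cancel, and the parallel ones are symmetric. This is the coefficient of
  \<open>\<lambda>\<^sup>0\<mu>\<^sup>s\<close>, where \<open>\<lambda>\<close> belongs to \<open>g\<close> and \<open>\<mu>\<close> to \<open>h\<close>.
\<close>

lemma pre_lie:
  assumes f: "f \<in> Inv a" and g: "g \<in> Inv b" "g \<in> hpart (X b) p"
    and h: "h \<in> Inv c" "h \<in> hpart (X c) q" and N: "N = a + b + c - 2"
  shows "boxR a b c (bul a b f g 0) h s \<ominus>\<^bsub>X N\<^esub>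
      (\<Oplus>\<^bsub>X N\<^esub>t\<in>{..s}. boxL a b c f (bul b c g h t) (s - t)) =
    sgn_of F p q \<odot>\<^bsub>X N\<^esub> (boxR a c b (bul a c f h s) g 0 \<ominus>\<^bsub>X N\<^esub> boxL a c b f (bul c b h g 0) s)"
proof (cases a)
  case 0
  have car: "g \<in> carrier (X b)" "h \<in> carrier (X c)"
    using g h by (auto simp: Inv_closed)
  have z: "boxR 0 b c \<zero>\<^bsub>X (b - 1)\<^esub> h s = \<zero>\<^bsub>X N\<^esub>" "boxR 0 c b \<zero>\<^bsub>X (c - 1)\<^esub> g 0 = \<zero>\<^bsub>X N\<^esub>"
    using linear_map.zero[OF boxR_linear[OF car(2), of N 0 b s]]
      linear_map.zero[OF boxR_linear[OF car(1), of N 0 c 0]] by (simp_all add: N 0 add.commute[of c b])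
  have z': "boxL 0 b c f w k = \<zero>\<^bsub>X N\<^esub>" "boxL 0 c b f w k = \<zero>\<^bsub>X N\<^esub>" for w k
    by (auto simp: boxL_def bul_0 N 0 add.commute[of c b] numeral_2_eq_2)
  have "\<zero>\<^bsub>X N\<^esub> \<ominus>\<^bsub>X N\<^esub> \<zero>\<^bsub>X N\<^esub> = \<zero>\<^bsub>X N\<^esub>" by (simp add: X.minus_eq_zero_iff)
  then show ?thesis unfolding 0 bul_0 z z' by simp
next
  case n: (Suc n)
  have NN: "N = b + c + n - 1" "N = c + b + n - 1" using N n by auto
  let ?k = "fact n * fact b * fact c :: nat"
  have car: "f \<in> carrier (X (Suc n))" "g \<in> carrier (X b)" "h \<in> carrier (X c)"
    using f g h by (auto simp: Inv_closed n)
  note fI = f[unfolded n]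
  have comp: "ocirc P (Suc n) (c + b - 1) 1 f (ocirc P b c j g h t) w \<in> carrier (X N)" if "j \<in> {1..b}" for j t w
    using car that by (intro circ_closed) (auto simp: NN)
  have comp': "ocirc P (Suc n) (b + c - 1) 1 f (ocirc P c b j h g t) w \<in> carrier (X N)" if "j \<in> {1..c}" for j t w
    using car that by (intro circ_closed) (auto simp: NN)
  define A where "A = bul (b + n) c (bul (Suc n) b f g 0) h s"
  define B where "B = (\<Oplus>\<^bsub>X N\<^esub>t\<in>{..s}. boxL (Suc n) b c f (bul b c g h t) (s - t))"
  define A' where "A' = bul (c + n) b (bul (Suc n) c f h s) g 0"
  define B' where "B' = boxL (Suc n) c b f (bul c b h g 0) s"
  define O1 where "O1 = outer n b c f g 0 h s"
  define O2 where "O2 = outer n c b f h s g 0"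
  have cl: "A \<in> carrier (X N)" "B \<in> carrier (X N)" "A' \<in> carrier (X N)" "B' \<in> carrier (X N)"
    unfolding A_def B_def A'_def B'_def using car
    by (auto intro!: bul_closed boxL_closed X.finsum_closed simp: NN)
  have O_cl: "O1 \<in> carrier (X N)" "O2 \<in> carrier (X N)"
    unfolding O1_def O2_def outer_def NN(1)[symmetric] NN(2)[symmetric] using car
    by (auto intro!: X.finsum_closed Sym_closed circ_closed simp: NN)
  have 1: "[?k] \<cdot>\<^bsub>X N\<^esub> A = [?k] \<cdot>\<^bsub>X N\<^esub> B \<oplus>\<^bsub>X N\<^esub> O1"
    unfolding A_def B_def O1_def
  proof (rule associator[OF fI g(1) h(1) NN(1)])
    fix j assume j: "j \<in> {1..b}"
    have "ocirc P (b + Suc n - 1) c j (ocirc P (Suc n) b 1 f g 0) h s = (\<Oplus>\<^bsub>X (c + b + Suc n - 2)\<^esub>t\<in>{..s}.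
        [int ((0 + s - t) choose 0)] \<cdot>\<^bsub>X (c + b + Suc n - 2)\<^esub>
          ocirc P (Suc n) (c + b - 1) 1 f (ocirc P b c (j - 1 + 1) g h t) (0 + s - t))"
      using car j by (intro assoc_nested) auto
    moreover have "c + b + Suc n - 2 = N" "b + Suc n - 1 = b + n" "j - 1 + 1 = j" using j by (auto simp: NN)
    ultimately have "ocirc P (b + n) c j (ocirc P (Suc n) b 1 f g 0) h s = (\<Oplus>\<^bsub>X N\<^esub>t\<in>{..s}.
        [(1::int)] \<cdot>\<^bsub>X N\<^esub> ocirc P (Suc n) (c + b - 1) 1 f (ocirc P b c j g h t) (s - t))"
      by simp
    also have "\<dots> = (\<Oplus>\<^bsub>X N\<^esub>t\<in>{..s}. ocirc P (Suc n) (c + b - 1) 1 f (ocirc P b c j g h t) (s - t))"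
      using comp[OF j] by (intro X.finsum_cong') auto
    finally show "ocirc P (b + n) c j (ocirc P (Suc n) b 1 f g 0) h s =
        (\<Oplus>\<^bsub>X N\<^esub>t\<in>{..s}. ocirc P (Suc n) (c + b - 1) 1 f (ocirc P b c j g h t) (s - t))" .
  qed simp
  have 2: "[?k] \<cdot>\<^bsub>X N\<^esub> A' = [?k] \<cdot>\<^bsub>X N\<^esub> B' \<oplus>\<^bsub>X N\<^esub> O2"
  proof -
    have "ocirc P (c + n) b j (ocirc P (Suc n) c 1 f h s) g 0 =
        (\<Oplus>\<^bsub>X N\<^esub>t\<in>{0::nat}. ocirc P (Suc n) (b + c - 1) 1 f (ocirc P c b j h g 0) s)"
      if j: "j \<in> {1..c}" for j
    proof -
      have "ocirc P (c + Suc n - 1) b j (ocirc P (Suc n) c 1 f h s) g 0 = (\<Oplus>\<^bsub>X (b + c + Suc n - 2)\<^esub>t\<in>{..0}.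
          [int ((s + 0 - t) choose s)] \<cdot>\<^bsub>X (b + c + Suc n - 2)\<^esub>
            ocirc P (Suc n) (b + c - 1) 1 f (ocirc P c b (j - 1 + 1) h g t) (s + 0 - t))"
        using car j by (intro assoc_nested) auto
      moreover have "b + c + Suc n - 2 = N" "c + Suc n - 1 = c + n" "j - 1 + 1 = j" using j by (auto simp: NN)
      ultimately show ?thesis using comp'[OF j] by simp
    qed
    from associator[OF fI h(1) g(1) NN(2), where r = s and s = 0 and A = "{0::nat}" and v = "\<lambda>_. 0"
        and u = "\<lambda>_. s", OF this]
    show ?thesis unfolding A'_def B'_def O2_def
      using cl(4) by (simp add: B'_def ac_simps)
  qed
  have 3: "O1 = sgn_of F p q \<odot>\<^bsub>X N\<^esub> O2"
    unfolding O1_def O2_def by (rule outer_symmetric[OF fI g h NN(1)])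
  have "A \<ominus>\<^bsub>X N\<^esub> B = sgn_of F p q \<odot>\<^bsub>X N\<^esub> (A' \<ominus>\<^bsub>X N\<^esub> B')"
  proof (rule nat_cancel)
    show "0 < ?k" by simp
    have diff: "x \<ominus>\<^bsub>X N\<^esub> y = z" if "x = y \<oplus>\<^bsub>X N\<^esub> z" "y \<in> carrier (X N)" "z \<in> carrier (X N)" for x y z
      using that by (simp add: X.a_comm[of y N z] X.a_assoc X.r_neg X.minus_eq)
    have mult: "[?k] \<cdot>\<^bsub>X N\<^esub> (x \<ominus>\<^bsub>X N\<^esub> y) = [?k] \<cdot>\<^bsub>X N\<^esub> x \<ominus>\<^bsub>X N\<^esub> [?k] \<cdot>\<^bsub>X N\<^esub> y"
      if "x \<in> carrier (X N)" "y \<in> carrier (X N)" for x y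
      using that by (simp add: X.minus_eq X.nat_scalar X.smult_r_distr X.smult_r_minus)
    have "[?k] \<cdot>\<^bsub>X N\<^esub> (A \<ominus>\<^bsub>X N\<^esub> B) = O1"
      unfolding mult[OF cl(1,2)] using cl O_cl by (intro diff 1) auto
    moreover have "[?k] \<cdot>\<^bsub>X N\<^esub> (A' \<ominus>\<^bsub>X N\<^esub> B') = O2"
      unfolding mult[OF cl(3,4)] using cl O_cl by (intro diff 2) auto
    ultimately show "[?k] \<cdot>\<^bsub>X N\<^esub> (A \<ominus>\<^bsub>X N\<^esub> B) =
        [?k] \<cdot>\<^bsub>X N\<^esub> (sgn_of F p q \<odot>\<^bsub>X N\<^esub> (A' \<ominus>\<^bsub>X N\<^esub> B'))"
      using cl 3 by (simp add: X.nat_scalar X.smult_commute[of _ "sgn_of F p q"])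
  qed (use cl in auto)
  then show ?thesis
    by (simp add: A_def B_def A'_def B'_def boxR_def n add.commute)
qed

section \<open>The substitution of minus the derivation\<close>

lemma proj_linear: "linear_map F (X n) (osys P q n) (oproj P q n)"
  using proj_hom[of n q] by (intro linear_mapI X.superspace_axioms S.superspace_axioms) (simp add: dS_hom_def)

lemma proj_closed [simp]: "x \<in> carrier (X n) \<Longrightarrow> oproj P q n x \<in> carrier (osys P q n)"
  by (rule linear_map.closed[OF proj_linear])

lemma proj_der: "x \<in> carrier (X n) \<Longrightarrow> oproj P q n (oder P n x) = osysder P q n (oproj P q n x)"
  using proj_hom[of n q] by (simp add: dS_hom_def)

lemma proj_act: "x \<in> carrier (X n) \<Longrightarrow> \<sigma> permutes {1..n} \<Longrightarrow>
    oproj P q n (oact P n x \<sigma>) = osysact P q n (oproj P q n x) \<sigma>"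
  using proj_hom[of n q] by (simp add: dS_hom_def)

lemma proj_eqI:
  assumes "x \<in> carrier (X n)" "y \<in> carrier (X n)" "\<And>q. oproj P q n x = oproj P q n y"
  shows "x = y"
  using proj_limit[of "\<lambda>q. oproj P q n x" n] assms by (auto simp: proj_trans)

lemma proj_hpartI:
  assumes x: "x \<in> carrier (X n)" and "\<And>q. oproj P q n x \<in> hpart (osys P q n) p"
  shows "x \<in> hpart (X n) p"
proof -
  have "x = hcomp (X n) p x"
  proof (rule proj_eqI[OF x X.hcomp_closed[OF x]])
    fix q
    have "oproj P q n \<in> even_maps F (X n) (osys P q n)" using proj_hom[of n q] by (simp add: dS_hom_def)
    from hcomp_even_map[OF X.superspace_axioms S.superspace_axioms this x]
    show "oproj P q n x = oproj P q n (hcomp (X n) p x)"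
      using S.hcomp_homogeneous[OF assms(2)] by metis
  qed
  then show ?thesis using X.hcomp_hpart[OF x] by metis
qed

lemma trans_linear: "linear_map F (osys P (Suc q) n) (osys P q n) (otrans P q n)"
  using trans_hom[of n q] by (intro linear_mapI S.superspace_axioms) (simp add: dS_hom_def)

lemma der_pow_linear: "linear_map F (osys P q n) (osys P q n) (osysder P q n ^^ k)"
proof (induction k)
  case 0
  show ?case by (auto simp: linear_map_def linear_map_axioms_def linear_maps_def S.module_axioms)
next
  case (Suc k)
  from linear_map_comp[OF this S.d.linear_map_axioms] show ?case by (simp add: comp_def)
qed

lemma der_pow_closed [simp]: "y \<in> carrier (osys P q n) \<Longrightarrow> (osysder P q n ^^ k) y \<in> carrier (osys P q n)"
  by (rule linear_map.closed[OF der_pow_linear])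

lemma trans_der_pow:
  assumes "y \<in> carrier (osys P (Suc q) n)"
  shows "otrans P q n ((osysder P (Suc q) n ^^ k) y) = (osysder P q n ^^ k) (otrans P q n y)"
proof (induction k)
  case (Suc k)
  have "(osysder P (Suc q) n ^^ k) y \<in> carrier (osys P (Suc q) n)" using assms by simp
  with Suc show ?case using trans_hom[of n q] by (simp add: dS_hom_def)
qed simp

text \<open>
  These are the sequences of coefficients of the power series whose images over all \<open>P\<^sub>q(N)\<close> are
  polynomials.
\<close>

definition pro_null :: "nat \<Rightarrow> (nat \<Rightarrow> 'v) \<Rightarrow> bool" where
  "pro_null N c \<longleftrightarrow> (\<forall>k. c k \<in> carrier (X N)) \<and>
     (\<forall>q. \<exists>K. \<forall>k>K. oproj P q N (c k) = \<zero>\<^bsub>osys P q N\<^esub>)"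

lemma pro_null_closed: "pro_null N c \<Longrightarrow> c k \<in> carrier (X N)"
  by (simp add: pro_null_def)

lemma pro_null_bound:
  assumes "pro_null N c"
  obtains K where "\<forall>k>K. oproj P q N (c k) = \<zero>\<^bsub>osys P q N\<^esub>"
  using assms unfolding pro_null_def by blast

lemma pro_null_circ:
  assumes "1 \<le> i" "i \<le> n" "f \<in> carrier (X n)" "g \<in> carrier (X m)" "N = m + n - 1"
  shows "pro_null N (ocirc P n m i f g)"
  unfolding pro_null_def
proof (intro conjI allI)
  fix q
  have fin: "finite {k. oproj P q N (ocirc P n m i f g k) \<noteq> \<zero>\<^bsub>osys P q N\<^esub>}"
    using proj_circ_polynomial[OF assms(1-4), of q] assms(5) by simp
  then obtain K where "\<And>k. k \<in> {k. oproj P q N (ocirc P n m i f g k) \<noteq> \<zero>\<^bsub>osys P q N\<^esub>} \<Longrightarrow> k \<le> K"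
    using finite_nat_set_iff_bounded_le by auto
  then show "\<exists>K. \<forall>k>K. oproj P q N (ocirc P n m i f g k) = \<zero>\<^bsub>osys P q N\<^esub>"
    by (intro exI[of _ K]) (metis (mono_tags, lifting) mem_Collect_eq not_le)
qed (use assms in \<open>auto intro: circ_closed\<close>)

lemma pro_null_shift:
  assumes "pro_null N c"
  shows "pro_null N (\<lambda>k. c (k + j))"
  unfolding pro_null_def
proof (intro conjI allI)
  fix q
  obtain K where "\<forall>k>K. oproj P q N (c k) = \<zero>\<^bsub>osys P q N\<^esub>" by (rule pro_null_bound[OF assms, where q = q])
  then show "\<exists>K. \<forall>k>K. oproj P q N (c (k + j)) = \<zero>\<^bsub>osys P q N\<^esub>" by (intro exI[of _ K]) auto
qed (use assms in \<open>simp add: pro_null_def\<close>)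

text \<open>
  The linear maps used below act on the projective systems, too, and commute with the derivations.
\<close>

definition level_map :: "nat \<Rightarrow> nat \<Rightarrow> ('v \<Rightarrow> 'v) \<Rightarrow> bool" where
  "level_map M N h \<longleftrightarrow> linear_map F (X M) (X N) h \<and> (\<exists>h'. \<forall>q. linear_map F (osys P q M) (osys P q N) (h' q) \<and>
     (\<forall>x\<in>carrier (X M). oproj P q N (h x) = h' q (oproj P q M x)) \<and>
     (\<forall>y\<in>carrier (osys P q M). h' q (osysder P q M y) = osysder P q N (h' q y)))"

lemma level_map_act:
  assumes \<sigma>: "\<sigma> permutes {1..n}"
  shows "level_map n n (\<lambda>x. oact P n x \<sigma>)"
  unfolding level_map_def
proof (intro conjI act_linear \<sigma> exI allI ballI)
  fix q
  show "linear_map F (osys P q n) (osys P q n) (\<lambda>x. osysact P q n x \<sigma>)"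
    using sys_dS_module[of n q] \<sigma> by (intro linear_mapI S.superspace_axioms) (simp add: dS_module_def)
  show "osysact P q n (osysder P q n y) \<sigma> = osysder P q n (osysact P q n y \<sigma>)"
    if "y \<in> carrier (osys P q n)" for y
    using sys_dS_module[of n q] \<sigma> that by (simp add: dS_module_def)
qed (use \<sigma> proj_act in simp)

lemma level_map_der: "level_map n n (oder P n)"
  unfolding level_map_def
  by (intro conjI exI[of _ "\<lambda>q. osysder P q n"] allI ballI X.d.linear_map_axioms S.d.linear_map_axioms)
    (simp_all add: proj_der)

lemma level_map_smult:
  assumes a: "a \<in> carrier F"
  shows "level_map n n (\<lambda>x. a \<odot>\<^bsub>X n\<^esub> x)"
  unfolding level_map_def
proof (intro conjI exI allI ballI)
  show "linear_map F (X n) (X n) (\<lambda>x. a \<odot>\<^bsub>X n\<^esub> x)"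
    using a by (auto simp: linear_map_def linear_map_axioms_def linear_maps_def X.module_axioms
        X.smult_r_distr X.smult_commute)
  fix q
  show "linear_map F (osys P q n) (osys P q n) (\<lambda>x. a \<odot>\<^bsub>osys P q n\<^esub> x)"
    using a by (auto simp: linear_map_def linear_map_axioms_def linear_maps_def S.module_axioms
        S.smult_r_distr S.smult_commute)
qed (use a in \<open>simp_all add: linear_map.scale[OF proj_linear] S.d.scale\<close>)

lemma level_map_der_pow:
  assumes "\<And>q. linear_map F (osys P q M) (osys P q N) (h q)"
    and "\<And>y q. y \<in> carrier (osys P q M) \<Longrightarrow> h q (osysder P q M y) = osysder P q N (h q y)"
    and "y \<in> carrier (osys P q M)"
  shows "h q ((osysder P q M ^^ k) y) = (osysder P q N ^^ k) (h q y)"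
  by (induction k) (use assms in simp_all)

lemma pro_null_map:
  assumes "level_map M N h" "pro_null M c"
  shows "pro_null N (\<lambda>k. h (c k))"
proof -
  obtain h' where h: "linear_map F (X M) (X N) h" and h': "\<And>q. linear_map F (osys P q M) (osys P q N) (h' q)"
    "\<And>q x. x \<in> carrier (X M) \<Longrightarrow> oproj P q N (h x) = h' q (oproj P q M x)"
    using assms(1) unfolding level_map_def by blast
  show ?thesis
    unfolding pro_null_def
  proof (intro conjI allI)
    show "h (c k) \<in> carrier (X N)" for k
      by (rule linear_map.closed[OF h pro_null_closed[OF assms(2)]])
    fix q
    obtain K where "\<forall>k>K. oproj P q M (c k) = \<zero>\<^bsub>osys P q M\<^esub>" by (rule pro_null_bound[OF assms(2), where q = q])
    then show "\<exists>K. \<forall>k>K. oproj P q N (h (c k)) = \<zero>\<^bsub>osys P q N\<^esub>"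
      using pro_null_closed[OF assms(2)] by (intro exI[of _ K]) (simp add: h'(2) linear_map.zero[OF h'(1)])
  qed
qed

lemma pro_null_finsum:
  assumes "finite A" "\<And>i. i \<in> A \<Longrightarrow> pro_null N (c i)"
  shows "pro_null N (\<lambda>k. \<Oplus>\<^bsub>X N\<^esub>i\<in>A. c i k)"
  unfolding pro_null_def
proof (intro conjI allI)
  show "(\<Oplus>\<^bsub>X N\<^esub>i\<in>A. c i k) \<in> carrier (X N)" for k
    using assms(2) by (intro X.finsum_closed) (auto simp: pro_null_closed)
  fix q
  have "\<exists>K. \<forall>k>K. oproj P q N (c i k) = \<zero>\<^bsub>osys P q N\<^esub>" if "i \<in> A" for i
    using assms(2)[OF that] unfolding pro_null_def by blast
  then obtain K where K: "\<And>i k. i \<in> A \<Longrightarrow> K i < k \<Longrightarrow> oproj P q N (c i k) = \<zero>\<^bsub>osys P q N\<^esub>" by metis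
  have "oproj P q N (\<Oplus>\<^bsub>X N\<^esub>i\<in>A. c i k) = \<zero>\<^bsub>osys P q N\<^esub>" if "(\<Sum>i\<in>A. K i) < k" for k
  proof -
    have "oproj P q N (\<Oplus>\<^bsub>X N\<^esub>i\<in>A. c i k) = (\<Oplus>\<^bsub>osys P q N\<^esub>i\<in>A. oproj P q N (c i k))"
      using assms(2) by (intro linear_map.finsum[OF proj_linear]) (auto simp: pro_null_closed)
    also have "\<dots> = \<zero>\<^bsub>osys P q N\<^esub>"
    proof (rule S.add.finprod_one_eqI)
      fix i assume i: "i \<in> A"
      have "K i \<le> (\<Sum>i\<in>A. K i)" using assms(1) i by (intro member_le_sum) auto
      with that K[OF i] show "oproj P q N (c i k) = \<zero>\<^bsub>osys P q N\<^esub>" by simp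
    qed
    finally show ?thesis .
  qed
  then show "\<exists>K. \<forall>k>K. oproj P q N (\<Oplus>\<^bsub>X N\<^esub>i\<in>A. c i k) = \<zero>\<^bsub>osys P q N\<^esub>" by blast
qed

text \<open>Over \<open>P\<^sub>q(N)\<close>, both substitutions are sums of terms of this form.\<close>

abbreviation tm :: "nat \<Rightarrow> nat \<Rightarrow> (nat \<Rightarrow> int) \<Rightarrow> (nat \<Rightarrow> nat) \<Rightarrow> (nat \<Rightarrow> 'v) \<Rightarrow> nat \<Rightarrow> 'w" where
  "tm q N w e c k \<equiv> [w k] \<cdot>\<^bsub>osys P q N\<^esub> (osysder P q N ^^ e k) (oproj P q N (c k))"

lemma tm_closed: "pro_null N c \<Longrightarrow> tm q N w e c k \<in> carrier (osys P q N)"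
  by (simp add: pro_null_closed)

lemma tm_zero: "oproj P q N (c k) = \<zero>\<^bsub>osys P q N\<^esub> \<or> w k = 0 \<Longrightarrow> pro_null N c \<Longrightarrow> tm q N w e c k = \<zero>\<^bsub>osys P q N\<^esub>"
  using linear_map.zero[OF der_pow_linear] by (auto simp: S.int_scalar pro_null_closed)

lemma finsum_tm_eq:
  assumes c: "pro_null N c" and "finite A" "finite B"
    and "\<And>k. k \<notin> A \<Longrightarrow> oproj P q N (c k) = \<zero>\<^bsub>osys P q N\<^esub> \<or> w k = 0"
    and "\<And>k. k \<notin> B \<Longrightarrow> oproj P q N (c k) = \<zero>\<^bsub>osys P q N\<^esub> \<or> w k = 0"
  shows "finsum (osys P q N) (tm q N w e c) A = finsum (osys P q N) (tm q N w e c) B"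
proof (rule S.add.finprod_mono_neutral_cong)
  show "tm q N w e c k = \<zero>\<^bsub>osys P q N\<^esub>" if "k \<in> B - A" for k
    using that assms(4)[of k] by (intro tm_zero c) auto
  show "tm q N w e c k = \<zero>\<^bsub>osys P q N\<^esub>" if "k \<in> A - B" for k
    using that assms(5)[of k] by (intro tm_zero c) auto
qed (use assms tm_closed[OF c] in auto)

text \<open>
  The transition maps carry the finite sums at the different levels into each other. Their index sets
  may differ by terms that vanish at the lower level.
\<close>

lemma series_limit:
  assumes c: "pro_null N c"
  shows "\<exists>!x. x \<in> carrier (X N) \<and> (\<forall>q. oproj P q N x =
    finsum (osys P q N) (tm q N w e c) {k. w k \<noteq> 0 \<and> oproj P q N (c k) \<noteq> \<zero>\<^bsub>osys P q N\<^esub>})"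
proof (rule proj_limit)
  let ?A = "\<lambda>q. {k. w k \<noteq> 0 \<and> oproj P q N (c k) \<noteq> \<zero>\<^bsub>osys P q N\<^esub>}"
  have fin: "finite (?A q)" for q
  proof -
    obtain K where "\<forall>k>K. oproj P q N (c k) = \<zero>\<^bsub>osys P q N\<^esub>" by (rule pro_null_bound[OF c, where q = q])
    then have "?A q \<subseteq> {..K}" by (auto simp: not_less[symmetric])
    then show ?thesis by (rule finite_subset) simp
  qed
  fix q
  show "finsum (osys P q N) (tm q N w e c) (?A q) \<in> carrier (osys P q N)"
    using tm_closed[OF c] by (intro S.finsum_closed) auto
  have pc: "oproj P (Suc q) N (c k) \<in> carrier (osys P (Suc q) N)" for k
    using c by (simp add: pro_null_closed)
  have "otrans P q N (finsum (osys P (Suc q) N) (tm (Suc q) N w e c) (?A (Suc q))) =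
      (\<Oplus>\<^bsub>osys P q N\<^esub>k\<in>?A (Suc q). otrans P q N (tm (Suc q) N w e c k))"
    using tm_closed[OF c] by (intro linear_map.finsum[OF trans_linear]) auto
  also have "\<dots> = finsum (osys P q N) (tm q N w e c) (?A (Suc q))"
  proof (rule S.finsum_cong'[OF refl])
    show "otrans P q N (tm (Suc q) N w e c k) = tm q N w e c k" for k
      using pc[of k] pro_null_closed[OF c, of k]
      by (simp add: linear_map.int_mult[OF trans_linear] trans_der_pow proj_trans)
  qed (use tm_closed[OF c] in auto)
  also have "\<dots> = finsum (osys P q N) (tm q N w e c) (?A q)"
  proof (rule finsum_tm_eq[OF c fin fin])
    show "oproj P q N (c k) = \<zero>\<^bsub>osys P q N\<^esub> \<or> w k = 0" if "k \<notin> ?A (Suc q)" for k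
      using that proj_trans[OF pro_null_closed[OF c], of q k] linear_map.zero[OF trans_linear[of q N]]
      by auto
  qed auto
  finally show "otrans P q N (finsum (osys P (Suc q) N) (tm (Suc q) N w e c) (?A (Suc q))) =
      finsum (osys P q N) (tm q N w e c) (?A q)" .
qed

lemma subst_neg_closed: "pro_null N c \<Longrightarrow> subst_neg P N c j \<in> carrier (X N)"
  and proj_subst_neg: "pro_null N c \<Longrightarrow> \<forall>k>K. oproj P q N (c k) = \<zero>\<^bsub>osys P q N\<^esub> \<Longrightarrow>
    oproj P q N (subst_neg P N c j) =
      finsum (osys P q N) (tm q N (\<lambda>k. (-1) ^ k * int (k choose j)) (\<lambda>k. k - j) c) {..K}"
proof -
  assume c: "pro_null N c"
  let ?w = "\<lambda>k. (-1) ^ k * int (k choose j)"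
  have "{k. j \<le> k \<and> oproj P q N (c k) \<noteq> \<zero>\<^bsub>osys P q N\<^esub>} =
      {k. ?w k \<noteq> 0 \<and> oproj P q N (c k) \<noteq> \<zero>\<^bsub>osys P q N\<^esub>}" for q
    by (auto simp: binomial_eq_0_iff not_less)
  then have *: "subst_neg P N c j \<in> carrier (X N) \<and> (\<forall>q. oproj P q N (subst_neg P N c j) =
      finsum (osys P q N) (tm q N ?w (\<lambda>k. k - j) c) {k. ?w k \<noteq> 0 \<and> oproj P q N (c k) \<noteq> \<zero>\<^bsub>osys P q N\<^esub>})"
    unfolding subst_neg_def using theI'[OF series_limit[OF c, of ?w "\<lambda>k. k - j"]] by simp
  then show "subst_neg P N c j \<in> carrier (X N)" by simp
  assume K: "\<forall>k>K. oproj P q N (c k) = \<zero>\<^bsub>osys P q N\<^esub>"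
  then have sub: "{k. ?w k \<noteq> 0 \<and> oproj P q N (c k) \<noteq> \<zero>\<^bsub>osys P q N\<^esub>} \<subseteq> {..K}"
    by (auto simp: not_less[symmetric])
  have "finsum (osys P q N) (tm q N ?w (\<lambda>k. k - j) c) {k. ?w k \<noteq> 0 \<and> oproj P q N (c k) \<noteq> \<zero>\<^bsub>osys P q N\<^esub>} =
      finsum (osys P q N) (tm q N ?w (\<lambda>k. k - j) c) {..K}"
    by (rule finsum_tm_eq[OF c finite_subset[OF sub]]) (use K in \<open>auto simp: not_le\<close>)
  with * show "oproj P q N (subst_neg P N c j) = finsum (osys P q N) (tm q N ?w (\<lambda>k. k - j) c) {..K}"
    by simp
qed

abbreviation E :: "nat \<Rightarrow> (nat \<Rightarrow> 'v) \<Rightarrow> 'v" where "E \<equiv> eval_neg_der P"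

lemma E_closed: "pro_null N c \<Longrightarrow> E N c \<in> carrier (X N)"
  and proj_E: "pro_null N c \<Longrightarrow> \<forall>k>K. oproj P q N (c k) = \<zero>\<^bsub>osys P q N\<^esub> \<Longrightarrow>
    oproj P q N (E N c) = finsum (osys P q N) (tm q N (\<lambda>k. (-1) ^ k) (\<lambda>k. k) c) {..K}"
proof -
  assume c: "pro_null N c"
  let ?w = "\<lambda>k. (-1::int) ^ k"
  have *: "E N c \<in> carrier (X N) \<and> (\<forall>q. oproj P q N (E N c) =
      finsum (osys P q N) (tm q N ?w (\<lambda>k. k) c) {k. ?w k \<noteq> 0 \<and> oproj P q N (c k) \<noteq> \<zero>\<^bsub>osys P q N\<^esub>})"
    unfolding eval_neg_der_def using theI'[OF series_limit[OF c, of ?w "\<lambda>k. k"]] by simp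
  then show "E N c \<in> carrier (X N)" by simp
  assume K: "\<forall>k>K. oproj P q N (c k) = \<zero>\<^bsub>osys P q N\<^esub>"
  then have sub: "{k. ?w k \<noteq> 0 \<and> oproj P q N (c k) \<noteq> \<zero>\<^bsub>osys P q N\<^esub>} \<subseteq> {..K}"
    by (auto simp: not_less[symmetric])
  have "finsum (osys P q N) (tm q N ?w (\<lambda>k. k) c) {k. ?w k \<noteq> 0 \<and> oproj P q N (c k) \<noteq> \<zero>\<^bsub>osys P q N\<^esub>} =
      finsum (osys P q N) (tm q N ?w (\<lambda>k. k) c) {..K}"
    by (rule finsum_tm_eq[OF c finite_subset[OF sub]]) (use K in \<open>auto simp: not_le\<close>)
  with * show "oproj P q N (E N c) = finsum (osys P q N) (tm q N ?w (\<lambda>k. k) c) {..K}"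
    by simp
qed

lemma subst_neg_0: "pro_null N c \<Longrightarrow> subst_neg P N c 0 = E N c"
proof (rule proj_eqI)
  assume c: "pro_null N c"
  show "subst_neg P N c 0 \<in> carrier (X N)" "E N c \<in> carrier (X N)"
    by (rule subst_neg_closed[OF c], rule E_closed[OF c])
  fix q
  obtain K where "\<forall>k>K. oproj P q N (c k) = \<zero>\<^bsub>osys P q N\<^esub>" by (rule pro_null_bound[OF c, where q = q])
  from proj_subst_neg[OF c this] proj_E[OF c this]
  show "oproj P q N (subst_neg P N c 0) = oproj P q N (E N c)" by simp
qed

lemma E_map:
  assumes h: "level_map M N h" and c: "pro_null M c"
  shows "E N (\<lambda>k. h (c k)) = h (E M c)"
proof -
  obtain h' where hl: "linear_map F (X M) (X N) h" and h': "\<And>q. linear_map F (osys P q M) (osys P q N) (h' q)"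
    "\<And>q x. x \<in> carrier (X M) \<Longrightarrow> oproj P q N (h x) = h' q (oproj P q M x)"
    "\<And>y q. y \<in> carrier (osys P q M) \<Longrightarrow> h' q (osysder P q M y) = osysder P q N (h' q y)"
    using h unfolding level_map_def by blast
  note hc = pro_null_map[OF h c]
  show ?thesis
  proof (rule proj_eqI[OF E_closed[OF hc] linear_map.closed[OF hl E_closed[OF c]]])
    fix q
    obtain K where K: "\<forall>k>K. oproj P q M (c k) = \<zero>\<^bsub>osys P q M\<^esub>" by (rule pro_null_bound[OF c, where q = q])
    then have K': "\<forall>k>K. oproj P q N (h (c k)) = \<zero>\<^bsub>osys P q N\<^esub>"
      using pro_null_closed[OF c] by (simp add: h'(2) linear_map.zero[OF h'(1)])
    have "oproj P q N (h (E M c)) = h' q (finsum (osys P q M) (tm q M (\<lambda>k. (-1) ^ k) (\<lambda>k. k) c) {..K})"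
      using E_closed[OF c] by (simp add: h'(2) proj_E[OF c K])
    also have "\<dots> = (\<Oplus>\<^bsub>osys P q N\<^esub>k\<in>{..K}. h' q (tm q M (\<lambda>k. (-1) ^ k) (\<lambda>k. k) c k))"
      using tm_closed[OF c] by (intro linear_map.finsum[OF h'(1)]) auto
    also have "\<dots> = finsum (osys P q N) (tm q N (\<lambda>k. (-1) ^ k) (\<lambda>k. k) (\<lambda>k. h (c k))) {..K}"
    proof (rule S.finsum_cong'[OF refl])
      show "h' q (tm q M (\<lambda>k. (-1) ^ k) (\<lambda>k. k) c k) = tm q N (\<lambda>k. (-1) ^ k) (\<lambda>k. k) (\<lambda>k. h (c k)) k" for k
        using pro_null_closed[OF c, of k]
        by (simp add: linear_map.int_mult[OF h'(1)] level_map_der_pow[of M N h', OF h'(1,3)] h'(2))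
    qed (use tm_closed[OF hc] in auto)
    finally show "oproj P q N (E N (\<lambda>k. h (c k))) = oproj P q N (h (E M c))"
      by (simp add: proj_E[OF hc K'])
  qed
qed

lemma E_add:
  assumes c: "pro_null N c" and d: "pro_null N d"
  shows "pro_null N (\<lambda>k. c k \<oplus>\<^bsub>X N\<^esub> d k)" "E N (\<lambda>k. c k \<oplus>\<^bsub>X N\<^esub> d k) = E N c \<oplus>\<^bsub>X N\<^esub> E N d"
proof -
  have cd: "c k \<in> carrier (X N)" "d k \<in> carrier (X N)" for k using c d by (auto simp: pro_null_closed)
  have bound: "\<exists>K. (\<forall>k>K. oproj P q N (c k) = \<zero>\<^bsub>osys P q N\<^esub>) \<and> (\<forall>k>K. oproj P q N (d k) = \<zero>\<^bsub>osys P q N\<^esub>) \<and>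
      (\<forall>k>K. oproj P q N (c k \<oplus>\<^bsub>X N\<^esub> d k) = \<zero>\<^bsub>osys P q N\<^esub>)" for q
  proof -
    obtain K where "\<forall>k>K. oproj P q N (c k) = \<zero>\<^bsub>osys P q N\<^esub>" by (rule pro_null_bound[OF c, where q = q])
    moreover obtain K' where "\<forall>k>K'. oproj P q N (d k) = \<zero>\<^bsub>osys P q N\<^esub>" by (rule pro_null_bound[OF d, where q = q])
    ultimately show ?thesis
      using cd by (intro exI[of _ "max K K'"]) (simp add: linear_map.add[OF proj_linear])
  qed
  then show cd_null: "pro_null N (\<lambda>k. c k \<oplus>\<^bsub>X N\<^esub> d k)"
    using cd unfolding pro_null_def by (meson X.a_closed)
  show "E N (\<lambda>k. c k \<oplus>\<^bsub>X N\<^esub> d k) = E N c \<oplus>\<^bsub>X N\<^esub> E N d"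
  proof (rule proj_eqI)
    fix q
    from bound[of q] obtain K where K: "\<forall>k>K. oproj P q N (c k) = \<zero>\<^bsub>osys P q N\<^esub>"
      "\<forall>k>K. oproj P q N (d k) = \<zero>\<^bsub>osys P q N\<^esub>"
      "\<forall>k>K. oproj P q N (c k \<oplus>\<^bsub>X N\<^esub> d k) = \<zero>\<^bsub>osys P q N\<^esub>" by blast
    have "oproj P q N (E N (\<lambda>k. c k \<oplus>\<^bsub>X N\<^esub> d k)) = (\<Oplus>\<^bsub>osys P q N\<^esub>k\<in>{..K}.
        tm q N (\<lambda>k. (-1) ^ k) (\<lambda>k. k) c k \<oplus>\<^bsub>osys P q N\<^esub> tm q N (\<lambda>k. (-1) ^ k) (\<lambda>k. k) d k)"
      unfolding proj_E[OF cd_null K(3)] using cd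
      by (intro S.finsum_cong') (auto simp: linear_map.add[OF proj_linear] linear_map.add[OF der_pow_linear]
          S.int_scalar S.smult_r_distr)
    also have "\<dots> = oproj P q N (E N c) \<oplus>\<^bsub>osys P q N\<^esub> oproj P q N (E N d)"
      unfolding proj_E[OF c K(1)] proj_E[OF d K(2)] using tm_closed[OF c] tm_closed[OF d]
      by (intro S.finsum_addf) auto
    finally show "oproj P q N (E N (\<lambda>k. c k \<oplus>\<^bsub>X N\<^esub> d k)) = oproj P q N (E N c \<oplus>\<^bsub>X N\<^esub> E N d)"
      using E_closed[OF c] E_closed[OF d] by (simp add: linear_map.add[OF proj_linear])
  qed (use E_closed[OF c] E_closed[OF d] E_closed[OF cd_null] in auto)
qed

lemma E_zero: "E N (\<lambda>_. \<zero>\<^bsub>X N\<^esub>) = \<zero>\<^bsub>X N\<^esub>" and pro_null_zero: "pro_null N (\<lambda>_. \<zero>\<^bsub>X N\<^esub>)"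
proof -
  show null: "pro_null N (\<lambda>_. \<zero>\<^bsub>X N\<^esub>)" using linear_map.zero[OF proj_linear] by (simp add: pro_null_def)
  have "E N (\<lambda>_. \<zero>\<^bsub>F\<^esub> \<odot>\<^bsub>X N\<^esub> \<zero>\<^bsub>X N\<^esub>) = \<zero>\<^bsub>F\<^esub> \<odot>\<^bsub>X N\<^esub> E N (\<lambda>_. \<zero>\<^bsub>X N\<^esub>)"
    by (rule E_map[OF level_map_smult null]) simp
  then show "E N (\<lambda>_. \<zero>\<^bsub>X N\<^esub>) = \<zero>\<^bsub>X N\<^esub>" using E_closed[OF null] by simp
qed

lemma E_finsum:
  assumes "finite A" "\<And>i. i \<in> A \<Longrightarrow> pro_null N (c i)"
  shows "E N (\<lambda>k. \<Oplus>\<^bsub>X N\<^esub>i\<in>A. c i k) = (\<Oplus>\<^bsub>X N\<^esub>i\<in>A. E N (c i))"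
  using assms
proof (induction A)
  case empty
  then show ?case by (simp add: E_zero)
next
  case (insert a A)
  then have cl: "(\<lambda>i. c i k) \<in> A \<rightarrow> carrier (X N)" "c a k \<in> carrier (X N)" for k by (auto simp: pro_null_closed)
  have "E N (\<lambda>k. \<Oplus>\<^bsub>X N\<^esub>i\<in>insert a A. c i k) = E N (\<lambda>k. c a k \<oplus>\<^bsub>X N\<^esub> (\<Oplus>\<^bsub>X N\<^esub>i\<in>A. c i k))"
    using insert.hyps cl by simp
  also have "\<dots> = E N (c a) \<oplus>\<^bsub>X N\<^esub> (\<Oplus>\<^bsub>X N\<^esub>i\<in>A. E N (c i))"
    using insert by (simp add: E_add(2) pro_null_finsum)
  also have "\<dots> = (\<Oplus>\<^bsub>X N\<^esub>i\<in>insert a A. E N (c i))"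
    using insert by (intro X.finsum_insert[symmetric]) (auto intro: E_closed)
  finally show ?case .
qed

lemma E_hpart:
  assumes c: "pro_null N c" and "\<And>k. c k \<in> hpart (X N) p"
  shows "E N c \<in> hpart (X N) p"
proof (rule proj_hpartI[OF E_closed[OF c]])
  fix q
  obtain K where K: "\<forall>k>K. oproj P q N (c k) = \<zero>\<^bsub>osys P q N\<^esub>" by (rule pro_null_bound[OF c, where q = q])
  have "oproj P q N (c k) \<in> hpart (osys P q N) p" for k
    using proj_hom[of N q] assms(2) by (auto simp: dS_hom_def even_maps_def)
  moreover have "(osysder P q N ^^ k) y \<in> hpart (osys P q N) p" if "y \<in> hpart (osys P q N) p" for k y
    using S.even that by (induction k) (auto simp: even_maps_def)
  ultimately have "tm q N (\<lambda>k. (-1) ^ k) (\<lambda>k. k) c k \<in> hpart (osys P q N) p" for k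
    using pro_null_closed[OF c] by (simp add: S.int_scalar)
  then show "oproj P q N (E N c) \<in> hpart (osys P q N) p"
    unfolding proj_E[OF c K] by (rule S.hpart_finsum)
qed

text \<open>
  The arguments about infinite sums below take finitely many steps of this recursion, and show that the
  remainder vanishes.
\<close>

lemma E_unfold:
  assumes c: "pro_null N c"
  shows "E N c = c 0 \<ominus>\<^bsub>X N\<^esub> oder P N (E N (\<lambda>k. c (Suc k)))"
proof (rule proj_eqI)
  have c': "pro_null N (\<lambda>k. c (Suc k))" using pro_null_shift[OF c, of 1] by simp
  note cl = E_closed[OF c] E_closed[OF c'] pro_null_closed[OF c]
  show "E N c \<in> carrier (X N)" "c 0 \<ominus>\<^bsub>X N\<^esub> oder P N (E N (\<lambda>k. c (Suc k))) \<in> carrier (X N)"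
    using cl by auto
  fix q
  let ?S = "osys P q N" and ?d = "osysder P q N"
  let ?t = "tm q N (\<lambda>k. (-1) ^ k) (\<lambda>k. k)"
  obtain K where K: "\<forall>k>K. oproj P q N (c k) = \<zero>\<^bsub>?S\<^esub>" by (rule pro_null_bound[OF c, where q = q])
  then have K': "\<forall>k>K. oproj P q N (c (Suc k)) = \<zero>\<^bsub>?S\<^esub>" by simp
  have step: "?t c (Suc k) = \<ominus>\<^bsub>?S\<^esub> ?d (?t (\<lambda>k. c (Suc k)) k)" for k
    using cl by (simp add: S.d.int_mult S.add.int_pow_neg)
  have tc: "?t (\<lambda>k. c (Suc k)) k \<in> carrier ?S" for k by (rule tm_closed[OF c'])
  have "oproj P q N (E N c) = finsum ?S (?t c) {..Suc K}"
    by (rule proj_E[OF c]) (use K in simp)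
  also have "\<dots> = (\<Oplus>\<^bsub>?S\<^esub>k\<in>{..K}. ?t c (Suc k)) \<oplus>\<^bsub>?S\<^esub> ?t c 0"
    using tm_closed[OF c] by (intro S.finsum_Suc2) auto
  also have "(\<Oplus>\<^bsub>?S\<^esub>k\<in>{..K}. ?t c (Suc k)) = (\<Oplus>\<^bsub>?S\<^esub>k\<in>{..K}. (\<ominus>\<^bsub>F\<^esub> \<one>\<^bsub>F\<^esub>) \<odot>\<^bsub>?S\<^esub> ?d (?t (\<lambda>k. c (Suc k)) k))"
    unfolding step using tc by (intro S.finsum_cong') (auto simp: S.smult_l_minus)
  also have "\<dots> = (\<ominus>\<^bsub>F\<^esub> \<one>\<^bsub>F\<^esub>) \<odot>\<^bsub>?S\<^esub> ?d (finsum ?S (?t (\<lambda>k. c (Suc k))) {..K})"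
    using tc
    by (subst S.finsum_smult_ldistr[symmetric]) (auto intro!: arg_cong2[of _ _ _ _ "smult ?S"] S.d.finsum[symmetric])
  also have "finsum ?S (?t (\<lambda>k. c (Suc k))) {..K} = oproj P q N (E N (\<lambda>k. c (Suc k)))"
    by (rule proj_E[OF c' K', symmetric])
  finally show "oproj P q N (E N c) = oproj P q N (c 0 \<ominus>\<^bsub>X N\<^esub> oder P N (E N (\<lambda>k. c (Suc k))))"
    using cl by (simp add: linear_map.minus[OF proj_linear] proj_der S.minus_eq S.smult_l_minus S.a_comm)
qed

text \<open>
  The series is a multiple of \<open>\<lambda> + \<partial>\<close>, which vanishes at \<open>\<lambda> = -\<partial>\<close>.
\<close>

lemma E_der_shift:
  assumes c: "pro_null N c"
  shows "E N (\<lambda>k. (if k = 0 then \<zero>\<^bsub>X N\<^esub> else c (k - 1)) \<oplus>\<^bsub>X N\<^esub> oder P N (c k)) = \<zero>\<^bsub>X N\<^esub>"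
proof -
  let ?s = "\<lambda>k. if k = 0 then \<zero>\<^bsub>X N\<^esub> else c (k - 1)"
  have s: "pro_null N ?s"
    unfolding pro_null_def
  proof (intro conjI allI)
    fix q
    obtain K where "\<forall>k>K. oproj P q N (c k) = \<zero>\<^bsub>osys P q N\<^esub>" by (rule pro_null_bound[OF c, where q = q])
    then show "\<exists>K. \<forall>k>K. oproj P q N (?s k) = \<zero>\<^bsub>osys P q N\<^esub>" by (intro exI[of _ "Suc K"]) auto
  qed (use c in \<open>simp add: pro_null_closed\<close>)
  have "E N ?s = \<zero>\<^bsub>X N\<^esub> \<ominus>\<^bsub>X N\<^esub> oder P N (E N c)" using E_unfold[OF s] by simp
  moreover have "E N (\<lambda>k. oder P N (c k)) = oder P N (E N c)" by (rule E_map[OF level_map_der c])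
  ultimately show ?thesis
    using E_add(2)[OF s pro_null_map[OF level_map_der c]] E_closed[OF c] by (simp add: X.minus_eq X.l_neg)
qed

lemma pro_null_subst_neg:
  assumes c: "pro_null N c"
  shows "pro_null N (subst_neg P N c)"
  unfolding pro_null_def
proof (intro conjI allI)
  fix q
  obtain K where K: "\<forall>k>K. oproj P q N (c k) = \<zero>\<^bsub>osys P q N\<^esub>" by (rule pro_null_bound[OF c, where q = q])
  have "oproj P q N (subst_neg P N c j) = \<zero>\<^bsub>osys P q N\<^esub>" if "K < j" for j
    unfolding proj_subst_neg[OF c K] using that
    by (intro S.add.finprod_one_eqI tm_zero c disjI2) (auto simp: binomial_eq_0)
  then show "\<exists>K. \<forall>k>K. oproj P q N (subst_neg P N c k) = \<zero>\<^bsub>osys P q N\<^esub>" by blast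
qed (use subst_neg_closed[OF c] in simp)

text \<open>
  The substitution \<open>\<lambda> \<mapsto> -\<lambda> - \<partial>\<close> is an involution, and its square is evaluated at \<open>\<lambda> = 0\<close> here. The
  coefficients cancel because the alternating sums of the binomial coefficients vanish.
\<close>

lemma E_subst_neg:
  assumes c: "pro_null N c"
  shows "E N (subst_neg P N c) = c 0"
proof (rule proj_eqI)
  note s = pro_null_subst_neg[OF c]
  show "E N (subst_neg P N c) \<in> carrier (X N)" "c 0 \<in> carrier (X N)"
    using E_closed[OF s] pro_null_closed[OF c] by auto
  fix q
  let ?S = "osys P q N" and ?d = "osysder P q N"
  let ?y = "\<lambda>k. oproj P q N (c k)"
  have y: "?y k \<in> carrier ?S" for k using pro_null_closed[OF c] by simp
  obtain K where K: "\<forall>k>K. ?y k = \<zero>\<^bsub>?S\<^esub>" by (rule pro_null_bound[OF c, where q = q])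
  have K': "\<forall>j>K. oproj P q N (subst_neg P N c j) = \<zero>\<^bsub>?S\<^esub>"
    unfolding proj_subst_neg[OF c K]
    by (intro allI impI S.add.finprod_one_eqI tm_zero c disjI2) (auto simp: binomial_eq_0)
  have "oproj P q N (E N (subst_neg P N c)) = (\<Oplus>\<^bsub>?S\<^esub>j\<in>{..K}. [((-1) ^ j :: int)] \<cdot>\<^bsub>?S\<^esub> (?d ^^ j)
      (\<Oplus>\<^bsub>?S\<^esub>k\<in>{..K}. [((-1) ^ k * int (k choose j))] \<cdot>\<^bsub>?S\<^esub> (?d ^^ (k - j)) (?y k)))"
    unfolding proj_E[OF s K'] proj_subst_neg[OF c K] ..
  also have "\<dots> = (\<Oplus>\<^bsub>?S\<^esub>j\<in>{..K}. \<Oplus>\<^bsub>?S\<^esub>k\<in>{..K}. [((-1) ^ j * (-1) ^ k * int (k choose j))] \<cdot>\<^bsub>?S\<^esub> (?d ^^ k) (?y k))"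
  proof (rule S.finsum_cong'[OF refl])
    fix j
    have inner: "[((-1) ^ j :: int)] \<cdot>\<^bsub>?S\<^esub> (?d ^^ j) ([((-1) ^ k * int (k choose j))] \<cdot>\<^bsub>?S\<^esub> (?d ^^ (k - j)) (?y k)) =
        [((-1) ^ j * (-1) ^ k * int (k choose j))] \<cdot>\<^bsub>?S\<^esub> (?d ^^ k) (?y k)" for k
    proof (cases "j \<le> k")
      case True
      then have "(?d ^^ j) ((?d ^^ (k - j)) (?y k)) = (?d ^^ k) (?y k)"
        by (metis comp_apply funpow_add le_add_diff_inverse)
      then show ?thesis
        using y by (simp add: linear_map.int_mult[OF der_pow_linear] S.add.int_pow_pow ac_simps)
    next
      case False
      then show ?thesis using y by (simp add: binomial_eq_0 linear_map.zero[OF der_pow_linear] S.int_scalar)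
    qed
    have "linear_map F ?S ?S (\<lambda>x. [((-1) ^ j :: int)] \<cdot>\<^bsub>?S\<^esub> (?d ^^ j) x)"
    proof -
      interpret l: linear_map F ?S ?S "?d ^^ j" by (rule der_pow_linear)
      show ?thesis
        by (auto simp: linear_map_def linear_map_axioms_def linear_maps_def S.module_axioms
            S.int_scalar l.add l.scale S.smult_r_distr S.smult_commute)
    qed
    from linear_map.finsum[OF this, of "\<lambda>k. [((-1) ^ k * int (k choose j))] \<cdot>\<^bsub>?S\<^esub> (?d ^^ (k - j)) (?y k)" "{..K}"]
    show "[((-1) ^ j :: int)] \<cdot>\<^bsub>?S\<^esub> (?d ^^ j)
        (\<Oplus>\<^bsub>?S\<^esub>k\<in>{..K}. [((-1) ^ k * int (k choose j))] \<cdot>\<^bsub>?S\<^esub> (?d ^^ (k - j)) (?y k)) =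
        (\<Oplus>\<^bsub>?S\<^esub>k\<in>{..K}. [((-1) ^ j * (-1) ^ k * int (k choose j))] \<cdot>\<^bsub>?S\<^esub> (?d ^^ k) (?y k))"
      using y by (simp add: inner)
  qed (use y in \<open>auto intro!: S.finsum_closed\<close>)
  also have "\<dots> = (\<Oplus>\<^bsub>?S\<^esub>k\<in>{..K}. \<Oplus>\<^bsub>?S\<^esub>j\<in>{..K}. [((-1) ^ j * (-1) ^ k * int (k choose j))] \<cdot>\<^bsub>?S\<^esub> (?d ^^ k) (?y k))"
    using y by (intro S.finsum_swap) auto
  also have "\<dots> = (\<Oplus>\<^bsub>?S\<^esub>k\<in>{..K}. if 0 = k then ?y k else \<zero>\<^bsub>?S\<^esub>)"
  proof (rule S.finsum_cong'[OF refl])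
    fix k assume k: "k \<in> {..K}"
    have "(\<Sum>j\<le>K. (-1) ^ j * (-1) ^ k * int (k choose j)) = (-1) ^ k * (\<Sum>j\<le>k. (-1) ^ j * int (k choose j))"
      using k by (subst sum_distrib_left, intro sum.mono_neutral_cong_right) (auto simp: binomial_eq_0)
    also have "\<dots> = (if k = 0 then 1 else 0)"
      using choose_alternating_sum[of k] by (cases k) auto
    finally show "(\<Oplus>\<^bsub>?S\<^esub>j\<in>{..K}. [((-1) ^ j * (-1) ^ k * int (k choose j))] \<cdot>\<^bsub>?S\<^esub> (?d ^^ k) (?y k)) =
        (if 0 = k then ?y k else \<zero>\<^bsub>?S\<^esub>)"
      using y by (simp add: S.finsum_int_mult)
  qed (use y in auto)
  also have "\<dots> = ?y 0"
    using y by (intro S.finsum_singleton) auto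
  finally show "oproj P q N (E N (subst_neg P N c)) = ?y 0" .
qed

section \<open>Continuity of the products\<close>

text \<open>
  As \<open>f \<circ>\<^sub>\<lambda> \<partial>g = -\<lambda> (f \<circ>\<^sub>\<lambda> g)\<close>, the value \<open>-\<partial>\<close> of a parameter inside the right factor becomes \<open>\<lambda>\<close>. So each
  coefficient of the product involves finitely many terms.
\<close>

lemma circ_E_right:
  assumes i: "1 \<le> i" "i \<le> n" and f: "f \<in> carrier (X n)" and d: "pro_null m d" and N: "N = m + n - 1"
  shows "ocirc P n m i f (E m d) s = (\<Oplus>\<^bsub>X N\<^esub>t\<in>{..s}. ocirc P n m i f (d t) (s - t))"
  using d
proof (induction s arbitrary: d)
  case (0 d)
  interpret l: linear_map F "X m" "X N" "\<lambda>g. ocirc P n m i f g 0"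
    by (rule circ_linear_right[OF i f N])
  have d': "pro_null m (\<lambda>k. d (Suc k))" using pro_null_shift[OF 0, of 1] by simp
  have "ocirc P n m i f (E m d) 0 = ocirc P n m i f (d 0) 0 \<ominus>\<^bsub>X N\<^esub> ocirc P n m i f (oder P m (E m (\<lambda>k. d (Suc k)))) 0"
    unfolding E_unfold[OF 0] using E_closed[OF d'] pro_null_closed[OF 0] by (simp add: l.minus)
  also have "ocirc P n m i f (oder P m (E m (\<lambda>k. d (Suc k)))) 0 = \<zero>\<^bsub>X N\<^esub>"
    using sesqui_right[OF i f E_closed[OF d'], of 0] N by simp
  finally show ?case using pro_null_closed[OF 0] by (simp add: X.minus_eq)
next
  case (Suc s d)
  interpret l: linear_map F "X m" "X N" "\<lambda>g. ocirc P n m i f g (Suc s)"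
    by (rule circ_linear_right[OF i f N])
  have d': "pro_null m (\<lambda>k. d (Suc k))" using pro_null_shift[OF Suc.prems, of 1] by simp
  have cl: "ocirc P n m i f (d t) k \<in> carrier (X N)" for t k
    by (rule circ_closed[OF i f pro_null_closed[OF Suc.prems] N])
  have "ocirc P n m i f (E m d) (Suc s) =
      ocirc P n m i f (d 0) (Suc s) \<ominus>\<^bsub>X N\<^esub> ocirc P n m i f (oder P m (E m (\<lambda>k. d (Suc k)))) (Suc s)"
    unfolding E_unfold[OF Suc.prems] using E_closed[OF d'] pro_null_closed[OF Suc.prems] by (simp add: l.minus)
  also have "ocirc P n m i f (oder P m (E m (\<lambda>k. d (Suc k)))) (Suc s) =
      \<ominus>\<^bsub>X N\<^esub> ocirc P n m i f (E m (\<lambda>k. d (Suc k))) s"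
    using sesqui_right[OF i f E_closed[OF d'], of "Suc s"] N by simp
  also have "ocirc P n m i f (E m (\<lambda>k. d (Suc k))) s = (\<Oplus>\<^bsub>X N\<^esub>t\<in>{..s}. ocirc P n m i f (d (Suc t)) (s - t))"
    by (rule Suc.IH[OF d'])
  finally have "ocirc P n m i f (E m d) (Suc s) = ocirc P n m i f (d 0) (Suc s) \<oplus>\<^bsub>X N\<^esub>
      (\<Oplus>\<^bsub>X N\<^esub>t\<in>{..s}. ocirc P n m i f (d (Suc t)) (s - t))"
    using cl by (simp add: X.minus_eq X.finsum_closed)
  also have "\<dots> = (\<Oplus>\<^bsub>X N\<^esub>t\<in>{..Suc s}. ocirc P n m i f (d t) (Suc s - t))"
    using cl by (subst X.finsum_Suc2) (auto intro: X.a_comm simp: X.finsum_closed)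
  finally show ?case .
qed

text \<open>Multiplication by \<open>\<lambda> + \<partial>\<close> over \<open>P\<^sub>q(N)\<close>.\<close>

definition Lop :: "nat \<Rightarrow> nat \<Rightarrow> (nat \<Rightarrow> 'w) \<Rightarrow> nat \<Rightarrow> 'w" where
  "Lop q N z r = (if r = 0 then \<zero>\<^bsub>osys P q N\<^esub> else z (r - 1)) \<oplus>\<^bsub>osys P q N\<^esub> osysder P q N (z r)"

text \<open>
  Multiplication by \<open>\<lambda> + \<partial>\<close> raises the degree of a polynomial by \<open>1\<close>.
\<close>

lemma Lop_degree:
  assumes z: "\<And>r. z r \<in> carrier (osys P q N)" and fin: "finite {r. z r \<noteq> \<zero>\<^bsub>osys P q N\<^esub>}"
    and top: "\<And>r. D \<le> r \<Longrightarrow> Lop q N z r = \<zero>\<^bsub>osys P q N\<^esub>" and r: "D \<le> Suc r"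
  shows "z r = \<zero>\<^bsub>osys P q N\<^esub>"
proof (rule ccontr)
  assume "z r \<noteq> \<zero>\<^bsub>osys P q N\<^esub>"
  define R where "R = Max {r. z r \<noteq> \<zero>\<^bsub>osys P q N\<^esub>}"
  have R: "z R \<noteq> \<zero>\<^bsub>osys P q N\<^esub>" "r \<le> R"
    using Max_in[OF fin] Max_ge[OF fin] \<open>z r \<noteq> _\<close> unfolding R_def by auto
  have "z (Suc R) = \<zero>\<^bsub>osys P q N\<^esub>"
    using Max_ge[OF fin, of "Suc R"] unfolding R_def[symmetric] by auto
  then have "Lop q N z (Suc R) = z R" using z by (simp add: Lop_def)
  with top[of "Suc R"] R r show False by simp
qed

end

text \<open>
  In the applications, \<open>Z K\<close> is the image over \<open>P\<^sub>q(N)\<close> of \<open>E (c K, c (K + 1), \<dots>) \<circ>\<^sub>\<lambda> h\<close>, and \<open>y K\<close> is that of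
  \<open>c K \<circ>\<^sub>\<lambda> h\<close>. The recursion for \<open>E\<close> and the sesquilinearity of the products give the relation between them.
\<close>

locale telescope = char0_pro_operad F P
  for F :: "('f, 'r) ring_scheme" and P :: "('f, 'v, 'w) pro_operad" +
  fixes q N :: nat and Z y :: "nat \<Rightarrow> nat \<Rightarrow> 'w"
  assumes Z: "Z K r \<in> carrier (osys P q N)" and Z_fin: "finite {r. Z K r \<noteq> \<zero>\<^bsub>osys P q N\<^esub>}"
    and y: "y K r \<in> carrier (osys P q N)"
    and step: "Z K r = y K r \<ominus>\<^bsub>osys P q N\<^esub> Lop q N (Z (Suc K)) r"
begin

lemma Lop_closed: "Lop q N (Z K) r \<in> carrier (osys P q N)"
  using Z by (simp add: Lop_def)

lemma Lop_Suc: "Lop q N (Z (Suc K)) r = y K r \<ominus>\<^bsub>osys P q N\<^esub> Z K r"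
  using y Lop_closed unfolding step[of K r]
  by (simp add: S.minus_eq S.minus_add S.r_neg1 S.r_neg2)

text \<open>
  Each step divides by \<open>\<lambda> + \<partial>\<close> what is left after the subtraction of \<open>y K\<close>. So the degree of \<open>Z K\<close> drops by
  \<open>1\<close> in each step in which it exceeds the degree of \<open>y K\<close>.
\<close>

lemma bound:
  assumes "\<And>r. B 0 \<le> r \<Longrightarrow> Z 0 r = \<zero>\<^bsub>osys P q N\<^esub>" and mono: "\<And>K. B K \<le> B (Suc K)"
    and "\<And>K r. B (Suc K) \<le> r + K \<Longrightarrow> y K r = \<zero>\<^bsub>osys P q N\<^esub>"
  shows "B K \<le> r + K \<Longrightarrow> Z K r = \<zero>\<^bsub>osys P q N\<^esub>"
proof (induction K arbitrary: r)
  case 0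
  then show ?case using assms(1) by simp
next
  case (Suc K)
  have "Lop q N (Z (Suc K)) r = \<zero>\<^bsub>osys P q N\<^esub>" if "B (Suc K) - K \<le> r" for r
    using that Suc.IH[of r] assms(3)[of K r] mono[of K] by (simp add: Lop_Suc S.minus_eq_zero_iff)
  note top = this
  show ?case
  proof (rule Lop_degree[OF Z Z_fin])
    show "Lop q N (Z (Suc K)) r = \<zero>\<^bsub>osys P q N\<^esub>" if "B (Suc K) - K \<le> r" for r
      using that by (rule top)
    show "B (Suc K) - K \<le> Suc r" using Suc.prems by linarith
  qed
qed

lemma backwards:
  assumes "\<And>r. Z K' r = \<zero>\<^bsub>osys P q N\<^esub>" "\<And>k r. K \<le> k \<Longrightarrow> k < K' \<Longrightarrow> y k r = \<zero>\<^bsub>osys P q N\<^esub>" "K \<le> K'"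
  shows "Z K r = \<zero>\<^bsub>osys P q N\<^esub>"
  using assms(3,2)
proof (induction K arbitrary: r rule: inc_induct)
  case base
  then show ?case using assms(1) by simp
next
  case (step k)
  then have "Z (Suc k) r = \<zero>\<^bsub>osys P q N\<^esub>" for r by simp
  then have "Lop q N (Z (Suc k)) r = \<zero>\<^bsub>osys P q N\<^esub>" by (simp add: Lop_def)
  then show ?case using step telescope.step[OF telescope_axioms, of k r] by (simp add: S.minus_eq_zero_iff)
qed

end

context char0_pro_operad
begin

lemma telescope_circ:
  assumes i: "1 \<le> i" "i \<le> n" and h: "h \<in> carrier (X m)" and c: "pro_null n c" and N: "N = m + n - 1"
  shows "telescope F P q N (\<lambda>K r. oproj P q N (ocirc P n m i (E n (\<lambda>k. c (k + K))) h r))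
    (\<lambda>K r. oproj P q N (ocirc P n m i (c K) h r))"
proof (intro telescope.intro telescope_axioms.intro char0_pro_operad_axioms)
  fix K r
  have c': "pro_null n (\<lambda>k. c (k + K))" for K by (rule pro_null_shift[OF c])
  note Ecl = E_closed[OF c']
  have circ_cl: "ocirc P n m i f h r \<in> carrier (X N)" if "f \<in> carrier (X n)" for f r
    by (rule circ_closed[OF i that h N])
  show "oproj P q N (ocirc P n m i (E n (\<lambda>k. c (k + K))) h r) \<in> carrier (osys P q N)"
    "oproj P q N (ocirc P n m i (c K) h r) \<in> carrier (osys P q N)"
    using circ_cl[OF Ecl] circ_cl[OF pro_null_closed[OF c]] by auto
  show "finite {r. oproj P q N (ocirc P n m i (E n (\<lambda>k. c (k + K))) h r) \<noteq> \<zero>\<^bsub>osys P q N\<^esub>}"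
    using proj_circ_polynomial[OF i Ecl h, of q K] N by simp
  interpret l: linear_map F "X n" "X N" "\<lambda>f. ocirc P n m i f h r"
    by (rule circ_linear_left[OF i h N])
  let ?e = "E n (\<lambda>k. c (k + Suc K))"
  have "E n (\<lambda>k. c (k + K)) = c K \<ominus>\<^bsub>X n\<^esub> oder P n ?e"
    using E_unfold[OF c', of K] by simp
  then have "ocirc P n m i (E n (\<lambda>k. c (k + K))) h r = ocirc P n m i (c K) h r \<ominus>\<^bsub>X N\<^esub> ocirc P n m i (oder P n ?e) h r"
    using Ecl[of "Suc K"] pro_null_closed[OF c] by (simp add: l.minus)
  also have "ocirc P n m i (oder P n ?e) h r = (if r = 0 then \<zero>\<^bsub>X N\<^esub> else ocirc P n m i ?e h (r - 1))
      \<oplus>\<^bsub>X N\<^esub> oder P N (ocirc P n m i ?e h r)"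
    using sesqui_left[OF i Ecl[of "Suc K"] h, of r] N by simp
  finally show "oproj P q N (ocirc P n m i (E n (\<lambda>k. c (k + K))) h r) =
      oproj P q N (ocirc P n m i (c K) h r) \<ominus>\<^bsub>osys P q N\<^esub>
        Lop q N (\<lambda>r. oproj P q N (ocirc P n m i (E n (\<lambda>k. c (k + Suc K))) h r)) r"
    using circ_cl[OF Ecl, of "Suc K"] circ_cl[OF pro_null_closed[OF c]]
    by (auto simp: Lop_def linear_map.minus[OF proj_linear] linear_map.add[OF proj_linear]
        linear_map.zero[OF proj_linear] proj_der)
qed

text \<open>
  The products are continuous in the left factor, because their values are polynomials over
  \<open>P\<^sub>q(N)\<close>. The members of \<open>g\<close> are spread over a sequence \<open>c\<close> with such large gaps that their
  contributions to the product of \<open>E c\<close> and \<open>h\<close> have different degrees. As this product is a polynomial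
  over \<open>P\<^sub>q(N)\<close>, all but finitely many of the contributions vanish.
\<close>

lemma circ_left_continuous:
  assumes i: "1 \<le> i" "i \<le> n" and h: "h \<in> carrier (X m)" and g: "pro_null n g" and N: "N = m + n - 1"
  shows "\<exists>K. \<forall>k\<ge>K. \<forall>r. oproj P q N (ocirc P n m i (g k) h r) = \<zero>\<^bsub>osys P q N\<^esub>"
proof -
  let ?S = "osys P q N"
  have poly: "\<exists>D. \<forall>r\<ge>D. oproj P q N (ocirc P n m i f h r) = \<zero>\<^bsub>?S\<^esub>" if f: "f \<in> carrier (X n)" for f
  proof -
    obtain D where "\<forall>r>D. oproj P q N (ocirc P n m i f h r) = \<zero>\<^bsub>?S\<^esub>"
      by (rule pro_null_bound[OF pro_null_circ[OF i f h N], where q = q])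
    then show ?thesis by (intro exI[of _ "Suc D"]) auto
  qed
  have "\<forall>t. \<exists>D. \<forall>r\<ge>D. oproj P q N (ocirc P n m i (g t) h r) = \<zero>\<^bsub>?S\<^esub>"
    using poly[OF pro_null_closed[OF g]] by blast
  then obtain \<delta> where \<delta>: "\<And>t r. \<delta> t \<le> r \<Longrightarrow> oproj P q N (ocirc P n m i (g t) h r) = \<zero>\<^bsub>?S\<^esub>" by metis
  \<comment> \<open>The gap behind the index \<open>e t\<close> exceeds the degree of the product of \<open>g t\<close> and \<open>h\<close>.\<close>
  define e where "e t = t + (\<Sum>s<t. \<delta> s)" for t
  have e_Suc: "e (Suc t) = e t + \<delta> t + 1" for t by (simp add: e_def)
  have e_mono: "e s < e t \<longleftrightarrow> s < t" for s t
    by (rule strict_mono_less) (rule strict_mono_Suc_iff[THEN iffD2], simp add: e_Suc)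
  then have e_le: "e s \<le> e t \<longleftrightarrow> s \<le> t" and e_inj: "e s = e t \<longleftrightarrow> s = t" for s t
    by (metis linorder_not_less, metis nat_neq_iff)
  have e_ge: "t \<le> e t" for t by (simp add: e_def)
  define c where "c k = (if k \<in> range e then g (THE t. e t = k) else \<zero>\<^bsub>X n\<^esub>)" for k
  have c_e: "c (e t) = g t" for t by (simp add: c_def e_inj)
  have c_other: "c k = \<zero>\<^bsub>X n\<^esub>" if "k \<notin> range e" for k using that by (simp add: c_def)
  have c: "pro_null n c"
    unfolding pro_null_def
  proof (intro conjI allI)
    show "c k \<in> carrier (X n)" for k
      using pro_null_closed[OF g] by (cases "k \<in> range e") (auto simp: c_e c_other)
    fix q'
    obtain K where K: "\<forall>k>K. oproj P q' n (g k) = \<zero>\<^bsub>osys P q' n\<^esub>"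
      by (rule pro_null_bound[OF g, where q = q'])
    have "oproj P q' n (c k) = \<zero>\<^bsub>osys P q' n\<^esub>" if "e K < k" for k
    proof (cases "k \<in> range e")
      case True
      then obtain t where "k = e t" by blast
      with that K show ?thesis by (simp add: c_e e_mono)
    qed (simp add: c_other linear_map.zero[OF proj_linear])
    then show "\<exists>K. \<forall>k>K. oproj P q' n (c k) = \<zero>\<^bsub>osys P q' n\<^esub>" by blast
  qed
  define Z where "Z K r = oproj P q N (ocirc P n m i (E n (\<lambda>k. c (k + K))) h r)" for K r
  define y where "y K r = oproj P q N (ocirc P n m i (c K) h r)" for K r
  interpret telescope F P q N Z y
    unfolding Z_def y_def by (rule telescope_circ[OF i h c N])
  have y_e: "y (e t) r = oproj P q N (ocirc P n m i (g t) h r)" for t r by (simp add: y_def c_e)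
  have y_other: "y k r = \<zero>\<^bsub>?S\<^esub>" if "k \<notin> range e" for k r
    using linear_map.zero[OF circ_linear_left[OF i h N]] linear_map.zero[OF proj_linear]
    by (simp add: y_def c_other[OF that])
  obtain D where D: "\<And>r. D \<le> r \<Longrightarrow> Z 0 r = \<zero>\<^bsub>?S\<^esub>"
    using poly[OF E_closed[OF c]] by (auto simp: Z_def)
  \<comment> \<open>The first index from \<open>K\<close> on that is in use.\<close>
  define b where "b K = e (LEAST t. K \<le> e t)" for K
  have b_mono: "b K \<le> b (Suc K)" for K
    unfolding b_def e_le by (rule Least_le) (metis LeastI Suc_leD e_ge)
  have b_e: "b (e t) = e t" for t
    by (auto simp: b_def e_le intro!: arg_cong[of _ _ e] Least_equality)
  have b_Suc_e: "b (Suc (e t)) = e (Suc t)" for t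
    by (auto simp: b_def Suc_le_eq e_mono intro!: arg_cong[of _ _ e] Least_equality)
  have Z_zero: "Z (e t) r = \<zero>\<^bsub>?S\<^esub>" if "D \<le> t" for t r
  proof (rule bound[of "\<lambda>K. max D (b K)"])
    show "max D (b K) \<le> max D (b (Suc K))" for K using b_mono[of K] by linarith
    show "y K r = \<zero>\<^bsub>?S\<^esub>" if "max D (b (Suc K)) \<le> r + K" for K r
    proof (cases "K \<in> range e")
      case True
      then obtain t where t: "K = e t" by blast
      then have "\<delta> t \<le> r" using that by (simp add: b_Suc_e e_Suc)
      with \<delta> show ?thesis by (simp add: t y_e)
    qed (rule y_other)
    show "max D (b (e t)) \<le> r + e t" using that e_ge[of t] by (simp add: b_e)
  qed (use D in simp)
  have "oproj P q N (ocirc P n m i (g t) h r) = \<zero>\<^bsub>?S\<^esub>" if "D \<le> t" for t r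
  proof -
    have "Z (Suc (e t)) r = \<zero>\<^bsub>?S\<^esub>" for r
    proof (rule backwards[of "e (Suc t)"])
      show "Z (e (Suc t)) r = \<zero>\<^bsub>?S\<^esub>" for r using Z_zero[of "Suc t"] that by simp
      show "y k r = \<zero>\<^bsub>?S\<^esub>" if "Suc (e t) \<le> k" "k < e (Suc t)" for k r
      proof (rule y_other)
        show "k \<notin> range e"
          using that by (auto simp: Suc_le_eq e_mono)
      qed
    qed (simp add: e_Suc)
    then have "Lop q N (Z (Suc (e t))) r = \<zero>\<^bsub>?S\<^esub>" by (simp add: Lop_def)
    then have "y (e t) r \<ominus>\<^bsub>?S\<^esub> \<zero>\<^bsub>?S\<^esub> = \<zero>\<^bsub>?S\<^esub>"
      using Lop_Suc[of "e t" r] Z_zero[OF that] by simp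
    then show ?thesis using y[of "e t" r] by (simp add: y_e S.minus_eq_zero_iff)
  qed
  then show ?thesis by blast
qed

text \<open>
  Because of \<open>(\<partial>f) \<circ>\<^sub>0 h = \<partial>(f \<circ>\<^sub>0 h)\<close>, finitely many terms of the series can be moved out of the product. By
  continuity, the remaining terms do not contribute over \<open>P\<^sub>q(N)\<close> if enough of them have been moved.
\<close>

lemma circ_E_left:
  assumes i: "1 \<le> i" "i \<le> n" and h: "h \<in> carrier (X m)" and d: "pro_null n d" and N: "N = m + n - 1"
  shows "pro_null N (\<lambda>k. ocirc P n m i (d k) h 0)"
    "ocirc P n m i (E n d) h 0 = E N (\<lambda>k. ocirc P n m i (d k) h 0)"
proof -
  have cl: "ocirc P n m i (d k) h r \<in> carrier (X N)" for k r
    by (rule circ_closed[OF i pro_null_closed[OF d] h N])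
  show null: "pro_null N (\<lambda>k. ocirc P n m i (d k) h 0)"
    unfolding pro_null_def using cl circ_left_continuous[OF i h d N] by (meson less_imp_le)
  show "ocirc P n m i (E n d) h 0 = E N (\<lambda>k. ocirc P n m i (d k) h 0)"
  proof (rule proj_eqI)
    show "ocirc P n m i (E n d) h 0 \<in> carrier (X N)" "E N (\<lambda>k. ocirc P n m i (d k) h 0) \<in> carrier (X N)"
      by (rule circ_closed[OF i E_closed[OF d] h N], rule E_closed[OF null])
    fix q
    let ?S = "osys P q N"
    define Z where "Z K r = oproj P q N (ocirc P n m i (E n (\<lambda>k. d (k + K))) h r)" for K r
    define y where "y K r = oproj P q N (ocirc P n m i (d K) h r)" for K r
    interpret telescope F P q N Z y
      unfolding Z_def y_def by (rule telescope_circ[OF i h d N])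
    obtain K0 where K0: "\<And>k r. K0 \<le> k \<Longrightarrow> y k r = \<zero>\<^bsub>?S\<^esub>"
      using circ_left_continuous[OF i h d N, of q] by (auto simp: y_def)
    have "\<exists>D. \<forall>r\<ge>D. oproj P q N (ocirc P n m i f h r) = \<zero>\<^bsub>?S\<^esub>" if f: "f \<in> carrier (X n)" for f
    proof -
      obtain D where "\<forall>r>D. oproj P q N (ocirc P n m i f h r) = \<zero>\<^bsub>?S\<^esub>"
        by (rule pro_null_bound[OF pro_null_circ[OF i f h N], where q = q])
      then show ?thesis by (intro exI[of _ "Suc D"]) auto
    qed
    note poly = this
    have "\<forall>t. \<exists>D. \<forall>r\<ge>D. y t r = \<zero>\<^bsub>?S\<^esub>"
      using poly[OF pro_null_closed[OF d]] by (simp add: y_def)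
    then obtain \<delta> where \<delta>: "\<And>t r. \<delta> t \<le> r \<Longrightarrow> y t r = \<zero>\<^bsub>?S\<^esub>" by metis
    obtain D where D: "\<And>r. D \<le> r \<Longrightarrow> Z 0 r = \<zero>\<^bsub>?S\<^esub>"
      using poly[OF E_closed[OF d]] by (auto simp: Z_def)
    \<comment> \<open>Only the \<open>y k\<close> with \<open>k < K0\<close> have to be taken into account, and \<open>B\<close> bounds all their degrees.\<close>
    define B where "B = D + (\<Sum>k<K0. k + \<delta> k)"
    have y_B: "y k r = \<zero>\<^bsub>?S\<^esub>" if "B \<le> r + k" for k r
    proof (cases "k < K0")
      case True
      then have "k + \<delta> k \<le> (\<Sum>k<K0. k + \<delta> k)" by (intro member_le_sum) auto
      with that show ?thesis by (intro \<delta>) (simp add: B_def)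
    qed (use K0 in simp)
    have "Z (max B K0) r = \<zero>\<^bsub>?S\<^esub>" for r
      by (rule bound[of "\<lambda>_. B"]) (use D y_B in \<open>auto simp: B_def\<close>)
    then have Z_K0: "Z K0 r = \<zero>\<^bsub>?S\<^esub>" for r
      by (rule backwards) (use K0 in auto)
    define Y where "Y K = oproj P q N (E N (\<lambda>k. ocirc P n m i (d (k + K)) h 0))" for K
    have null': "pro_null N (\<lambda>k. ocirc P n m i (d (k + K)) h 0)" for K
      by (rule pro_null_shift[OF null])
    have Y_step: "Y K = y K 0 \<ominus>\<^bsub>?S\<^esub> osysder P q N (Y (Suc K))" for K
    proof -
      have "E N (\<lambda>k. ocirc P n m i (d (k + K)) h 0) = ocirc P n m i (d K) h 0 \<ominus>\<^bsub>X N\<^esub>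
          oder P N (E N (\<lambda>k. ocirc P n m i (d (k + Suc K)) h 0))"
        using E_unfold[OF null', of K] by simp
      then show ?thesis
        using cl E_closed[OF null', of "Suc K"]
        by (simp add: Y_def y_def linear_map.minus[OF proj_linear] proj_der)
    qed
    have "Y K0 = \<zero>\<^bsub>?S\<^esub>"
    proof -
      have "\<forall>k>0. oproj P q N (ocirc P n m i (d (k + K0)) h 0) = \<zero>\<^bsub>?S\<^esub>"
        using K0 by (simp add: y_def)
      from proj_E[OF null' this] show ?thesis
        using K0[of K0 0] linear_map.zero[OF der_pow_linear] by (simp add: Y_def y_def)
    qed
    moreover have "Z k 0 = Y k" if "Z (Suc k) 0 = Y (Suc k)" for k
    proof -
      have "Y (Suc k) \<in> carrier ?S" using E_closed[OF null', of "Suc k"] by (simp add: Y_def)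
      with that step[of k 0] Y_step[of k] show ?thesis by (simp add: Lop_def)
    qed
    ultimately have descend: "Z K0 0 = Y K0" "\<And>k. Z (Suc k) 0 = Y (Suc k) \<Longrightarrow> Z k 0 = Y k"
      using Z_K0 by auto
    have "Z 0 0 = Y 0" if "Z k 0 = Y k" for k
      using that by (induction k) (auto intro: descend(2))
    from this[OF descend(1)] have "Z 0 0 = Y 0" .
    then show "oproj P q N (ocirc P n m i (E n d) h 0) = oproj P q N (E N (\<lambda>k. ocirc P n m i (d k) h 0))"
      by (simp add: Z_def Y_def)
  qed
qed

section \<open>The Jacobi identity\<close>

lemma pro_null_bul:
  assumes "f \<in> carrier (X a)" "g \<in> carrier (X b)" "N = b + a - 1"
  shows "pro_null N (bul a b f g)"
  unfolding bul_def assms(3) using assms(1,2) shuffle_inv_permutes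
  by (intro pro_null_finsum finite_shuffle_perms pro_null_map[OF level_map_act] pro_null_circ) auto

text \<open>This is \<open>circ_E_right\<close>, summed over the shuffles.\<close>

lemma bul_E_right:
  assumes f: "f \<in> carrier (X a)" and d: "pro_null b d" and N: "N = b + a - 1"
  shows "bul a b f (E b d) s = (\<Oplus>\<^bsub>X N\<^esub>t\<in>{..s}. bul a b f (d t) (s - t))"
proof -
  let ?A = "shuffle_perms (int b) (int a - 1)"
  have cl: "oact P N (ocirc P a b 1 f (d t) k) (inv_into UNIV \<sigma>) \<in> carrier (X N)"
    "ocirc P a b 1 f (d t) k \<in> carrier (X N)" if "\<sigma> \<in> ?A" for t k \<sigma>
    using shuffle_inv_permutes[OF that] f pro_null_closed[OF d]
    by (auto intro!: act_closed circ_closed simp: N)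
  have "bul a b f (E b d) s = (\<Oplus>\<^bsub>X N\<^esub>\<sigma>\<in>?A. \<Oplus>\<^bsub>X N\<^esub>t\<in>{..s}. oact P N (ocirc P a b 1 f (d t) (s - t)) (inv_into UNIV \<sigma>))"
    unfolding bul_def N[symmetric]
  proof (rule X.finsum_cong'[OF refl])
    fix \<sigma> assume \<sigma>: "\<sigma> \<in> ?A"
    note p = shuffle_inv_permutes[OF \<sigma>]
    have "ocirc P a b 1 f (E b d) s = (\<Oplus>\<^bsub>X N\<^esub>t\<in>{..s}. ocirc P a b 1 f (d t) (s - t))"
      using p(2) by (intro circ_E_right f d N) auto
    then show "oact P N (ocirc P a b 1 f (E b d) s) (inv_into UNIV \<sigma>) =
        (\<Oplus>\<^bsub>X N\<^esub>t\<in>{..s}. oact P N (ocirc P a b 1 f (d t) (s - t)) (inv_into UNIV \<sigma>))"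
      using linear_map.finsum[OF act_linear[OF p(1)], of "\<lambda>t. ocirc P a b 1 f (d t) (s - t)" "{..s}"] cl(2)[OF \<sigma>]
      by (simp add: N)
  qed (use cl in \<open>auto intro!: X.finsum_closed\<close>)
  also have "\<dots> = (\<Oplus>\<^bsub>X N\<^esub>t\<in>{..s}. \<Oplus>\<^bsub>X N\<^esub>\<sigma>\<in>?A. oact P N (ocirc P a b 1 f (d t) (s - t)) (inv_into UNIV \<sigma>))"
    using cl by (intro X.finsum_swap finite_shuffle_perms) auto
  finally show ?thesis by (simp add: bul_def N)
qed

lemma bul_E_left:
  assumes d: "pro_null a d" and g: "g \<in> carrier (X b)" and N: "N = b + a - 1"
  shows "pro_null N (\<lambda>k. bul a b (d k) g 0)"
    "bul a b (E a d) g 0 = E N (\<lambda>k. bul a b (d k) g 0)"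
proof -
  let ?A = "shuffle_perms (int b) (int a - 1)"
  have null: "pro_null N (\<lambda>k. ocirc P a b 1 (d k) g 0)" "ocirc P a b 1 (E a d) g 0 = E N (\<lambda>k. ocirc P a b 1 (d k) g 0)"
    if "\<sigma> \<in> ?A" for \<sigma>
    using circ_E_left[OF _ _ g d N, of 1] shuffle_inv_permutes(2)[OF that] by auto
  have p: "inv_into UNIV \<sigma> permutes {1..N}" if "\<sigma> \<in> ?A" for \<sigma>
    using shuffle_inv_permutes(1)[OF that] by (simp add: N)
  have null': "pro_null N (\<lambda>k. oact P N (ocirc P a b 1 (d k) g 0) (inv_into UNIV \<sigma>))" if "\<sigma> \<in> ?A" for \<sigma>
    by (rule pro_null_map[OF level_map_act[OF p[OF that]] null(1)[OF that]])
  show "pro_null N (\<lambda>k. bul a b (d k) g 0)"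
    unfolding bul_def N[symmetric] by (intro pro_null_finsum finite_shuffle_perms null')
  have "bul a b (E a d) g 0 = (\<Oplus>\<^bsub>X N\<^esub>\<sigma>\<in>?A. E N (\<lambda>k. oact P N (ocirc P a b 1 (d k) g 0) (inv_into UNIV \<sigma>)))"
    unfolding bul_def N[symmetric] using null p null'
    by (intro X.finsum_cong') (auto simp: E_map[OF level_map_act] E_closed)
  also have "\<dots> = E N (\<lambda>k. bul a b (d k) g 0)"
    unfolding bul_def N[symmetric] by (rule E_finsum[symmetric, OF finite_shuffle_perms null'])
  finally show "bul a b (E a d) g 0 = E N (\<lambda>k. bul a b (d k) g 0)" .
qed

lemma bul_der_left:
  assumes f: "f \<in> carrier (X a)" and g: "g \<in> carrier (X b)" and N: "N = b + a - 1"
  shows "bul a b (oder P a f) g k =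
    (if k = 0 then \<zero>\<^bsub>X N\<^esub> else bul a b f g (k - 1)) \<oplus>\<^bsub>X N\<^esub> oder P N (bul a b f g k)"
proof -
  let ?A = "shuffle_perms (int b) (int a - 1)"
  let ?c = "\<lambda>k \<sigma>. oact P N (ocirc P a b 1 f g k) (inv_into UNIV \<sigma>)"
  have p: "inv_into UNIV \<sigma> permutes {1..N}" "1 \<le> a" if "\<sigma> \<in> ?A" for \<sigma>
    using shuffle_inv_permutes[OF that] by (auto simp: N)
  have cl: "ocirc P a b 1 f g k \<in> carrier (X N)" if "\<sigma> \<in> ?A" for k \<sigma>
    using p(2)[OF that] f g by (intro circ_closed) (auto simp: N)
  have cl': "?c k \<sigma> \<in> carrier (X N)" if "\<sigma> \<in> ?A" for k \<sigma>
    using p(1)[OF that] cl[OF that] by simp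
  have prev: "(if k = 0 then \<zero>\<^bsub>X N\<^esub> else ?c (k - 1) \<sigma>) \<in> carrier (X N)" if "\<sigma> \<in> ?A" for \<sigma>
  proof (cases "k = 0")
    case True
    then show ?thesis by simp
  next
    case False
    show ?thesis unfolding if_not_P[OF False] by (rule cl'[OF that])
  qed
  have "bul a b (oder P a f) g k =
      (\<Oplus>\<^bsub>X N\<^esub>\<sigma>\<in>?A. (if k = 0 then \<zero>\<^bsub>X N\<^esub> else ?c (k - 1) \<sigma>) \<oplus>\<^bsub>X N\<^esub> oder P N (?c k \<sigma>))"
    unfolding bul_def N[symmetric]
  proof (rule X.finsum_cong'[OF refl])
    fix \<sigma> assume \<sigma>: "\<sigma> \<in> ?A"
    interpret l: linear_map F "X N" "X N" "\<lambda>x. oact P N x (inv_into UNIV \<sigma>)"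
      by (rule act_linear[OF p(1)[OF \<sigma>]])
    have e: "ocirc P a b 1 (oder P a f) g k =
        (if k = 0 then \<zero>\<^bsub>X N\<^esub> else ocirc P a b 1 f g (k - 1)) \<oplus>\<^bsub>X N\<^esub> oder P N (ocirc P a b 1 f g k)"
      by (rule sesqui_left[OF le_refl p(2)[OF \<sigma>] f g, folded N])
    show "oact P N (ocirc P a b 1 (oder P a f) g k) (inv_into UNIV \<sigma>) =
        (if k = 0 then \<zero>\<^bsub>X N\<^esub> else ?c (k - 1) \<sigma>) \<oplus>\<^bsub>X N\<^esub> oder P N (?c k \<sigma>)"
      unfolding e act_der[OF cl[OF \<sigma>] p(1)[OF \<sigma>]] using cl[OF \<sigma>]
      by (cases "k = 0") (subst l.add, simp, simp, simp)+
  qed (intro funcsetI X.a_closed X.d.closed prev cl')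
  also have "\<dots> = (\<Oplus>\<^bsub>X N\<^esub>\<sigma>\<in>?A. if k = 0 then \<zero>\<^bsub>X N\<^esub> else ?c (k - 1) \<sigma>) \<oplus>\<^bsub>X N\<^esub> (\<Oplus>\<^bsub>X N\<^esub>\<sigma>\<in>?A. oder P N (?c k \<sigma>))"
    by (intro X.finsum_addf funcsetI X.d.closed prev cl')
  also have "(\<Oplus>\<^bsub>X N\<^esub>\<sigma>\<in>?A. oder P N (?c k \<sigma>)) = oder P N (\<Oplus>\<^bsub>X N\<^esub>\<sigma>\<in>?A. ?c k \<sigma>)"
    by (intro X.d.finsum[symmetric] funcsetI cl')
  finally show ?thesis by (cases "k = 0") (simp_all add: bul_def N)
qed

lemma bul_der_right:
  assumes f: "f \<in> carrier (X a)" and g: "g \<in> carrier (X b)" and N: "N = b + a - 1"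
  shows "bul a b f (oder P b g) k = (if k = 0 then \<zero>\<^bsub>X N\<^esub> else \<ominus>\<^bsub>X N\<^esub> bul a b f g (k - 1))"
proof -
  let ?A = "shuffle_perms (int b) (int a - 1)"
  let ?c = "\<lambda>k \<sigma>. oact P N (ocirc P a b 1 f g k) (inv_into UNIV \<sigma>)"
  have p: "inv_into UNIV \<sigma> permutes {1..N}" "1 \<le> a" if "\<sigma> \<in> ?A" for \<sigma>
    using shuffle_inv_permutes[OF that] by (auto simp: N)
  have cl: "ocirc P a b 1 f g k \<in> carrier (X N)" if "\<sigma> \<in> ?A" for k \<sigma>
    using p(2)[OF that] f g by (intro circ_closed) (auto simp: N)
  have cl': "?c k \<sigma> \<in> carrier (X N)" if "\<sigma> \<in> ?A" for k \<sigma>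
    using p(1)[OF that] cl[OF that] by simp
  have prev: "(if k = 0 then \<zero>\<^bsub>X N\<^esub> else (\<ominus>\<^bsub>F\<^esub> \<one>\<^bsub>F\<^esub>) \<odot>\<^bsub>X N\<^esub> ?c (k - 1) \<sigma>) \<in> carrier (X N)" if "\<sigma> \<in> ?A" for \<sigma>
  proof (cases "k = 0")
    case True
    then show ?thesis by simp
  next
    case False
    show ?thesis unfolding if_not_P[OF False] by (rule X.smult_closed[OF _ cl'[OF that]], simp)
  qed
  have "bul a b f (oder P b g) k =
      (\<Oplus>\<^bsub>X N\<^esub>\<sigma>\<in>?A. if k = 0 then \<zero>\<^bsub>X N\<^esub> else (\<ominus>\<^bsub>F\<^esub> \<one>\<^bsub>F\<^esub>) \<odot>\<^bsub>X N\<^esub> ?c (k - 1) \<sigma>)"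
    unfolding bul_def N[symmetric]
  proof (rule X.finsum_cong'[OF refl])
    fix \<sigma> assume \<sigma>: "\<sigma> \<in> ?A"
    interpret l: linear_map F "X N" "X N" "\<lambda>x. oact P N x (inv_into UNIV \<sigma>)"
      by (rule act_linear[OF p(1)[OF \<sigma>]])
    have e: "ocirc P a b 1 f (oder P b g) k = (if k = 0 then \<zero>\<^bsub>X N\<^esub> else \<ominus>\<^bsub>X N\<^esub> ocirc P a b 1 f g (k - 1))"
      by (rule sesqui_right[OF le_refl p(2)[OF \<sigma>] f g, folded N])
    show "oact P N (ocirc P a b 1 f (oder P b g) k) (inv_into UNIV \<sigma>) =
        (if k = 0 then \<zero>\<^bsub>X N\<^esub> else (\<ominus>\<^bsub>F\<^esub> \<one>\<^bsub>F\<^esub>) \<odot>\<^bsub>X N\<^esub> ?c (k - 1) \<sigma>)"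
      unfolding e using cl[OF \<sigma>] cl'[OF \<sigma>]
      by (cases "k = 0") (simp, subst X.smult_l_minus, simp, simp, simp add: l.uminus)
  qed (intro funcsetI prev)
  also have "\<dots> = (if k = 0 then \<zero>\<^bsub>X N\<^esub> else (\<ominus>\<^bsub>F\<^esub> \<one>\<^bsub>F\<^esub>) \<odot>\<^bsub>X N\<^esub> (\<Oplus>\<^bsub>X N\<^esub>\<sigma>\<in>?A. ?c (k - 1) \<sigma>))"
    using cl' by (cases "k = 0") (simp_all add: X.finsum_smult_ldistr finite_shuffle_perms Pi_def)
  also have "(\<Oplus>\<^bsub>X N\<^esub>\<sigma>\<in>?A. ?c (k - 1) \<sigma>) = bul a b f g (k - 1)"
    by (simp add: bul_def N)
  finally show ?thesis using bul_closed[OF f g N] by (simp add: X.smult_l_minus)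
qed

text \<open>The two products in the bracket, for the conformal parameter \<open>0\<close>.\<close>

definition star :: "nat \<Rightarrow> nat \<Rightarrow> 'v \<Rightarrow> 'v \<Rightarrow> 'v" where
  "star a b f g = E (b + a - 1) (bul a b f g)"

definition dot :: "nat \<Rightarrow> nat \<Rightarrow> 'v \<Rightarrow> 'v \<Rightarrow> 'v" where
  "dot a b f g = bul a b f g 0"

lemma star_closed: "f \<in> carrier (X a) \<Longrightarrow> g \<in> carrier (X b) \<Longrightarrow> N = b + a - 1 \<Longrightarrow> star a b f g \<in> carrier (X N)"
  by (simp add: star_def E_closed pro_null_bul)

lemma dot_closed: "f \<in> carrier (X a) \<Longrightarrow> g \<in> carrier (X b) \<Longrightarrow> N = b + a - 1 \<Longrightarrow> dot a b f g \<in> carrier (X N)"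
  unfolding dot_def by (rule bul_closed)

lemma E_Inv:
  assumes "pro_null N c" "\<And>k. c k \<in> Inv N"
  shows "E N c \<in> Inv N"
proof -
  have "oact P N (E N c) \<sigma> = E N c" if "\<sigma> permutes {1..N}" for \<sigma>
    unfolding E_map[OF level_map_act[OF that] assms(1), symmetric] Inv_act[OF assms(2) that] ..
  then show ?thesis using E_closed[OF assms(1)] by (simp add: Inv_def)
qed

text \<open>
  The values of a polynomial at \<open>-\<partial>\<close> and \<open>0\<close> differ by a multiple of \<open>\<partial>\<close>.
\<close>

lemma star_dot:
  assumes f: "f \<in> Inv a" and g: "g \<in> Inv b" and N: "N = b + a - 1"
  shows "\<exists>w\<in>Inv N. star a b f g = dot a b f g \<ominus>\<^bsub>X N\<^esub> oder P N w"
proof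
  have null: "pro_null N (bul a b f g)" using f g by (intro pro_null_bul N) (auto simp: Inv_closed)
  show "E N (\<lambda>k. bul a b f g (Suc k)) \<in> Inv N"
    using pro_null_shift[OF null, of 1] bul_Inv[OF f g N] by (intro E_Inv) auto
  show "star a b f g = dot a b f g \<ominus>\<^bsub>X N\<^esub> oder P N (E N (\<lambda>k. bul a b f g (Suc k)))"
    unfolding star_def dot_def N[symmetric] by (rule E_unfold[OF null])
qed

lemma star_Inv:
  assumes f: "f \<in> Inv a" and g: "g \<in> Inv b" and N: "N = b + a - 1"
  shows "star a b f g \<in> Inv N"
  unfolding star_def N[symmetric]
  by (rule E_Inv[OF pro_null_bul[OF Inv_closed[OF f] Inv_closed[OF g] N] bul_Inv[OF f g N]])

lemma dot_Inv: "f \<in> Inv a \<Longrightarrow> g \<in> Inv b \<Longrightarrow> N = b + a - 1 \<Longrightarrow> dot a b f g \<in> Inv N"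
  unfolding dot_def by (rule bul_Inv)

lemma star_hpart:
  assumes "f \<in> hpart (X a) p" "g \<in> hpart (X b) q" "N = b + a - 1"
  shows "star a b f g \<in> hpart (X N) (p + q)"
  unfolding star_def assms(3)[symmetric]
  by (rule E_hpart[OF pro_null_bul[OF X.hpart_closed[OF assms(1)] X.hpart_closed[OF assms(2)] assms(3)]
        bul_hpart[OF assms]])

lemma dot_hpart:
  assumes "f \<in> hpart (X a) p" "g \<in> hpart (X b) q" "N = b + a - 1"
  shows "dot a b f g \<in> hpart (X N) (p + q)"
  unfolding dot_def by (rule bul_hpart[OF assms])

lemma dot_der_left:
  assumes "f \<in> carrier (X a)" "g \<in> carrier (X b)" "N = b + a - 1"
  shows "dot a b (oder P a f) g = oder P N (dot a b f g)"
proof -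
  have "dot a b (oder P a f) g = \<zero>\<^bsub>X N\<^esub> \<oplus>\<^bsub>X N\<^esub> oder P N (dot a b f g)"
    unfolding dot_def using bul_der_left[OF assms, of 0] by (simp only: if_True refl simp_thms)
  also have "\<dots> = oder P N (dot a b f g)"
    by (rule X.l_zero[OF X.d.closed[OF dot_closed[OF assms]]])
  finally show ?thesis .
qed

lemma dot_der_right:
  assumes "f \<in> carrier (X a)" "g \<in> carrier (X b)" "N = b + a - 1"
  shows "dot a b f (oder P b g) = \<zero>\<^bsub>X N\<^esub>"
  unfolding dot_def using bul_der_right[OF assms, of 0] by (simp only: if_True refl simp_thms)

lemma star_der_left:
  assumes "f \<in> carrier (X a)" "g \<in> carrier (X b)" "N = b + a - 1"
  shows "star a b (oder P a f) g = \<zero>\<^bsub>X N\<^esub>"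
proof -
  have "bul a b (oder P a f) g =
      (\<lambda>k. (if k = 0 then \<zero>\<^bsub>X N\<^esub> else bul a b f g (k - 1)) \<oplus>\<^bsub>X N\<^esub> oder P N (bul a b f g k))"
    using bul_der_left[OF assms] by (intro ext)
  then show ?thesis
    unfolding star_def assms(3)[symmetric] by (simp only: E_der_shift[OF pro_null_bul[OF assms]])
qed

lemma star_der_right:
  assumes f: "f \<in> carrier (X a)" and g: "g \<in> carrier (X b)" and N: "N = b + a - 1"
  shows "star a b f (oder P b g) = oder P N (star a b f g)"
proof -
  have null: "pro_null N (bul a b f (oder P b g))" by (rule pro_null_bul[OF f X.d.closed[OF g] N])
  have null': "pro_null N (bul a b f g)" by (rule pro_null_bul[OF f g N])
  have "E N (bul a b f (oder P b g)) =
      \<zero>\<^bsub>X N\<^esub> \<ominus>\<^bsub>X N\<^esub> oder P N (E N (\<lambda>k. (\<ominus>\<^bsub>F\<^esub> \<one>\<^bsub>F\<^esub>) \<odot>\<^bsub>X N\<^esub> bul a b f g k))"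
    unfolding E_unfold[OF null] bul_der_right[OF f g N] using bul_closed[OF f g N]
    by (simp add: X.smult_l_minus)
  also have "E N (\<lambda>k. (\<ominus>\<^bsub>F\<^esub> \<one>\<^bsub>F\<^esub>) \<odot>\<^bsub>X N\<^esub> bul a b f g k) = (\<ominus>\<^bsub>F\<^esub> \<one>\<^bsub>F\<^esub>) \<odot>\<^bsub>X N\<^esub> E N (bul a b f g)"
    by (rule E_map[OF level_map_smult null']) simp
  finally show ?thesis
    unfolding star_def N[symmetric] using E_closed[OF null']
    by (simp add: X.smult_l_minus X.d.uminus X.minus_eq)
qed

lemma star_linear_left:
  assumes g: "g \<in> carrier (X b)" and N: "N = b + a - 1"
  shows "linear_map F (X a) (X N) (\<lambda>f. star a b f g)"
proof (intro linear_map.intro linear_map_axioms.intro X.module_axioms)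
  note l = bul_linear_left[OF g N] and null = pro_null_bul[OF _ g N]
  show "(\<lambda>f. star a b f g) \<in> linear_maps F (X a) (X N)"
    unfolding linear_maps_def
  proof (intro CollectI conjI ballI funcsetI)
    fix x y assume xy: "x \<in> carrier (X a)" "y \<in> carrier (X a)"
    have "bul a b (x \<oplus>\<^bsub>X a\<^esub> y) g = (\<lambda>k. bul a b x g k \<oplus>\<^bsub>X N\<^esub> bul a b y g k)"
      using xy by (intro ext linear_map.add[OF l])
    then show "star a b (x \<oplus>\<^bsub>X a\<^esub> y) g = star a b x g \<oplus>\<^bsub>X N\<^esub> star a b y g"
      unfolding star_def N[symmetric] by (simp only: E_add(2)[OF null[OF xy(1)] null[OF xy(2)]])
  next
    fix r x assume rx: "r \<in> carrier F" "x \<in> carrier (X a)"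
    have "bul a b (r \<odot>\<^bsub>X a\<^esub> x) g = (\<lambda>k. r \<odot>\<^bsub>X N\<^esub> bul a b x g k)"
      using rx by (intro ext linear_map.scale[OF l])
    then show "star a b (r \<odot>\<^bsub>X a\<^esub> x) g = r \<odot>\<^bsub>X N\<^esub> star a b x g"
      unfolding star_def N[symmetric] by (simp only: E_map[OF level_map_smult[OF rx(1)] null[OF rx(2)]])
  qed (rule star_closed[OF _ g N])
qed

lemma star_linear_right:
  assumes f: "f \<in> carrier (X a)" and N: "N = b + a - 1"
  shows "linear_map F (X b) (X N) (\<lambda>g. star a b f g)"
proof (intro linear_map.intro linear_map_axioms.intro X.module_axioms)
  note l = bul_linear_right[OF f N] and null = pro_null_bul[OF f _ N]
  show "(\<lambda>g. star a b f g) \<in> linear_maps F (X b) (X N)"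
    unfolding linear_maps_def
  proof (intro CollectI conjI ballI funcsetI)
    fix x y assume xy: "x \<in> carrier (X b)" "y \<in> carrier (X b)"
    have "bul a b f (x \<oplus>\<^bsub>X b\<^esub> y) = (\<lambda>k. bul a b f x k \<oplus>\<^bsub>X N\<^esub> bul a b f y k)"
      using xy by (intro ext linear_map.add[OF l])
    then show "star a b f (x \<oplus>\<^bsub>X b\<^esub> y) = star a b f x \<oplus>\<^bsub>X N\<^esub> star a b f y"
      unfolding star_def N[symmetric] by (simp only: E_add(2)[OF null[OF xy(1)] null[OF xy(2)]])
  next
    fix r x assume rx: "r \<in> carrier F" "x \<in> carrier (X b)"
    have "bul a b f (r \<odot>\<^bsub>X b\<^esub> x) = (\<lambda>k. r \<odot>\<^bsub>X N\<^esub> bul a b f x k)"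
      using rx by (intro ext linear_map.scale[OF l])
    then show "star a b f (r \<odot>\<^bsub>X b\<^esub> x) = r \<odot>\<^bsub>X N\<^esub> star a b f x"
      unfolding star_def N[symmetric] by (simp only: E_map[OF level_map_smult[OF rx(1)] null[OF rx(2)]])
  qed (rule star_closed[OF f _ N])
qed

lemma dot_linear_left: "g \<in> carrier (X b) \<Longrightarrow> N = b + a - 1 \<Longrightarrow> linear_map F (X a) (X N) (\<lambda>f. dot a b f g)"
  unfolding dot_def by (rule bul_linear_left)

lemma dot_linear_right: "f \<in> carrier (X a) \<Longrightarrow> N = b + a - 1 \<Longrightarrow> linear_map F (X b) (X N) (\<lambda>g. dot a b f g)"
  unfolding dot_def by (rule bul_linear_right)

text \<open>
  As in \<open>boxL\<close> and \<open>boxR\<close>, the case where the inner product would have arity \<open>-1\<close> is singled out, because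
  \<open>b + c - 1\<close> is \<open>0\<close> there.
\<close>

definition starL :: "nat \<Rightarrow> nat \<Rightarrow> nat \<Rightarrow> 'v \<Rightarrow> 'v \<Rightarrow> 'v" where
  "starL a b c f w = (if b + c = 0 then \<zero>\<^bsub>X (a + b + c - 2)\<^esub> else star a (b + c - 1) f w)"

definition starR :: "nat \<Rightarrow> nat \<Rightarrow> nat \<Rightarrow> 'v \<Rightarrow> 'v \<Rightarrow> 'v" where
  "starR a b c w h = (if a + b = 0 then \<zero>\<^bsub>X (a + b + c - 2)\<^esub> else star (a + b - 1) c w h)"

lemma starL_E:
  assumes f: "f \<in> carrier (X a)" and w: "w \<in> carrier (X (b + c - 1))" and N: "N = a + b + c - 2"
  shows "pro_null N (boxL a b c f w)" "starL a b c f w = E N (boxL a b c f w)"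
proof -
  have "pro_null N (boxL a b c f w) \<and> starL a b c f w = E N (boxL a b c f w)"
  proof (cases "b + c = 0")
    case True
    then have "boxL a b c f w = (\<lambda>_. \<zero>\<^bsub>X N\<^esub>)" by (auto simp: boxL_def N)
    then show ?thesis using True by (simp add: pro_null_zero E_zero starL_def N)
  next
    case False
    then have N': "N = b + c - 1 + a - 1" using N by arith
    have "boxL a b c f w = bul a (b + c - 1) f w" using False by (auto simp: boxL_def)
    then show ?thesis
      unfolding starL_def if_not_P[OF False] star_def N'[symmetric] using pro_null_bul[OF f w N'] by metis
  qed
  then show "pro_null N (boxL a b c f w)" "starL a b c f w = E N (boxL a b c f w)" by auto
qed

lemma starR_E:
  assumes w: "w \<in> carrier (X (a + b - 1))" and h: "h \<in> carrier (X c)" and N: "N = a + b + c - 2"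
  shows "pro_null N (boxR a b c w h)" "starR a b c w h = E N (boxR a b c w h)"
proof -
  have "pro_null N (boxR a b c w h) \<and> starR a b c w h = E N (boxR a b c w h)"
  proof (cases "a + b = 0")
    case True
    then have "boxR a b c w h = (\<lambda>_. \<zero>\<^bsub>X N\<^esub>)" by (auto simp: boxR_def N)
    then show ?thesis using True by (simp add: pro_null_zero E_zero starR_def N)
  next
    case False
    then have N': "N = c + (a + b - 1) - 1" using N by arith
    have "boxR a b c w h = bul (a + b - 1) c w h" using False by (auto simp: boxR_def)
    then show ?thesis
      unfolding starR_def if_not_P[OF False] star_def N'[symmetric] using pro_null_bul[OF w h N'] by metis
  qed
  then show "pro_null N (boxR a b c w h)" "starR a b c w h = E N (boxR a b c w h)" by auto
qed

end

context abelian_group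
begin

definition combination :: "'a list \<Rightarrow> (nat \<Rightarrow> int) \<Rightarrow> 'a" where
  "combination xs w = (\<Oplus>i\<in>{..<length xs}. [w i] \<cdot> (xs ! i))"

lemma combination_add:
  assumes "set xs \<subseteq> carrier G"
  shows "combination xs v \<oplus> combination xs w = combination xs (\<lambda>i. v i + w i)"
proof -
  have cl: "xs ! i \<in> carrier G" if "i < length xs" for i using assms that nth_mem by blast
  have "combination xs (\<lambda>i. v i + w i) = (\<Oplus>i\<in>{..<length xs}. [v i] \<cdot> (xs ! i) \<oplus> [w i] \<cdot> (xs ! i))"
    unfolding combination_def using cl by (intro finsum_cong') (auto simp: add.int_pow_mult)
  also have "\<dots> = combination xs v \<oplus> combination xs w"
    unfolding combination_def using cl by (intro finsum_addf) auto
  finally show ?thesis by simp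
qed

lemma combination_mult:
  assumes "set xs \<subseteq> carrier G"
  shows "[(k::int)] \<cdot> combination xs w = combination xs (\<lambda>i. k * w i)"
proof -
  have cl: "xs ! i \<in> carrier G" if "i < length xs" for i using assms that nth_mem by blast
  have "[k] \<cdot> (\<Oplus>i\<in>A. [w i] \<cdot> (xs ! i)) = (\<Oplus>i\<in>A. [(k * w i)] \<cdot> (xs ! i))" if "finite A" "A \<subseteq> {..<length xs}" for A
    using that
  proof (induction A)
    case empty
    then show ?case by (simp add: add.int_pow_one)
  next
    case (insert a A)
    then show ?case
      using cl by (simp add: Pi_def subset_iff add.int_pow_distrib add.int_pow_pow mult.commute)
  qed
  then show ?thesis by (simp add: combination_def)
qed

lemma combination_single:
  assumes "set xs \<subseteq> carrier G" "j < length xs"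
  shows "xs ! j = combination xs (\<lambda>i. if i = j then 1 else 0)"
proof -
  have cl: "xs ! i \<in> carrier G" if "i < length xs" for i using assms that nth_mem by blast
  have "combination xs (\<lambda>i. if i = j then 1 else 0) = (\<Oplus>i\<in>{..<length xs}. if j = i then xs ! i else \<zero>)"
    unfolding combination_def using cl by (intro finsum_cong') auto
  also have "\<dots> = xs ! j" using cl assms(2) by (intro finsum_singleton) auto
  finally show ?thesis by simp
qed

lemma combination_minus:
  assumes "set xs \<subseteq> carrier G"
  shows "combination xs v \<ominus> combination xs w = combination xs (\<lambda>i. v i - w i)"
proof -
  have cl: "combination xs w \<in> carrier G"
    using assms nth_mem unfolding combination_def by (intro finsum_closed) (auto simp: subset_iff)
  have "\<ominus> combination xs w = combination xs (\<lambda>i. (-1) * w i)"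
    using combination_mult[OF assms, of "-1" w] cl by (simp add: add.int_pow_neg)
  then show ?thesis using combination_add[OF assms] by (simp add: minus_eq)
qed

text \<open>
  In the free abelian group on the summands, the Jacobi identity is a combination of three
  associativity relations. Linear combinations are represented by their coefficients, and the signs
  \<open>\<alpha>\<close>, \<open>\<beta>\<close>, \<open>\<gamma>\<close> are treated as indeterminates with square \<open>1\<close>.
\<close>

lemma jacobi_sum:
  fixes \<alpha> \<beta> \<gamma> :: int
  assumes cl: "{x1, x2, x3, x4, x5, x6, x7, x8, x9, x10, x11, x12} \<subseteq> carrier G"
    and sq: "\<alpha> * \<alpha> = 1" "\<beta> * \<beta> = 1" "\<gamma> * \<gamma> = 1"
    and 1: "x5 \<ominus> x1 = [\<alpha>] \<cdot> (x11 \<ominus> x2)" and 2: "x6 \<ominus> x9 = [\<gamma>] \<cdot> (x3 \<ominus> x10)"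
    and 3: "x4 \<ominus> x8 = [\<beta>] \<cdot> (x12 \<ominus> x7)"
  shows "(x1 \<ominus> [\<alpha>] \<cdot> x2) \<ominus> [(\<beta> * \<gamma>)] \<cdot> (x3 \<ominus> [\<alpha>] \<cdot> x4) =
    ((x5 \<ominus> [\<beta>] \<cdot> x6) \<ominus> [(\<gamma> * \<alpha>)] \<cdot> (x7 \<ominus> [\<beta>] \<cdot> x8)) \<oplus>
      [\<beta>] \<cdot> ((x9 \<ominus> [\<gamma>] \<cdot> x10) \<ominus> [(\<beta> * \<alpha>)] \<cdot> (x11 \<ominus> [\<gamma>] \<cdot> x12))"
proof -
  let ?xs = "[x1, x2, x3, x7, x8, x9, x10, x11, x12]"
  let ?e = "\<lambda>j i. if i = j then 1 else 0 :: int"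
  have xs: "set ?xs \<subseteq> carrier G" using cl by auto
  have eq: "u = v \<oplus> w" if "u \<ominus> v = w" "u \<in> carrier G" "v \<in> carrier G" for u v w
    using that(1)[symmetric] that(2,3) by (simp add: minus_eq a_ac r_neg1 r_neg2 r_neg)
  have x4: "x4 = x8 \<oplus> [\<beta>] \<cdot> (x12 \<ominus> x7)" and x5: "x5 = x1 \<oplus> [\<alpha>] \<cdot> (x11 \<ominus> x2)"
    and x6: "x6 = x9 \<oplus> [\<gamma>] \<cdot> (x3 \<ominus> x10)"
    using cl by (auto intro!: eq 1 2 3)
  have single: "x1 = combination ?xs (?e 0)" "x2 = combination ?xs (?e 1)" "x3 = combination ?xs (?e 2)"
    "x7 = combination ?xs (?e 3)" "x8 = combination ?xs (?e 4)" "x9 = combination ?xs (?e 5)"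
    "x10 = combination ?xs (?e 6)" "x11 = combination ?xs (?e 7)" "x12 = combination ?xs (?e 8)"
    using combination_single[OF xs, of 0] combination_single[OF xs, of 1] combination_single[OF xs, of 2]
      combination_single[OF xs, of 3] combination_single[OF xs, of 4] combination_single[OF xs, of 5]
      combination_single[OF xs, of 6] combination_single[OF xs, of 7] combination_single[OF xs, of 8]
    by simp_all
  define c where "c = combination ?xs"
  note single = single[folded c_def]
  have rules: "c v \<oplus> c w = c (\<lambda>i. v i + w i)" "c v \<ominus> c w = c (\<lambda>i. v i - w i)"
    "[k] \<cdot> c w = c (\<lambda>i. k * w i)" for v w k
    unfolding c_def by (rule combination_add[OF xs], rule combination_minus[OF xs], rule combination_mult[OF xs])
  have sq': "\<alpha> * (\<alpha> * z) = z" "\<beta> * (\<beta> * z) = z" "\<gamma> * (\<gamma> * z) = z" for z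
    using sq by (simp_all add: mult.assoc[symmetric])
  show ?thesis
    unfolding x4 x5 x6
    apply (subst (1 2) single(1), subst (1 2) single(2), subst (1 2) single(3), subst (1 2) single(4),
      subst (1 2) single(5), subst (1 2) single(6), subst (1 2) single(7), subst (1 2) single(8),
      subst (1 2) single(9))
    unfolding rules
    by (rule arg_cong[of _ _ c]) (auto simp: fun_eq_iff algebra_simps sq')
qed

end

context char0_pro_operad
begin

text \<open>
  The difference of the two products is in the image of the derivation, which is killed by the
  value at \<open>-\<partial>\<close> in the left factor and by the value at \<open>0\<close> in the right factor.
\<close>

lemma starR_star:
  assumes f: "f \<in> Inv a" and g: "g \<in> Inv b" and h: "h \<in> Inv c"
  shows "starR a b c (star a b f g) h = starR a b c (dot a b f g) h"
proof (cases "a + b = 0")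
  case False
  then have M: "a + b + c - 2 = c + (a + b - 1) - 1" by arith
  obtain w where w: "w \<in> Inv (a + b - 1)" "star a b f g = dot a b f g \<ominus>\<^bsub>X (a + b - 1)\<^esub> oder P (a + b - 1) w"
    using star_dot[OF f g, of "a + b - 1", OF arg_cong[of _ _ "\<lambda>x. x - 1", OF add.commute]] by blast
  have cl: "dot a b f g \<in> carrier (X (a + b - 1))"
    using f g by (intro dot_closed) (auto simp: Inv_closed)
  interpret l: linear_map F "X (a + b - 1)" "X (a + b + c - 2)" "\<lambda>w. star (a + b - 1) c w h"
    by (rule star_linear_left[OF Inv_closed[OF h] M])
  have "star (a + b - 1) c (oder P (a + b - 1) w) h = \<zero>\<^bsub>X (a + b + c - 2)\<^esub>"
    by (rule star_der_left[OF Inv_closed[OF w(1)] Inv_closed[OF h] M])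
  then have "star (a + b - 1) c (star a b f g) h = star (a + b - 1) c (dot a b f g) h"
    unfolding w(2) l.minus[OF cl X.d.closed[OF Inv_closed[OF w(1)]]]
    using l.closed[OF cl] by (simp add: X.minus_eq)
  then show ?thesis by (simp add: starR_def)
qed (simp add: starR_def)

lemma boxL_star:
  assumes f: "f \<in> Inv a" and g: "g \<in> Inv b" and h: "h \<in> Inv c"
  shows "boxL a b c f (star b c g h) 0 = boxL a b c f (dot b c g h) 0"
proof (cases "b + c = 0")
  case False
  then have M: "a + b + c - 2 = b + c - 1 + a - 1" by arith
  obtain w where w: "w \<in> Inv (b + c - 1)" "star b c g h = dot b c g h \<ominus>\<^bsub>X (b + c - 1)\<^esub> oder P (b + c - 1) w"
    using star_dot[OF g h, of "b + c - 1", OF arg_cong[of _ _ "\<lambda>x. x - 1", OF add.commute]] by blast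
  have d: "dot b c g h \<in> carrier (X (b + c - 1))"
    using g h by (intro dot_closed) (auto simp: Inv_closed)
  interpret l: linear_map F "X (b + c - 1)" "X (a + b + c - 2)" "\<lambda>w. dot a (b + c - 1) f w"
    by (rule dot_linear_right[OF Inv_closed[OF f] M])
  have "dot a (b + c - 1) f (oder P (b + c - 1) w) = \<zero>\<^bsub>X (a + b + c - 2)\<^esub>"
    by (rule dot_der_right[OF Inv_closed[OF f] Inv_closed[OF w(1)] M])
  then have "dot a (b + c - 1) f (star b c g h) = dot a (b + c - 1) f (dot b c g h)"
    unfolding w(2) l.minus[OF d X.d.closed[OF Inv_closed[OF w(1)]]]
    using l.closed[OF d] by (simp add: X.minus_eq)
  then show ?thesis by (simp add: boxL_def dot_def)
qed (simp add: boxL_def)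

lemma boxL_commute: "boxL a c b = boxL a b c" and boxR_commute: "boxR b a c = boxR a b c"
  and starL_commute: "starL a c b = starL a b c" and starR_commute: "starR b a c = starR a b c"
  by (simp_all add: boxL_def boxR_def starL_def starR_def fun_eq_iff ac_simps)

text \<open>
  Both evaluations of the symmetry of the associator: at \<open>\<lambda> = 0\<close> and \<open>\<mu> = -\<partial>\<close>, and at \<open>\<lambda> = \<mu> = 0\<close>.
\<close>

lemma associator_star:
  assumes f: "f \<in> Inv a" and g: "g \<in> Inv b" "g \<in> hpart (X b) p"
    and h: "h \<in> Inv c" "h \<in> hpart (X c) q" and N: "N = a + b + c - 2"
  shows "starR a b c (star a b f g) h \<ominus>\<^bsub>X N\<^esub> starL a b c f (star b c g h) =
    [koszul p q] \<cdot>\<^bsub>X N\<^esub> (boxR a c b (star a c f h) g 0 \<ominus>\<^bsub>X N\<^esub> starL a c b f (dot c b h g))"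
proof -
  have car: "f \<in> carrier (X a)" "g \<in> carrier (X b)" "h \<in> carrier (X c)"
    using f g h by (auto simp: Inv_closed)
  have N': "N = a + c + b - 2" using N by simp
  have cl: "star a b f g \<in> carrier (X (a + b - 1))" "dot a b f g \<in> carrier (X (a + b - 1))"
    "star b c g h \<in> carrier (X (b + c - 1))" "dot c b h g \<in> carrier (X (c + b - 1))"
    "star a c f h \<in> carrier (X (a + c - 1))"
    using car by (auto intro!: star_closed dot_closed)
  have null1: "pro_null (b + c - 1) (bul b c g h)" "pro_null (a + c - 1) (bul a c f h)"
    using car by (auto intro!: pro_null_bul)
  let ?A = "boxR a b c (dot a b f g) h" and ?B = "boxL a b c f (star b c g h)"
    and ?C = "\<lambda>s. boxR a c b (bul a c f h s) g 0" and ?D = "boxL a c b f (dot c b h g)"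
  have A: "pro_null N ?A" "starR a b c (dot a b f g) h = E N ?A" by (rule starR_E[OF cl(2) car(3) N])+
  have B: "pro_null N ?B" "starL a b c f (star b c g h) = E N ?B" by (rule starL_E[OF car(1) cl(3) N])+
  have D: "pro_null N ?D" "starL a c b f (dot c b h g) = E N ?D" by (rule starL_E[OF car(1) cl(4) N'])+
  have C: "pro_null N ?C \<and> boxR a c b (star a c f h) g 0 = E N ?C"
  proof (cases "a + c = 0")
    case True
    then have "?C = (\<lambda>_. \<zero>\<^bsub>X N\<^esub>)" by (auto simp: boxR_def N')
    then show ?thesis using True by (simp add: pro_null_zero E_zero boxR_def N')
  next
    case False
    then have N'': "N = b + (a + c - 1) - 1" using N by arith
    have "a + c - 1 = c + a - 1" by simp
    then show ?thesis
      unfolding boxR_def if_not_P[OF False] star_def using bul_E_left[OF null1(2) car(2) N''] by metis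
  qed
  have sum: "boxL a b c f (star b c g h) s = (\<Oplus>\<^bsub>X N\<^esub>t\<in>{..s}. boxL a b c f (bul b c g h t) (s - t))" for s
  proof (cases "b + c = 0")
    case True
    then show ?thesis by (simp add: boxL_def N)
  next
    case False
    then have M: "N = b + c - 1 + a - 1" using N by arith
    have "b + c - 1 = c + b - 1" by simp
    then show ?thesis
      unfolding boxL_def if_not_P[OF False] star_def using bul_E_right[OF car(1) null1(1) M] by metis
  qed
  have minus: "pro_null N (\<lambda>s. u s \<ominus>\<^bsub>X N\<^esub> v s) \<and> E N (\<lambda>s. u s \<ominus>\<^bsub>X N\<^esub> v s) = E N u \<ominus>\<^bsub>X N\<^esub> E N v"
    if u: "pro_null N u" and v: "pro_null N v" for u v
  proof -
    note m = level_map_smult[of "\<ominus>\<^bsub>F\<^esub> \<one>\<^bsub>F\<^esub>" N]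
    have m: "pro_null N (\<lambda>s. (\<ominus>\<^bsub>F\<^esub> \<one>\<^bsub>F\<^esub>) \<odot>\<^bsub>X N\<^esub> v s)"
      "E N (\<lambda>s. (\<ominus>\<^bsub>F\<^esub> \<one>\<^bsub>F\<^esub>) \<odot>\<^bsub>X N\<^esub> v s) = (\<ominus>\<^bsub>F\<^esub> \<one>\<^bsub>F\<^esub>) \<odot>\<^bsub>X N\<^esub> E N v"
      using pro_null_map[OF m v] E_map[OF m v] by auto
    have "(\<lambda>s. u s \<ominus>\<^bsub>X N\<^esub> v s) = (\<lambda>s. u s \<oplus>\<^bsub>X N\<^esub> (\<ominus>\<^bsub>F\<^esub> \<one>\<^bsub>F\<^esub>) \<odot>\<^bsub>X N\<^esub> v s)"
      using pro_null_closed[OF u] pro_null_closed[OF v] by (simp add: X.minus_scalar)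
    then show ?thesis
      using E_add[OF u m(1)] m(2) E_closed[OF u] E_closed[OF v] by (simp add: X.minus_scalar)
  qed
  have "(\<lambda>s. ?A s \<ominus>\<^bsub>X N\<^esub> ?B s) = (\<lambda>s. sgn_of F p q \<odot>\<^bsub>X N\<^esub> (?C s \<ominus>\<^bsub>X N\<^esub> ?D s))"
    using pre_lie[OF f g h N] unfolding sum dot_def by (intro ext)
  then have "E N (\<lambda>s. ?A s \<ominus>\<^bsub>X N\<^esub> ?B s) = E N (\<lambda>s. sgn_of F p q \<odot>\<^bsub>X N\<^esub> (?C s \<ominus>\<^bsub>X N\<^esub> ?D s))" by simp
  also have "\<dots> = sgn_of F p q \<odot>\<^bsub>X N\<^esub> (E N (\<lambda>s. ?C s \<ominus>\<^bsub>X N\<^esub> ?D s))"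
    using minus[OF conjunct1[OF C] D(1)] by (intro E_map[OF level_map_smult]) auto
  finally have "E N ?A \<ominus>\<^bsub>X N\<^esub> E N ?B = sgn_of F p q \<odot>\<^bsub>X N\<^esub> (E N ?C \<ominus>\<^bsub>X N\<^esub> E N ?D)"
    using minus[OF A(1) B(1)] minus[OF conjunct1[OF C] D(1)] by simp
  then show ?thesis
    unfolding starR_star[OF f g(1) h(1)] A(2) B(2) D(2) conjunct2[OF C]
    using E_closed[OF conjunct1[OF C]] E_closed[OF D(1)] by (simp add: X.koszul_scalar)
qed

lemma associator_dot:
  assumes f: "f \<in> Inv a" and g: "g \<in> Inv b" "g \<in> hpart (X b) p"
    and h: "h \<in> Inv c" "h \<in> hpart (X c) q" and N: "N = a + b + c - 2"
  shows "boxR a b c (dot a b f g) h 0 \<ominus>\<^bsub>X N\<^esub> boxL a b c f (star b c g h) 0 =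
    [koszul p q] \<cdot>\<^bsub>X N\<^esub> (boxR a c b (dot a c f h) g 0 \<ominus>\<^bsub>X N\<^esub> boxL a c b f (star c b h g) 0)"
proof -
  have car: "f \<in> carrier (X a)" "g \<in> carrier (X b)" "h \<in> carrier (X c)"
    using f g h by (auto simp: Inv_closed)
  have cl: "boxR a c b (dot a c f h) g 0 \<in> carrier (X N)" "boxL a c b f (dot c b h g) 0 \<in> carrier (X N)"
    "boxL a b c f (dot b c g h) 0 \<in> carrier (X N)"
    using car by (auto intro!: boxR_closed boxL_closed dot_closed simp: N)
  show ?thesis
    unfolding boxL_star[OF f g(1) h(1)] boxL_star[OF f h(1) g(1)]
    using pre_lie[OF f g h N, of 0] cl by (simp add: dot_def X.koszul_scalar)
qed

lemma starL_linear:
  assumes "f \<in> carrier (X a)" "N = a + b + c - 2"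
  shows "linear_map F (X (b + c - 1)) (X N) (starL a b c f)"
proof (cases "b + c = 0")
  case True
  then show ?thesis
    using assms by (auto simp: starL_def linear_map_def linear_map_axioms_def linear_maps_def X.module_axioms)
next
  case False
  then have M: "N = b + c - 1 + a - 1" using assms(2) by arith
  have "starL a b c f = (\<lambda>w. star a (b + c - 1) f w)" using False by (auto simp: starL_def)
  then show ?thesis using star_linear_right[OF assms(1) M] by simp
qed

lemma starR_linear:
  assumes "h \<in> carrier (X c)" "N = a + b + c - 2"
  shows "linear_map F (X (a + b - 1)) (X N) (\<lambda>w. starR a b c w h)"
proof (cases "a + b = 0")
  case True
  then show ?thesis
    using assms by (auto simp: starR_def linear_map_def linear_map_axioms_def linear_maps_def X.module_axioms)
next
  case False
  then have M: "N = c + (a + b - 1) - 1" using assms(2) by arith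
  have "(\<lambda>w. starR a b c w h) = (\<lambda>w. star (a + b - 1) c w h)" using False by (auto simp: starR_def)
  then show ?thesis using star_linear_left[OF assms(1) M] by simp
qed

text \<open>
  The bracket \<open>[f\<^sub>0 g]\<close> of elements of the parities \<open>p\<close> and \<open>q\<close>.
\<close>

definition bkt :: "nat \<Rightarrow> nat \<Rightarrow> bit \<Rightarrow> bit \<Rightarrow> 'v \<Rightarrow> 'v \<Rightarrow> 'v" where
  "bkt a b p q f g = star a b f g \<ominus>\<^bsub>X (b + a - 1)\<^esub> [koszul p q] \<cdot>\<^bsub>X (b + a - 1)\<^esub> dot b a g f"

lemma bkt_linear:
  assumes l: "linear_map F (X M) W l" and f: "f \<in> carrier (X a)" and g: "g \<in> carrier (X b)"
    and M: "M = b + a - 1"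
  shows "l (bkt a b p q f g) = l (star a b f g) \<ominus>\<^bsub>W\<^esub> [koszul p q] \<cdot>\<^bsub>W\<^esub> l (dot b a g f)"
proof -
  have M': "M = a + b - 1" using M by simp
  have cl: "star a b f g \<in> carrier (X M)" "dot b a g f \<in> carrier (X M)"
    by (rule star_closed[OF f g M] dot_closed[OF g f M'])+
  show ?thesis
    unfolding bkt_def M[symmetric]
    using linear_map.minus[OF l cl(1) X.add.int_pow_closed[OF cl(2)]] linear_map.int_mult[OF l cl(2)]
    by simp
qed

lemma bkt_closed:
  assumes "f \<in> carrier (X a)" "g \<in> carrier (X b)" "M = b + a - 1"
  shows "bkt a b p q f g \<in> carrier (X M)"
proof -
  have M': "M = a + b - 1" using assms(3) by simp
  show ?thesis
    unfolding bkt_def assms(3)[symmetric]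
    by (intro X.minus_closed X.add.int_pow_closed star_closed[OF assms] dot_closed[OF assms(2,1) M'])
qed

text \<open>
  The relations to be combined are the symmetries of the associators of \<open>(f, g, h)\<close> and \<open>(g, f, h)\<close> at
  \<open>\<mu> = -\<partial>\<close> and of \<open>(h, g, f)\<close> at \<open>\<mu> = 0\<close>.
\<close>

lemma jacobi_homogeneous:
  assumes f: "f \<in> Inv a" "f \<in> hpart (X a) p" and g: "g \<in> Inv b" "g \<in> hpart (X b) q"
    and h: "h \<in> Inv c" "h \<in> hpart (X c) r" and N: "N = a + b + c - 2"
  shows "starL a b c f (bkt b c q r g h) \<ominus>\<^bsub>X N\<^esub>
      [koszul p (q + r)] \<cdot>\<^bsub>X N\<^esub> boxR b c a (bkt b c q r g h) f 0 =
    (starR a b c (bkt a b p q f g) h \<ominus>\<^bsub>X N\<^esub>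
      [koszul (p + q) r] \<cdot>\<^bsub>X N\<^esub> boxL c a b h (bkt a b p q f g) 0) \<oplus>\<^bsub>X N\<^esub>
    [koszul p q] \<cdot>\<^bsub>X N\<^esub> (starL b a c g (bkt a c p r f h) \<ominus>\<^bsub>X N\<^esub>
      [koszul q (p + r)] \<cdot>\<^bsub>X N\<^esub> boxR a c b (bkt a c p r f h) g 0)"
proof -
  have car: "f \<in> carrier (X a)" "g \<in> carrier (X b)" "h \<in> carrier (X c)"
    using f g h by (auto simp: Inv_closed)
  have e: "c + b - 1 = b + c - 1" "b + a - 1 = a + b - 1" "c + a - 1 = a + c - 1" by auto
  have N': "N = b + c + a - 2" "N = c + a + b - 2" "N = b + a + c - 2" "N = a + c + b - 2" using N by auto
  note s = star_closed[OF car(2,3) e(1)[symmetric]] star_closed[OF car(1,2) e(2)[symmetric]]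
    star_closed[OF car(1,3) e(3)[symmetric]]
  note d = dot_closed[OF car(3,2), of "b + c - 1", OF refl] dot_closed[OF car(2,1), of "a + b - 1", OF refl]
    dot_closed[OF car(3,1), of "a + c - 1", OF refl]
  note lin = bkt_linear[OF _ car(2,3) e(1)[symmetric]]
    and lin' = bkt_linear[OF _ car(1,2) e(2)[symmetric]]
    and lin'' = bkt_linear[OF _ car(1,3) e(3)[symmetric]]
  have lm: "linear_map F (X (b + c - 1)) (X N) (starL a b c f)"
    "linear_map F (X (b + c - 1)) (X N) (\<lambda>w. boxR b c a w f 0)"
    "linear_map F (X (a + b - 1)) (X N) (\<lambda>w. starR a b c w h)"
    "linear_map F (X (a + b - 1)) (X N) (\<lambda>w. boxL c a b h w 0)"
    "linear_map F (X (a + c - 1)) (X N) (starL b a c g)"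
    "linear_map F (X (a + c - 1)) (X N) (\<lambda>w. boxR a c b w g 0)"
    by (rule starL_linear[OF car(1) N] boxR_linear[OF car(1) N'(1)] starR_linear[OF car(3) N]
        boxL_linear[OF car(3) N'(2)] starL_linear[OF car(2) N'(3)] boxR_linear[OF car(2) N'(4)])+
  have cl: "{starL a b c f (star b c g h), starL a b c f (dot c b h g),
      boxR b c a (star b c g h) f 0, boxR b c a (dot c b h g) f 0,
      starR a b c (star a b f g) h, starR a b c (dot b a g f) h,
      boxL c a b h (star a b f g) 0, boxL c a b h (dot b a g f) 0,
      starL b a c g (star a c f h), starL b a c g (dot c a h f),
      boxR a c b (star a c f h) g 0, boxR a c b (dot c a h f) g 0} \<subseteq> carrier (X N)"
    using s d linear_map.closed[OF lm(1)] linear_map.closed[OF lm(2)] linear_map.closed[OF lm(3)]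
      linear_map.closed[OF lm(4)] linear_map.closed[OF lm(5)] linear_map.closed[OF lm(6)] by simp
  show ?thesis
    unfolding lin[OF lm(1)] lin[OF lm(2)] lin'[OF lm(3)] lin'[OF lm(4)] lin''[OF lm(5)] lin''[OF lm(6)]
      koszul_add koszul_commute[of q p]
  proof (rule X.jacobi_sum[OF cl koszul_sq koszul_sq koszul_sq])
    show "starR a b c (star a b f g) h \<ominus>\<^bsub>X N\<^esub> starL a b c f (star b c g h) =
        [koszul q r] \<cdot>\<^bsub>X N\<^esub> (boxR a c b (star a c f h) g 0 \<ominus>\<^bsub>X N\<^esub> starL a b c f (dot c b h g))"
      using associator_star[OF f(1) g h N] by (simp only: starL_commute[of a c b])
    show "starR a b c (dot b a g f) h \<ominus>\<^bsub>X N\<^esub> starL b a c g (star a c f h) =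
        [koszul p r] \<cdot>\<^bsub>X N\<^esub> (boxR b c a (star b c g h) f 0 \<ominus>\<^bsub>X N\<^esub> starL b a c g (dot c a h f))"
      using associator_star[OF g(1) f h N'(3)]
      by (simp only: starL_commute[of b c a] starR_commute[of b a c] starR_star[OF g(1) f(1) h(1), unfolded starR_commute[of b a c]])
    show "boxR b c a (dot c b h g) f 0 \<ominus>\<^bsub>X N\<^esub> boxL c a b h (dot b a g f) 0 =
        [koszul p q] \<cdot>\<^bsub>X N\<^esub> (boxR a c b (dot c a h f) g 0 \<ominus>\<^bsub>X N\<^esub> boxL c a b h (star a b f g) 0)"
      using associator_dot[OF h(1) g f, of N, unfolded boxL_star[OF h(1) g(1) f(1)]] N
      by (simp add: boxR_commute[of c b a] boxR_commute[of c a b]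
          boxL_commute[of c b a] koszul_commute[of q p] ac_simps)
  qed
qed

section \<open>The bracket of homogeneous invariants\<close>

abbreviation ar :: "int \<Rightarrow> nat" where "ar n \<equiv> nat (n + 1)"

lemma ar_add: "-1 \<le> n \<Longrightarrow> -1 \<le> m \<Longrightarrow> nat (n + m + 1) = ar m + ar n - 1"
  by arith

lemma act_even: "\<sigma> permutes {1..n} \<Longrightarrow> (\<lambda>x. oact P n x \<sigma>) \<in> even_maps F (X n) (X n)"
  using dS_module[of n] by (simp add: dS_module_def)

lemma W_carrier: "carrier (conf_W P n) = Inv (ar n)"
  and W_hpart: "hpart (conf_W P n) p = hpart (X (ar n)) p \<inter> Inv (ar n)"
  and W_add: "x \<oplus>\<^bsub>conf_W P n\<^esub> y = x \<oplus>\<^bsub>X (ar n)\<^esub> y"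
  and W_zero: "\<zero>\<^bsub>conf_W P n\<^esub> = \<zero>\<^bsub>X (ar n)\<^esub>"
  and W_smult: "a \<odot>\<^bsub>conf_W P n\<^esub> x = a \<odot>\<^bsub>X (ar n)\<^esub> x"
  by (simp_all add: conf_W_def invariants_def Inv_def Let_def)

lemma W_superspace: "superspace F (conf_W P n)"
  and W_hcomp: "f \<in> Inv (ar n) \<Longrightarrow> hcomp (conf_W P n) p f = hcomp (X (ar n)) p f"
  and W_inclusion: "linear_map F (conf_W P n) (X (ar n)) (\<lambda>x. x)"
proof -
  show "superspace F (conf_W P n)"
    unfolding conf_W_def by (intro invariants_superspace(1) X.superspace_axioms act_even)
  show "linear_map F (conf_W P n) (X (ar n)) (\<lambda>x. x)"
    unfolding conf_W_def by (intro invariants_superspace(3) X.superspace_axioms act_even)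
  show "hcomp (conf_W P n) p f = hcomp (X (ar n)) p f" if "f \<in> Inv (ar n)"
    using that unfolding conf_W_def
    by (intro invariants_superspace(2)[where F = F] X.superspace_axioms act_even)
      (simp_all flip: conf_W_def add: W_carrier)
qed

lemma hcomp_Inv: "f \<in> Inv a \<Longrightarrow> hcomp (X a) p f \<in> Inv a"
  using hcomp_even_map[OF X.superspace_axioms X.superspace_axioms act_even, of _ a f p]
  by (auto simp: Inv_def)

lemma Inv_zero: "\<zero>\<^bsub>X a\<^esub> \<in> Inv a"
  and Inv_minus: "x \<in> Inv a \<Longrightarrow> y \<in> Inv a \<Longrightarrow> x \<ominus>\<^bsub>X a\<^esub> y \<in> Inv a"
  and Inv_int_mult: "x \<in> Inv a \<Longrightarrow> [(k::int)] \<cdot>\<^bsub>X a\<^esub> x \<in> Inv a"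
  by (auto simp: Inv_def linear_map.zero[OF act_linear] linear_map.minus[OF act_linear]
      linear_map.int_mult[OF act_linear])

lemma Inv_finsum:
  assumes "\<And>i. i \<in> A \<Longrightarrow> f i \<in> Inv a"
  shows "(\<Oplus>\<^bsub>X a\<^esub>i\<in>A. f i) \<in> Inv a"
proof -
  have "oact P a (\<Oplus>\<^bsub>X a\<^esub>i\<in>A. f i) \<sigma> = (\<Oplus>\<^bsub>X a\<^esub>i\<in>A. f i)" if \<sigma>: "\<sigma> permutes {1..a}" for \<sigma>
  proof -
    have "oact P a (\<Oplus>\<^bsub>X a\<^esub>i\<in>A. f i) \<sigma> = (\<Oplus>\<^bsub>X a\<^esub>i\<in>A. oact P a (f i) \<sigma>)"
      using assms by (intro linear_map.finsum[OF act_linear[OF \<sigma>]]) (auto simp: Inv_closed)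
    also have "\<dots> = (\<Oplus>\<^bsub>X a\<^esub>i\<in>A. f i)"
      using assms by (intro X.finsum_cong') (auto simp: Inv_closed Inv_act[OF _ \<sigma>])
    finally show ?thesis .
  qed
  moreover have "(\<Oplus>\<^bsub>X a\<^esub>i\<in>A. f i) \<in> carrier (X a)"
    by (intro X.finsum_closed funcsetI Inv_closed assms)
  ultimately show ?thesis unfolding Inv_def by blast
qed

text \<open>
  The box product at \<open>\<lambda> = 0\<close> involves the substitution \<open>\<lambda> = -\<partial>\<close> in the products of the operad,
  while the substitution \<open>\<lambda> = -\<partial>\<close> in the box product reverts the one in its definition.
\<close>

lemma conf_box_values:
  assumes n: "-1 \<le> n" and m: "-1 \<le> m" and f: "f \<in> carrier (X (ar n))" and g: "g \<in> carrier (X (ar m))"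
    and N: "N = nat (n + m + 1)"
  shows conf_box_null: "pro_null N (conf_box P n m f g)"
    and conf_box_0: "conf_box P n m f g 0 = star (ar n) (ar m) f g"
    and E_conf_box: "E N (conf_box P n m f g) = dot (ar n) (ar m) f g"
proof -
  let ?a = "ar n" and ?b = "ar m"
  let ?c = "ocirc P ?a ?b 1 f g"
  let ?A = "shuffle_perms (int ?b) (int ?a - 1)"
  have N': "N = ?b + ?a - 1" using ar_add[OF n m] N by simp
  have box: "conf_box P n m f g = (\<lambda>k. \<Oplus>\<^bsub>X N\<^esub>\<sigma>\<in>?A. oact P N (subst_neg P N ?c k) (inv_into UNIV \<sigma>))"
    using n m by (simp add: conf_box_def Let_def N fun_eq_iff)
  have p: "inv_into UNIV \<sigma> permutes {1..N}" "1 \<le> ?a" if "\<sigma> \<in> ?A" for \<sigma>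
    using shuffle_inv_permutes[OF that] N' by auto
  have c: "pro_null N ?c" if "\<sigma> \<in> ?A" for \<sigma>
    by (rule pro_null_circ[OF le_refl p(2)[OF that] f g N'])
  have t: "pro_null N (\<lambda>k. oact P N (subst_neg P N ?c k) (inv_into UNIV \<sigma>))"
    "E N (\<lambda>k. oact P N (subst_neg P N ?c k) (inv_into UNIV \<sigma>)) = oact P N (?c 0) (inv_into UNIV \<sigma>)"
    if \<sigma>: "\<sigma> \<in> ?A" for \<sigma>
    using pro_null_map[OF level_map_act[OF p(1)[OF \<sigma>]] pro_null_subst_neg[OF c[OF \<sigma>]]]
      E_map[OF level_map_act[OF p(1)[OF \<sigma>]] pro_null_subst_neg[OF c[OF \<sigma>]]] E_subst_neg[OF c[OF \<sigma>]]
    by auto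
  show "pro_null N (conf_box P n m f g)"
    unfolding box by (rule pro_null_finsum[OF finite_shuffle_perms t(1)])
  have "E N (conf_box P n m f g) =
      (\<Oplus>\<^bsub>X N\<^esub>\<sigma>\<in>?A. E N (\<lambda>k. oact P N (subst_neg P N ?c k) (inv_into UNIV \<sigma>)))"
    unfolding box by (rule E_finsum[OF finite_shuffle_perms t(1)])
  also have "\<dots> = (\<Oplus>\<^bsub>X N\<^esub>\<sigma>\<in>?A. oact P N (?c 0) (inv_into UNIV \<sigma>))"
    by (intro X.finsum_cong'[OF refl] t(2) funcsetI act_closed p pro_null_closed[OF c])
  finally show "E N (conf_box P n m f g) = dot ?a ?b f g" by (simp add: dot_def bul_def N')
  have t': "pro_null N (\<lambda>k. oact P N (?c k) (inv_into UNIV \<sigma>))"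
    "E N (\<lambda>k. oact P N (?c k) (inv_into UNIV \<sigma>)) = oact P N (E N ?c) (inv_into UNIV \<sigma>)"
    if \<sigma>: "\<sigma> \<in> ?A" for \<sigma>
    using pro_null_map[OF level_map_act[OF p(1)[OF \<sigma>]] c[OF \<sigma>]] E_map[OF level_map_act[OF p(1)[OF \<sigma>]] c[OF \<sigma>]]
    by auto
  have "star ?a ?b f g = E N (\<lambda>k. \<Oplus>\<^bsub>X N\<^esub>\<sigma>\<in>?A. oact P N (?c k) (inv_into UNIV \<sigma>))"
    unfolding star_def bul_def N' ..
  also have "\<dots> = (\<Oplus>\<^bsub>X N\<^esub>\<sigma>\<in>?A. E N (\<lambda>k. oact P N (?c k) (inv_into UNIV \<sigma>)))"
    by (rule E_finsum[OF finite_shuffle_perms t'(1)])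
  also have "\<dots> = (\<Oplus>\<^bsub>X N\<^esub>\<sigma>\<in>?A. oact P N (subst_neg P N ?c 0) (inv_into UNIV \<sigma>))"
  proof (intro X.finsum_cong'[OF refl] funcsetI act_closed p subst_neg_closed[OF c])
    fix \<sigma> assume \<sigma>: "\<sigma> \<in> ?A"
    show "E N (\<lambda>k. oact P N (?c k) (inv_into UNIV \<sigma>)) = oact P N (subst_neg P N ?c 0) (inv_into UNIV \<sigma>)"
      unfolding subst_neg_0[OF c[OF \<sigma>]] by (rule t'(2)[OF \<sigma>])
  qed
  also have "\<dots> = conf_box P n m f g 0" unfolding box ..
  finally show "conf_box P n m f g 0 = star ?a ?b f g" by simp
qed

text \<open>The bilinear extension of \<open>bkt\<close>.\<close>

definition deg_bracket :: "nat \<Rightarrow> nat \<Rightarrow> 'v \<Rightarrow> 'v \<Rightarrow> 'v" where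
  "deg_bracket a b f g = (\<Oplus>\<^bsub>X (b + a - 1)\<^esub>p\<in>{0, 1}. \<Oplus>\<^bsub>X (b + a - 1)\<^esub>q\<in>{0, 1}.
     bkt a b p q (hcomp (X a) p f) (hcomp (X b) q g))"

lemma conf_bracket_deg_0:
  assumes n: "-1 \<le> n" and m: "-1 \<le> m" and f: "f \<in> Inv (ar n)" and g: "g \<in> Inv (ar m)"
  shows "conf_bracket_deg P n m f g 0 = deg_bracket (ar n) (ar m) f g"
proof -
  have N: "nat (n + m + 1) = ar m + ar n - 1" "ar m + ar n - 1 = nat (m + n + 1)"
    using n m by auto
  have "conf_box P n m (hcomp (conf_W P n) p f) (hcomp (conf_W P m) q g) 0 =
      star (ar n) (ar m) (hcomp (X (ar n)) p f) (hcomp (X (ar m)) q g)"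
    "subst_neg P (ar m + ar n - 1) (conf_box P m n (hcomp (conf_W P m) q g) (hcomp (conf_W P n) p f)) 0 =
      dot (ar m) (ar n) (hcomp (X (ar m)) q g) (hcomp (X (ar n)) p f)" for p q
    unfolding W_hcomp[OF f] W_hcomp[OF g]
    using conf_box_0[OF n m _ _ refl] subst_neg_0[OF conf_box_null[OF m n _ _ N(2)]] E_conf_box[OF m n _ _ N(2)]
      Inv_closed[OF f] Inv_closed[OF g] by simp_all
  then show ?thesis
    by (simp only: conf_bracket_deg_def Let_def N(1) deg_bracket_def bkt_def)
qed

lemma hcomp_linear_map: "linear_map F (X a) (X a) (hcomp (X a) p)"
  by (intro linear_map.intro linear_map_axioms.intro X.module_axioms X.hcomp_linear)

lemma bkt_linear_left:
  assumes "g \<in> carrier (X b)" "N = b + a - 1"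
  shows "linear_map F (X a) (X N) (\<lambda>f. bkt a b p q f g)"
  unfolding bkt_def assms(2)[symmetric] using assms
  by (intro linear_map_diff star_linear_left dot_linear_right) auto

lemma bkt_linear_right:
  assumes "f \<in> carrier (X a)" "N = b + a - 1"
  shows "linear_map F (X b) (X N) (\<lambda>g. bkt a b p q f g)"
  unfolding bkt_def assms(2)[symmetric] using assms
  by (intro linear_map_diff star_linear_right dot_linear_left) auto

lemma deg_bracket_linear_left:
  assumes "g \<in> carrier (X b)" "N = b + a - 1"
  shows "linear_map F (X a) (X N) (\<lambda>f. deg_bracket a b f g)"
  unfolding deg_bracket_def assms(2)[symmetric]
  by (intro finsum_linear linear_map_comp[OF hcomp_linear_map bkt_linear_left[OF _ assms(2)]])
    (simp_all add: assms(1))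

lemma deg_bracket_linear_right:
  assumes "f \<in> carrier (X a)" "N = b + a - 1"
  shows "linear_map F (X b) (X N) (\<lambda>g. deg_bracket a b f g)"
  unfolding deg_bracket_def assms(2)[symmetric]
  by (intro finsum_linear linear_map_comp[OF hcomp_linear_map bkt_linear_right[OF _ assms(2)]])
    (simp_all add: assms(1))

lemma bkt_Inv:
  assumes "f \<in> Inv a" "g \<in> Inv b" "N = b + a - 1"
  shows "bkt a b p q f g \<in> Inv N"
proof -
  have N': "N = a + b - 1" using assms(3) by simp
  show ?thesis
    unfolding bkt_def assms(3)[symmetric]
    by (intro Inv_minus Inv_int_mult star_Inv[OF assms] dot_Inv[OF assms(2,1) N'])
qed

lemma bkt_hpart:
  assumes "f \<in> hpart (X a) p" "g \<in> hpart (X b) q" "N = b + a - 1"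
  shows "bkt a b p q f g \<in> hpart (X N) (p + q)"
proof -
  have N': "N = a + b - 1" using assms(3) by simp
  have d: "dot b a g f \<in> hpart (X N) (p + q)"
    using dot_hpart[OF assms(2,1) N'] unfolding add.commute[of q p] .
  note s = star_hpart[OF assms]
  show ?thesis
    unfolding bkt_def assms(3)[symmetric] using s d X.hpart_closed[OF s] X.hpart_closed[OF d]
    by (simp add: X.minus_scalar X.koszul_scalar)
qed

lemma deg_bracket_Inv:
  assumes "f \<in> Inv a" "g \<in> Inv b" "N = b + a - 1"
  shows "deg_bracket a b f g \<in> Inv N"
  unfolding deg_bracket_def assms(3)[symmetric]
  by (intro Inv_finsum bkt_Inv[OF hcomp_Inv[OF assms(1)] hcomp_Inv[OF assms(2)] assms(3)])

lemma deg_bracket_homogeneous: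
  assumes f: "f \<in> hpart (X a) p" and g: "g \<in> hpart (X b) q"
  shows "deg_bracket a b f g = bkt a b p q f g"
proof -
  let ?N = "b + a - 1"
  have cl: "f \<in> carrier (X a)" "g \<in> carrier (X b)" using f g by auto
  have z: "bkt a b p' q' \<zero>\<^bsub>X a\<^esub> g' = \<zero>\<^bsub>X ?N\<^esub>" if "g' \<in> carrier (X b)" for p' q' g'
    by (rule linear_map.zero[OF bkt_linear_left[OF that refl]])
  have z': "bkt a b p' q' f' \<zero>\<^bsub>X b\<^esub> = \<zero>\<^bsub>X ?N\<^esub>" if "f' \<in> carrier (X a)" for p' q' f'
    by (rule linear_map.zero[OF bkt_linear_right[OF that refl]])
  have c: "bkt a b p q f g \<in> carrier (X ?N)" by (rule bkt_closed[OF cl refl])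
  show ?thesis
    unfolding deg_bracket_def X.hcomp_homogeneous[OF f] X.hcomp_homogeneous[OF g]
    using c cl by (cases p; cases q; simp add: z z')
qed

lemma deg_bracket_even:
  assumes n: "-1 \<le> n" and m: "-1 \<le> m" and nm: "-1 \<le> n + m"
  shows "even_bilinear F (conf_W P n) (conf_W P m) (conf_W P (n + m)) (\<lambda>f g. conf_bracket_deg P n m f g 0)"
proof -
  have N: "ar (n + m) = ar m + ar n - 1" using n m by auto
  have e: "conf_bracket_deg P n m f g 0 = deg_bracket (ar n) (ar m) f g" "deg_bracket (ar n) (ar m) f g \<in> Inv (ar (n + m))"
    if "f \<in> Inv (ar n)" "g \<in> Inv (ar m)" for f g
    using conf_bracket_deg_0[OF n m that] deg_bracket_Inv[OF that N] by auto
  interpret n: superspace F "conf_W P n" by (rule W_superspace)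
  interpret m: superspace F "conf_W P m" by (rule W_superspace)
  note cl = n.M.a_closed[of _ _, unfolded W_carrier W_add] n.smult_closed[unfolded W_carrier W_smult]
    m.M.a_closed[unfolded W_carrier W_add] m.smult_closed[unfolded W_carrier W_smult]
  have "(\<lambda>g. conf_bracket_deg P n m f g 0) \<in> linear_maps F (conf_W P m) (conf_W P (n + m))"
    if f: "f \<in> carrier (conf_W P n)" for f
  proof -
    interpret l: linear_map F "X (ar m)" "X (ar (n + m))" "deg_bracket (ar n) (ar m) f"
      using f by (intro deg_bracket_linear_right N) (simp add: W_carrier Inv_closed)
    show ?thesis
      using f by (auto simp: linear_maps_def W_carrier W_add W_smult e cl l.add l.scale Inv_closed)
  qed
  moreover have "(\<lambda>f. conf_bracket_deg P n m f g 0) \<in> linear_maps F (conf_W P n) (conf_W P (n + m))"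
    if g: "g \<in> carrier (conf_W P m)" for g
  proof -
    interpret l: linear_map F "X (ar n)" "X (ar (n + m))" "\<lambda>f. deg_bracket (ar n) (ar m) f g"
      using g by (intro deg_bracket_linear_left N) (simp add: W_carrier Inv_closed)
    show ?thesis
      using g by (auto simp: linear_maps_def W_carrier W_add W_smult e cl l.add l.scale Inv_closed)
  qed
  moreover have "conf_bracket_deg P n m f g 0 \<in> hpart (conf_W P (n + m)) (p + q)"
    if "f \<in> hpart (conf_W P n) p" "g \<in> hpart (conf_W P m) q" for f g p q
  proof -
    have fg: "f \<in> Inv (ar n)" "f \<in> hpart (X (ar n)) p" "g \<in> Inv (ar m)" "g \<in> hpart (X (ar m)) q"
      using that by (auto simp: W_hpart)
    show ?thesis
      unfolding e(1)[OF fg(1,3)] W_hpart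
      using e(2)[OF fg(1,3)] bkt_hpart[OF fg(2,4) N] deg_bracket_homogeneous[OF fg(2,4)] by simp
  qed
  ultimately show ?thesis unfolding even_bilinear_def by blast
qed

sublocale T: dsum_product F "conf_W P" "\<lambda>n m f g. conf_bracket_deg P n m f g 0"
  by (intro dsum_product.intro dsum.intro dsum_product_axioms.intro W_superspace deg_bracket_even)

lemma conf_bracket_br: "conf_bracket P x y 0 = T.br x y"
  by (simp add: conf_bracket_def T.br_def)

section \<open>The bracket on the direct sum\<close>

lemma T_hpart: "f \<in> hpart (conf_W P i) p \<Longrightarrow> f \<in> Inv (ar i)"
  "f \<in> hpart (conf_W P i) p \<Longrightarrow> f \<in> hpart (X (ar i)) p"
  by (auto simp: W_hpart)

lemma br_emb_bkt:
  assumes i: "-1 \<le> i" and j: "-1 \<le> j" and f: "f \<in> hpart (conf_W P i) p" and g: "g \<in> hpart (conf_W P j) q"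
  shows "T.br (dsum_emb (conf_W P) i f) (dsum_emb (conf_W P) j g) =
    dsum_emb (conf_W P) (i + j) (bkt (ar i) (ar j) p q f g)"
proof -
  note f' = T_hpart[OF f] and g' = T_hpart[OF g]
  have "f \<in> carrier (conf_W P i)" "g \<in> carrier (conf_W P j)" using f' g' by (auto simp: W_carrier)
  then show ?thesis
    using T.br_emb[OF i j] conf_bracket_deg_0[OF i j f'(1) g'(1)] deg_bracket_homogeneous[OF f'(2) g'(2)]
    by simp
qed

lemma emb_zero_or_low: "(-1 \<le> s \<Longrightarrow> N = ar s) \<Longrightarrow> dsum_emb (conf_W P) s \<zero>\<^bsub>X N\<^esub> = \<zero>\<^bsub>T.D\<^esub>"
  using T.emb_zero[of s] T.emb_low[of s "\<zero>\<^bsub>X N\<^esub>"] by (cases "-1 \<le> s") (auto simp: W_zero)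

lemma br_zero: "x \<in> carrier T.D \<Longrightarrow> T.br x \<zero>\<^bsub>T.D\<^esub> = \<zero>\<^bsub>T.D\<^esub>"
    "x \<in> carrier T.D \<Longrightarrow> T.br \<zero>\<^bsub>T.D\<^esub> x = \<zero>\<^bsub>T.D\<^esub>"
  and br_add: "x \<in> carrier T.D \<Longrightarrow> y \<in> carrier T.D \<Longrightarrow> z \<in> carrier T.D \<Longrightarrow>
      T.br x (y \<oplus>\<^bsub>T.D\<^esub> z) = T.br x y \<oplus>\<^bsub>T.D\<^esub> T.br x z"
    "x \<in> carrier T.D \<Longrightarrow> y \<in> carrier T.D \<Longrightarrow> z \<in> carrier T.D \<Longrightarrow>
      T.br (y \<oplus>\<^bsub>T.D\<^esub> z) x = T.br y x \<oplus>\<^bsub>T.D\<^esub> T.br z x"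
proof -
  have l: "linear_map F T.D T.D (T.br x)" "linear_map F T.D T.D (\<lambda>y. T.br y x)" if "x \<in> carrier T.D" for x
    using T.br_bilinear that T.D_module
    by (auto simp: even_bilinear_def linear_map_def linear_map_axioms_def)
  show "x \<in> carrier T.D \<Longrightarrow> T.br x \<zero>\<^bsub>T.D\<^esub> = \<zero>\<^bsub>T.D\<^esub>" "x \<in> carrier T.D \<Longrightarrow> T.br \<zero>\<^bsub>T.D\<^esub> x = \<zero>\<^bsub>T.D\<^esub>"
    by (rule linear_map.zero[OF l(1)] linear_map.zero[OF l(2)]; assumption)+
  show "x \<in> carrier T.D \<Longrightarrow> y \<in> carrier T.D \<Longrightarrow> z \<in> carrier T.D \<Longrightarrow>
      T.br x (y \<oplus>\<^bsub>T.D\<^esub> z) = T.br x y \<oplus>\<^bsub>T.D\<^esub> T.br x z"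
    "x \<in> carrier T.D \<Longrightarrow> y \<in> carrier T.D \<Longrightarrow> z \<in> carrier T.D \<Longrightarrow>
      T.br (y \<oplus>\<^bsub>T.D\<^esub> z) x = T.br y x \<oplus>\<^bsub>T.D\<^esub> T.br z x"
    by (rule linear_map.add[OF l(1)] linear_map.add[OF l(2)]; assumption)+
qed

lemma arity_pred: "b + c \<noteq> (0::nat) \<Longrightarrow> b + c - 1 + a - 1 = a + b + c - 2"
  by arith

text \<open>
  If the degrees of \<open>g\<close> and \<open>h\<close> add up to less than \<open>-1\<close>, then both sides vanish, by the convention in
  \<open>boxL\<close> and \<open>starL\<close>.
\<close>

lemma br_nested_right:
  assumes i: "-1 \<le> i" and j: "-1 \<le> j" and k: "-1 \<le> k" and f: "f \<in> hpart (conf_W P i) p"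
    and g: "g \<in> hpart (conf_W P j) q" and h: "h \<in> hpart (conf_W P k) r"
    and N: "N = ar i + ar j + ar k - 2" and u: "u = bkt (ar j) (ar k) q r g h"
  shows "T.br (dsum_emb (conf_W P) i f) (T.br (dsum_emb (conf_W P) j g) (dsum_emb (conf_W P) k h)) =
    dsum_emb (conf_W P) (i + j + k) (starL (ar i) (ar j) (ar k) f u
      \<ominus>\<^bsub>X N\<^esub> [koszul p (q + r)] \<cdot>\<^bsub>X N\<^esub> boxR (ar j) (ar k) (ar i) u f 0)"
proof (cases "ar j + ar k = 0")
  case True
  have low: "j + k < -1" using True j k by arith
  have "starL (ar i) (ar j) (ar k) f u \<ominus>\<^bsub>X N\<^esub> [koszul p (q + r)] \<cdot>\<^bsub>X N\<^esub> boxR (ar j) (ar k) (ar i) u f 0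
      = \<zero>\<^bsub>X N\<^esub>"
    using True by (simp add: starL_def boxR_def N X.minus_eq)
  moreover have "-1 \<le> i + j + k \<Longrightarrow> N = ar (i + j + k)" using True j k N by arith
  moreover have "dsum_emb (conf_W P) i f \<in> carrier T.D"
    using T_hpart[OF f] by (intro T.emb_closed) (simp add: W_carrier)
  ultimately show ?thesis
    unfolding br_emb_bkt[OF j k g h] T.emb_low[OF low] by (simp add: br_zero emb_zero_or_low)
next
  case False
  have jk: "-1 \<le> j + k" and e: "ar (j + k) = ar j + ar k - 1" using False j k by arith+
  have e': "ar (j + k) = ar k + ar j - 1" and M: "ar j + ar k - 1 + ar i - 1 = N"
    using e arity_pred[OF False, of "ar i"] N by (simp_all add: ac_simps)
  have hp: "u \<in> hpart (conf_W P (j + k)) (q + r)"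
    unfolding u W_hpart by (intro IntI bkt_Inv[OF T_hpart(1)[OF g] T_hpart(1)[OF h] e']
        bkt_hpart[OF T_hpart(2)[OF g] T_hpart(2)[OF h] e'])
  show ?thesis
    unfolding br_emb_bkt[OF j k g h, folded u] br_emb_bkt[OF i jk f hp] starL_def boxR_def if_not_P[OF False]
    unfolding bkt_def[of _ "ar (j + k)"] dot_def unfolding e M unfolding add.assoc ..
qed

lemma br_nested_left:
  assumes i: "-1 \<le> i" and j: "-1 \<le> j" and k: "-1 \<le> k" and f: "f \<in> hpart (conf_W P i) p"
    and g: "g \<in> hpart (conf_W P j) q" and h: "h \<in> hpart (conf_W P k) r"
    and N: "N = ar i + ar j + ar k - 2" and u: "u = bkt (ar i) (ar j) p q f g"
  shows "T.br (T.br (dsum_emb (conf_W P) i f) (dsum_emb (conf_W P) j g)) (dsum_emb (conf_W P) k h) =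
    dsum_emb (conf_W P) (i + j + k) (starR (ar i) (ar j) (ar k) u h
      \<ominus>\<^bsub>X N\<^esub> [koszul (p + q) r] \<cdot>\<^bsub>X N\<^esub> boxL (ar k) (ar i) (ar j) h u 0)"
proof (cases "ar i + ar j = 0")
  case True
  have low: "i + j < -1" using True i j by arith
  have M: "ar k + ar i + ar j - 2 = N" using N by arith
  have "starR (ar i) (ar j) (ar k) u h \<ominus>\<^bsub>X N\<^esub> [koszul (p + q) r] \<cdot>\<^bsub>X N\<^esub> boxL (ar k) (ar i) (ar j) h u 0
      = \<zero>\<^bsub>X N\<^esub>"
    unfolding starR_def boxL_def if_P[OF True] M N[symmetric] by (simp add: X.minus_eq)
  moreover have "-1 \<le> i + j + k \<Longrightarrow> N = ar (i + j + k)" using True i j N by arith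
  moreover have "dsum_emb (conf_W P) k h \<in> carrier T.D"
    using T_hpart[OF h] by (intro T.emb_closed) (simp add: W_carrier)
  ultimately show ?thesis
    unfolding br_emb_bkt[OF i j f g] T.emb_low[OF low] by (simp add: br_zero emb_zero_or_low)
next
  case False
  have ij: "-1 \<le> i + j" and e: "ar (i + j) = ar i + ar j - 1" using False i j by arith+
  have e': "ar (i + j) = ar j + ar i - 1" and M: "ar k + (ar i + ar j - 1) - 1 = N"
    using e arity_pred[OF False, of "ar k"] N by (simp_all add: ac_simps)
  have hp: "u \<in> hpart (conf_W P (i + j)) (p + q)"
    unfolding u W_hpart by (intro IntI bkt_Inv[OF T_hpart(1)[OF f] T_hpart(1)[OF g] e']
        bkt_hpart[OF T_hpart(2)[OF f] T_hpart(2)[OF g] e'])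
  show ?thesis
    unfolding br_emb_bkt[OF i j f g, folded u] br_emb_bkt[OF ij k hp h] starR_def boxL_def if_not_P[OF False]
    unfolding bkt_def[of "ar (i + j)"] dot_def unfolding e M ..
qed

lemma emb_combination:
  assumes "w \<in> carrier (X N)" "-1 \<le> s \<Longrightarrow> N = ar s"
  shows "dsum_emb (conf_W P) s (v \<oplus>\<^bsub>X N\<^esub> [koszul p q] \<cdot>\<^bsub>X N\<^esub> w) =
    dsum_emb (conf_W P) s v \<oplus>\<^bsub>T.D\<^esub> sgn_of F p q \<odot>\<^bsub>T.D\<^esub> dsum_emb (conf_W P) s w"
proof
  fix n
  consider "n < -1" | "-1 \<le> n" "n = s" | "-1 \<le> n" "n \<noteq> s" by linarith
  then show "dsum_emb (conf_W P) s (v \<oplus>\<^bsub>X N\<^esub> [koszul p q] \<cdot>\<^bsub>X N\<^esub> w) n =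
    (dsum_emb (conf_W P) s v \<oplus>\<^bsub>T.D\<^esub> sgn_of F p q \<odot>\<^bsub>T.D\<^esub> dsum_emb (conf_W P) s w) n"
  proof cases
    case 1
    then show ?thesis by (simp add: dsum_emb_def dsum_space_def)
  next
    case 2
    then have N: "N = ar s" using assms(2) by simp
    show ?thesis
      using 2 assms(1) unfolding T.D_add[OF 2(1)] T.D_smult[OF 2(1)] N W_add W_smult
      by (simp add: X.koszul_scalar)
  next
    case 3
    then show ?thesis
      using T.W.smult_closed[of "sgn_of F p q" "\<zero>\<^bsub>conf_W P n\<^esub>"]
      by (simp add: T.D_add T.D_smult T.emb_other)
  qed
qed

definition leibniz :: "bit \<Rightarrow> bit \<Rightarrow> (int \<Rightarrow> 'v) \<Rightarrow> (int \<Rightarrow> 'v) \<Rightarrow> (int \<Rightarrow> 'v) \<Rightarrow> bool" where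
  "leibniz p q x y z \<longleftrightarrow> T.br x (T.br y z) =
     T.br (T.br x y) z \<oplus>\<^bsub>T.D\<^esub> sgn_of F p q \<odot>\<^bsub>T.D\<^esub> T.br y (T.br x z)"

lemma leibniz_emb:
  assumes i: "-1 \<le> i" and j: "-1 \<le> j" and k: "-1 \<le> k" and f: "f \<in> hpart (conf_W P i) p"
    and g: "g \<in> hpart (conf_W P j) q" and h: "h \<in> hpart (conf_W P k) r"
  shows "leibniz p q (dsum_emb (conf_W P) i f) (dsum_emb (conf_W P) j g) (dsum_emb (conf_W P) k h)"
proof -
  define N where "N = ar i + ar j + ar k - 2"
  have N': "N = ar j + ar i + ar k - 2" "N = ar i + ar k + ar j - 2" using N_def by arith+
  have s: "-1 \<le> i + j + k \<Longrightarrow> N = ar (i + j + k)" using i j k N_def by arith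
  have car: "f \<in> carrier (X (ar i))" "g \<in> carrier (X (ar j))" "h \<in> carrier (X (ar k))"
    using T_hpart f g h Inv_closed by auto
  have ik: "ar i + ar k - 1 = ar k + ar i - 1" by simp
  have c: "starL (ar j) (ar i) (ar k) g (bkt (ar i) (ar k) p r f h)
      \<ominus>\<^bsub>X N\<^esub> [koszul q (p + r)] \<cdot>\<^bsub>X N\<^esub> boxR (ar i) (ar k) (ar j) (bkt (ar i) (ar k) p r f h) g 0 \<in> carrier (X N)"
    by (intro X.minus_closed X.add.int_pow_closed linear_map.closed[OF starL_linear[OF car(2) N'(1)]]
        boxR_closed[OF _ car(2) N'(2)] bkt_closed[OF car(1,3) ik])
  have e: "j + i + k = i + j + k" by simp
  show ?thesis
    unfolding leibniz_def br_nested_right[OF i j k f g h N_def refl] br_nested_left[OF i j k f g h N_def refl]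
      br_nested_right[OF j i k g f h N'(1) refl]
      jacobi_homogeneous[OF T_hpart[OF f] T_hpart[OF g] T_hpart[OF h] N_def] e
    by (rule emb_combination[OF c s])
qed

lemma leibniz_add:
  assumes "x \<in> carrier T.D" "y \<in> carrier T.D" "z \<in> carrier T.D" "w \<in> carrier T.D"
  shows "leibniz p q x y z \<Longrightarrow> leibniz p q w y z \<Longrightarrow> leibniz p q (x \<oplus>\<^bsub>T.D\<^esub> w) y z"
    and "leibniz p q x y z \<Longrightarrow> leibniz p q x w z \<Longrightarrow> leibniz p q x (y \<oplus>\<^bsub>T.D\<^esub> w) z"
    and "leibniz p q x y z \<Longrightarrow> leibniz p q x y w \<Longrightarrow> leibniz p q x y (z \<oplus>\<^bsub>T.D\<^esub> w)"
  unfolding leibniz_def using assms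
  by (simp_all add: br_add T.br_closed T.D.smult_r_distr T.D.M.a_ac)

lemma leibniz_zero:
  assumes "x \<in> carrier T.D" "y \<in> carrier T.D"
  shows "leibniz p q \<zero>\<^bsub>T.D\<^esub> x y" "leibniz p q x \<zero>\<^bsub>T.D\<^esub> y" "leibniz p q x y \<zero>\<^bsub>T.D\<^esub>"
  unfolding leibniz_def using assms by (simp_all add: br_zero T.br_closed)

lemma T_leibniz:
  assumes x: "x \<in> hpart T.D p" and y: "y \<in> hpart T.D q" and z: "z \<in> carrier T.D"
  shows "T.br x (T.br y z) = T.br (T.br x y) z \<oplus>\<^bsub>T.D\<^esub> sgn_of F p q \<odot>\<^bsub>T.D\<^esub> T.br y (T.br x z)"
proof -
  note cl = T.D.hpart_closed
  have emb: "dsum_emb (conf_W P) n f \<in> carrier T.D" if "f \<in> hpart (conf_W P n) p" for n f p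
    by (rule cl[OF T.emb_hpart[OF that]])
  have 1: "leibniz p q (dsum_emb (conf_W P) i f) (dsum_emb (conf_W P) j g) z"
    if ij: "-1 \<le> i" "-1 \<le> j" and f: "f \<in> hpart (conf_W P i) p" and g: "g \<in> hpart (conf_W P j) q"
      and z: "z \<in> hpart T.D r" for i j f g z r
    using z
  proof (induction rule: T.homogeneous_induct)
    case zero
    show ?case by (rule leibniz_zero(3)[OF emb[OF f] emb[OF g]])
  next
    case (add z w)
    show ?case by (rule leibniz_add(3)[OF emb[OF f] emb[OF g] cl[OF add(1)] cl[OF add(2)] add(3,4)])
  next
    case (emb n h)
    show ?case by (rule leibniz_emb[OF ij emb(1) f g emb(2)])
  qed
  have 2: "leibniz p q (dsum_emb (conf_W P) i f) y z"
    if i: "-1 \<le> i" and f: "f \<in> hpart (conf_W P i) p" and z: "z \<in> hpart T.D r" for i f z r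
    using y
  proof (induction rule: T.homogeneous_induct)
    case zero
    show ?case by (rule leibniz_zero(2)[OF emb[OF f] cl[OF z]])
  next
    case (add y w)
    show ?case by (rule leibniz_add(2)[OF emb[OF f] cl[OF add(1)] cl[OF z] cl[OF add(2)] add(3,4)])
  next
    case (emb n h)
    show ?case by (rule 1[OF i emb(1) f emb(2) z])
  qed
  have 3: "leibniz p q x y z" if z: "z \<in> hpart T.D r" for z r
    using x
  proof (induction rule: T.homogeneous_induct)
    case zero
    show ?case by (rule leibniz_zero(1)[OF cl[OF y] cl[OF z]])
  next
    case (add x w)
    show ?case by (rule leibniz_add(1)[OF cl[OF add(1)] cl[OF y] cl[OF z] cl[OF add(2)] add(3,4)])
  next
    case (emb n h)
    show ?case by (rule 2[OF emb(1) emb(2) z])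
  qed
  have "leibniz p q x y (hcomp T.D 0 z \<oplus>\<^bsub>T.D\<^esub> hcomp T.D 1 z)"
    by (rule leibniz_add(3)[OF cl[OF x] cl[OF y] _ _ 3[OF T.D.hcomp_hpart[OF z]] 3[OF T.D.hcomp_hpart[OF z]]])
      (rule T.D.hcomp_closed[OF z])+
  then show ?thesis unfolding T.D.hcomp_sum[OF z] leibniz_def .
qed

lemma Inv_der: "f \<in> Inv n \<Longrightarrow> oder P n f \<in> Inv n"
  using act_der[of f n] by (auto simp: Inv_def)

lemma W_der_even: "oder P (ar n) \<in> even_maps F (conf_W P n) (conf_W P n)"
  using X.even[of "ar n"]
  by (auto simp: even_maps_def linear_maps_def W_carrier W_hpart W_add W_smult Inv_der Inv_closed)

sublocale dmap: dsum_map F "conf_W P" "conf_W P" "\<lambda>n. oder P (ar n)"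
  by (intro dsum_map.intro dsum_map_axioms.intro T.dsum_axioms W_der_even)

sublocale WD: even_endomorphism F "conf_W P n" "oder P (ar n)" for n
  by (intro even_endomorphism.intro even_endomorphism_axioms.intro W_superspace W_der_even)

sublocale TD: even_endomorphism F T.D dmap.H
  by (intro even_endomorphism.intro even_endomorphism_axioms.intro T.D_superspace dmap.H_even)

lemma deg_bracket_der:
  assumes f: "f \<in> carrier (X a)" and g: "g \<in> carrier (X b)" and N: "N = b + a - 1"
  shows "deg_bracket a b (oder P a f) g = \<zero>\<^bsub>X N\<^esub>"
    and "deg_bracket a b f (oder P b g) = oder P N (deg_bracket a b f g)"
proof -
  have N': "N = a + b - 1" using N by simp
  have hc: "hcomp (X n) p (oder P n x) = oder P n (hcomp (X n) p x)" if "x \<in> carrier (X n)" for n p x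
    by (rule hcomp_even_map[OF X.superspace_axioms X.superspace_axioms X.even that])
  have l: "bkt a b p q (oder P a u) v = \<zero>\<^bsub>X N\<^esub>" and r: "bkt a b p q u (oder P b v) = oder P N (bkt a b p q u v)"
    if u: "u \<in> carrier (X a)" and v: "v \<in> carrier (X b)" for p q u v
  proof -
    show "bkt a b p q (oder P a u) v = \<zero>\<^bsub>X N\<^esub>"
      unfolding bkt_def N[symmetric] star_der_left[OF u v N] dot_der_right[OF v u N'] by (simp add: X.minus_eq)
    show "bkt a b p q u (oder P b v) = oder P N (bkt a b p q u v)"
      unfolding bkt_def N[symmetric] star_der_right[OF u v N] dot_der_left[OF v u N']
      using star_closed[OF u v N] dot_closed[OF v u N'] by (simp add: X.d.minus X.d.int_mult)
  qed
  have c: "hcomp (X a) p f \<in> carrier (X a)" "hcomp (X b) p g \<in> carrier (X b)" for p using f g by auto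
  have b: "bkt a b p q (hcomp (X a) p f) (hcomp (X b) q g) \<in> carrier (X N)" for p q
    by (rule bkt_closed[OF c N])
  show "deg_bracket a b (oder P a f) g = \<zero>\<^bsub>X N\<^esub>"
    unfolding deg_bracket_def hc[OF f] N[symmetric] l[OF c] by simp
  show "deg_bracket a b f (oder P b g) = oder P N (deg_bracket a b f g)"
    unfolding deg_bracket_def hc[OF g] N[symmetric] r[OF c] using b by (simp add: X.d.add)
qed

text \<open>
  This is the sesquilinearity of the \<open>\<lambda>\<close>-bracket at \<open>\<lambda> = 0\<close>.
\<close>

lemma br_der:
  assumes x: "x \<in> carrier T.D" and y: "y \<in> carrier T.D"
  shows br_der_left: "T.br (dmap.H x) y = \<zero>\<^bsub>T.D\<^esub>"
    and br_der_right: "T.br x (dmap.H y) = dmap.H (T.br x y)"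
proof -
  have inv: "x i \<in> Inv (ar i)" "y i \<in> Inv (ar i)" if "-1 \<le> i" for i
    using T.D_closed[OF x that] T.D_closed[OF y that] by (auto simp: W_carrier)
  have e: "ar n = ar (n - i) + ar i - 1" "-1 \<le> n - i" "-1 \<le> i" if "-1 \<le> n" "i \<in> {-1..n + 1}" for n i
    using that by auto
  show "T.br (dmap.H x) y = \<zero>\<^bsub>T.D\<^esub>"
  proof (rule T.D_eqI)
    fix n :: int assume n: "-1 \<le> n"
    have "conf_bracket_deg P i (n - i) (dmap.H x i) (y (n - i)) 0 = \<zero>\<^bsub>conf_W P n\<^esub>" if "i \<in> {-1..n + 1}" for i
    proof -
      note e = e[OF n that]
      note xi = inv(1)[OF e(3)] and yi = inv(2)[OF e(2)]
      have "dmap.H x i = oder P (ar i) (x i)" using e(3) by (rule dmap.H_app)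
      then show ?thesis
        using conf_bracket_deg_0[OF e(3,2) Inv_der[OF xi] yi]
          deg_bracket_der(1)[OF Inv_closed[OF xi] Inv_closed[OF yi] e(1)] by (simp add: W_zero)
    qed
    then have "(\<Oplus>\<^bsub>conf_W P n\<^esub>i\<in>{-1..n + 1}. conf_bracket_deg P i (n - i) (dmap.H x i) (y (n - i)) 0) = \<zero>\<^bsub>conf_W P n\<^esub>"
      by (rule T.W.M.add.finprod_one_eqI)
    then show "T.br (dmap.H x) y n = \<zero>\<^bsub>T.D\<^esub> n"
      using n unfolding T.br_def T.D_zero[OF n] by (subst restrict_apply') simp_all
  qed (rule T.br_closed[OF dmap.H_closed[OF x] y] T.D_zero_closed)+
  show "T.br x (dmap.H y) = dmap.H (T.br x y)"
  proof (rule T.D_eqI)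
    fix n :: int assume n: "-1 \<le> n"
    have "conf_bracket_deg P i (n - i) (x i) (dmap.H y (n - i)) 0 =
        oder P (ar n) (conf_bracket_deg P i (n - i) (x i) (y (n - i)) 0)" if "i \<in> {-1..n + 1}" for i
    proof -
      note e = e[OF n that]
      note xi = inv(1)[OF e(3)] and yi = inv(2)[OF e(2)]
      have "dmap.H y (n - i) = oder P (ar (n - i)) (y (n - i))" using e(2) by (rule dmap.H_app)
      then show ?thesis
        using conf_bracket_deg_0[OF e(3,2) xi Inv_der[OF yi]] conf_bracket_deg_0[OF e(3,2) xi yi]
          deg_bracket_der(2)[OF Inv_closed[OF xi] Inv_closed[OF yi] e(1)] by simp
    qed
    then have "T.br x (dmap.H y) n = (\<Oplus>\<^bsub>conf_W P n\<^esub>i\<in>{-1..n + 1}.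
        oder P (ar n) (conf_bracket_deg P i (n - i) (x i) (y (n - i)) 0))"
      using n T.term_closed[OF n _ x y] unfolding T.br_def
      by (subst restrict_apply') (auto intro!: T.W.M.finsum_cong' WD.d.closed)
    also have "\<dots> = oder P (ar n) (T.br x y n)"
      using n T.term_closed[OF n _ x y] by (simp add: T.br_def WD.d.finsum Pi_def)
    finally show "T.br x (dmap.H y) n = dmap.H (T.br x y) n" using n by (simp add: dmap.H_app)
  qed (rule T.br_closed[OF x dmap.H_closed[OF y]] dmap.H_closed[OF T.br_closed[OF x y]])+
qed

text \<open>
  By \<open>star_dot\<close>, the bracket agrees with the supercommutator of the product \<open>dot\<close> up to the image of
  the derivation.
\<close>

lemma T_skew:
  assumes x: "x \<in> hpart T.D p" and y: "y \<in> hpart T.D q"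
  shows "\<exists>z\<in>carrier T.D. T.br x y \<oplus>\<^bsub>T.D\<^esub> sgn_of F p q \<odot>\<^bsub>T.D\<^esub> T.br y x = dmap.H z"
proof -
  define S where "S x y \<longleftrightarrow>
    (\<exists>z\<in>carrier T.D. T.br x y \<oplus>\<^bsub>T.D\<^esub> sgn_of F p q \<odot>\<^bsub>T.D\<^esub> T.br y x = dmap.H z)" for x y
  note cl = T.D.hpart_closed
  have S_zero: "S x \<zero>\<^bsub>T.D\<^esub>" "S \<zero>\<^bsub>T.D\<^esub> x" if "x \<in> carrier T.D" for x
    unfolding S_def br_zero[OF that]
    by (rule bexI[of _ "\<zero>\<^bsub>T.D\<^esub>", OF _ T.D_zero_closed], simp only: T.D.smult_r_null T.D.sgn_of_closed
        T.D.M.l_zero[OF T.D_zero_closed] TD.d.zero)+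
  have comb: "\<exists>z\<in>carrier T.D. u \<oplus>\<^bsub>T.D\<^esub> v = dmap.H z"
    if uv: "\<exists>z\<in>carrier T.D. u = dmap.H z" "\<exists>z\<in>carrier T.D. v = dmap.H z" for u v
  proof -
    obtain z z' where z: "z \<in> carrier T.D" "u = dmap.H z" "z' \<in> carrier T.D" "v = dmap.H z'"
      using uv by blast
    have "u \<oplus>\<^bsub>T.D\<^esub> v = dmap.H (z \<oplus>\<^bsub>T.D\<^esub> z')" unfolding z TD.d.add[OF z(1,3)] ..
    then show ?thesis using T.D_add_closed[OF z(1,3)] by blast
  qed
  have S_add: "S x (y \<oplus>\<^bsub>T.D\<^esub> z)" if "x \<in> carrier T.D" "y \<in> carrier T.D" "z \<in> carrier T.D" "S x y" "S x z" for x y z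
    using comb[OF that(4)[unfolded S_def] that(5)[unfolded S_def]] that(1-3)
    by (simp add: S_def br_add T.br_closed T.D.smult_r_distr T.D.M.a_ac)
  have add': "S (y \<oplus>\<^bsub>T.D\<^esub> z) x" if "x \<in> carrier T.D" "y \<in> carrier T.D" "z \<in> carrier T.D" "S y x" "S z x" for x y z
    using comb[OF that(4)[unfolded S_def] that(5)[unfolded S_def]] that(1-3)
    by (simp add: S_def br_add T.br_closed T.D.smult_r_distr T.D.M.a_ac)
  have S_emb: "S (dsum_emb (conf_W P) i f) (dsum_emb (conf_W P) j g)"
    if i: "-1 \<le> i" and j: "-1 \<le> j" and f: "f \<in> hpart (conf_W P i) p" and g: "g \<in> hpart (conf_W P j) q" for i j f g
  proof (cases "-1 \<le> i + j")
    case False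
    then have "j + i < -1" "i + j < -1" by auto
    then show ?thesis
      unfolding S_def br_emb_bkt[OF i j f g] br_emb_bkt[OF j i g f] T.emb_low[OF \<open>i + j < -1\<close>] T.emb_low[OF \<open>j + i < -1\<close>]
      by (intro bexI[of _ "\<zero>\<^bsub>T.D\<^esub>"]) (auto simp: TD.d.zero)
  next
    case True
    let ?N = "ar (i + j)"
    have N: "?N = ar j + ar i - 1" "?N = ar i + ar j - 1" using True i j by auto
    note f' = T_hpart[OF f] and g' = T_hpart[OF g]
    obtain w where w: "w \<in> Inv ?N" "star (ar i) (ar j) f g = dot (ar i) (ar j) f g \<ominus>\<^bsub>X ?N\<^esub> oder P ?N w"
      using star_dot[OF f'(1) g'(1) N(1)] by blast
    obtain v where v: "v \<in> Inv ?N" "star (ar j) (ar i) g f = dot (ar j) (ar i) g f \<ominus>\<^bsub>X ?N\<^esub> oder P ?N v"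
      using star_dot[OF g'(1) f'(1) N(2)] by blast
    note d = dot_closed[OF Inv_closed[OF f'(1)] Inv_closed[OF g'(1)] N(1)]
      dot_closed[OF Inv_closed[OF g'(1)] Inv_closed[OF f'(1)] N(2)]
    have wv: "w \<in> carrier (X ?N)" "v \<in> carrier (X ?N)" using w v Inv_closed by auto
    let ?s = "sgn_of F p q"
    let ?z = "\<ominus>\<^bsub>conf_W P (i + j)\<^esub> (w \<oplus>\<^bsub>conf_W P (i + j)\<^esub> ?s \<odot>\<^bsub>conf_W P (i + j)\<^esub> v)"
    have z: "?z \<in> carrier (conf_W P (i + j))" using w v by (simp add: W_carrier[symmetric])
    have z': "?z = \<ominus>\<^bsub>X ?N\<^esub> (w \<oplus>\<^bsub>X ?N\<^esub> ?s \<odot>\<^bsub>X ?N\<^esub> v)"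
      using linear_map.uminus[OF W_inclusion[of "i + j"], of "w \<oplus>\<^bsub>conf_W P (i + j)\<^esub> ?s \<odot>\<^bsub>conf_W P (i + j)\<^esub> v"] w v
      by (simp add: W_carrier[symmetric]) (simp add: W_add W_smult)
    have "bkt (ar i) (ar j) p q f g \<oplus>\<^bsub>X ?N\<^esub> [koszul p q] \<cdot>\<^bsub>X ?N\<^esub> bkt (ar j) (ar i) q p g f = oder P ?N ?z"
      unfolding z' bkt_def N(1)[symmetric] N(2)[symmetric] w(2) v(2) koszul_commute[of q p]
      using d wv
      by (simp add: X.koszul_scalar X.minus_eq X.smult_r_distr X.smult_r_minus X.d.uminus X.d.add X.d.scale
          X.sgn_of_sq X.minus_add X.a_ac X.interleaved_cancel)
    moreover have "bkt (ar j) (ar i) q p g f \<in> carrier (X ?N)"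
      by (rule bkt_closed[OF Inv_closed[OF g'(1)] Inv_closed[OF f'(1)] N(2)])
    note emb_combination[OF this refl, of "bkt (ar i) (ar j) p q f g" p q]
    ultimately have "dsum_emb (conf_W P) (i + j) (bkt (ar i) (ar j) p q f g) \<oplus>\<^bsub>T.D\<^esub>
        sgn_of F p q \<odot>\<^bsub>T.D\<^esub> dsum_emb (conf_W P) (i + j) (bkt (ar j) (ar i) q p g f) =
        dmap.H (dsum_emb (conf_W P) (i + j) ?z)"
      by (simp only: dmap.H_emb)
    moreover have "j + i = i + j" by simp
    ultimately show ?thesis
      unfolding S_def br_emb_bkt[OF i j f g] br_emb_bkt[OF j i g f] using T.emb_closed[OF z] by metis
  qed
  have 1: "S (dsum_emb (conf_W P) i f) y" if i: "-1 \<le> i" and f: "f \<in> hpart (conf_W P i) p" for i f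
    using y
  proof (induction rule: T.homogeneous_induct)
    case zero
    show ?case by (rule S_zero(1)[OF cl[OF T.emb_hpart[OF f]]])
  next
    case (add y w)
    show ?case by (rule S_add[OF cl[OF T.emb_hpart[OF f]] cl[OF add(1)] cl[OF add(2)] add(3,4)])
  next
    case (emb n h)
    show ?case by (rule S_emb[OF i emb(1) f emb(2)])
  qed
  have "S x y"
    using x
  proof (induction rule: T.homogeneous_induct)
    case zero
    show ?case by (rule S_zero(2)[OF cl[OF y]])
  next
    case (add x w)
    show ?case by (rule add'[OF cl[OF y] cl[OF add(1)] cl[OF add(2)] add(3,4)])
  next
    case (emb n h)
    show ?case by (rule 1[OF emb(1) emb(2)])
  qed
  then show ?thesis by (simp only: S_def)
qed

section \<open>The linear pseudo operad\<close>

abbreviation "L \<equiv> quot_operad P"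

lemma op_class_cls: "op_class P n = X.cls n"
  by (simp add: op_class_def X.cls_def fun_eq_iff)

lemma lsp_quot: "lsp L n = X.Q n"
  by (simp add: quot_operad_def)

lemma cls_linear: "linear_map F (X n) (X.Q n) (X.cls n)"
  by (rule linear_mapI[OF X.superspace_axioms X.superspace_quot X.cls_even])

lemma lact_cls:
  assumes f: "f \<in> carrier (X n)" and \<sigma>: "\<sigma> permutes {1..n}"
  shows "lact L n (X.cls n f) \<sigma> = X.cls n (oact P n f \<sigma>)"
proof -
  have "lact L n (X.cls n f) \<sigma> = (\<Union>g\<in>X.cls n f. X.cls n (oact P n g \<sigma>))"
    by (simp add: quot_operad_def op_class_cls)
  also have "\<dots> = X.cls n (oact P n f \<sigma>)"
  proof (rule X.UN_cls[OF f])
    fix z assume z: "z \<in> carrier (X n)"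
    have "oact P n (f \<oplus>\<^bsub>X n\<^esub> oder P n z) \<sigma> = oact P n f \<sigma> \<oplus>\<^bsub>X n\<^esub> oder P n (oact P n z \<sigma>)"
      by (simp add: linear_map.add[OF act_linear[OF \<sigma>] f X.d.closed[OF z]] act_der[OF z \<sigma>])
    then show "X.cls n (oact P n (f \<oplus>\<^bsub>X n\<^esub> oder P n z) \<sigma>) = X.cls n (oact P n f \<sigma>)"
      using f z \<sigma> by (intro X.cls_eqI[of _ n _ "oact P n z \<sigma>"]) simp_all
  qed
  finally show ?thesis .
qed

lemma lcirc_cls:
  assumes i: "1 \<le> i" "i \<le> n" and f: "f \<in> carrier (X n)" and g: "g \<in> carrier (X m)"
  shows "lcirc L n m i (X.cls n f) (X.cls m g) = X.cls (m + n - 1) (ocirc P n m i f g 0)"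
proof -
  let ?N = "m + n - 1"
  have cl: "ocirc P n m i x y 0 \<in> carrier (X ?N)" if "x \<in> carrier (X n)" "y \<in> carrier (X m)" for x y
    by (rule circ_closed[OF i that refl])
  have inner: "(\<Union>y\<in>X.cls m g. X.cls ?N (ocirc P n m i x y 0)) = X.cls ?N (ocirc P n m i x g 0)"
    if x: "x \<in> carrier (X n)" for x
  proof (rule X.UN_cls[OF g])
    fix z assume z: "z \<in> carrier (X m)"
    have "ocirc P n m i x (g \<oplus>\<^bsub>X m\<^esub> oder P m z) 0 = ocirc P n m i x g 0 \<oplus>\<^bsub>X ?N\<^esub> ocirc P n m i x (oder P m z) 0"
      by (rule linear_map.add[OF circ_linear_right[OF i x refl] g X.d.closed[OF z]])
    also have "\<dots> = ocirc P n m i x g 0"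
      using cl[OF x g] sesqui_right[OF i x z, of 0] by simp
    finally show "X.cls ?N (ocirc P n m i x (g \<oplus>\<^bsub>X m\<^esub> oder P m z) 0) = X.cls ?N (ocirc P n m i x g 0)" by simp
  qed
  have "lcirc L n m i (X.cls n f) (X.cls m g) =
      (\<Union>x\<in>X.cls n f. \<Union>y\<in>X.cls m g. X.cls ?N (ocirc P n m i x y 0))"
    by (simp add: quot_operad_def op_class_cls)
  also have "\<dots> = (\<Union>y\<in>X.cls m g. X.cls ?N (ocirc P n m i f y 0))"
  proof (rule X.UN_cls[OF f])
    fix z assume z: "z \<in> carrier (X n)"
    have fz: "f \<oplus>\<^bsub>X n\<^esub> oder P n z \<in> carrier (X n)" using f z by simp
    have "ocirc P n m i (f \<oplus>\<^bsub>X n\<^esub> oder P n z) g 0 = ocirc P n m i f g 0 \<oplus>\<^bsub>X ?N\<^esub> ocirc P n m i (oder P n z) g 0"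
      by (rule linear_map.add[OF circ_linear_left[OF i g refl] f X.d.closed[OF z]])
    also have "\<dots> = ocirc P n m i f g 0 \<oplus>\<^bsub>X ?N\<^esub> oder P ?N (ocirc P n m i z g 0)"
      using cl[OF z g] sesqui_left[OF i z g, of 0] by simp
    finally show "(\<Union>y\<in>X.cls m g. X.cls ?N (ocirc P n m i (f \<oplus>\<^bsub>X n\<^esub> oder P n z) y 0)) =
        (\<Union>y\<in>X.cls m g. X.cls ?N (ocirc P n m i f y 0))"
      unfolding inner[OF f] inner[OF fz] by (intro X.cls_eqI[OF cl[OF fz g] cl[OF f g] cl[OF z g]])
  qed
  finally show ?thesis unfolding inner[OF f] .
qed

lemma lact_even: "\<sigma> permutes {1..n} \<Longrightarrow> (\<lambda>A. lact L n A \<sigma>) \<in> even_maps F (X.Q n) (X.Q n)"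
  by (auto simp: even_maps_def linear_maps_def X.quot_carrier X.quot_hpart X.quot_add X.quot_smult lact_cls
      linear_map.add[OF act_linear] linear_map.scale[OF act_linear] act_hpart)

lemma L_carrier: "A \<in> carrier (lin_W L n) \<longleftrightarrow>
    A \<in> carrier (X.Q (ar n)) \<and> (\<forall>\<sigma>. \<sigma> permutes {1..ar n} \<longrightarrow> lact L (ar n) A \<sigma> = A)"
  and L_hpart: "hpart (lin_W L n) p = hpart (X.Q (ar n)) p \<inter> carrier (lin_W L n)"
  and L_add: "A \<oplus>\<^bsub>lin_W L n\<^esub> B = A \<oplus>\<^bsub>X.Q (ar n)\<^esub> B"
  and L_zero: "\<zero>\<^bsub>lin_W L n\<^esub> = \<zero>\<^bsub>X.Q (ar n)\<^esub>"
  and L_smult: "a \<odot>\<^bsub>lin_W L n\<^esub> A = a \<odot>\<^bsub>X.Q (ar n)\<^esub> A"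
  by (simp_all add: lin_W_def invariants_def Let_def lsp_quot)

lemma L_superspace: "superspace F (lin_W L n)"
  unfolding lin_W_def lsp_quot by (intro invariants_superspace(1) X.superspace_quot lact_even)

sublocale L: dsum F "lin_W L"
  by (intro dsum.intro L_superspace)

text \<open>
  In characteristic \<open>0\<close>, averaging over \<open>S\<^sub>n\<close> turns a representative of an invariant class into an
  invariant one, and a primitive of an invariant element into an invariant one. Hence the
  invariants of the quotient are the quotient of the invariants.
\<close>

definition average :: "nat \<Rightarrow> 'v \<Rightarrow> 'v" where
  "average n x = inv\<^bsub>F\<^esub> ([(fact n :: nat)] \<cdot>\<^bsub>F\<^esub> \<one>\<^bsub>F\<^esub>) \<odot>\<^bsub>X n\<^esub> Sym n x"

lemma fact_inverse: "inv\<^bsub>F\<^esub> ([(fact n :: nat)] \<cdot>\<^bsub>F\<^esub> \<one>\<^bsub>F\<^esub>) \<in> carrier F"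
  "inv\<^bsub>F\<^esub> ([(fact n :: nat)] \<cdot>\<^bsub>F\<^esub> \<one>\<^bsub>F\<^esub>) \<otimes>\<^bsub>F\<^esub> ([(fact n :: nat)] \<cdot>\<^bsub>F\<^esub> \<one>\<^bsub>F\<^esub>) = \<one>\<^bsub>F\<^esub>"
  using char_zero[of "fact n"] F.field_Units by auto

lemma fact_divide:
  assumes "x \<in> carrier (X n)"
  shows "inv\<^bsub>F\<^esub> ([(fact n :: nat)] \<cdot>\<^bsub>F\<^esub> \<one>\<^bsub>F\<^esub>) \<odot>\<^bsub>X n\<^esub> ([(fact n :: nat)] \<cdot>\<^bsub>X n\<^esub> x) = x"
  using fact_inverse[of n] assms
  by (simp add: X.nat_scalar X.smult_assoc1[symmetric])

lemma average_Inv: "x \<in> carrier (X n) \<Longrightarrow> average n x \<in> Inv n"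
  using Sym_Inv[of x n] fact_inverse[of n]
  by (auto simp: average_def Inv_def linear_map.scale[OF act_linear])

lemma average_of_Inv: "x \<in> Inv n \<Longrightarrow> average n x = x"
  by (simp add: average_def Sym_of_Inv fact_divide Inv_closed)

lemma average_der:
  assumes x: "x \<in> carrier (X n)"
  shows "average n (oder P n x) = oder P n (average n x)"
proof -
  have "Sym n (oder P n x) = (\<Oplus>\<^bsub>X n\<^esub>\<sigma>\<in>perms n. oder P n (oact P n x \<sigma>))"
    unfolding Sym_def using x by (intro X.finsum_cong') (auto simp: act_der)
  also have "\<dots> = oder P n (Sym n x)"
    unfolding Sym_def using x by (intro X.d.finsum[symmetric]) auto
  finally show ?thesis
    unfolding average_def using X.d.scale[OF fact_inverse(1) Sym_closed[OF x]] by simp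
qed

lemma Inv_primitive:
  assumes "f \<in> Inv n" "f = oder P n z" "z \<in> carrier (X n)"
  shows "f \<in> oder P n ` Inv n"
proof
  show "f = oder P n (average n z)"
    using average_of_Inv[OF assms(1)] average_der[OF assms(3)] unfolding assms(2) by (rule trans[OF sym])
qed (rule average_Inv[OF assms(3)])

lemma cls_average:
  assumes f: "f \<in> carrier (X n)" and inv: "\<And>\<sigma>. \<sigma> permutes {1..n} \<Longrightarrow> X.cls n (oact P n f \<sigma>) = X.cls n f"
  shows "X.cls n (average n f) = X.cls n f"
proof -
  interpret c: linear_map F "X n" "X.Q n" "X.cls n" by (rule cls_linear)
  have "X.cls n (Sym n f) = (\<Oplus>\<^bsub>X.Q n\<^esub>\<sigma>\<in>perms n. X.cls n (oact P n f \<sigma>))"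
    unfolding Sym_def using f by (intro c.finsum) auto
  also have "\<dots> = (\<Oplus>\<^bsub>X.Q n\<^esub>\<sigma>\<in>perms n. X.cls n f)"
    using f inv by (intro c.W.finsum_cong') auto
  also have "\<dots> = [card (perms n)] \<cdot>\<^bsub>X.Q n\<^esub> X.cls n f"
    using c.W.add.finprod_const[OF c.closed[OF f], of "perms n"] by simp
  also have "\<dots> = X.cls n ([(fact n :: nat)] \<cdot>\<^bsub>X n\<^esub> f)"
    using c.nat_mult[OF f] by (simp add: card_permutations[of _ n])
  finally show ?thesis
    unfolding average_def using f fact_inverse(1)[of n] fact_divide[OF f]
    by (simp add: c.scale) (simp add: c.scale[symmetric])
qed

lemma op_class_even: "op_class P (ar n) \<in> even_maps F (conf_W P n) (lin_W L n)"
  unfolding op_class_cls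
  by (auto simp: even_maps_def linear_maps_def W_carrier W_hpart W_add W_smult L_carrier L_hpart L_add L_smult
      X.quot_carrier X.quot_hpart X.quot_add X.quot_smult Inv_closed lact_cls Inv_act)

lemma op_class_surj: "op_class P (ar n) ` carrier (conf_W P n) = carrier (lin_W L n)"
proof (intro equalityI subsetI)
  fix A assume A: "A \<in> carrier (lin_W L n)"
  then obtain f where f: "f \<in> carrier (X (ar n))" "A = X.cls (ar n) f"
    by (auto simp: L_carrier X.quot_carrier)
  have "X.cls (ar n) (oact P (ar n) f \<sigma>) = X.cls (ar n) f" if "\<sigma> permutes {1..ar n}" for \<sigma>
    using A that lact_cls[OF f(1) that] by (simp add: L_carrier f(2))
  then have "A = X.cls (ar n) (average (ar n) f)" using cls_average[OF f(1)] f(2) by simp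
  then show "A \<in> op_class P (ar n) ` carrier (conf_W P n)"
    using average_Inv[OF f(1)] by (auto simp: op_class_cls W_carrier)
qed (use op_class_even[of n] in \<open>auto simp: even_maps_def linear_maps_def\<close>)

lemma op_class_kernel:
  assumes "f \<in> carrier (conf_W P n)" "op_class P (ar n) f = \<zero>\<^bsub>lin_W L n\<^esub>"
  shows "f \<in> oder P (ar n) ` carrier (conf_W P n)"
proof -
  have f: "f \<in> Inv (ar n)" using assms(1) by (simp add: W_carrier)
  then have "f \<in> oder P (ar n) ` carrier (X (ar n))"
    using assms(2) X.cls_zero_iff[OF Inv_closed[OF f]] by (simp add: op_class_cls L_zero)
  then show ?thesis using Inv_primitive[OF f] by (auto simp: W_carrier)
qed

lemma op_class_der:
  "z \<in> carrier (conf_W P n) \<Longrightarrow> op_class P (ar n) (oder P (ar n) z) = \<zero>\<^bsub>lin_W L n\<^esub>"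
  using X.cls_zero_iff[of "oder P (ar n) z" "ar n"] by (auto simp: op_class_cls L_zero W_carrier Inv_closed)

lemma lin_box_cls:
  assumes n: "-1 \<le> n" and m: "-1 \<le> m" and f: "f \<in> carrier (X (ar n))" and g: "g \<in> carrier (X (ar m))"
    and N: "N = nat (n + m + 1)"
  shows "lin_box L n m (X.cls (ar n) f) (X.cls (ar m) g) = X.cls N (dot (ar n) (ar m) f g)"
proof -
  let ?a = "ar n" and ?b = "ar m"
  let ?A = "shuffle_perms (int ?b) (int ?a - 1)"
  have N': "N = ?b + ?a - 1" using ar_add[OF n m] N by simp
  have p: "inv_into UNIV \<sigma> permutes {1..N}" "1 \<le> ?a" if "\<sigma> \<in> ?A" for \<sigma>
    using shuffle_inv_permutes[OF that] N' by auto
  have cl: "ocirc P ?a ?b 1 f g 0 \<in> carrier (X N)" if "\<sigma> \<in> ?A" for \<sigma>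
    by (rule circ_closed[OF le_refl p(2)[OF that] f g N'])
  interpret c: linear_map F "X N" "X.Q N" "X.cls N" by (rule cls_linear)
  have "lin_box L n m (X.cls ?a f) (X.cls ?b g) =
      (\<Oplus>\<^bsub>X.Q N\<^esub>\<sigma>\<in>?A. lact L N (lcirc L ?a ?b 1 (X.cls ?a f) (X.cls ?b g)) (inv_into UNIV \<sigma>))"
    using n m by (simp add: lin_box_def Let_def N lsp_quot)
  also have "\<dots> = (\<Oplus>\<^bsub>X.Q N\<^esub>\<sigma>\<in>?A. X.cls N (oact P N (ocirc P ?a ?b 1 f g 0) (inv_into UNIV \<sigma>)))"
  proof (intro c.W.finsum_cong'[OF refl] funcsetI c.closed act_closed p cl)
    fix \<sigma> assume \<sigma>: "\<sigma> \<in> ?A"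
    show "lact L N (lcirc L ?a ?b 1 (X.cls ?a f) (X.cls ?b g)) (inv_into UNIV \<sigma>) =
        X.cls N (oact P N (ocirc P ?a ?b 1 f g 0) (inv_into UNIV \<sigma>))"
      unfolding lcirc_cls[OF le_refl p(2)[OF \<sigma>] f g] N'[symmetric] by (rule lact_cls[OF cl[OF \<sigma>] p(1)[OF \<sigma>]])
  qed
  also have "\<dots> = X.cls N (\<Oplus>\<^bsub>X N\<^esub>\<sigma>\<in>?A. oact P N (ocirc P ?a ?b 1 f g 0) (inv_into UNIV \<sigma>))"
    by (intro c.finsum[symmetric] funcsetI act_closed p cl)
  finally show ?thesis by (simp add: dot_def bul_def N')
qed

text \<open>
  In the quotient, the values at \<open>0\<close> and \<open>-\<partial>\<close> coincide, so that both terms of the bracket become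
  products of the linear pseudo operad.
\<close>

lemma lin_bracket_deg_cls:
  assumes n: "-1 \<le> n" and m: "-1 \<le> m" and f: "f \<in> Inv (ar n)" and g: "g \<in> Inv (ar m)"
    and N: "N = nat (n + m + 1)"
  shows "lin_bracket_deg L n m (X.cls (ar n) f) (X.cls (ar m) g) = X.cls N (deg_bracket (ar n) (ar m) f g)"
proof -
  let ?a = "ar n" and ?b = "ar m"
  have N': "N = ?b + ?a - 1" "N = nat (m + n + 1)" "N = ?a + ?b - 1"
    using n m N by auto
  interpret c: linear_map F "X N" "X.Q N" "X.cls N" by (rule cls_linear)
  let ?f = "\<lambda>p. hcomp (X ?a) p f" and ?g = "\<lambda>q. hcomp (X ?b) q g"
  have hc: "hcomp (lin_W L k) p (X.cls (ar k) u) = X.cls (ar k) (hcomp (X (ar k)) p u)" if "u \<in> Inv (ar k)" for k p u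
    using hcomp_even_map[OF W_superspace L_superspace op_class_even[of k], of u p] that W_hcomp[OF that]
    by (simp add: W_carrier op_class_cls)
  have fg: "?f p \<in> Inv ?a" "?g q \<in> Inv ?b" for p q using f g by (auto intro: hcomp_Inv)
  have fg': "?f p \<in> carrier (X ?a)" "?g q \<in> carrier (X ?b)" for p q using fg Inv_closed by auto
  note cl = star_closed[OF fg' N'(1)] dot_closed[OF fg' N'(1)] dot_closed[OF fg'(2,1) N'(3)]
  have star: "X.cls N (star ?a ?b (?f p) (?g q)) = X.cls N (dot ?a ?b (?f p) (?g q))" for p q
  proof -
    obtain w where w: "w \<in> Inv N"
      "star ?a ?b (?f p) (?g q) = dot ?a ?b (?f p) (?g q) \<ominus>\<^bsub>X N\<^esub> oder P N w"
      using star_dot[OF fg N'(1)] by blast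
    then have "w \<in> carrier (X N)" by (simp add: Inv_closed)
    then show ?thesis
      by (intro X.cls_eqI[OF cl(1,2), of "\<ominus>\<^bsub>X N\<^esub> w"]) (simp_all add: w(2) X.minus_eq X.d.uminus)
  qed
  have "lin_box L n m (X.cls ?a (?f p)) (X.cls ?b (?g q)) \<ominus>\<^bsub>X.Q N\<^esub> [koszul p q] \<cdot>\<^bsub>X.Q N\<^esub>
      lin_box L m n (X.cls ?b (?g q)) (X.cls ?a (?f p)) = X.cls N (bkt ?a ?b p q (?f p) (?g q))" for p q
    unfolding lin_box_cls[OF n m fg' N] lin_box_cls[OF m n fg'(2,1) N'(2)]
      bkt_linear[OF cls_linear fg' N'(1)] star ..
  then have "lin_bracket_deg L n m (X.cls ?a f) (X.cls ?b g) =
      (\<Oplus>\<^bsub>X.Q N\<^esub>p\<in>{0, 1}. \<Oplus>\<^bsub>X.Q N\<^esub>q\<in>{0, 1}. X.cls N (bkt ?a ?b p q (?f p) (?g q)))"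
    unfolding lin_bracket_deg_def Let_def lsp_quot hc[OF f] hc[OF g] N[symmetric] by (simp only:)
  also have "\<dots> = X.cls N (deg_bracket ?a ?b f g)"
  proof -
    have b: "bkt ?a ?b p q (?f p) (?g q) \<in> carrier (X N)" for p q by (rule bkt_closed[OF fg' N'(1)])
    show ?thesis unfolding deg_bracket_def N'(1)[symmetric] using b by (simp add: c.add)
  qed
  finally show ?thesis .
qed

sublocale opf: dsum_map F "conf_W P" "lin_W L" "\<lambda>n. op_class P (ar n)"
  by (intro dsum_map.intro dsum_map_axioms.intro T.dsum_axioms L.dsum_axioms op_class_even)

lemma opf_surj: "opf.H ` carrier T.D = carrier L.D" "opf.H ` dsum_part (conf_W P) n = dsum_part (lin_W L) n"
  by (rule opf.H_surj; simp only: op_class_surj simp_thms)+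

lemma opf_der: "z \<in> carrier T.D \<Longrightarrow> opf.H (dmap.H z) = \<zero>\<^bsub>L.D\<^esub>"
  by (rule L.D_eqI) (simp_all add: opf.H_closed dmap.H_closed opf.H_app dmap.H_app L.D_zero L.D_zero_closed
      op_class_der T.D_closed)

lemma opf_kernel:
  assumes x: "x \<in> carrier T.D" and zero: "opf.H x = \<zero>\<^bsub>L.D\<^esub>"
  shows "x \<in> dmap.H ` carrier T.D"
proof -
  have im: "x n \<in> oder P (ar n) ` carrier (conf_W P n)" if n: "-1 \<le> n" for n
    using op_class_kernel[OF T.D_closed[OF x n]] fun_cong[OF zero, of n] n by (simp add: opf.H_app L.D_zero)
  \<comment> \<open>The zero components have the primitive zero, so that the family of the primitives has finite support.\<close>
  define s where "s n = (if x n = \<zero>\<^bsub>conf_W P n\<^esub> then \<zero>\<^bsub>conf_W P n\<^esub>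
    else inv_into (carrier (conf_W P n)) (oder P (ar n)) (x n))" for n
  have s: "s n \<in> carrier (conf_W P n)" "oder P (ar n) (s n) = x n" if "-1 \<le> n" for n
    using inv_into_into[OF im[OF that]] f_inv_into_f[OF im[OF that]] by (simp_all add: s_def WD.d.zero)
  let ?z = "\<lambda>n\<in>{-1..}. s n"
  have z: "?z \<in> carrier T.D"
    by (rule T.D_restrict_closed[OF s(1) x x]) (simp_all add: s_def)
  have "dmap.H ?z = x"
    by (rule T.D_eqI[OF dmap.H_closed[OF z] x]) (simp add: dmap.H_app s(2))
  then show ?thesis using z by blast
qed

section \<open>The homomorphism and the action\<close>

lemma total_simps: "gspace (conf_W_total P) = T.D" "gpart (conf_W_total P) = dsum_part (conf_W P)"
  and lin_simps: "gspace (lin_W_lie L) = L.D" "gpart (lin_W_lie L) = dsum_part (lin_W L)"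
  by (simp_all add: conf_W_total_def lin_W_lie_def)

lemma der_image: "conf_der_image P = dmap.H ` carrier T.D"
  by (simp add: conf_der_image_def total_simps dmap.H_def image_def)

lemma conf_class_cls: "conf_class P = TD.cls"
  by (simp add: conf_class_def TD.cls_def total_simps der_image fun_eq_iff)

lemma quot_simps: "gspace (conf_W_quot P) = TD.Q"
    "gpart (conf_W_quot P) n = TD.cls ` dsum_part (conf_W P) n"
    "bracket (conf_W_quot P) A B = (\<Union>a\<in>A. \<Union>b\<in>B. TD.cls (T.br a b))"
  by (simp_all add: conf_W_quot_def total_simps der_image conf_class_cls conf_bracket_br)

lemma total_graded: "graded_superspace F (conf_W_total P)"
  by (rule T.dsum_graded) (simp_all add: total_simps)

lemma lin_graded: "graded_superspace F (lin_W_lie L)"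
  by (rule L.dsum_graded) (simp_all add: lin_simps)

lemma bracket_cls:
  assumes x: "x \<in> carrier T.D" and y: "y \<in> carrier T.D"
  shows "bracket (conf_W_quot P) (TD.cls x) (TD.cls y) = TD.cls (T.br x y)"
proof -
  have inner: "(\<Union>b\<in>TD.cls y. TD.cls (T.br a b)) = TD.cls (T.br a y)" if a: "a \<in> carrier T.D" for a
  proof (rule TD.UN_cls[OF y])
    fix z assume z: "z \<in> carrier T.D"
    show "TD.cls (T.br a (y \<oplus>\<^bsub>T.D\<^esub> dmap.H z)) = TD.cls (T.br a y)"
      by (rule TD.cls_eqI[of _ _ "T.br a z"])
        (simp_all only: br_add[OF a y dmap.H_closed[OF z]] br_der_right[OF a z] T.D_add_closed
          T.br_closed dmap.H_closed a y z)
  qed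
  have "bracket (conf_W_quot P) (TD.cls x) (TD.cls y) = (\<Union>a\<in>TD.cls x. \<Union>b\<in>TD.cls y. TD.cls (T.br a b))"
    by (rule quot_simps(3))
  also have "\<dots> = (\<Union>b\<in>TD.cls y. TD.cls (T.br x b))"
  proof (rule TD.UN_cls[OF x])
    fix z assume z: "z \<in> carrier T.D"
    have xz: "x \<oplus>\<^bsub>T.D\<^esub> dmap.H z \<in> carrier T.D" using x z by (intro T.D_add_closed dmap.H_closed)
    have "T.br (x \<oplus>\<^bsub>T.D\<^esub> dmap.H z) y = T.br x y"
      unfolding br_add(2)[OF y x dmap.H_closed[OF z]] br_der_left[OF z y] by (rule T.D.M.r_zero[OF T.br_closed[OF x y]])
    then show "(\<Union>b\<in>TD.cls y. TD.cls (T.br (x \<oplus>\<^bsub>T.D\<^esub> dmap.H z) b)) = (\<Union>b\<in>TD.cls y. TD.cls (T.br x b))"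
      unfolding inner[OF x] inner[OF xz] by simp
  qed
  finally show ?thesis unfolding inner[OF x] .
qed

lemma bracket_opf:
  assumes x: "x \<in> carrier T.D" and y: "y \<in> carrier T.D"
  shows "bracket (lin_W_lie L) (opf.H x) (opf.H y) = opf.H (T.br x y)"
proof
  fix n
  show "bracket (lin_W_lie L) (opf.H x) (opf.H y) n = opf.H (T.br x y) n"
  proof (cases "-1 \<le> n")
    case False
    then show ?thesis by (simp add: lin_W_lie_def opf.H_def)
  next
    case n: True
    have t: "lin_bracket_deg L i (n - i) (opf.H x i) (opf.H y (n - i)) =
        op_class P (ar n) (conf_bracket_deg P i (n - i) (x i) (y (n - i)) 0)" if "i \<in> {-1..n + 1}" for i
    proof -
      have i: "-1 \<le> i" "-1 \<le> n - i" using that by auto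
      have inv: "x i \<in> Inv (ar i)" "y (n - i) \<in> Inv (ar (n - i))"
        using T.D_closed[OF x i(1)] T.D_closed[OF y i(2)] by (auto simp: W_carrier)
      have N: "ar n = nat (i + (n - i) + 1)" by simp
      show ?thesis
        unfolding opf.H_app[OF i(1)] opf.H_app[OF i(2)] conf_bracket_deg_0[OF i inv]
        unfolding op_class_cls by (rule lin_bracket_deg_cls[OF i inv N])
    qed
    have cl: "conf_bracket_deg P i (n - i) (x i) (y (n - i)) 0 \<in> carrier (conf_W P n)" if "i \<in> {-1..n + 1}" for i
      by (rule T.term_closed[OF n that x y])
    have "bracket (lin_W_lie L) (opf.H x) (opf.H y) n =
        (\<Oplus>\<^bsub>lin_W L n\<^esub>i\<in>{-1..n + 1}. lin_bracket_deg L i (n - i) (opf.H x i) (opf.H y (n - i)))"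
      using n by (simp add: lin_W_lie_def)
    also have "\<dots> = (\<Oplus>\<^bsub>lin_W L n\<^esub>i\<in>{-1..n + 1}.
        op_class P (ar n) (conf_bracket_deg P i (n - i) (x i) (y (n - i)) 0))"
      by (intro L.W.M.finsum_cong'[OF refl] t funcsetI linear_map.closed[OF opf.component_linear[OF n]] cl)
    also have "\<dots> = op_class P (ar n) (T.br x y n)"
      using n by (simp add: T.br_def linear_map.finsum[OF opf.component_linear[OF n]] cl Pi_def)
    finally show ?thesis using n by (simp add: opf.H_app)
  qed
qed

lemma skew_image:
  assumes h: "linear_map F T.D V h" and der: "\<And>z. z \<in> carrier T.D \<Longrightarrow> h (dmap.H z) = \<zero>\<^bsub>V\<^esub>"
    and x: "x \<in> hpart T.D p" and y: "y \<in> hpart T.D q"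
  shows "h (T.br x y) = \<ominus>\<^bsub>V\<^esub> (sgn_of F p q \<odot>\<^bsub>V\<^esub> h (T.br y x))"
proof -
  interpret h: linear_map F T.D V h by fact
  note c = T.br_closed[OF T.D.hpart_closed[OF x] T.D.hpart_closed[OF y]]
    T.br_closed[OF T.D.hpart_closed[OF y] T.D.hpart_closed[OF x]]
  obtain z where z: "z \<in> carrier T.D" "T.br x y \<oplus>\<^bsub>T.D\<^esub> sgn_of F p q \<odot>\<^bsub>T.D\<^esub> T.br y x = dmap.H z"
    using T_skew[OF x y] by (rule bexE)
  have "h (T.br x y) \<oplus>\<^bsub>V\<^esub> sgn_of F p q \<odot>\<^bsub>V\<^esub> h (T.br y x) =
      h (T.br x y \<oplus>\<^bsub>T.D\<^esub> sgn_of F p q \<odot>\<^bsub>T.D\<^esub> T.br y x)"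
    using c by (simp add: h.add h.scale)
  also have "\<dots> = \<zero>\<^bsub>V\<^esub>" unfolding z(2) by (rule der[OF z(1)])
  finally show ?thesis using c by (intro h.W.minus_equality[symmetric]) simp_all
qed

lemma opf_linear: "linear_map F T.D L.D opf.H"
  by (rule linear_mapI[OF T.D_superspace L.D_superspace opf.H_even])

lemma lin_lie: "graded_super_lie F (lin_W_lie L)"
proof (rule graded_super_lie_image[OF total_graded lin_graded, where h = opf.H and br = T.br, unfolded total_simps lin_simps])
  show "opf.H ` carrier T.D = carrier L.D" "\<And>n. dsum_part (lin_W L) n \<subseteq> opf.H ` dsum_part (conf_W P) n"
    by (simp_all add: opf_surj)
  show "opf.H (T.br x y) = \<ominus>\<^bsub>L.D\<^esub> (sgn_of F p q \<odot>\<^bsub>L.D\<^esub> opf.H (T.br y x))"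
    if "x \<in> hpart T.D p" "y \<in> hpart T.D q" for x y p q
    by (rule skew_image[OF opf_linear opf_der that])
qed (rule opf.H_even opf.H_part T.br_bilinear bracket_opf T_leibniz T.br_part; assumption)+

text \<open>
  The map on \<open>W / \<partial>W\<close> that is induced by the quotient maps of the operad.
\<close>

abbreviation can :: "(int \<Rightarrow> 'v) set \<Rightarrow> int \<Rightarrow> 'v set" where "can \<equiv> TD.lift opf.H"

lemma can:
  shows can_cls: "x \<in> carrier T.D \<Longrightarrow> can (TD.cls x) = opf.H x"
    and can_even: "can \<in> even_maps F TD.Q L.D"
    and can_image: "can ` carrier TD.Q = carrier L.D"
    and can_inj: "inj_on can (carrier TD.Q)"
proof -
  show "can (TD.cls x) = opf.H x" if "x \<in> carrier T.D"
    by (rule TD.lift_cls[OF L.D_superspace opf.H_even opf_der that])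
  show "can \<in> even_maps F TD.Q L.D"
    by (rule TD.lift_even[OF L.D_superspace opf.H_even opf_der])
  have "can ` carrier TD.Q = opf.H ` carrier T.D"
    by (rule TD.lift_image[OF L.D_superspace opf.H_even opf_der])
  then show "can ` carrier TD.Q = carrier L.D" unfolding opf_surj .
  show "inj_on can (carrier TD.Q)"
    by (rule TD.lift_inj[OF L.D_superspace opf.H_even opf_der opf_kernel])
qed

lemma can_part: "can ` TD.cls ` dsum_part (conf_W P) n = dsum_part (lin_W L) n"
proof -
  have "can ` TD.cls ` dsum_part (conf_W P) n = opf.H ` dsum_part (conf_W P) n"
    unfolding image_image by (intro image_cong refl can_cls) (simp add: dsum_part_def)
  then show ?thesis by (simp add: opf_surj)
qed

lemma quot_graded: "graded_superspace F (conf_W_quot P)"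
proof (rule graded_superspace_iso[OF lin_graded, where h = can], unfold quot_simps(1,2) lin_simps)
  show "TD.cls ` dsum_part (conf_W P) n \<subseteq> carrier TD.Q" for n
    by (auto simp: TD.quot_carrier dsum_part_def)
qed (fact TD.superspace_quot can_even can_inj can_part)+

lemma quot_lie: "graded_super_lie F (conf_W_quot P)"
proof (rule graded_super_lie_image[OF total_graded quot_graded, where h = TD.cls and br = T.br, unfolded total_simps quot_simps(1,2)])
  have l: "linear_map F T.D TD.Q TD.cls"
    by (rule linear_mapI[OF T.D_superspace TD.superspace_quot TD.cls_even])
  have z: "TD.cls (dmap.H z) = \<zero>\<^bsub>TD.Q\<^esub>" if "z \<in> carrier T.D" for z
    using TD.cls_zero_iff[OF dmap.H_closed[OF that]] that by blast
  show "TD.cls (T.br x y) = \<ominus>\<^bsub>TD.Q\<^esub> (sgn_of F p q \<odot>\<^bsub>TD.Q\<^esub> TD.cls (T.br y x))"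
    if "x \<in> hpart T.D p" "y \<in> hpart T.D q" for x y p q
    by (rule skew_image[OF l z that])
  show "TD.cls x \<in> TD.cls ` dsum_part (conf_W P) n" if "x \<in> dsum_part (conf_W P) n" for x n
    using that by (rule imageI)
qed (rule TD.cls_even TD.quot_carrier[symmetric] subset_refl T.br_bilinear bracket_cls T_leibniz T.br_part; assumption)+

lemma can_hom: "graded_super_lie_hom F (conf_W_quot P) (lin_W_lie L) can"
proof (rule graded_super_lie_hom.intro[OF quot_lie lin_lie], unfold quot_simps(1,2) lin_simps)
  show "can \<in> even_maps F TD.Q L.D" by (rule can_even)
  fix A B assume "A \<in> carrier TD.Q" "B \<in> carrier TD.Q"
  then obtain x y where xy: "x \<in> carrier T.D" "y \<in> carrier T.D" "A = TD.cls x" "B = TD.cls y"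
    unfolding TD.quot_carrier by blast
  show "can (bracket (conf_W_quot P) A B) = bracket (lin_W_lie L) (can A) (can B)"
    unfolding xy(3,4) bracket_cls[OF xy(1,2)] can_cls[OF xy(1)] can_cls[OF xy(2)]
      can_cls[OF T.br_closed[OF xy(1,2)]] bracket_opf[OF xy(1,2)] ..
next
  fix A n assume "A \<in> TD.cls ` dsum_part (conf_W P) n"
  then have "can A \<in> can ` TD.cls ` dsum_part (conf_W P) n" by (rule imageI)
  then show "can A \<in> dsum_part (lin_W L) n" unfolding can_part .
qed

lemma can_degree:
  shows "superspace_iso F (quot_space (conf_W P n) (oder P (ar n) ` carrier (conf_W P n))) (lin_W L n)
      (WD.lift (op_class P (ar n)))" (is ?iso)
    and "f \<in> carrier (conf_W P n) \<Longrightarrow> can (conf_class P (dsum_emb (conf_W P) n f)) =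
      dsum_emb (lin_W L) n (WD.lift (op_class P (ar n))
        ((oder P (ar n) ` carrier (conf_W P n)) +>\<^bsub>conf_W P n\<^esub> f))"
proof -
  have "WD.lift (op_class P (ar n)) \<in> even_maps F (WD.Q n) (lin_W L n)"
    by (rule WD.lift_even[OF L_superspace op_class_even op_class_der])
  moreover have "WD.lift (op_class P (ar n)) ` carrier (WD.Q n) = op_class P (ar n) ` carrier (conf_W P n)"
    by (rule WD.lift_image[OF L_superspace op_class_even op_class_der])
  moreover have "inj_on (WD.lift (op_class P (ar n))) (carrier (WD.Q n))"
    by (rule WD.lift_inj[OF L_superspace op_class_even op_class_der op_class_kernel])
  ultimately show ?iso
    unfolding superspace_iso_def bij_betw_def op_class_surj by blast
  assume f: "f \<in> carrier (conf_W P n)"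
  have l: "WD.lift (op_class P (ar n)) (WD.cls n f) = op_class P (ar n) f"
    by (rule WD.lift_cls[OF L_superspace op_class_even op_class_der f])
  show "can (conf_class P (dsum_emb (conf_W P) n f)) =
      dsum_emb (lin_W L) n (WD.lift (op_class P (ar n))
        ((oder P (ar n) ` carrier (conf_W P n)) +>\<^bsub>conf_W P n\<^esub> f))"
    unfolding conf_class_cls can_cls[OF T.emb_closed[OF f]] opf.H_emb WD.cls_def[symmetric] l ..
qed

text \<open>
  The preimages of \<open>w\<close> differ by derivatives, whose brackets vanish, so that any of them will do.
\<close>

definition action :: "(int \<Rightarrow> 'v set) \<Rightarrow> (int \<Rightarrow> 'v) \<Rightarrow> int \<Rightarrow> 'v" where
  "action w b = T.br (inv_into (carrier T.D) opf.H w) b"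

lemma action_opf:
  assumes a: "a \<in> carrier T.D" and b: "b \<in> carrier T.D"
  shows "action (opf.H a) b = T.br a b"
proof -
  let ?c = "inv_into (carrier T.D) opf.H (opf.H a)"
  have "opf.H a \<in> opf.H ` carrier T.D" using a by (rule imageI)
  then have c: "?c \<in> carrier T.D" "opf.H ?c = opf.H a" by (rule inv_into_into, rule f_inv_into_f)
  have "can (TD.cls ?c) = can (TD.cls a)" using c by (simp add: can_cls a)
  then have "TD.cls ?c = TD.cls a"
    using can_inj a c(1) by (intro inj_onD[OF can_inj]) (auto simp: TD.quot_carrier)
  then obtain z where z: "z \<in> carrier T.D" "?c = a \<oplus>\<^bsub>T.D\<^esub> dmap.H z"
    unfolding TD.cls_eq_iff[OF c(1) a] by (rule bexE)
  show ?thesis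
    unfolding action_def z(2) br_add(2)[OF b a dmap.H_closed[OF z(1)]] br_der_left[OF z(1) b]
    by (rule T.D.M.r_zero[OF T.br_closed[OF a b]])
qed

lemma L_action: "graded_super_lie_action F (lin_W_lie L) (conf_W_total P) action"
proof (rule graded_super_lie_action.intro[OF lin_lie total_graded], unfold total_simps lin_simps)
  interpret h: linear_map F T.D L.D opf.H by (rule opf_linear)
  have lift: "\<exists>a\<in>hpart T.D p. w = opf.H a" if w: "w \<in> hpart L.D p" for w p
  proof -
    obtain a where "a \<in> hpart T.D p" "opf.H a = w"
      by (rule even_lift[OF T.D_superspace L.D_superspace opf.H_even opf_surj(1) w])
    then show ?thesis by blast
  qed
  have lift': "\<exists>a\<in>carrier T.D. w = opf.H a" if "w \<in> carrier L.D" for w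
    using that unfolding opf_surj(1)[symmetric] by blast
  have br: "linear_map F T.D T.D (T.br x)" "linear_map F T.D T.D (\<lambda>y. T.br y x)" if "x \<in> carrier T.D" for x
    using T.br_bilinear that T.D_module
    by (auto simp: even_bilinear_def linear_map_def linear_map_axioms_def)
  show "even_bilinear F L.D T.D T.D action"
    unfolding even_bilinear_def
  proof (intro conjI ballI allI)
    fix w assume "w \<in> carrier L.D"
    then obtain a where a: "a \<in> carrier T.D" "w = opf.H a" using lift' by blast
    interpret l: linear_map F T.D T.D "T.br a" by (rule br(1)[OF a(1)])
    show "action w \<in> linear_maps F T.D T.D"
      unfolding a(2) linear_maps_def
      by (intro CollectI conjI ballI funcsetI; simp only: action_opf[OF a(1)] T.D_add_closed T.D_smult_closed
          l.closed l.add l.scale)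
  next
    fix b assume b: "b \<in> carrier T.D"
    interpret l: linear_map F T.D T.D "\<lambda>a. T.br a b" by (rule br(2)[OF b])
    show "(\<lambda>w. action w b) \<in> linear_maps F L.D T.D"
      unfolding linear_maps_def
    proof (intro CollectI conjI ballI funcsetI)
      fix w assume "w \<in> carrier L.D"
      then obtain a where a: "a \<in> carrier T.D" "w = opf.H a" using lift' by blast
      show "action w b \<in> carrier T.D" unfolding a(2) action_opf[OF a(1) b] by (rule T.br_closed[OF a(1) b])
      fix k assume k: "k \<in> carrier F"
      show "action (k \<odot>\<^bsub>L.D\<^esub> w) b = k \<odot>\<^bsub>T.D\<^esub> action w b"
        unfolding a(2) h.scale[OF k a(1), symmetric] action_opf[OF a(1) b] action_opf[OF T.D_smult_closed[OF k a(1)] b]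
        by (rule l.scale[OF k a(1)])
    next
      fix w v assume "w \<in> carrier L.D" "v \<in> carrier L.D"
      then obtain a c where ac: "a \<in> carrier T.D" "w = opf.H a" "c \<in> carrier T.D" "v = opf.H c" using lift' by blast
      show "action (w \<oplus>\<^bsub>L.D\<^esub> v) b = action w b \<oplus>\<^bsub>T.D\<^esub> action v b"
        unfolding ac(2,4) h.add[OF ac(1,3), symmetric] action_opf[OF ac(1) b] action_opf[OF ac(3) b]
          action_opf[OF T.D_add_closed[OF ac(1,3)] b]
        by (rule l.add[OF ac(1,3)])
    qed
  next
    fix p q w b assume w: "w \<in> hpart L.D p" and b: "b \<in> hpart T.D q"
    obtain a where a: "a \<in> hpart T.D p" "w = opf.H a" using lift[OF w] by blast
    have "T.br a b \<in> hpart T.D (p + q)"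
      using T.br_bilinear a(1) b unfolding even_bilinear_def by blast
    then show "action w b \<in> hpart T.D (p + q)"
      unfolding a(2) action_opf[OF T.D.hpart_closed[OF a(1)] T.D.hpart_closed[OF b]] .
  qed
  fix w u p q v assume w: "w \<in> hpart L.D p" and u: "u \<in> hpart L.D q" and v: "v \<in> carrier T.D"
  obtain a where a: "a \<in> hpart T.D p" "w = opf.H a" using lift[OF w] by blast
  obtain c where c: "c \<in> hpart T.D q" "u = opf.H c" using lift[OF u] by blast
  note ac = T.D.hpart_closed[OF a(1)] T.D.hpart_closed[OF c(1)]
  note cl = T.br_closed[OF ac(1) T.br_closed[OF ac(2) v]] T.br_closed[OF ac(2) T.br_closed[OF ac(1) v]]
    T.br_closed[OF T.br_closed[OF ac] v]
  show "action (bracket (lin_W_lie L) w u) v = action w (action u v) \<ominus>\<^bsub>T.D\<^esub> [koszul p q] \<cdot>\<^bsub>T.D\<^esub> action u (action w v)"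
    unfolding a(2) c(2) bracket_opf[OF ac] action_opf[OF T.br_closed[OF ac] v] action_opf[OF ac(1) v]
      action_opf[OF ac(2) v] action_opf[OF ac(1) T.br_closed[OF ac(2) v]] action_opf[OF ac(2) T.br_closed[OF ac(1) v]]
      T.D.koszul_scalar[OF cl(2)] T_leibniz[OF a(1) c(1) v]
    using cl T.D.smult_closed[OF T.D.sgn_of_closed cl(2)] by (simp add: T.D.M.minus_eq T.D.M.a_assoc T.D.M.r_neg)
next
  fix w v i j assume w: "w \<in> dsum_part (lin_W L) i" and v: "v \<in> dsum_part (conf_W P) j"
  obtain a where a: "a \<in> dsum_part (conf_W P) i" "w = opf.H a"
    using w unfolding opf_surj(2)[symmetric] by blast
  have cl: "a \<in> carrier T.D" "v \<in> carrier T.D" using a(1) v by (simp_all add: dsum_part_def)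
  show "action w v \<in> dsum_part (conf_W P) (i + j)"
    unfolding a(2) action_opf[OF cl] by (rule T.br_part[OF a(1) v])
qed

lemma action_formula:
  assumes m: "-1 \<le> m" and n: "-1 \<le> n" and f: "f \<in> hpart (conf_W P m) p" and g: "g \<in> hpart (conf_W P n) q"
    and w: "can (conf_class P (dsum_emb (conf_W P) m f)) = dsum_emb (lin_W L) m w"
  shows "action (dsum_emb (lin_W L) m w) (dsum_emb (conf_W P) n g) =
    dsum_emb (conf_W P) (m + n)
      (conf_box P m n f g 0 \<ominus>\<^bsub>X (nat (m + n + 1))\<^esub> [koszul p q] \<cdot>\<^bsub>X (nat (m + n + 1))\<^esub>
        eval_neg_der P (nat (m + n + 1)) (conf_box P n m g f))"
proof -
  have fg: "f \<in> carrier (conf_W P m)" "g \<in> carrier (conf_W P n)"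
    using T_hpart[OF f] T_hpart[OF g] by (simp_all add: W_carrier)
  then have fg': "f \<in> carrier (X (ar m))" "g \<in> carrier (X (ar n))" by (auto simp: W_carrier Inv_closed)
  have N: "nat (m + n + 1) = nat (n + m + 1)" by (simp add: add.commute)
  have "action (dsum_emb (lin_W L) m w) (dsum_emb (conf_W P) n g) =
      T.br (dsum_emb (conf_W P) m f) (dsum_emb (conf_W P) n g)"
    unfolding w[symmetric] conf_class_cls can_cls[OF T.emb_closed[OF fg(1)]]
    by (rule action_opf[OF T.emb_closed[OF fg(1)] T.emb_closed[OF fg(2)]])
  also have "\<dots> = dsum_emb (conf_W P) (m + n) (bkt (ar m) (ar n) p q f g)"
    by (rule br_emb_bkt[OF m n f g])
  also have "bkt (ar m) (ar n) p q f g = conf_box P m n f g 0 \<ominus>\<^bsub>X (nat (m + n + 1))\<^esub>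
      [koszul p q] \<cdot>\<^bsub>X (nat (m + n + 1))\<^esub> eval_neg_der P (nat (m + n + 1)) (conf_box P n m g f)"
    unfolding bkt_def conf_box_0[OF m n fg' refl] E_conf_box[OF n m fg'(2,1) N] ar_add[OF m n, symmetric] ..
  finally show ?thesis .
qed

end

theorem proposition4p11:
  fixes F :: "('f, 'r) ring_scheme" and P :: "('f, 'v, 'w) pro_operad"
  assumes "field F"
    and "\<forall>k::nat. 0 < k \<longrightarrow> [k] \<cdot>\<^bsub>F\<^esub> \<one>\<^bsub>F\<^esub> \<noteq> \<zero>\<^bsub>F\<^esub>"
    and "pro_conformal_pseudo_operad F P"
  shows "\<exists>\<phi>.
    graded_super_lie_hom F (conf_W_quot P) (lin_W_lie (quot_operad P)) \<phi> \<and>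
    \<phi> ` carrier (gspace (conf_W_quot P)) = carrier (gspace (lin_W_lie (quot_operad P))) \<and>
    (\<forall>x\<in>carrier (gspace (conf_W_total P)).
       \<phi> (conf_class P x) = (\<lambda>n\<in>{-1..}. op_class P (nat (n + 1)) (x n))) \<and>
    (\<forall>n\<ge>-1.
       (\<forall>x\<in>carrier (osp P (nat (n + 1))).
          oder P (nat (n + 1)) x = \<zero>\<^bsub>osp P (nat (n + 1))\<^esub> \<longrightarrow> x = \<zero>\<^bsub>osp P (nat (n + 1))\<^esub>) \<or> n = 0 \<longrightarrow>
       (\<exists>\<psi>.
          superspace_iso F
            (quot_space (conf_W P n) (oder P (nat (n + 1)) ` carrier (conf_W P n)))
            (lin_W (quot_operad P) n) \<psi> \<and>
          (\<forall>f\<in>carrier (conf_W P n).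
             \<phi> (conf_class P (dsum_emb (conf_W P) n f)) =
               dsum_emb (lin_W (quot_operad P)) n
                 (\<psi> ((oder P (nat (n + 1)) ` carrier (conf_W P n)) +>\<^bsub>conf_W P n\<^esub> f))))) \<and>
    (\<exists>act.
       graded_super_lie_action F (lin_W_lie (quot_operad P)) (conf_W_total P) act \<and>
       (\<forall>a\<in>carrier (gspace (conf_W_total P)). \<forall>b\<in>carrier (gspace (conf_W_total P)).
          act (\<phi> (conf_class P a)) b = conf_bracket P a b 0) \<and>
       (\<forall>m\<ge>-1. \<forall>n\<ge>-1. \<forall>p q.
          \<forall>fbar\<in>carrier (lin_W (quot_operad P) m).
          \<forall>ftilde\<in>hpart (conf_W P m) p.
          \<forall>g\<in>hpart (conf_W P n) q.
            \<phi> (conf_class P (dsum_emb (conf_W P) m ftilde))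
              = dsum_emb (lin_W (quot_operad P)) m fbar \<longrightarrow>
            act (dsum_emb (lin_W (quot_operad P)) m fbar) (dsum_emb (conf_W P) n g) =
              dsum_emb (conf_W P) (m + n)
                (conf_box P m n ftilde g 0
                  \<ominus>\<^bsub>osp P (nat (m + n + 1))\<^esub>
                  [koszul p q] \<cdot>\<^bsub>osp P (nat (m + n + 1))\<^esub>
                    eval_neg_der P (nat (m + n + 1)) (conf_box P n m g ftilde))))"
proof -
  interpret char0_pro_operad F P
    using assms by (intro char0_pro_operad.intro char0_pro_operad_axioms.intro) auto
  show ?thesis
  proof (intro exI[of _ can] conjI)
    show "graded_super_lie_hom F (conf_W_quot P) (lin_W_lie L) can" by (rule can_hom)
    show "can ` carrier (gspace (conf_W_quot P)) = carrier (gspace (lin_W_lie L))"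
      unfolding quot_simps lin_simps by (rule can_image)
    show "\<forall>x\<in>carrier (gspace (conf_W_total P)). can (conf_class P x) = (\<lambda>n\<in>{-1..}. op_class P (nat (n + 1)) (x n))"
      unfolding total_simps conf_class_cls opf.H_def[symmetric] by (intro ballI can_cls)
    show "\<forall>n\<ge>-1. (\<forall>x\<in>carrier (X (ar n)). oder P (ar n) x = \<zero>\<^bsub>X (ar n)\<^esub> \<longrightarrow> x = \<zero>\<^bsub>X (ar n)\<^esub>) \<or> n = 0 \<longrightarrow>
       (\<exists>\<psi>. superspace_iso F (quot_space (conf_W P n) (oder P (ar n) ` carrier (conf_W P n))) (lin_W L n) \<psi> \<and>
          (\<forall>f\<in>carrier (conf_W P n). can (conf_class P (dsum_emb (conf_W P) n f)) =
             dsum_emb (lin_W L) n (\<psi> ((oder P (ar n) ` carrier (conf_W P n)) +>\<^bsub>conf_W P n\<^esub> f))))"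
      using can_degree by blast
    show "\<exists>act. graded_super_lie_action F (lin_W_lie L) (conf_W_total P) act \<and>
       (\<forall>a\<in>carrier (gspace (conf_W_total P)). \<forall>b\<in>carrier (gspace (conf_W_total P)).
          act (can (conf_class P a)) b = conf_bracket P a b 0) \<and>
       (\<forall>m\<ge>-1. \<forall>n\<ge>-1. \<forall>p q. \<forall>fbar\<in>carrier (lin_W L m). \<forall>ftilde\<in>hpart (conf_W P m) p.
          \<forall>g\<in>hpart (conf_W P n) q.
            can (conf_class P (dsum_emb (conf_W P) m ftilde)) = dsum_emb (lin_W L) m fbar \<longrightarrow>
            act (dsum_emb (lin_W L) m fbar) (dsum_emb (conf_W P) n g) =
              dsum_emb (conf_W P) (m + n)
                (conf_box P m n ftilde g 0 \<ominus>\<^bsub>X (nat (m + n + 1))\<^esub> [koszul p q] \<cdot>\<^bsub>X (nat (m + n + 1))\<^esub>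
                  eval_neg_der P (nat (m + n + 1)) (conf_box P n m g ftilde)))"
    proof (intro exI[of _ action] conjI allI impI ballI L_action action_formula)
      fix a b assume "a \<in> carrier (gspace (conf_W_total P))" "b \<in> carrier (gspace (conf_W_total P))"
      then have ab: "a \<in> carrier T.D" "b \<in> carrier T.D" by (simp_all only: total_simps)
      show "action (can (conf_class P a)) b = conf_bracket P a b 0"
        unfolding conf_class_cls can_cls[OF ab(1)] conf_bracket_br by (rule action_opf[OF ab])
    qed
  qed
qed

end
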